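(* For every real $p>1$ there is a constant $c_p>0$ such that for all sufficiently large $R$, \[ \int_R^{2R} |E^*(t)|^p\, dt \ \ge\ c_p\, R^{p+1} (\log R)^{p/2}. \]
   Context: A point $\vec{x}=(x_1,x_2,x_3)\in\mathbb{Z}^3\setminus\{\vec 0\}$ is called visible if $\gcd(x_1,x_2,x_3)=1$. For $R>0$ let $\mathcal{N}^*(R)$ be the number of visible points $\vec{x}$ with Euclidean norm $\|\vec{x}\|\le R$, and define the error term $E^*(R)=\mathcal{N}^*(R)-\frac{4\pi}{3\zeta(3)}R^3$, where $\zeta$ is the Riemann zeta function. *)

theory Defs
  imports "HOL-Analysis.Analysis"
begin

text \<open>The Riemann zeta function on the real half-line \<open>s > 1\<close>, where the Dirichlet series converges.\<close>

definition zeta :: "real \<Rightarrow> real" where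
  "zeta s = (\<Sum>n. 1 / real (Suc n) powr s)"

definition real_vec :: "int ^ 3 \<Rightarrow> real ^ 3" where
  "real_vec x = (\<chi> i. real_of_int (x $ i))"

definition visible :: "int ^ 3 \<Rightarrow> bool" where
  "visible x \<longleftrightarrow> x \<noteq> 0 \<and> gcd (x $ 1) (gcd (x $ 2) (x $ 3)) = 1"

definition visible_count :: "real \<Rightarrow> nat" where
  "visible_count R = card {x. visible x \<and> norm (real_vec x) \<le> R}"

definition visible_error :: "real \<Rightarrow> real" where
  "visible_error R = real (visible_count R) - 4 * pi / (3 * zeta 3) * R ^ 3"

end

theory Submission
  imports Defs "HOL-Probability.Probability" "HOL-Computational_Algebra.Computational_Algebra" "HOL-Real_Asymp.Real_Asymp"
begin

text \<open>
  The idea is to test \<open>E\<^sup>*\<close> against a resonating function. For frequencies \<open>c \<surd>m\<close> with \<open>m \<le> N\<close>,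
  \<open>c \<le> Z\<close>, let \<open>T\<close> be the sum of \<open>1 / (m c\<^sup>2)\<close> times the derivative of \<open>bump (r / R) sin (2 \<pi> c \<surd>m r) / r\<close>;
  to leading order \<open>R T\<close> is the cosine sum with coefficients \<open>1 / (c \<surd>m)\<close>. Here \<open>N\<close>, \<open>Z\<close> are small powers of \<open>R\<close>.

  Integration by parts turns \<open>\<integral> E\<^sup>* T\<close> into a sum of waves over visible points. Moebius inversion
  rewrites it with weights \<open>\<mu>(d)\<close> as sums over the lattices \<open>d \<int>\<^sup>3\<close>, and Poisson summation (the Fourier
  transform of a radial function in dimension three being elementary) isolates the resonant shell
  \<open>|k|\<^sup>2 = m c\<^sup>2 d\<^sup>2\<close>. Collecting \<open>f = c d\<close>, the divisor sum of \<open>\<mu>\<close> kills every \<open>f\<close> with \<open>1 < f \<le> Z\<close>, and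
  what is left is \<open>R\<close> times \<open>\<Sum>m\<le>N. r\<^sub>3(m) m\<^bsup>-3/2\<^esup>\<close>, which is of order \<open>R log R\<close>.

  On the other side, the \<open>2k\<close>-th moment of the cosine sum over \<open>[R, 2R]\<close> is \<open>O(R (log R)\<^sup>k)\<close>: sums of
  \<open>2k\<close> frequencies either vanish or are at least a negative power of \<open>N Z\<close>, and, since square roots of distinct
  squarefree numbers are linearly independent over the rationals, the vanishing sums split along the squarefree
  kernels \<open>s\<close>; each kernel contributes \<open>O(1/s)\<close> to an exponential generating function. Young's
  inequality with exponent \<open>p\<close> and a suitable \<open>k\<close> then yields the lower bound.
\<close>

section \<open>Representations as sums of squares\<close>

text \<open>The frequencies \<open>c * sqrt m\<close> with \<open>c > 1\<close> avoid the arithmetic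
  of \<open>r3\<close>. A test wave of frequency \<open>sqrt m\<close> alone resonates with weight
  \<open>\<Sum>d. moebius_mu d * r3 (m * d^2) / d^3\<close>, whose size is not evident; with the
  extra weights \<open>1 / c^3\<close> the double sum over \<open>c\<close> and \<open>d\<close>
  collapses to \<open>r3 m\<close> up to a small tail. The argument needs a power saving over the
  trivial \<open>r3 n = O(n)\<close>, and \<open>O(n^(5/6))\<close> supplies it: the sum over
  \<open>f > Z\<close> becomes small, the sum over shells far from the resonance converges, and
  there is room for the cut \<open>D\<close> in the Moebius sum, which must lie between
  \<open>R^(1/2)\<close> (trivial bound for \<open>d > D\<close>) and about \<open>R^(6/11)\<close>
  (Poisson error for \<open>d \<le> D\<close>). With \<open>O(n)\<close> the two ends would
  coincide. The power of the logarithm comes from a mismatch: the correlation has size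
  \<open>R * ln R\<close>, while \<open>R * T\<close> has size only \<open>sqrt (ln R)\<close> in
  every even mean. Spacing of sums of \<open>2k\<close> square roots costs an exponent
  \<open>2^(2k)\<close>, so the exponents of \<open>N\<close> and \<open>Z\<close> depend on
  \<open>k\<close>, hence on \<open>p\<close>; \<open>ln N\<close> stays comparable to
  \<open>ln R\<close>.\<close>

definition nsq :: "int \<times> int \<times> int \<Rightarrow> int" where
  "nsq v = (fst v)\<^sup>2 + (fst (snd v))\<^sup>2 + (snd (snd v))\<^sup>2"

definition r2 :: "nat \<Rightarrow> nat" where
  "r2 n = card {(x :: int, y :: int). x\<^sup>2 + y\<^sup>2 = int n}"

definition r3 :: "nat \<Rightarrow> nat" where
  "r3 n = card {v. nsq v = int n}"

text \<open>For three points on a circle of radius \<open>sqrt n\<close>, the product of the sides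
  is four times the circumradius times the area. This is the square of that relation; the last
  bracket is twice the signed area, an integer.\<close>

lemma circle_triangle_identity:
  fixes x1 x2 x3 y1 y2 y3 n :: int
  assumes "x1\<^sup>2 + y1\<^sup>2 = n" "x2\<^sup>2 + y2\<^sup>2 = n" "x3\<^sup>2 + y3\<^sup>2 = n"
  shows "((x1 - x2)\<^sup>2 + (y1 - y2)\<^sup>2) * ((x2 - x3)\<^sup>2 + (y2 - y3)\<^sup>2) * ((x1 - x3)\<^sup>2 + (y1 - y3)\<^sup>2)
       = 4 * n * (x1 * (y2 - y3) + x2 * (y3 - y1) + x3 * (y1 - y2))\<^sup>2"
proof -
  define a b c D where "a = x1 * x2 + y1 * y2" and "b = x1 * x3 + y1 * y3" and "c = x2 * x3 + y2 * y3"
    and "D = x1 * (y2 - y3) + x2 * (y3 - y1) + x3 * (y1 - y2)"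
  define n1 n2 n3 where "n1 = x1\<^sup>2 + y1\<^sup>2" and "n2 = x2\<^sup>2 + y2\<^sup>2" and "n3 = x3\<^sup>2 + y3\<^sup>2"
  have n: "n1 = n" "n2 = n" "n3 = n" using assms by (simp_all add: n1_def n2_def n3_def)
  \<comment> \<open>Gram determinants of the three vectors in the plane and of the same vectors lifted to height one.\<close>
  have "n1 * n2 * n3 + 2 * a * b * c - n1 * c\<^sup>2 - n2 * b\<^sup>2 - n3 * a\<^sup>2 = 0"
    unfolding n1_def n2_def n3_def a_def b_def c_def by algebra
  then have G: "n ^ 3 + 2 * a * b * c = n * (a\<^sup>2 + b\<^sup>2 + c\<^sup>2)"
    by (simp add: n algebra_simps power_numeral_reduce)
  have "D\<^sup>2 = (n2 * n3 - c\<^sup>2) + (n1 * n3 - b\<^sup>2) + (n1 * n2 - a\<^sup>2)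
      + 2 * (b * c - a * n3) + 2 * (a * c - b * n2) + 2 * (a * b - c * n1)"
    unfolding n1_def n2_def n3_def a_def b_def c_def D_def by algebra
  then have D: "D\<^sup>2 = 3 * n\<^sup>2 - (a\<^sup>2 + b\<^sup>2 + c\<^sup>2) + 2 * (a * b + b * c + a * c) - 2 * n * (a + b + c)"
    by (simp add: n algebra_simps power2_eq_square)
  have "(x1 - x2)\<^sup>2 + (y1 - y2)\<^sup>2 = n1 + n2 - 2 * a" "(x2 - x3)\<^sup>2 + (y2 - y3)\<^sup>2 = n2 + n3 - 2 * c"
    "(x1 - x3)\<^sup>2 + (y1 - y3)\<^sup>2 = n1 + n3 - 2 * b"
    by (simp_all add: n1_def n2_def n3_def a_def b_def c_def algebra_simps power2_eq_square)
  then have L: "(x1 - x2)\<^sup>2 + (y1 - y2)\<^sup>2 = 2 * (n - a)" "(x2 - x3)\<^sup>2 + (y2 - y3)\<^sup>2 = 2 * (n - c)"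
    "(x1 - x3)\<^sup>2 + (y1 - y3)\<^sup>2 = 2 * (n - b)" by (simp_all add: n)
  have "2 * (n - a) * (2 * (n - c)) * (2 * (n - b)) = 4 * n * D\<^sup>2"
    using G unfolding D by algebra
  then show ?thesis unfolding L D_def by simp
qed

lemma abs_le_of_sq: "\<bar>x\<bar> \<le> int n" if "x\<^sup>2 \<le> int n" for x :: int
proof -
  have "\<bar>x\<bar> \<le> \<bar>x\<bar> * \<bar>x\<bar>" 
    using mult_left_mono[of 1 "\<bar>x\<bar>" "\<bar>x\<bar>"] by (cases "x = 0") auto
  also have "\<dots> = x\<^sup>2" by (simp add: power2_eq_square)
  finally show ?thesis using that by linarith
qed

lemma abs_le_sqrt_of_sq: "\<bar>real_of_int x\<bar> \<le> sqrt n" if "x\<^sup>2 \<le> int n" for x :: int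
proof -
  have "(real_of_int x)\<^sup>2 \<le> real n" using that by (metis of_int_le_iff of_int_of_nat_eq of_int_power)
  then show ?thesis using real_le_rsqrt real_sqrt_abs real_sqrt_le_iff by metis
qed

text \<open>Three lattice points on a circle of radius \<open>\<surd>n\<close> span a triangle of area at least \<open>1/2\<close>, so the product of its sides, which is \<open>4 \<surd>n\<close> times the area, prevents them from sharing a short arc. This gives \<open>r2 n = O(n\<^bsup>1/3\<^esup>)\<close> without factoring in the Gaussian integers.\<close>

lemma card_circle_fibre:
  fixes n l :: nat and i :: int
  assumes "l = 1 \<or> 2 * l ^ 6 < n" "n \<ge> 1" "l \<ge> 1"
  shows "card {x. \<exists>y>0. \<bar>x\<bar> \<le> y \<and> x\<^sup>2 + y\<^sup>2 = int n \<and> x div int l = i} \<le> 2"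
    (is "card ?F \<le> 2")
proof (rule ccontr)
  assume "\<not> card ?F \<le> 2"
  then have "3 \<le> card ?F" by simp
  then obtain T where T: "T \<subseteq> ?F" "card T = 3"
    by (meson obtain_subset_with_card_n)
  then obtain a b c where abc: "T = {a, b, c}" "a \<noteq> b" "b \<noteq> c" "a \<noteq> c"
    by (metis card_3_iff)
  have dist: "\<bar>x - x'\<bar> < int l" if "x div int l = i" "x' div int l = i" for x x'
  proof -
    have "x = i * int l + x mod int l" "x' = i * int l + x' mod int l"
      using that by (metis div_mult_mod_eq)+
    moreover have "0 \<le> x mod int l" "x mod int l < int l" "0 \<le> x' mod int l" "x' mod int l < int l"
      using assms(3) by auto
    ultimately show ?thesis by linarith
  qed
  obtain ya where ya: "ya > 0" "\<bar>a\<bar> \<le> ya" "a\<^sup>2 + ya\<^sup>2 = int n" "a div int l = i"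
    using T abc by auto
  obtain yb where yb: "yb > 0" "\<bar>b\<bar> \<le> yb" "b\<^sup>2 + yb\<^sup>2 = int n" "b div int l = i"
    using T abc by auto
  obtain yc where yc: "yc > 0" "\<bar>c\<bar> \<le> yc" "c\<^sup>2 + yc\<^sup>2 = int n" "c div int l = i"
    using T abc by auto
  show False
  proof (cases "l = 1")
    case True
    then show False using ya yb abc by simp
  next
    case False
    then have l: "2 * l ^ 6 < n" using assms by simp
    \<comment> \<open>Where \<open>\<bar>x\<bar> \<le> y\<close> the circle has slope at most 1, so
      points whose \<open>x\<close> share a block of length \<open>l\<close> are within
      \<open>l\<close> in \<open>y\<close> too. This is why the fibre is restricted to a quarter of
      the circle.\<close>
    have ydist: "(x - x')\<^sup>2 + (y - y')\<^sup>2 \<le> 2 * (int l)\<^sup>2"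
      if "y > 0" "\<bar>x\<bar> \<le> y" "x\<^sup>2 + y\<^sup>2 = int n" "x div int l = i"
         "y' > 0" "\<bar>x'\<bar> \<le> y'" "x'\<^sup>2 + y'\<^sup>2 = int n" "x' div int l = i" for x y x' y' :: int
    proof -
      have d: "\<bar>x - x'\<bar> < int l" using dist that by blast
      have "\<bar>y - y'\<bar> * (y + y') = \<bar>(y - y') * (y + y')\<bar>" using that by (simp add: abs_mult)
      also have "(y - y') * (y + y') = (x' - x) * (x + x')"
        using that by (simp add: algebra_simps power2_eq_square)
      also have "\<bar>(x' - x) * (x + x')\<bar> = \<bar>x - x'\<bar> * \<bar>x + x'\<bar>" by (simp add: abs_mult abs_minus_commute)
      also have "\<dots> \<le> \<bar>x - x'\<bar> * (y + y')" using that by (intro mult_left_mono) auto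
      finally have "\<bar>y - y'\<bar> \<le> \<bar>x - x'\<bar>" using that by (simp add: mult_le_cancel_right)
      then have "\<bar>y - y'\<bar> \<le> int l" "\<bar>x - x'\<bar> \<le> int l" using d by auto
      then have "(y - y')\<^sup>2 \<le> (int l)\<^sup>2" "(x - x')\<^sup>2 \<le> (int l)\<^sup>2"
        by (metis abs_ge_zero power2_abs power_mono)+
      then show ?thesis by simp
    qed
    have P: "((a - b)\<^sup>2 + (ya - yb)\<^sup>2) * ((b - c)\<^sup>2 + (yb - yc)\<^sup>2) * ((a - c)\<^sup>2 + (ya - yc)\<^sup>2)
       = 4 * int n * (a * (yb - yc) + b * (yc - ya) + c * (ya - yb))\<^sup>2" (is "?L = 4 * int n * ?D\<^sup>2")
      by (rule circle_triangle_identity) (use ya yb yc in auto)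
    have pos: "(a - b)\<^sup>2 + (ya - yb)\<^sup>2 > 0" "(b - c)\<^sup>2 + (yb - yc)\<^sup>2 > 0" "(a - c)\<^sup>2 + (ya - yc)\<^sup>2 > 0"
      using abc by (auto intro!: add_pos_nonneg)
    have "?L > 0" using pos by simp
    then have "?D\<^sup>2 \<noteq> 0" using P by auto
    then have "?D\<^sup>2 \<ge> 1" by (smt (verit) zero_le_power2)
    then have "4 * int n \<le> 4 * int n * ?D\<^sup>2" by (simp add: mult_le_cancel_left1)
    also have "\<dots> = ?L" using P by simp
    also have "\<dots> \<le> (2 * (int l)\<^sup>2) * (2 * (int l)\<^sup>2) * (2 * (int l)\<^sup>2)"
      using ydist[OF ya yb] ydist[OF yb yc] ydist[OF ya yc] pos
      by (intro mult_mono) auto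
    also have "\<dots> = 8 * int (l ^ 6)" by (simp add: power_numeral_reduce)
    finally show False using l by linarith
  qed
qed

lemma finite_circle: "finite {(x :: int, y :: int). x\<^sup>2 + y\<^sup>2 = int n}"
proof (rule finite_subset)
  show "{(x :: int, y :: int). x\<^sup>2 + y\<^sup>2 = int n} \<subseteq> {- int n..int n} \<times> {- int n..int n}"
  proof clarify
    fix x y :: int assume "x\<^sup>2 + y\<^sup>2 = int n"
    then have "x\<^sup>2 \<le> int n" "y\<^sup>2 \<le> int n" using zero_le_power2[of x] zero_le_power2[of y] by linarith+
    then show "x \<in> {- int n..int n} \<and> y \<in> {- int n..int n}"
      using abs_le_of_sq[of x n] abs_le_of_sq[of y n] by auto
  qed
qed auto

text \<open>The circle is cut into four arcs according to the dominant coordinate and its sign. On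
  each arc the smaller coordinate is split into blocks of length about \<open>n^(1/6)\<close>, which
  hold at most two points by \<open>card_circle_fibre\<close>; there are about
  \<open>n^(1/2) / n^(1/6) = n^(1/3)\<close> blocks.\<close>

lemma r2_bound: "\<exists>C\<ge>1. \<forall>n\<ge>1. real (r2 n) \<le> C * real n powr (1/3)"
proof (intro exI conjI allI impI)
  show "(1::real) \<le> 100" by simp
  fix n :: nat assume n: "1 \<le> n"
  define l where "l = max 1 (nat \<lfloor>(real n / 4) powr (1/6)\<rfloor>)"
  have l1: "l \<ge> 1" by (simp add: l_def)
  have lcond: "l = 1 \<or> 2 * l ^ 6 < n"
  proof (cases "l = 1")
    case False
    then have "l = nat \<lfloor>(real n / 4) powr (1/6)\<rfloor>" by (auto simp: l_def max_def split: if_splits)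
    then have "real l \<le> (real n / 4) powr (1/6)" by (simp add: of_nat_floor)
    then have "real l ^ 6 \<le> ((real n / 4) powr (1/6)) ^ 6" by (intro power_mono) auto
    also have "\<dots> = real n / 4" using n by (simp flip: powr_numeral add: powr_powr)
    finally have "2 * real l ^ 6 < real n" using n by simp
    then have "real (2 * l ^ 6) < real n" by simp
    then show ?thesis by linarith
  qed simp
  have lbig: "real n powr (1/6) \<le> 4 * real l"
  proof -
    have "(real n / 4) powr (1/6) \<le> real l + 1"
    proof -
      have "nat \<lfloor>(real n / 4) powr (1/6)\<rfloor> \<le> l" by (simp add: l_def)
      then have "(real n / 4) powr (1/6) < real l + 1" by linarith
      then show ?thesis by simp
    qed
    also have "\<dots> \<le> 2 * real l" using l1 by simp
    finally have "(real n / 4) powr (1/6) \<le> 2 * real l" .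
    moreover have "(real n / 4) powr (1/6) = real n powr (1/6) / 4 powr (1/6)" by (simp add: powr_divide)
    moreover have "(4::real) powr (1/6) \<le> 2"
    proof -
      have "(4::real) powr (1/6) \<le> 4 powr (1/2)" by (intro powr_mono) auto
      then show ?thesis by (simp add: powr_half_sqrt)
    qed
    ultimately have "real n powr (1/6) \<le> 2 * real l * 4 powr (1/6)" by (simp add: field_simps)
    also have "\<dots> \<le> 2 * real l * 2" using \<open>4 powr (1/6) \<le> (2::real)\<close> by (intro mult_left_mono) auto
    finally show ?thesis by simp
  qed
  define X where "X = {x. \<exists>y>0. \<bar>x\<bar> \<le> y \<and> x\<^sup>2 + y\<^sup>2 = int n}"
  define F where "F i = {x. \<exists>y>0. \<bar>x\<bar> \<le> y \<and> x\<^sup>2 + y\<^sup>2 = int n \<and> x div int l = i}" for i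
  define s where "s = \<lfloor>sqrt n / l\<rfloor>"
  have Xs: "\<bar>real_of_int x\<bar> \<le> sqrt n" if "x \<in> X" for x
  proof -
    from that have "x\<^sup>2 \<le> int n" unfolding X_def by (smt (verit) mem_Collect_eq zero_le_power2)
    then show ?thesis by (rule abs_le_sqrt_of_sq)
  qed
  have sub: "X \<subseteq> (\<Union>i\<in>{- s - 1..s}. F i)"
  proof
    fix x assume x: "x \<in> X"
    have "x div int l = \<lfloor>real_of_int x / real l\<rfloor>"
      by (metis floor_divide_of_int_eq of_int_of_nat_eq)
    moreover have "real_of_int x / real l \<le> sqrt n / l" "- (sqrt n / l) \<le> real_of_int x / real l"
      using Xs[OF x] l1 by (auto simp: field_simps)
    ultimately have "x div int l \<le> s" "- s - 1 \<le> x div int l" unfolding s_def by linarith+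
    then show "x \<in> (\<Union>i\<in>{- s - 1..s}. F i)" using x by (auto simp: X_def F_def)
  qed
  have s0: "s \<ge> 0" using l1 by (simp add: s_def)
  have Ffin: "finite (F i)" for i
    by (rule finite_subset[of _ "fst ` {(x :: int, y :: int). x\<^sup>2 + y\<^sup>2 = int n}"])
      (auto simp: F_def finite_circle image_iff)
  have Xfin: "finite X" using sub Ffin by (meson finite_UN finite_atLeastAtMost_int finite_subset)
  have "card X \<le> card (\<Union>i\<in>{- s - 1..s}. F i)" using sub Ffin by (intro card_mono) auto
  also have "\<dots> \<le> (\<Sum>i\<in>{- s - 1..s}. card (F i))" by (intro card_UN_le) auto
  also have "\<dots> \<le> (\<Sum>i\<in>{- s - 1..s}. 2)"
    unfolding F_def by (intro sum_mono card_circle_fibre lcond n l1)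
  also have "\<dots> = 2 * nat (2 * s + 2)" by simp
  finally have "card X \<le> 2 * nat (2 * s + 2)" .
  then have "real (card X) \<le> 4 * real_of_int s + 4" using s0 by linarith
  also have "\<dots> \<le> 4 * (sqrt n / l) + 4" unfolding s_def by linarith
  finally have cX: "real (card X) \<le> 4 * (sqrt n / l) + 4" .
  have key: "sqrt n / l \<le> 4 * real n powr (1/3)"
  proof -
    have "sqrt n = real n powr (1/3) * real n powr (1/6)"
      by (simp flip: powr_add add: powr_half_sqrt)
    also have "\<dots> \<le> real n powr (1/3) * (4 * real l)" using lbig by (intro mult_left_mono) auto
    finally show ?thesis using l1 by (simp add: field_simps)
  qed
  define Y where "Y x = \<lfloor>sqrt (real n - (real_of_int x)\<^sup>2)\<rfloor>" for x
  have YI: "Y x = y" if "y \<ge> 0" "x\<^sup>2 + y\<^sup>2 = int n" for x y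
  proof -
    have "real_of_int (x\<^sup>2 + y\<^sup>2) = real_of_int (int n)" using that by simp
    then have "real n - (real_of_int x)\<^sup>2 = (real_of_int y)\<^sup>2" by simp
    then show ?thesis using that by (simp add: Y_def)
  qed
  \<comment> \<open>A point is recovered from its smaller coordinate, as \<open>Y\<close> returns
    the absolute value of the other one; the four images are the four arcs.\<close>
  have "{(x, y). x\<^sup>2 + y\<^sup>2 = int n} \<subseteq> (\<lambda>x. (x, Y x)) ` X \<union> (\<lambda>x. (x, - Y x)) ` X
      \<union> (\<lambda>x. (Y x, x)) ` X \<union> (\<lambda>x. (- Y x, x)) ` X" (is "?S \<subseteq> ?T")
  proof clarify
    fix x y :: int assume xy: "x\<^sup>2 + y\<^sup>2 = int n" and 1: "(x, y) \<notin> (\<lambda>x. (- Y x, x)) ` X"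
      "(x, y) \<notin> (\<lambda>x. (Y x, x)) ` X" "(x, y) \<notin> (\<lambda>x. (x, - Y x)) ` X"
    show "(x, y) \<in> (\<lambda>x. (x, Y x)) ` X"
    proof (cases "\<bar>x\<bar> \<le> \<bar>y\<bar>")
      case True
      then have "y \<noteq> 0" using xy n by auto
      then have "x \<in> X" unfolding X_def using True xy by (auto intro!: exI[of _ "\<bar>y\<bar>"])
      moreover have "Y x = \<bar>y\<bar>" using xy by (intro YI) auto
      ultimately show ?thesis using 1 by (cases "y \<ge> 0") (auto simp: image_iff)
    next
      case False
      then have "x \<noteq> 0" using xy n by auto
      then have "y \<in> X" unfolding X_def using False xy by (auto intro!: exI[of _ "\<bar>x\<bar>"] simp: add.commute)
      moreover have "Y y = \<bar>x\<bar>" using xy by (intro YI) (auto simp: add.commute)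
      ultimately show ?thesis using 1 by (cases "x \<ge> 0") (auto simp: image_iff)
    qed
  qed
  then have "r2 n \<le> card ?T" unfolding r2_def using Xfin by (intro card_mono) auto
  also have "\<dots> \<le> card X + card X + card X + card X"
    using Xfin by (intro card_Un_le[THEN order_trans] add_mono card_image_le) auto
  finally have "real (r2 n) \<le> 4 * real (card X)" by linarith
  also have "\<dots> \<le> 4 * (4 * (4 * real n powr (1/3)) + 4)" 
    using cX mult_left_mono[OF key, of 4] by simp
  also have "\<dots> \<le> 100 * real n powr (1/3)"
    using ge_one_powr_ge_zero[of "real n" "1/3"] n by simp
  finally show "real (r2 n) \<le> 100 * real n powr (1/3)" .
qed

section \<open>Lattice points on spheres\<close>

lemma nsq_nonneg: "nsq v \<ge> 0"
  by (simp add: nsq_def)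

lemma finite_nsq_le: "finite {v. nsq v \<le> int n}"
proof (rule finite_subset)
  show "{v. nsq v \<le> int n} \<subseteq> {- int n..int n} \<times> {- int n..int n} \<times> {- int n..int n}"
  proof clarify
    fix x y z assume "nsq (x, y, z) \<le> int n"
    then have "x\<^sup>2 \<le> int n" "y\<^sup>2 \<le> int n" "z\<^sup>2 \<le> int n"
      using zero_le_power2[of x] zero_le_power2[of y] zero_le_power2[of z]
      unfolding nsq_def fst_conv snd_conv by linarith+
    from this[THEN abs_le_of_sq]
    show "x \<in> {- int n..int n} \<and> (y, z) \<in> {- int n..int n} \<times> {- int n..int n}" by auto
  qed
qed auto

lemma finite_nsq_eq: "finite {v. nsq v = int n}"
  by (rule finite_subset[OF _ finite_nsq_le[of n]]) auto

text \<open>Slicing by the last coordinate leaves \<open>O(sqrt n)\<close> circles with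
  \<open>O(n^(1/3))\<close> points each.\<close>

lemma r3_bound: "\<exists>C\<ge>1. \<forall>n\<ge>1. real (r3 n) \<le> C * real n powr (5/6)"
proof -
  obtain C where C: "C \<ge> 1" "\<And>n. n \<ge> 1 \<Longrightarrow> real (r2 n) \<le> C * real n powr (1/3)"
    using r2_bound by blast
  have "real (r3 n) \<le> (3 * C) * real n powr (5/6)" if n: "n \<ge> 1" for n
  proof -
    define s where "s = \<lfloor>sqrt n\<rfloor>"
    have s0: "s \<ge> 0" by (simp add: s_def)
    have "{v. nsq v = int n} \<subseteq> (\<Union>z\<in>{-s..s}. (\<lambda>(x, y). (x, y, z)) ` {(x, y). x\<^sup>2 + y\<^sup>2 = int (nat (int n - z\<^sup>2))})"
    proof clarify
      fix x y z assume a: "nsq (x, y, z) = int n"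
      then have "z\<^sup>2 \<le> int n" using zero_le_power2[of x] zero_le_power2[of y]
        unfolding nsq_def fst_conv snd_conv by linarith
      then have "\<bar>real_of_int z\<bar> \<le> sqrt n" by (rule abs_le_sqrt_of_sq)
      then have "z \<in> {-s..s}" unfolding s_def by (auto simp: le_floor_iff minus_le_iff abs_le_iff)
      moreover have "x\<^sup>2 + y\<^sup>2 = int (nat (int n - z\<^sup>2))" using a \<open>z\<^sup>2 \<le> int n\<close> by (simp add: nsq_def)
      ultimately show "(x, y, z) \<in> (\<Union>z\<in>{-s..s}. (\<lambda>(x, y). (x, y, z)) ` {(x, y). x\<^sup>2 + y\<^sup>2 = int (nat (int n - z\<^sup>2))})"
        by force
    qed
    then have "r3 n \<le> card (\<Union>z\<in>{-s..s}. (\<lambda>(x, y). (x, y, z)) ` {(x, y). x\<^sup>2 + y\<^sup>2 = int (nat (int n - z\<^sup>2))})"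
      unfolding r3_def by (intro card_mono) (auto simp: finite_circle simp del: of_nat_nat int_nat_eq)
    also have "\<dots> \<le> (\<Sum>z\<in>{-s..s}. card ((\<lambda>(x, y). (x, y, z)) ` {(x, y). x\<^sup>2 + y\<^sup>2 = int (nat (int n - z\<^sup>2))}))"
      by (intro card_UN_le) auto
    also have "\<dots> \<le> (\<Sum>z\<in>{-s..s}. r2 (nat (int n - z\<^sup>2)))"
      unfolding r2_def by (intro sum_mono card_image_le finite_circle)
    finally have "real (r3 n) \<le> real (\<Sum>z\<in>{-s..s}. r2 (nat (int n - z\<^sup>2)))" by (rule of_nat_mono)
    also have "\<dots> = (\<Sum>z\<in>{-s..s}. real (r2 (nat (int n - z\<^sup>2))))" by simp
    also have "\<dots> \<le> (\<Sum>z\<in>{-s..s}. C * real n powr (1/3))"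
    proof (rule sum_mono)
      fix z
      show "real (r2 (nat (int n - z\<^sup>2))) \<le> C * real n powr (1/3)"
      proof (cases "nat (int n - z\<^sup>2) \<ge> 1")
        case True
        have "nat (int n - z\<^sup>2) \<le> n" using zero_le_power2[of z] by linarith
        then have "C * real (nat (int n - z\<^sup>2)) powr (1/3) \<le> C * real n powr (1/3)"
          using C by (intro mult_left_mono powr_mono2) auto
        then show ?thesis using C(2)[OF True] by linarith
      next
        case False
        then have "nat (int n - z\<^sup>2) = 0" by simp
        moreover have "r2 0 = 1"
        proof -
          have "{(x :: int, y :: int). x\<^sup>2 + y\<^sup>2 = int 0} = {(0, 0)}"
            by (auto simp: sum_power2_eq_zero_iff)
          then show ?thesis by (simp add: r2_def)
        qed
        moreover have "1 * 1 \<le> C * real n powr (1/3)"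
          using C n by (intro mult_mono ge_one_powr_ge_zero) auto
        ultimately show ?thesis by simp
      qed
    qed
    also have "\<dots> = real (nat (2 * s + 1)) * (C * real n powr (1/3))" by simp
    also have "\<dots> \<le> (3 * sqrt n) * (C * real n powr (1/3))"
    proof (intro mult_right_mono)
      have "1 \<le> sqrt n" using n by simp
      moreover have "real_of_int s \<le> sqrt n" by (simp add: s_def)
      ultimately show "real (nat (2 * s + 1)) \<le> 3 * sqrt n" using s0 by linarith
    qed (use C in auto)
    also have "\<dots> = 3 * C * (real n powr (1/2) * real n powr (1/3))" by (simp add: powr_half_sqrt)
    also have "\<dots> = 3 * C * real n powr (5/6)" by (simp flip: powr_add)
    finally show ?thesis .
  qed
  moreover have "3 * C \<ge> 1" using C by simp
  ultimately show ?thesis by blast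
qed

text \<open>Single values \<open>r3 m\<close> may vanish, so the bound is read off from a cone of
  lattice points: for each \<open>a \<le> K\<close> there are \<open>a^2\<close> triples
  \<open>(a, b, c)\<close> with \<open>0 \<le> b, c < a\<close>, of squared norm at most
  \<open>3 * a^2\<close>, and together they contribute at least \<open>1 / (3^(3/2) * a)\<close>.
  The harmonic sum over \<open>a\<close> gives the logarithm.\<close>

lemma r3_sum_lower:
  assumes "3 * K\<^sup>2 \<le> N"
  shows "(\<Sum>m=1..N. real (r3 m) / real m powr (3/2)) \<ge> ln (real K + 1) / 3 powr (3/2)"
proof -
  define T :: "(int \<times> int \<times> int) set" where
    "T = (SIGMA a:{1..int K}. {0..<a} \<times> {0..<a})"
  define F :: "int \<times> int \<times> int \<Rightarrow> real" where "F v = 1 / real_of_int (nsq v) powr (3/2)" for v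
  have Tfin: "finite T" by (auto simp: T_def)
  have Tn: "nsq v \<in> {1..int N}" "nsq v \<le> 3 * (fst v)\<^sup>2" if vT: "v \<in> T" for v
  proof -
    obtain a b c where v: "v = (a, b, c)" by (cases v) auto
    have abc: "1 \<le> a" "a \<le> int K" "0 \<le> b" "b < a" "0 \<le> c" "c < a"
      using vT by (auto simp: T_def v)
    have "b\<^sup>2 \<le> a\<^sup>2" "c\<^sup>2 \<le> a\<^sup>2" "1\<^sup>2 \<le> a\<^sup>2" "a\<^sup>2 \<le> (int K)\<^sup>2" using abc by (intro power_mono; simp)+
    moreover have "3 * (int K)\<^sup>2 \<le> int N" using assms by (metis of_nat_le_iff of_nat_mult of_nat_numeral of_nat_power)
    moreover have "0 \<le> b\<^sup>2" "0 \<le> c\<^sup>2" by simp_all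
    ultimately have "1 \<le> nsq v" "nsq v \<le> int N" "nsq v \<le> 3 * (fst v)\<^sup>2"
      unfolding nsq_def v fst_conv snd_conv one_power2 by linarith+
    then show "nsq v \<in> {1..int N}" "nsq v \<le> 3 * (fst v)\<^sup>2" by auto
  qed
  have "ln (real K + 1) / 3 powr (3/2) \<le> (\<Sum>a=1..K. 1 / real a) / 3 powr (3/2)"
    using ln_le_harm[of K] by (intro divide_right_mono) (auto simp: harm_def inverse_eq_divide)
  also have "\<dots> = (\<Sum>a\<in>{1..int K}. \<Sum>bc\<in>{0..<a} \<times> {0..<a}. 1 / (3 * (real_of_int a)\<^sup>2) powr (3/2))"
  proof -
    have "(\<Sum>a\<in>{1..int K}. \<Sum>bc\<in>{0..<a} \<times> {0..<a}. 1 / (3 * (real_of_int a)\<^sup>2) powr (3/2))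
        = (\<Sum>a\<in>int ` {1..K}. 1 / (real_of_int a * 3 powr (3/2)))"
    proof (rule sum.cong)
      show "{1..int K} = int ` {1..K}" by (simp add: image_int_atLeastAtMost)
      fix a assume "a \<in> int ` {1..K}"
      then have a: "a > 0" by auto
      have "((real_of_int a)\<^sup>2) powr (3/2) = real_of_int a ^ 3"
        using a by (simp flip: powr_numeral add: powr_powr)
      then have "(3 * (real_of_int a)\<^sup>2) powr (3/2) = 3 powr (3/2) * real_of_int a ^ 3"
        by (simp add: powr_mult)
      then show "(\<Sum>bc\<in>{0..<a} \<times> {0..<a}. 1 / (3 * (real_of_int a)\<^sup>2) powr (3/2)) = 1 / (real_of_int a * 3 powr (3/2))"
        using a by (simp add: card_cartesian_product power_numeral_reduce field_simps)
    qed
    also have "\<dots> = (\<Sum>a=1..K. 1 / (real a * 3 powr (3/2)))" by (subst sum.reindex) auto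
    finally show ?thesis by (simp add: sum_divide_distrib)
  qed
  also have "\<dots> = (\<Sum>v\<in>T. 1 / (3 * (real_of_int (fst v))\<^sup>2) powr (3/2))"
    unfolding T_def by (subst sum.Sigma) (auto intro!: sum.cong)
  also have "\<dots> \<le> (\<Sum>v\<in>T. F v)"
  proof (rule sum_mono)
    fix v assume v: "v \<in> T"
    have "real_of_int (nsq v) \<le> real_of_int (3 * (fst v)\<^sup>2)" using Tn(2)[OF v] by (simp only: of_int_le_iff)
    then have "real_of_int (nsq v) \<le> 3 * (real_of_int (fst v))\<^sup>2" by simp
    moreover have "real_of_int (nsq v) \<ge> 1" using Tn(1)[OF v] by simp
    ultimately show "1 / (3 * (real_of_int (fst v))\<^sup>2) powr (3/2) \<le> F v"
      unfolding F_def by (intro divide_left_mono powr_mono2 mult_pos_pos) auto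
  qed
  also have "\<dots> \<le> (\<Sum>v\<in>(\<Union>m\<in>{1..N}. {v. nsq v = int m}). F v)"
  proof (rule sum_mono2)
    show "T \<subseteq> (\<Union>m\<in>{1..N}. {v. nsq v = int m})"
    proof
      fix v assume "v \<in> T"
      then have "nsq v \<in> {1..int N}" by (rule Tn)
      then show "v \<in> (\<Union>m\<in>{1..N}. {v. nsq v = int m})"
        by (auto intro!: bexI[of _ "nat (nsq v)"])
    qed
  qed (auto simp: F_def finite_nsq_eq)
  also have "\<dots> = (\<Sum>m\<in>{1..N}. \<Sum>v\<in>{v. nsq v = int m}. F v)"
    by (intro sum.UNION_disjoint) (auto simp: finite_nsq_eq)
  also have "\<dots> = (\<Sum>m=1..N. real (r3 m) / real m powr (3/2))"
    by (intro sum.cong) (auto simp: F_def r3_def)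
  finally show ?thesis .
qed

section \<open>The Moebius function\<close>

definition moebius_mu :: "nat \<Rightarrow> real" where
  "moebius_mu n = (if squarefree n then (-1) ^ card (prime_factors n) else 0)"

lemma abs_moebius_le: "\<bar>moebius_mu n\<bar> \<le> 1"
  by (simp add: moebius_mu_def)

lemma moebius_prime_mult:
  assumes "prime p" "\<not> p dvd d"
  shows "moebius_mu (p * d) = - moebius_mu d"
proof -
  have cop: "coprime p d" using assms by (simp add: prime_imp_coprime)
  have d0: "d \<noteq> 0" using assms by (metis dvd_0_right)
  have "squarefree (p * d) \<longleftrightarrow> squarefree d"
    using cop assms by (auto simp: squarefree_mult_coprime squarefree_prime intro: squarefree_multD)
  moreover have "prime_factors (p * d) = insert p (prime_factors d)"
    using assms d0 by (auto simp: prime_factors_product prime_prime_factors)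
  moreover have "p \<notin> prime_factors d" using assms by auto
  ultimately show ?thesis by (simp add: moebius_mu_def)
qed

text \<open>For a prime \<open>p\<close> dividing \<open>n\<close>, the squarefree divisors pair up
  as \<open>d\<close> and \<open>p * d\<close> with \<open>p\<close> not dividing \<open>d\<close>,
  and the two values cancel.\<close>

lemma sum_moebius_divisors:
  assumes "n > 0"
  shows "(\<Sum>d | d dvd n. moebius_mu d) = (if n = 1 then 1 else 0)"
proof (cases "n = 1")
  case True
  then show ?thesis by (simp add: moebius_mu_def)
next
  case False
  then obtain p where p: "prime p" "p dvd n" using prime_factor_nat by blast
  define A where "A = {d. d dvd n \<and> \<not> p dvd d \<and> squarefree d}"
  have fin: "finite {d. d dvd n}" using assms by simp
  have "(\<Sum>d | d dvd n. moebius_mu d) = (\<Sum>d\<in>A \<union> (\<lambda>d. p * d) ` A. moebius_mu d)"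
  proof (rule sum.mono_neutral_right[OF fin])
    show "A \<union> (\<lambda>d. p * d) ` A \<subseteq> {d. d dvd n}"
      using p by (auto simp: A_def intro!: divides_mult prime_imp_coprime)
    show "\<forall>d\<in>{d. d dvd n} - (A \<union> (\<lambda>d. p * d) ` A). moebius_mu d = 0"
    proof
      fix d assume "d \<in> {d. d dvd n} - (A \<union> (\<lambda>d. p * d) ` A)"
      then have d: "d dvd n" "d \<notin> A" "d \<notin> (\<lambda>d. p * d) ` A" by auto
      show "moebius_mu d = 0"
      proof (rule ccontr)
        assume "moebius_mu d \<noteq> 0"
        then have sq: "squarefree d" by (auto simp: moebius_mu_def split: if_splits)
        then have "p dvd d" using d by (auto simp: A_def)
        then obtain e where e: "d = p * e" by auto
        have "\<not> p dvd e"
        proof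
          assume "p dvd e"
          then have "p ^ 2 dvd d" by (auto simp: e power2_eq_square)
          then show False using sq p by (auto simp: squarefree_def)
        qed
        moreover have "e dvd n" using d e by (metis dvd_mult_right)
        moreover have "squarefree e" using sq e by (auto dest: squarefree_multD)
        ultimately show False using d e by (auto simp: A_def)
      qed
    qed
  qed
  also have "\<dots> = (\<Sum>d\<in>A. moebius_mu d) + (\<Sum>d\<in>(\<lambda>d. p * d) ` A. moebius_mu d)"
    using fin by (intro sum.union_disjoint) (auto simp: A_def)
  also have "(\<Sum>d\<in>(\<lambda>d. p * d) ` A. moebius_mu d) = (\<Sum>d\<in>A. moebius_mu (p * d))"
    using p by (subst sum.reindex) (auto simp: inj_on_def prime_gt_0_nat)
  also have "\<dots> = (\<Sum>d\<in>A. - moebius_mu d)"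
    using p by (intro sum.cong) (auto simp: A_def moebius_prime_mult)
  finally show ?thesis using False by (simp add: sum_negf)
qed

section \<open>Linear independence of square roots\<close>

text \<open>Closure under \<open>inverse\<close> is demanded at 0 as well, which is harmless since
  \<open>inverse 0 = 0\<close>. Negation comes from multiplication by the rational
  \<open>-1\<close>.\<close>

definition real_subfield :: "real set \<Rightarrow> bool" where
  "real_subfield K \<longleftrightarrow> \<rat> \<subseteq> K \<and> (\<forall>x\<in>K. \<forall>y\<in>K. x + y \<in> K \<and> x * y \<in> K) \<and> (\<forall>x\<in>K. inverse x \<in> K)"

lemma real_subfieldD:
  assumes "real_subfield K"
  shows "x \<in> \<rat> \<Longrightarrow> x \<in> K" "x \<in> K \<Longrightarrow> y \<in> K \<Longrightarrow> x + y \<in> K" "x \<in> K \<Longrightarrow> y \<in> K \<Longrightarrow> x * y \<in> K"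
    "x \<in> K \<Longrightarrow> inverse x \<in> K" "x \<in> K \<Longrightarrow> - x \<in> K" "x \<in> K \<Longrightarrow> y \<in> K \<Longrightarrow> x - y \<in> K"
    "x \<in> K \<Longrightarrow> y \<in> K \<Longrightarrow> x / y \<in> K" "real n \<in> K" "0 \<in> K"
proof -
  show a: "x \<in> \<rat> \<Longrightarrow> x \<in> K" "x \<in> K \<Longrightarrow> y \<in> K \<Longrightarrow> x + y \<in> K" "x \<in> K \<Longrightarrow> y \<in> K \<Longrightarrow> x * y \<in> K"
    "x \<in> K \<Longrightarrow> inverse x \<in> K" for x y
    using assms by (auto simp: real_subfield_def)
  show b: "x \<in> K \<Longrightarrow> - x \<in> K" for x
    using a(3)[of "-1" x] a(1)[of "-1"] by auto
  show "x \<in> K \<Longrightarrow> y \<in> K \<Longrightarrow> x - y \<in> K" using a(2)[of x "-y"] b[of y] by auto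
  show "x \<in> K \<Longrightarrow> y \<in> K \<Longrightarrow> x / y \<in> K" using a(3)[of x "inverse y"] a(4)[of y] by (auto simp: divide_inverse)
  show "real n \<in> K" "0 \<in> K" using a(1) by auto
qed

lemma real_subfield_adjoin_sqrt:
  assumes K: "real_subfield K"
  shows "real_subfield {a + b * sqrt (real p) | a b. a \<in> K \<and> b \<in> K}" (is "real_subfield ?L")
proof -
  note D = real_subfieldD[OF K]
  have KL: "x \<in> ?L" if "x \<in> K" for x
  proof -
    have "x = x + 0 * sqrt (real p)" by simp
    then show ?thesis using that D(9) by blast
  qed
  have 1: "x + y \<in> ?L \<and> x * y \<in> ?L" if xy: "x \<in> ?L" "y \<in> ?L" for x y
  proof -
    obtain a b c d where x: "x = a + b * sqrt p" "a \<in> K" "b \<in> K" and y: "y = c + d * sqrt p" "c \<in> K" "d \<in> K"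
      using xy by blast
    have "x + y = (a + c) + (b + d) * sqrt p" by (simp add: x y algebra_simps)
    moreover have "x * y = (a * c + p * (b * d)) + (a * d + b * c) * sqrt p"
      by (simp add: x y algebra_simps)
    moreover have "a + c \<in> K" "b + d \<in> K" "a * c + p * (b * d) \<in> K" "a * d + b * c \<in> K"
      using x y D(2,3,8) by auto
    ultimately show ?thesis by blast
  qed
  have 2: "inverse x \<in> ?L" if xL: "x \<in> ?L" for x
  proof -
    obtain a b where x: "x = a + b * sqrt p" "a \<in> K" "b \<in> K"
      using xL by blast
    define q where "q = a\<^sup>2 - p * b\<^sup>2"
    have xq: "x * (a - b * sqrt p) = q" by (simp add: x q_def algebra_simps power2_eq_square)
    show ?thesis
    proof (cases "q = 0")
      case False
      then have x0: "x \<noteq> 0" using xq by auto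
      have "inverse x = (a - b * sqrt p) / q"
        using False x0 by (simp flip: xq add: field_simps)
      also have "\<dots> = a / q + (- b / q) * sqrt p" by (simp add: diff_divide_distrib)
      finally have "inverse x = a / q + (- b / q) * sqrt p" .
      moreover have "q \<in> K" unfolding q_def power2_eq_square using x D(3,6,8) by auto
      then have "a / q \<in> K" "- b / q \<in> K" using x D(5,7) by auto
      ultimately show ?thesis by blast
    next
      \<comment> \<open>If the norm \<open>q\<close> vanishes with \<open>b \<noteq> 0\<close>, then
        \<open>sqrt p = \<bar>a / b\<bar>\<close> already lies in \<open>K\<close>, hence so does
        \<open>x\<close>. This covers those \<open>p\<close> that are squares in
        \<open>K\<close>.\<close>
      case True
      have "x \<in> K"
      proof (cases "b = 0")
        case False
        have "real p = (a / b)\<^sup>2" using True False by (simp add: q_def field_simps)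
        then have "sqrt p = \<bar>a / b\<bar>" by simp
        then have "sqrt p = a / b \<or> sqrt p = - (a / b)" by linarith
        then have "sqrt p \<in> K" using D(5)[of "a / b"] D(7)[of a b] x by auto
        then show ?thesis using x D(2,3) by auto
      qed (use x in auto)
      then show ?thesis using KL D(4) by auto
    qed
  qed
  show ?thesis unfolding real_subfield_def
  proof (intro conjI subsetI ballI)
    show "x \<in> ?L" if "x \<in> \<rat>" for x by (rule KL, rule D(1), rule that)
    show "x + y \<in> ?L" if "x \<in> ?L" "y \<in> ?L" for x y by (rule conjunct1[OF 1[OF that]])
    show "x * y \<in> ?L" if "x \<in> ?L" "y \<in> ?L" for x y by (rule conjunct2[OF 1[OF that]])
    show "inverse x \<in> ?L" if "x \<in> ?L" for x by (rule 2[OF that])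
  qed
qed

primrec sqrt_tower :: "nat list \<Rightarrow> real set" where
  "sqrt_tower [] = \<rat>"
| "sqrt_tower (p # ps) = {a + b * sqrt (real p) | a b. a \<in> sqrt_tower ps \<and> b \<in> sqrt_tower ps}"

lemma real_subfield_sqrt_tower: "real_subfield (sqrt_tower ps)"
proof (induction ps)
  case Nil
  show ?case by (simp add: real_subfield_def)
next
  case (Cons p ps)
  then show ?case unfolding sqrt_tower.simps by (rule real_subfield_adjoin_sqrt)
qed

lemma sqrt_tower_mono: "x \<in> sqrt_tower ps \<Longrightarrow> x \<in> sqrt_tower (p # ps)"
proof -
  assume "x \<in> sqrt_tower ps"
  moreover have "x = x + 0 * sqrt (real p)" by simp
  ultimately show ?thesis using real_subfieldD(9)[OF real_subfield_sqrt_tower[of ps]]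
    unfolding sqrt_tower.simps by blast
qed

lemma sqrt_tower_sqrt: "sqrt p \<in> sqrt_tower (p # ps)"
proof -
  have "sqrt p = 0 + 1 * sqrt (real p)" by simp
  moreover have "1 \<in> sqrt_tower ps" using real_subfieldD(8)[OF real_subfield_sqrt_tower[of ps], of 1] by simp
  ultimately show ?thesis using real_subfieldD(9)[OF real_subfield_sqrt_tower[of ps]]
    unfolding sqrt_tower.simps by blast
qed

lemma sqrt_rational_imp_square:
  assumes "sqrt (real n) \<in> \<rat>"
  shows "\<exists>m. n = m\<^sup>2"
proof -
  obtain m k :: nat where mk: "k \<noteq> 0" "\<bar>sqrt n\<bar> = m / k" "coprime m k"
    using assms by (rule Rats_abs_nat_div_natE)
  then have "real n = (m / k)\<^sup>2" by (metis abs_of_nonneg of_nat_0_le_iff real_sqrt_ge_zero real_sqrt_pow2)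
  then have "real (n * k\<^sup>2) = real (m\<^sup>2)" using mk by (simp add: field_simps)
  then have *: "n * k\<^sup>2 = m\<^sup>2" by (simp only: of_nat_eq_iff)
  then have "k\<^sup>2 dvd m\<^sup>2" by (metis dvd_triv_right)
  then have "k dvd m" by simp
  then have "k = 1" using mk by (metis coprime_common_divisor_nat dvd_refl)
  then show ?thesis using * by auto
qed

text \<open>Kummer theory for square roots, by induction on the tower. Write
  \<open>sqrt n = a + b * sqrt p\<close>. If \<open>a = 0\<close>, then \<open>sqrt (n * p)\<close>
  lies one level down. If \<open>a\<close> and \<open>b\<close> are nonzero, squaring expresses
  \<open>sqrt p\<close> through the smaller field, which then contains
  \<open>sqrt n\<close>.\<close>

lemma sqrt_in_tower:
  assumes "sqrt (real n) \<in> sqrt_tower ps" "distinct ps"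
  shows "\<exists>A\<subseteq>set ps. \<exists>m. n * \<Prod>A = m\<^sup>2"
  using assms
proof (induction ps arbitrary: n)
  case Nil
  then show ?case using sqrt_rational_imp_square by auto
next
  case (Cons p ps)
  note D = real_subfieldD[OF real_subfield_sqrt_tower[of ps]]
  obtain a b where ab: "sqrt n = a + b * sqrt p" "a \<in> sqrt_tower ps" "b \<in> sqrt_tower ps"
    using Cons.prems by auto
  show ?case
  proof (cases "a = 0")
    case True
    then have "sqrt (n * p) = b * p" by (simp add: ab real_sqrt_mult)
    then have "sqrt (real (n * p)) \<in> sqrt_tower ps" using ab D(3,8) by simp
    then obtain A m where A: "A \<subseteq> set ps" "(n * p) * \<Prod>A = m\<^sup>2"
      using Cons.IH[of "n * p"] Cons.prems(2) by auto
    then have "finite A" "p \<notin> A" using Cons.prems finite_subset by auto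
    then have "n * \<Prod>(insert p A) = m\<^sup>2" using A by (simp add: mult.assoc)
    moreover have "insert p A \<subseteq> set (p # ps)" using A(1) by auto
    ultimately show ?thesis by blast
  next
    case a: False
    have "sqrt n \<in> sqrt_tower ps"
    proof (cases "b = 0")
      case False
      have "real n = (sqrt (real n))\<^sup>2" by (rule real_sqrt_pow2[symmetric]) simp
      also have "\<dots> = (a + b * sqrt p)\<^sup>2" by (simp only: ab(1))
      also have "\<dots> = a\<^sup>2 + b\<^sup>2 * (sqrt p)\<^sup>2 + 2 * a * (b * sqrt p)"
        by (simp only: power2_sum power_mult_distrib)
      also have "(sqrt (real p))\<^sup>2 = real p" by (rule real_sqrt_pow2) simp
      finally have "sqrt p * (2 * (a * b)) = n - a * a - p * (b * b)"
        by (simp only: power2_eq_square) argo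
      then have "sqrt p = (n - a * a - p * (b * b)) / (2 * (a * b))"
        using a False by (simp add: eq_divide_eq)
      moreover have "2 \<in> sqrt_tower ps" using D(8)[of 2] by simp
      moreover have "a * a \<in> sqrt_tower ps" "p * (b * b) \<in> sqrt_tower ps" "a * b \<in> sqrt_tower ps"
        using D(3,8) ab by auto
      ultimately have "sqrt p \<in> sqrt_tower ps"
        using D(3)[of 2 "a * b"] D(6)[of "real n" "a * a"] D(6)[of "n - a * a" "p * (b * b)"] D(8)[of n]
          D(7)[of "n - a * a - p * (b * b)" "2 * (a * b)"] by simp
      then show ?thesis unfolding ab(1) by (intro D(2) D(3) ab(2,3))
    qed (use ab in auto)
    then obtain A m where A: "A \<subseteq> set ps" "n * \<Prod>A = m\<^sup>2"
      using Cons.IH[of n] Cons.prems(2) by auto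
    moreover have "A \<subseteq> set (p # ps)" using A(1) by auto
    ultimately show ?thesis by blast
  qed
qed

lemma sum_in_sqrt_tower:
  assumes "\<And>A. A \<subseteq> set ps \<Longrightarrow> c A \<in> \<rat>" "distinct ps"
  shows "(\<Sum>A\<in>Pow (set ps). c A * sqrt (real (\<Prod>A))) \<in> sqrt_tower ps"
proof -
  note D = real_subfieldD[OF real_subfield_sqrt_tower[of ps]]
  have mem: "sqrt (real p) \<in> sqrt_tower ps" if "p \<in> set ps" for p
    using that
  proof (induction ps)
    case (Cons q ps)
    then show ?case using sqrt_tower_mono sqrt_tower_sqrt by (metis set_ConsD)
  qed auto
  have pr: "sqrt (real (\<Prod>A)) \<in> sqrt_tower ps" if "A \<subseteq> set ps" for A
  proof -
    have "finite A" using that finite_subset by auto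
    then show ?thesis using that
    proof (induction A rule: finite_induct)
      case empty
      then show ?case using D(1)[of 1] by simp
    next
      case (insert a A)
      then have "sqrt (real a) * sqrt (real (\<Prod>A)) \<in> sqrt_tower ps" using mem D(3) by auto
      then show ?case using insert by (simp add: real_sqrt_mult)
    qed
  qed
  have S: "sum f B \<in> sqrt_tower ps" if "\<And>x. x \<in> B \<Longrightarrow> f x \<in> sqrt_tower ps" for f and B :: "nat set set"
    using that by (induction B rule: infinite_finite_induct) (auto intro: D)
  show ?thesis
  proof (rule S)
    fix A assume "A \<in> Pow (set ps)"
    then have A: "A \<subseteq> set ps" by simp
    show "c A * sqrt (real (\<Prod>A)) \<in> sqrt_tower ps"
      by (rule D(3)[OF D(1)[OF assms(1)[OF A]] pr[OF A]])
  qed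
qed

text \<open>Sorting the subsets by whether they contain \<open>p\<close> turns the relation into
  \<open>x + sqrt p * y = 0\<close> with \<open>x\<close>, \<open>y\<close> in the tower of the
  other primes. If \<open>y \<noteq> 0\<close>, that tower contains \<open>sqrt p\<close>, and
  \<open>sqrt_in_tower\<close> makes \<open>p\<close> times a product of other primes a square,
  which is impossible. So both halves vanish and the induction hypothesis applies to each.\<close>

lemma sqrt_prod_independent:
  assumes "\<And>A. A \<subseteq> set ps \<Longrightarrow> c A \<in> \<rat>" "distinct ps" "\<And>p. p \<in> set ps \<Longrightarrow> prime p"
    "(\<Sum>A\<in>Pow (set ps). c A * sqrt (real (\<Prod>A))) = 0"
  shows "\<forall>A\<subseteq>set ps. c A = 0"
  using assms
proof (induction ps arbitrary: c)
  case Nil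
  then show ?case by auto
next
  case (Cons p ps)
  note D = real_subfieldD[OF real_subfield_sqrt_tower[of ps]]
  define x y where "x = (\<Sum>A\<in>Pow (set ps). c A * sqrt (real (\<Prod>A)))"
    and "y = (\<Sum>A\<in>Pow (set ps). c (insert p A) * sqrt (real (\<Prod>A)))"
  have p: "p \<notin> set ps" "prime p" using Cons.prems(2,3) by auto
  have "(\<Sum>A\<in>Pow (set (p # ps)). c A * sqrt (real (\<Prod>A)))
     = (\<Sum>A\<in>Pow (set ps) \<union> insert p ` Pow (set ps). c A * sqrt (real (\<Prod>A)))"
    by (simp add: Pow_insert)
  also have "\<dots> = x + (\<Sum>A\<in>insert p ` Pow (set ps). c A * sqrt (real (\<Prod>A)))"
    unfolding x_def using p by (intro sum.union_disjoint) auto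
  also have "(\<Sum>A\<in>insert p ` Pow (set ps). c A * sqrt (real (\<Prod>A)))
      = (\<Sum>A\<in>Pow (set ps). c (insert p A) * sqrt (real (\<Prod>(insert p A))))"
    using p by (subst sum.reindex) (auto simp: inj_on_def)
  also have "\<dots> = (\<Sum>A\<in>Pow (set ps). sqrt p * (c (insert p A) * sqrt (real (\<Prod>A))))"
  proof (rule sum.cong)
    fix A assume "A \<in> Pow (set ps)"
    then have "finite A" "p \<notin> A" using p finite_subset by auto
    then show "c (insert p A) * sqrt (real (\<Prod>(insert p A))) = sqrt p * (c (insert p A) * sqrt (real (\<Prod>A)))"
      by (simp add: real_sqrt_mult)
  qed auto
  also have "\<dots> = sqrt p * y" by (simp add: y_def sum_distrib_left)
  finally have xy: "x + sqrt p * y = 0" using Cons.prems(4) by simp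
  have xm: "x \<in> sqrt_tower ps" unfolding x_def
    using Cons.prems(1)[OF subset_trans[OF _ set_subset_Cons]] Cons.prems(2) by (intro sum_in_sqrt_tower) auto
  have cp: "c (insert p A) \<in> \<rat>" if "A \<subseteq> set ps" for A
    by (rule Cons.prems(1)) (use that in auto)
  have ym: "y \<in> sqrt_tower ps" unfolding y_def using cp Cons.prems(2) by (intro sum_in_sqrt_tower) auto
  have y0: "y = 0"
  proof (rule ccontr)
    assume "y \<noteq> 0"
    then have "sqrt p = - (x / y)" using xy by (simp add: field_simps)
    then have "sqrt p \<in> sqrt_tower ps" using D(5)[of "x / y"] D(7)[of x y] xm ym by simp
    then obtain A m where A: "A \<subseteq> set ps" "p * \<Prod>A = m\<^sup>2"
      using sqrt_in_tower[of p ps] Cons.prems(2) by auto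
    have "finite A" using A finite_subset by auto
    have "\<not> p dvd \<Prod>A"
    proof
      assume "p dvd \<Prod>A"
      then obtain q where "q \<in> A" "p dvd q"
        using \<open>finite A\<close> p prime_dvd_prod_iff[of A p "\<lambda>x. x"] by auto
      moreover have "prime q" using \<open>q \<in> A\<close> A Cons.prems(3) by auto
      ultimately have "p = q" using p by (metis primes_dvd_imp_eq)
      then show False using p A \<open>q \<in> A\<close> by auto
    qed
    moreover have "p dvd m" using A p by (metis dvd_triv_left prime_dvd_power)
    then have "p * p dvd p * \<Prod>A" using A by (simp add: power2_eq_square mult_dvd_mono)
    then have "p dvd \<Prod>A" using p by (simp add: prime_gt_0_nat)
    ultimately show False by simp
  qed
  then have x0: "x = 0" using xy by simp
  have 1: "\<forall>A\<subseteq>set ps. c A = 0"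
    by (rule Cons.IH[OF Cons.prems(1)[OF subset_trans[OF _ set_subset_Cons]] _ _ x0[unfolded x_def]])
      (use Cons.prems(2,3) in auto)
  have 2: "\<forall>A\<subseteq>set ps. c (insert p A) = 0"
    by (rule Cons.IH[OF cp _ _ y0[unfolded y_def]]) (use Cons.prems(2,3) in auto)
  show ?case
  proof (intro allI impI)
    fix A assume A: "A \<subseteq> set (p # ps)"
    show "c A = 0"
    proof (cases "p \<in> A")
      case True
      then have "A = insert p (A - {p})" "A - {p} \<subseteq> set ps" using A by auto
      then show ?thesis using 2 by metis
    qed (use 1 A in auto)
  qed
qed

lemma squarefree_prod_prime_factors:
  assumes "squarefree (n::nat)"
  shows "\<Prod>(prime_factors n) = n"
proof -
  have n0: "n \<noteq> 0"
    using assms not_squarefree_0[where ?'a = nat] by (cases "n = 0") simp_all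
  have "n = (\<Prod>p\<in>prime_factors n. p ^ multiplicity p n)"
    using prod_prime_factors[OF n0] by simp
  also have "\<dots> = (\<Prod>p\<in>prime_factors n. p)"
  proof (rule prod.cong)
    fix p assume p: "p \<in> prime_factors n"
    then have "multiplicity p n \<le> 1"
      using assms squarefree_factorial_semiring'[of n] n0 by auto
    moreover have "multiplicity p n \<ge> 1" using p n0
      by (simp add: prime_factors_multiplicity Suc_leI)
    ultimately have "multiplicity p n = 1" by simp
    then show "p ^ multiplicity p n = p" by (metis power_one_right)
  qed auto
  finally show ?thesis by simp
qed

text \<open>A squarefree number is the product of its set of prime factors, so the relation becomes
  one over subsets of the finite prime set \<open>P\<close>, with coefficient 0 on subsets that do
  not come from \<open>S\<close>.\<close>

lemma sqrt_squarefree_independent: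
  fixes b :: "nat \<Rightarrow> int"
  assumes "finite S" "\<And>s. s \<in> S \<Longrightarrow> squarefree s" "(\<Sum>s\<in>S. b s * sqrt (real s)) = 0" "s \<in> S"
  shows "b s = 0"
proof -
  define P where "P = (\<Union>s\<in>S. prime_factors s)"
  have Pfin: "finite P" using assms(1) by (auto simp: P_def)
  obtain ps where ps: "set ps = P" "distinct ps" using finite_distinct_list[OF Pfin] by auto
  define c where "c A = (if A \<in> prime_factors ` S then real_of_int (b (\<Prod>A)) else 0)" for A
  have inj: "inj_on prime_factors S"
  proof (rule inj_onI)
    fix s t assume "s \<in> S" "t \<in> S" "prime_factors s = prime_factors t"
    moreover have "\<Prod>(prime_factors s) = s" "\<Prod>(prime_factors t) = t"
      by (rule squarefree_prod_prime_factors, rule assms(2), fact)+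
    ultimately show "s = t" by metis
  qed
  have "(\<Sum>A\<in>Pow (set ps). c A * sqrt (real (\<Prod>A))) = (\<Sum>A\<in>prime_factors ` S. c A * sqrt (real (\<Prod>A)))"
  proof (rule sum.mono_neutral_right)
    show "finite (Pow (set ps))" by simp
    show "prime_factors ` S \<subseteq> Pow (set ps)" using ps(1) by (auto simp: P_def)
    show "\<forall>A\<in>Pow (set ps) - prime_factors ` S. c A * sqrt (real (\<Prod>A)) = 0" unfolding c_def by simp
  qed
  also have "\<dots> = (\<Sum>s\<in>S. c (prime_factors s) * sqrt (real (\<Prod>(prime_factors s))))"
    by (simp only: sum.reindex[OF inj] o_def)
  also have "\<dots> = (\<Sum>s\<in>S. b s * sqrt (real s))"
  proof (rule sum.cong)
    fix s assume s: "s \<in> S"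
    then have "\<Prod>(prime_factors s) = s" using squarefree_prod_prime_factors assms(2) by blast
    moreover have "c (prime_factors s) = b (\<Prod>(prime_factors s))" using s unfolding c_def by simp
    ultimately show "c (prime_factors s) * sqrt (real (\<Prod>(prime_factors s))) = b s * sqrt (real s)" by metis
  qed simp
  finally have zero: "(\<Sum>A\<in>Pow (set ps). c A * sqrt (real (\<Prod>A))) = 0" using assms(3) by (rule trans)
  have "\<forall>A\<subseteq>set ps. c A = 0"
  proof (rule sqrt_prod_independent[OF _ ps(2) _ zero])
    show "c A \<in> \<rat>" for A by (simp add: c_def)
    show "prime p" if "p \<in> set ps" for p using that ps(1) by (auto simp: P_def)
  qed
  moreover have "prime_factors s \<subseteq> set ps" using assms(4) ps(1) by (auto simp: P_def)
  ultimately have "c (prime_factors s) = 0" by blast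
  moreover have "c (prime_factors s) = b (\<Prod>(prime_factors s))" using assms(4) unfolding c_def by simp
  moreover have "\<Prod>(prime_factors s) = s" using squarefree_prod_prime_factors assms(2,4) by blast
  ultimately have "real_of_int (b s) = 0" by (simp only:)
  then show ?thesis by simp
qed

section \<open>Spacing of sums of square roots\<close>

definition int_coeffs :: "real poly \<Rightarrow> bool" where
  "int_coeffs p \<longleftrightarrow> (\<forall>i. coeff p i \<in> \<int>)"

lemma int_coeffs_add: "int_coeffs p \<Longrightarrow> int_coeffs q \<Longrightarrow> int_coeffs (p + q)"
  and int_coeffs_diff: "int_coeffs p \<Longrightarrow> int_coeffs q \<Longrightarrow> int_coeffs (p - q)"
  and int_coeffs_mult: "int_coeffs p \<Longrightarrow> int_coeffs q \<Longrightarrow> int_coeffs (p * q)"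
  and int_coeffs_smult: "x \<in> \<int> \<Longrightarrow> int_coeffs p \<Longrightarrow> int_coeffs (smult x p)"
  and int_coeffs_pCons: "x \<in> \<int> \<Longrightarrow> int_coeffs p \<Longrightarrow> int_coeffs (pCons x p)"
  and int_coeffs_0: "int_coeffs 0"
  by (auto simp: int_coeffs_def coeff_mult coeff_pCons intro!: Ints_sum split: nat.split)

text \<open>Separates the terms even and odd in \<open>u\<close>; as \<open>u^2\<close> is an
  integer, both parts have integer coefficients. The product of the two shifts is then
  \<open>A^2 - u^2 * B^2\<close>, in which \<open>u\<close> itself no longer occurs.\<close>

lemma int_coeffs_shift:
  assumes "int_coeffs q" "u\<^sup>2 \<in> \<int>"
  shows "\<exists>A B. int_coeffs A \<and> int_coeffs B \<and> pcompose q [:u, 1:] = A + smult u B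
            \<and> pcompose q [:- u, 1:] = A - smult u B"
  using assms(1)
proof (induction q)
  case 0
  then show ?case using int_coeffs_0 by (intro exI[of _ 0]) simp
next
  case (pCons a q)
  have a: "a \<in> \<int>" using pCons.prems by (auto simp: int_coeffs_def dest: spec[of _ 0])
  have "int_coeffs q" using pCons.prems by (auto simp: int_coeffs_def coeff_pCons dest: spec[of _ "Suc _"])
  then obtain A B where AB: "int_coeffs A" "int_coeffs B" "pcompose q [:u, 1:] = A + smult u B"
     "pcompose q [:- u, 1:] = A - smult u B" using pCons.IH by auto
  define A' B' where "A' = pCons a A + smult (u\<^sup>2) B" and "B' = A + pCons 0 B"
  have "pcompose (pCons a q) [:u, 1:] = A' + smult u B'"
    by (simp add: pcompose_pCons AB A'_def B'_def poly_eq_iff coeff_pCons algebra_simps power2_eq_square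
        split: nat.split)
  moreover have "pcompose (pCons a q) [:- u, 1:] = A' - smult u B'"
    by (simp add: pcompose_pCons AB A'_def B'_def poly_eq_iff coeff_pCons algebra_simps power2_eq_square
        split: nat.split)
  moreover have "int_coeffs A'" "int_coeffs B'"
    unfolding A'_def B'_def using AB a assms(2)
    by (auto intro!: int_coeffs_add int_coeffs_pCons int_coeffs_smult)
  ultimately show ?case by blast
qed

text \<open>All values \<open>\<plusminus>\<surd>n\<^sub>1 \<plusminus> \<dots> \<plusminus> \<surd>n\<^sub>r\<close>: the polynomial with these roots has integer coefficients, so the product of the nonzero ones is a nonzero integer.\<close>

primrec sign_sums :: "nat list \<Rightarrow> real list" where
  "sign_sums [] = [0]"
| "sign_sums (n # ns) = map (\<lambda>x. x + sqrt n) (sign_sums ns) @ map (\<lambda>x. x - sqrt n) (sign_sums ns)"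

lemma length_sign_sums: "length (sign_sums ns) = 2 ^ length ns"
  by (induction ns) auto

lemma pcompose_prod_list_linear:
  "pcompose (\<Prod>x\<leftarrow>xs. [:- x, 1:]) [:u :: real, 1:] = (\<Prod>x\<leftarrow>xs. [:u - x, 1:])"
proof (induction xs)
  case (Cons a xs)
  have "pcompose [:- a, 1:] [:u, 1:] = [:u - a, 1:]" by (simp add: pcompose_pCons)
  then show ?case by (simp only: list.map prod_list.Cons pcompose_mult Cons.IH)
qed (simp add: pcompose_1)

text \<open>Prepending \<open>n\<close> replaces the root polynomial by the product of its shifts by
  \<open>sqrt n\<close> and \<open>- sqrt n\<close>.\<close>

lemma int_coeffs_sign_sums: "int_coeffs (\<Prod>x\<leftarrow>sign_sums ns. [:- x, 1:])"
proof (induction ns)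
  case Nil
  then show ?case by (simp add: int_coeffs_def coeff_pCons split: nat.split)
next
  case (Cons n ns)
  define q where "q = (\<Prod>x\<leftarrow>sign_sums ns. [:- x, 1:])"
  obtain A B where AB: "int_coeffs A" "int_coeffs B" "pcompose q [:sqrt n, 1:] = A + smult (sqrt n) B"
     "pcompose q [:- sqrt n, 1:] = A - smult (sqrt n) B"
    using int_coeffs_shift[of q "sqrt n"] Cons.IH by (auto simp: q_def)
  have "(\<Prod>x\<leftarrow>sign_sums (n # ns). [:- x, 1:]) = pcompose q [:- sqrt n, 1:] * pcompose q [:sqrt n, 1:]"
  proof -
    have "(\<lambda>x. [:- (x + sqrt n), 1:]) = (\<lambda>x. [:- sqrt n - x, 1:])" "(\<lambda>x. [:- (x - sqrt n), 1:]) = (\<lambda>x. [:sqrt n - x, 1:])"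
      by auto
    then show ?thesis unfolding q_def pcompose_prod_list_linear
      by (simp only: sign_sums.simps map_append map_map o_def prod_list.append)
  qed
  also have "\<dots> = A * A - smult (real n) (B * B)"
  proof -
    have "(A - smult u B) * (A + smult u B) = A * A - smult (u * u) (B * B)" for u by (simp add: algebra_simps)
    from this[of "sqrt n"] show ?thesis by (simp add: AB)
  qed
  finally show ?case using AB by (simp add: int_coeffs_diff int_coeffs_mult int_coeffs_smult)
qed

text \<open>Splitting off the power of the variable that belongs to the zero roots makes the product
  of the nonzero roots, up to sign, a coefficient of the full polynomial, hence an integer.\<close>

lemma prod_list_nonzero_roots:
  fixes xs :: "real list"
  shows "\<exists>e. (\<Prod>x\<leftarrow>xs. [:- x, 1:]) = monom 1 e * (\<Prod>x\<leftarrow>filter (\<lambda>x. x \<noteq> 0) xs. [:- x, 1:])"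
proof (induction xs)
  case Nil
  then show ?case by (intro exI[of _ 0]) simp
next
  case (Cons x xs)
  then obtain e where e: "(\<Prod>x\<leftarrow>xs. [:- x, 1:]) = monom 1 e * (\<Prod>x\<leftarrow>filter (\<lambda>x. x \<noteq> 0) xs. [:- x, 1:])"
    by auto
  show ?case
  proof (cases "x = 0")
    case True
    then show ?thesis using e by (intro exI[of _ "Suc e"]) (simp add: monom_Suc)
  next
    case False
    then show ?thesis using e by (intro exI[of _ e]) (simp add: mult_ac)
  qed
qed

lemma prod_nonzero_sign_sums_ge:
  "1 \<le> \<bar>\<Prod>x\<leftarrow>filter (\<lambda>x. x \<noteq> 0) (sign_sums ns). x\<bar>"
proof -
  define ys where "ys = filter (\<lambda>x. x \<noteq> 0) (sign_sums ns)"
  obtain e where e: "(\<Prod>x\<leftarrow>sign_sums ns. [:- x, 1:]) = monom 1 e * (\<Prod>x\<leftarrow>ys. [:- x, 1:])"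
    using prod_list_nonzero_roots unfolding ys_def by blast
  have "coeff (\<Prod>x\<leftarrow>sign_sums ns. [:- x, 1:]) e = poly (\<Prod>x\<leftarrow>ys. [:- x, 1:]) 0"
    unfolding e by (simp add: coeff_monom_mult poly_0_coeff_0)
  also have "\<dots> = (\<Prod>x\<leftarrow>ys. - x)" by (induction ys) auto
  finally have Z: "(\<Prod>x\<leftarrow>ys. - x) \<in> \<int>"
    using int_coeffs_sign_sums[of ns] unfolding int_coeffs_def by metis
  have "\<bar>\<Prod>x\<leftarrow>ys. - x\<bar> = \<bar>\<Prod>x\<leftarrow>ys. x\<bar>" by (induction ys) (auto simp: abs_mult)
  moreover have "(\<Prod>x\<leftarrow>ys. - x) \<noteq> 0" unfolding ys_def by (auto simp: prod_list_zero_iff)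
  then have "\<bar>\<Prod>x\<leftarrow>ys. - x\<bar> \<ge> 1" using Z by (rule Ints_nonzero_abs_ge1[rotated])
  ultimately show ?thesis unfolding ys_def by simp
qed

lemma prod_list_abs_le:
  fixes B :: real
  assumes "B \<ge> 1" "\<And>x. x \<in> set xs \<Longrightarrow> \<bar>x\<bar> \<le> B"
  shows "\<bar>prod_list xs\<bar> \<le> B ^ length xs"
  using assms(2)
proof (induction xs)
  case (Cons x xs)
  then show ?case using assms(1) by (auto simp: abs_mult intro!: mult_mono)
qed simp

text \<open>The remaining nonzero values are at most \<open>B\<close> and there are fewer than
  \<open>2 ^ length ns\<close> of them, so a product of absolute value at least 1 leaves no room for
  a very small \<open>y\<close>.\<close>

lemma sign_sum_spacing:
  fixes B :: real
  assumes "B \<ge> 1" "\<And>x. x \<in> set (sign_sums ns) \<Longrightarrow> \<bar>x\<bar> \<le> B" "y \<in> set (sign_sums ns)" "y \<noteq> 0"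
  shows "1 \<le> \<bar>y\<bar> * B ^ (2 ^ length ns)"
proof -
  define ys where "ys = filter (\<lambda>x. x \<noteq> 0) (sign_sums ns)"
  have "y \<in> set ys" using assms by (simp add: ys_def)
  then obtain as bs where s: "ys = as @ y # bs" by (meson split_list)
  have len: "length ys \<le> 2 ^ length ns" unfolding ys_def using length_sign_sums length_filter_le by metis
  have "1 \<le> \<bar>prod_list ys\<bar>" using prod_nonzero_sign_sums_ge[of ns] by (simp add: ys_def)
  also have "\<dots> = \<bar>y\<bar> * \<bar>prod_list (as @ bs)\<bar>" by (simp add: s abs_mult)
  also have "\<dots> \<le> \<bar>y\<bar> * B ^ length (as @ bs)"
  proof (intro mult_left_mono prod_list_abs_le assms(1))
    fix x assume "x \<in> set (as @ bs)"
    then have "x \<in> set ys" by (auto simp: s)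
    then show "\<bar>x\<bar> \<le> B" using assms(2) by (simp add: ys_def)
  qed auto
  also have "\<dots> \<le> \<bar>y\<bar> * B ^ (2 ^ length ns)"
    using assms(1) len s by (intro mult_left_mono power_increasing) auto
  finally show ?thesis .
qed

lemma sqrt_sum_spacing:
  fixes e :: "nat \<Rightarrow> real" and n :: "nat \<Rightarrow> nat" and Q :: real
  assumes e: "\<And>i. i < r \<Longrightarrow> e i = 1 \<or> e i = -1" and n: "\<And>i. i < r \<Longrightarrow> sqrt (n i) \<le> Q"
    and nz: "(\<Sum>i<r. e i * sqrt (n i)) \<noteq> 0"
  shows "1 \<le> \<bar>\<Sum>i<r. e i * sqrt (n i)\<bar> * (1 + r * Q) ^ (2 ^ r)"
proof -
  \<comment> \<open>The list is reversed so that the newest index is at its head, matching the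
    recursion of \<open>sign_sums\<close>.\<close>
  define ns where "ns = (\<lambda>r. map n (rev [0..<r]))"
  have nsS: "ns (Suc r) = n r # ns r" for r by (simp add: ns_def)
  have mem: "(\<Sum>i<r. e i * sqrt (n i)) \<in> set (sign_sums (ns r))" using e
  proof (induction r)
    case 0
    then show ?case by (simp add: ns_def)
  next
    case (Suc r)
    have IH: "(\<Sum>i<r. e i * sqrt (n i)) \<in> set (sign_sums (ns r))" using Suc by simp
    have "e r = 1 \<or> e r = -1" using Suc.prems by simp
    then show ?case
    proof
      assume "e r = 1"
      then show ?thesis using IH by (simp add: nsS)
    next
      assume "e r = -1"
      then have "(\<Sum>i<Suc r. e i * sqrt (n i)) = (\<Sum>i<r. e i * sqrt (n i)) - sqrt (n r)" by simp
      then show ?thesis using IH unfolding nsS sign_sums.simps set_append set_map by blast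
    qed
  qed
  have bd: "\<forall>x\<in>set (sign_sums (ns r)). \<bar>x\<bar> \<le> r * Q" using n
  proof (induction r)
    case 0
    then show ?case by (simp add: ns_def)
  next
    case (Suc r)
    have "\<bar>x + sqrt (n r)\<bar> \<le> Suc r * Q" "\<bar>x - sqrt (n r)\<bar> \<le> Suc r * Q" if "x \<in> set (sign_sums (ns r))" for x
    proof -
      have "\<bar>x\<bar> \<le> r * Q" "sqrt (n r) \<le> Q" "0 \<le> sqrt (n r)" using Suc that by auto
      then show "\<bar>x + sqrt (n r)\<bar> \<le> Suc r * Q" "\<bar>x - sqrt (n r)\<bar> \<le> Suc r * Q"
        unfolding of_nat_Suc distrib_right mult_1 by linarith+
    qed
    then show ?case by (auto simp: nsS)
  qed
  have rQ: "0 \<le> r * Q"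
  proof (cases "r = 0")
    case False
    then have "0 \<le> Q" using n[of 0] by (meson gr0I of_nat_0_le_iff order_trans real_sqrt_ge_zero)
    then show ?thesis by simp
  qed simp
  have "1 \<le> \<bar>\<Sum>i<r. e i * sqrt (n i)\<bar> * (1 + r * Q) ^ (2 ^ length (ns r))"
    using rQ bd by (intro sign_sum_spacing mem nz) force+
  then show ?thesis by (simp add: ns_def)
qed

section \<open>Moments of exponential sums\<close>

lemma norm_integral_cis_le:
  assumes "l \<noteq> 0" "a \<le> b"
  shows "norm (integral {a..b} (\<lambda>t. cis (2 * pi * l * t))) \<le> 1 / (pi * \<bar>l\<bar>)"
proof -
  define F where "F t = cis (2 * pi * l * t) / (2 * pi * l * \<i>)" for t
  have "((\<lambda>t. cis (2 * pi * l * t)) has_integral (F b - F a)) {a..b}"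
  proof (rule fundamental_theorem_of_calculus[OF assms(2)])
    fix t assume "t \<in> {a..b}"
    have "((\<lambda>t. exp (\<i> * of_real (2 * pi * l) * t)) has_field_derivative
          exp (\<i> * of_real (2 * pi * l) * of_real t) * (\<i> * of_real (2 * pi * l))) (at (of_real t))"
      by (auto intro!: derivative_eq_intros)
    from has_vector_derivative_real_field[OF this]
    have "((\<lambda>t. cis (2 * pi * l * t)) has_vector_derivative ((2 * pi * l) *\<^sub>R (\<i> * cis (2 * pi * l * t)))) (at t)"
      by (simp add: cis_conv_exp scaleR_conv_of_real o_def mult_ac)
    then have "((\<lambda>t. cis (2 * pi * l * t) / (2 * pi * l * \<i>)) has_vector_derivative
          ((2 * pi * l) *\<^sub>R (\<i> * cis (2 * pi * l * t))) / (2 * pi * l * \<i>)) (at t within {a..b})"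
      by (intro has_vector_derivative_divide) (rule has_vector_derivative_at_within)
    moreover have "((2 * pi * l) *\<^sub>R (\<i> * cis (2 * pi * l * t))) / (2 * pi * l * \<i>) = cis (2 * pi * l * t)"
      using assms by (simp add: scaleR_conv_of_real)
    ultimately show "(F has_vector_derivative cis (2 * pi * l * t)) (at t within {a..b})"
      unfolding F_def by simp
  qed
  then have "integral {a..b} (\<lambda>t. cis (2 * pi * l * t)) = F b - F a" by (rule integral_unique)
  also have "norm \<dots> \<le> norm (F b) + norm (F a)" by (rule norm_triangle_ineq4)
  also have "\<dots> = 1 / (pi * \<bar>l\<bar>)" using assms by (simp add: F_def norm_divide norm_mult field_simps)
  finally show ?thesis .
qed

text \<open>Bohr mean value. It annihilates every nonzero frequency, so identities between zero
  moments follow from pointwise identities of exponential sums and uniqueness of limits, without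
  bijections between tuples.\<close>

definition has_mean :: "(real \<Rightarrow> complex) \<Rightarrow> complex \<Rightarrow> bool" where
  "has_mean f m \<longleftrightarrow> ((\<lambda>T. integral {0..T} f / of_real T) \<longlongrightarrow> m) at_top"

lemma has_mean_unique: "has_mean f a \<Longrightarrow> has_mean f b \<Longrightarrow> a = b"
  unfolding has_mean_def by (rule tendsto_unique[OF trivial_limit_at_top_linorder])

lemma integrable_cis: "(\<lambda>t. c * cis (l * t)) integrable_on {a..b::real}"
  by (intro integrable_continuous_interval continuous_intros)

lemma has_mean_exp_sum:
  assumes "finite J"
  shows "has_mean (\<lambda>t. \<Sum>j\<in>J. c j * cis (2 * pi * l j * t)) (\<Sum>j\<in>{j\<in>J. l j = 0}. c j)"
proof -
  have "((\<lambda>T. integral {0..T} (\<lambda>t. \<Sum>j\<in>J. c j * cis (2 * pi * l j * t)) / of_real T)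
      \<longlongrightarrow> (\<Sum>j\<in>J. c j * (if l j = 0 then 1 else 0))) at_top"
  proof (rule Lim_transform_eventually)
    have "((\<lambda>T. integral {0..T} (\<lambda>t. cis (2 * pi * k * t)) / of_real T) \<longlongrightarrow> (if k = 0 then 1 else 0)) at_top" for k
    proof (cases "k = 0")
      case True
      have "\<forall>\<^sub>F T in at_top. 1 = integral {0..T} (\<lambda>t. cis (2 * pi * k * t)) / of_real T"
        using eventually_gt_at_top[of 0] by eventually_elim (simp add: True scaleR_conv_of_real)
      then show ?thesis using True by (auto intro: Lim_transform_eventually[OF tendsto_const])
    next
      case False
      have "((\<lambda>T. integral {0..T} (\<lambda>t. cis (2 * pi * k * t)) / of_real T) \<longlongrightarrow> 0) at_top"
      proof (rule Lim_null_comparison)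
        show "\<forall>\<^sub>F T in at_top. norm (integral {0..T} (\<lambda>t. cis (2 * pi * k * t)) / of_real T) \<le> (1 / (pi * \<bar>k\<bar>)) / T"
          using eventually_gt_at_top[of 0]
        proof eventually_elim
          case (elim T)
          then have "norm (integral {0..T} (\<lambda>t. cis (2 * pi * k * t)) / of_real T)
            = norm (integral {0..T} (\<lambda>t. cis (2 * pi * k * t))) / T" by (simp add: norm_divide)
          also have "\<dots> \<le> (1 / (pi * \<bar>k\<bar>)) / T"
            using elim norm_integral_cis_le[OF False, of 0 T] by (intro divide_right_mono) auto
          finally show ?case .
        qed
        show "((\<lambda>T. (1 / (pi * \<bar>k\<bar>)) / T) \<longlongrightarrow> 0) at_top" by real_asymp
      qed
      then show ?thesis using False by simp
    qed
    then show "((\<lambda>T. \<Sum>j\<in>J. c j * (integral {0..T} (\<lambda>t. cis (2 * pi * l j * t)) / of_real T))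
        \<longlongrightarrow> (\<Sum>j\<in>J. c j * (if l j = 0 then 1 else 0))) at_top"
      by (intro tendsto_sum tendsto_mult tendsto_const)
    show "\<forall>\<^sub>F T in at_top. (\<Sum>j\<in>J. c j * (integral {0..T} (\<lambda>t. cis (2 * pi * l j * t)) / of_real T))
       = integral {0..T} (\<lambda>t. \<Sum>j\<in>J. c j * cis (2 * pi * l j * t)) / of_real T"
      by (intro always_eventually allI)
        (simp add: integral_sum[OF assms integrable_cis] sum_divide_distrib)
  qed
  also have "(\<Sum>j\<in>J. c j * (if l j = 0 then 1 else 0)) = (\<Sum>j\<in>{j\<in>J. l j = 0}. c j)"
    using assms by (simp add: sum.inter_filter if_distrib cong: if_cong)
  finally show ?thesis unfolding has_mean_def .
qed

lemma prod_cis: "(\<Prod>i\<in>A. cis (x i)) = cis (\<Sum>i\<in>A. x i)"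
  by (induction A rule: infinite_finite_induct) (auto simp: cis_mult)

definition exp_sum :: "'i set \<Rightarrow> ('i \<Rightarrow> real) \<Rightarrow> ('i \<Rightarrow> real) \<Rightarrow> real \<Rightarrow> complex" where
  "exp_sum J c l t = (\<Sum>j\<in>J. of_real (c j) * cis (2 * pi * l j * t))"

lemma exp_sum_power:
  assumes "finite J"
  shows "exp_sum J c l t ^ n = exp_sum (PiE {..<n} (\<lambda>_. J)) (\<lambda>\<phi>. \<Prod>i<n. c (\<phi> i)) (\<lambda>\<phi>. \<Sum>i<n. l (\<phi> i)) t"
proof -
  have "exp_sum J c l t ^ n = (\<Prod>i<n. \<Sum>j\<in>J. of_real (c j) * cis (2 * pi * l j * t))"
    by (simp add: exp_sum_def)
  also have "\<dots> = (\<Sum>\<phi>\<in>PiE {..<n} (\<lambda>_. J). \<Prod>i<n. of_real (c (\<phi> i)) * cis (2 * pi * l (\<phi> i) * t))"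
    using assms by (subst prod_sum_PiE) auto
  also have "\<dots> = exp_sum (PiE {..<n} (\<lambda>_. J)) (\<lambda>\<phi>. \<Prod>i<n. c (\<phi> i)) (\<lambda>\<phi>. \<Sum>i<n. l (\<phi> i)) t"
    unfolding exp_sum_def by (intro sum.cong refl)
      (simp add: prod.distrib prod_cis sum_distrib_left sum_distrib_right)
  finally show ?thesis .
qed

text \<open>The mean value of the \<open>n\<close>-th power of the exponential sum: only the tuples of frequencies adding up to \<open>0\<close> survive.\<close>

definition zero_moment :: "'i set \<Rightarrow> ('i \<Rightarrow> real) \<Rightarrow> ('i \<Rightarrow> real) \<Rightarrow> nat \<Rightarrow> real" where
  "zero_moment J c l n = (\<Sum>\<phi>\<in>{\<phi>\<in>PiE {..<n} (\<lambda>_. J). (\<Sum>i<n. l (\<phi> i)) = 0}. \<Prod>i<n. c (\<phi> i))"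

lemma has_mean_exp_sum_power:
  assumes "finite J"
  shows "has_mean (\<lambda>t. exp_sum J c l t ^ n) (of_real (zero_moment J c l n))"
  using has_mean_exp_sum[of "PiE {..<n} (\<lambda>_. J)" "\<lambda>\<phi>. of_real (\<Prod>i<n. c (\<phi> i))" "\<lambda>\<phi>. \<Sum>i<n. l (\<phi> i)"]
    assms finite_PiE[of "{..<n}" "\<lambda>_. J"]
  by (simp add: exp_sum_power[OF assms] exp_sum_def[of "PiE _ _"] zero_moment_def)

lemma zero_moment_nonneg:
  assumes "\<And>j. j \<in> J \<Longrightarrow> c j \<ge> 0"
  shows "zero_moment J c l n \<ge> 0"
  unfolding zero_moment_def by (intro sum_nonneg prod_nonneg) (use assms in \<open>auto simp: PiE_iff\<close>)

text \<open>In the mean of \<open>exp_sum J c l t ^ a * exp_sum J' c l t ^ b\<close> only pairs of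
  tuples with total frequency 0 survive; by \<open>indep\<close> both partial sums then vanish, so
  the mean is a product of zero moments. The binomial theorem does the rest.
  \<open>\<Lambda>\<close> and \<open>\<Lambda>'\<close> are sets closed under addition that contain
  the sums of the frequencies.\<close>

lemma zero_moment_union:
  fixes \<Lambda> \<Lambda>' :: "real set"
  assumes fin: "finite J" "finite J'" and disj: "J \<inter> J' = {}"
    and add: "0 \<in> \<Lambda>" "0 \<in> \<Lambda>'" "\<And>x y. x \<in> \<Lambda> \<Longrightarrow> y \<in> \<Lambda> \<Longrightarrow> x + y \<in> \<Lambda>" "\<And>x y. x \<in> \<Lambda>' \<Longrightarrow> y \<in> \<Lambda>' \<Longrightarrow> x + y \<in> \<Lambda>'"
    and freq: "\<And>j. j \<in> J \<Longrightarrow> l j \<in> \<Lambda>" "\<And>j. j \<in> J' \<Longrightarrow> l j \<in> \<Lambda>'"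
    and indep: "\<And>x y. x \<in> \<Lambda> \<Longrightarrow> y \<in> \<Lambda>' \<Longrightarrow> x + y = 0 \<Longrightarrow> x = 0"
  shows "zero_moment (J \<union> J') c l n = (\<Sum>k\<le>n. real (n choose k) * zero_moment J c l k * zero_moment J' c l (n - k))"
proof -
  have mem: "(\<Sum>i<m. f i) \<in> M" if "0 \<in> M" "\<And>x y. x \<in> M \<Longrightarrow> y \<in> M \<Longrightarrow> x + y \<in> M" "\<And>i. i < m \<Longrightarrow> f i \<in> M"
    for f :: "nat \<Rightarrow> real" and m M
    using that by (induction m) auto
  have cross: "has_mean (\<lambda>t. exp_sum J c l t ^ a * exp_sum J' c l t ^ b)
      (of_real (zero_moment J c l a * zero_moment J' c l b))" for a b
  proof -
    define P P' where "P = PiE {..<a} (\<lambda>_. J)" and "P' = PiE {..<b} (\<lambda>_. J')"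
    define C L C' L' where "C \<phi> = (\<Prod>i<a. c (\<phi> i))" and "L \<phi> = (\<Sum>i<a. l (\<phi> i))"
      and "C' \<phi> = (\<Prod>i<b. c (\<phi> i))" and "L' \<phi> = (\<Sum>i<b. l (\<phi> i))" for \<phi>
    have finP: "finite P" "finite P'" using fin by (auto simp: P_def P'_def intro: finite_PiE)
    have "exp_sum J c l t ^ a * exp_sum J' c l t ^ b
       = (\<Sum>\<phi>\<in>P \<times> P'. of_real (C (fst \<phi>) * C' (snd \<phi>)) * cis (2 * pi * (L (fst \<phi>) + L' (snd \<phi>)) * t))" for t
    proof -
      have "exp_sum J c l t ^ a * exp_sum J' c l t ^ b = exp_sum P C L t * exp_sum P' C' L' t"
        unfolding exp_sum_power[OF fin(1)] exp_sum_power[OF fin(2)] P_def P'_def C_def L_def C'_def L'_def ..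
      also have "\<dots> = (\<Sum>(\<phi>, \<psi>)\<in>P \<times> P'. (of_real (C \<phi>) * cis (2 * pi * L \<phi> * t)) * (of_real (C' \<psi>) * cis (2 * pi * L' \<psi> * t)))"
        unfolding exp_sum_def sum_product sum.cartesian_product ..
      also have "\<dots> = (\<Sum>\<phi>\<in>P \<times> P'. of_real (C (fst \<phi>) * C' (snd \<phi>)) * cis (2 * pi * (L (fst \<phi>) + L' (snd \<phi>)) * t))"
      proof (intro sum.cong refl)
        fix x assume "x \<in> P \<times> P'"
        have "cis (2 * pi * L (fst x) * t) * cis (2 * pi * L' (snd x) * t) = cis (2 * pi * (L (fst x) + L' (snd x)) * t)"
          by (simp add: cis_mult algebra_simps)
        then show "(case x of (\<phi>, \<psi>) \<Rightarrow> of_real (C \<phi>) * cis (2 * pi * L \<phi> * t) * (of_real (C' \<psi>) * cis (2 * pi * L' \<psi> * t)))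
           = of_real (C (fst x) * C' (snd x)) * cis (2 * pi * (L (fst x) + L' (snd x)) * t)"
          by (simp add: case_prod_beta mult_ac)
      qed
      finally show ?thesis .
    qed
    moreover have "has_mean (\<lambda>t. \<Sum>\<phi>\<in>P \<times> P'. of_real (C (fst \<phi>) * C' (snd \<phi>)) * cis (2 * pi * (L (fst \<phi>) + L' (snd \<phi>)) * t))
        (\<Sum>\<phi>\<in>{\<phi>\<in>P \<times> P'. L (fst \<phi>) + L' (snd \<phi>) = 0}. of_real (C (fst \<phi>) * C' (snd \<phi>)))"
      using finP by (intro has_mean_exp_sum) auto
    moreover have "{\<phi>\<in>P \<times> P'. L (fst \<phi>) + L' (snd \<phi>) = 0} = {\<phi>\<in>P. L \<phi> = 0} \<times> {\<phi>\<in>P'. L' \<phi> = 0}"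
    proof -
      have "L \<phi> = 0 \<and> L' \<psi> = 0" if "\<phi> \<in> P" "\<psi> \<in> P'" "L \<phi> + L' \<psi> = 0" for \<phi> \<psi>
      proof -
        have "L \<phi> \<in> \<Lambda>" unfolding L_def using that freq add by (intro mem) (auto simp: P_def PiE_iff)
        moreover have "L' \<psi> \<in> \<Lambda>'" unfolding L'_def using that freq add by (intro mem) (auto simp: P'_def PiE_iff)
        ultimately show ?thesis using indep that by fastforce
      qed
      then show ?thesis by force
    qed
    moreover have "(\<Sum>\<phi>\<in>{\<phi>\<in>P. L \<phi> = 0} \<times> {\<phi>\<in>P'. L' \<phi> = 0}. complex_of_real (C (fst \<phi>) * C' (snd \<phi>)))
        = of_real (zero_moment J c l a * zero_moment J' c l b)"
    proof -
      have "zero_moment J c l a * zero_moment J' c l b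
        = (\<Sum>\<phi>\<in>{\<phi>\<in>P. L \<phi> = 0} \<times> {\<phi>\<in>P'. L' \<phi> = 0}. C (fst \<phi>) * C' (snd \<phi>))"
        unfolding zero_moment_def P_def P'_def C_def L_def C'_def L'_def sum_product sum.cartesian_product
        by (simp add: case_prod_beta)
      then show ?thesis by simp
    qed
    ultimately show ?thesis by simp
  qed
  have "exp_sum (J \<union> J') c l t ^ n = (\<Sum>k\<le>n. of_nat (n choose k) * (exp_sum J c l t ^ k * exp_sum J' c l t ^ (n - k)))" for t
    using fin disj by (simp add: exp_sum_def sum.union_disjoint binomial_ring mult.assoc)
  moreover have "has_mean (\<lambda>t. \<Sum>k\<le>n. of_nat (n choose k) * (exp_sum J c l t ^ k * exp_sum J' c l t ^ (n - k)))
     (\<Sum>k\<le>n. of_nat (n choose k) * of_real (zero_moment J c l k * zero_moment J' c l (n - k)))"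
    unfolding has_mean_def
  proof (rule Lim_transform_eventually)
    show "((\<lambda>T. \<Sum>k\<le>n. of_nat (n choose k) * (integral {0..T} (\<lambda>t. exp_sum J c l t ^ k * exp_sum J' c l t ^ (n - k)) / of_real T))
      \<longlongrightarrow> (\<Sum>k\<le>n. of_nat (n choose k) * of_real (zero_moment J c l k * zero_moment J' c l (n - k)))) at_top"
      using cross unfolding has_mean_def by (intro tendsto_sum tendsto_mult tendsto_const)
    show "\<forall>\<^sub>F T in at_top. (\<Sum>k\<le>n. of_nat (n choose k) * (integral {0..T} (\<lambda>t. exp_sum J c l t ^ k * exp_sum J' c l t ^ (n - k)) / of_real T))
      = integral {0..T} (\<lambda>t. \<Sum>k\<le>n. of_nat (n choose k) * (exp_sum J c l t ^ k * exp_sum J' c l t ^ (n - k))) / of_real T"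
    proof (intro always_eventually allI)
      fix T :: real
      have "(\<lambda>t. of_nat (n choose k) * (exp_sum J c l t ^ k * exp_sum J' c l t ^ (n - k))) integrable_on {0..T}" for k
        unfolding exp_sum_def by (intro integrable_continuous_interval continuous_intros)
      then show "(\<Sum>k\<le>n. of_nat (n choose k) * (integral {0..T} (\<lambda>t. exp_sum J c l t ^ k * exp_sum J' c l t ^ (n - k)) / of_real T))
        = integral {0..T} (\<lambda>t. \<Sum>k\<le>n. of_nat (n choose k) * (exp_sum J c l t ^ k * exp_sum J' c l t ^ (n - k))) / of_real T"
        by (subst integral_sum) (auto simp: sum_divide_distrib)
    qed
  qed
  ultimately have "has_mean (\<lambda>t. exp_sum (J \<union> J') c l t ^ n)
     (\<Sum>k\<le>n. of_nat (n choose k) * of_real (zero_moment J c l k * zero_moment J' c l (n - k)))" by simp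
  moreover have "has_mean (\<lambda>t. exp_sum (J \<union> J') c l t ^ n) (of_real (zero_moment (J \<union> J') c l n))"
    using fin by (intro has_mean_exp_sum_power) auto
  ultimately have "complex_of_real (zero_moment (J \<union> J') c l n)
      = of_real (\<Sum>k\<le>n. real (n choose k) * zero_moment J c l k * zero_moment J' c l (n - k))"
    using has_mean_unique by (force simp: mult.assoc)
  then show ?thesis by (simp only: of_real_eq_iff)
qed

text \<open>Expanding the power leaves one exponential per tuple. Tuples of total frequency 0 give
  the zero moment times the length \<open>R\<close>; every other one oscillates and integrates to at
  most \<open>1 / \<delta>\<close>, and the weights of all tuples add up to
  \<open>(\<Sum>j\<in>J. c j) ^ n\<close>.\<close>

lemma integral_exp_sum_power_le:
  fixes g :: "real \<Rightarrow> real"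
  assumes fin: "finite J" and c: "\<And>j. j \<in> J \<Longrightarrow> c j \<ge> 0"
    and g: "\<And>t. exp_sum J c l t = of_real (g t)" and R: "R \<ge> 0" and \<delta>: "\<delta> > 0"
    and sp: "\<And>\<phi>. \<phi> \<in> PiE {..<n} (\<lambda>_. J) \<Longrightarrow> (\<Sum>i<n. l (\<phi> i)) \<noteq> 0 \<Longrightarrow> \<delta> \<le> \<bar>\<Sum>i<n. l (\<phi> i)\<bar>"
  shows "integral {R..2 * R} (\<lambda>t. g t ^ n) \<le> R * zero_moment J c l n + (\<Sum>j\<in>J. c j) ^ n / \<delta>"
proof -
  define P where "P = PiE {..<n} (\<lambda>_. J)"
  define C L where "C \<phi> = (\<Prod>i<n. c (\<phi> i))" and "L \<phi> = (\<Sum>i<n. l (\<phi> i))" for \<phi>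
  define I where "I \<phi> = integral {R..2 * R} (\<lambda>t. cis (2 * pi * L \<phi> * t))" for \<phi>
  have finP: "finite P" using fin by (auto simp: P_def intro: finite_PiE)
  have C0: "C \<phi> \<ge> 0" if "\<phi> \<in> P" for \<phi> unfolding C_def using that c by (intro prod_nonneg) (auto simp: P_def PiE_iff)
  have "continuous_on UNIV (\<lambda>t. Re (exp_sum J c l t))"
    unfolding exp_sum_def by (intro continuous_intros)
  then have gc: "continuous_on UNIV g" by (simp add: g)
  have "complex_of_real (integral {R..2 * R} (\<lambda>t. g t ^ n)) = integral {R..2 * R} (\<lambda>t. complex_of_real (g t ^ n))"
  proof -
    have "(\<lambda>t. g t ^ n) integrable_on {R..2 * R}"
      by (intro integrable_continuous_interval continuous_intros continuous_on_subset[OF gc]) auto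
    then have "((\<lambda>t. complex_of_real (g t ^ n)) has_integral complex_of_real (integral {R..2 * R} (\<lambda>t. g t ^ n))) {R..2 * R}"
      by (intro has_integral_of_real integrable_integral)
    then show ?thesis by (simp add: integral_unique)
  qed
  also have "\<dots> = integral {R..2 * R} (\<lambda>t. \<Sum>\<phi>\<in>P. of_real (C \<phi>) * cis (2 * pi * L \<phi> * t))"
    by (simp only: of_real_power g[symmetric] exp_sum_power[OF fin])
      (simp add: exp_sum_def P_def C_def L_def)
  also have "\<dots> = (\<Sum>\<phi>\<in>P. of_real (C \<phi>) * I \<phi>)"
    unfolding I_def by (subst integral_sum[OF finP integrable_cis]) simp
  finally have eq: "complex_of_real (integral {R..2 * R} (\<lambda>t. g t ^ n)) = (\<Sum>\<phi>\<in>P. of_real (C \<phi>) * I \<phi>)" .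
  have "integral {R..2 * R} (\<lambda>t. g t ^ n) = (\<Sum>\<phi>\<in>P. Re (of_real (C \<phi>) * I \<phi>))"
    using arg_cong[OF eq, of Re] by simp
  also have "\<dots> = (\<Sum>\<phi>\<in>P. C \<phi> * Re (I \<phi>))" by simp
  \<comment> \<open>The resonant tuples are charged \<open>1 / \<delta>\<close> too, so that the
    second sum runs over all tuples and becomes a pure power.\<close>
  also have "\<dots> \<le> (\<Sum>\<phi>\<in>P. C \<phi> * ((if L \<phi> = 0 then R else 0) + 1 / \<delta>))"
  proof (intro sum_mono mult_left_mono C0)
    fix \<phi> assume \<phi>: "\<phi> \<in> P"
    show "Re (I \<phi>) \<le> (if L \<phi> = 0 then R else 0) + 1 / \<delta>"
    proof (cases "L \<phi> = 0")
      case True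
      then have "Re (I \<phi>) = R" using R by (simp add: I_def)
      then show ?thesis using True \<delta> by simp
    next
      case False
      have "Re (I \<phi>) \<le> norm (I \<phi>)" by (rule complex_Re_le_cmod)
      also have "\<dots> \<le> 1 / (pi * \<bar>L \<phi>\<bar>)" unfolding I_def using False R by (intro norm_integral_cis_le) auto
      also have "\<dots> \<le> 1 / \<delta>"
      proof -
        have "\<delta> \<le> \<bar>L \<phi>\<bar>" using sp[of \<phi>] \<phi> False by (simp add: P_def L_def)
        also have "1 * \<bar>L \<phi>\<bar> \<le> pi * \<bar>L \<phi>\<bar>" using pi_ge_two by (intro mult_right_mono) auto
        finally show ?thesis using \<delta> by (intro divide_left_mono) auto
      qed
      finally show ?thesis using False by simp
    qed
  qed
  also have "\<dots> = R * (\<Sum>\<phi>\<in>P. if L \<phi> = 0 then C \<phi> else 0) + (\<Sum>\<phi>\<in>P. C \<phi>) / \<delta>"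
  proof -
    have "(\<Sum>\<phi>\<in>P. C \<phi> * ((if L \<phi> = 0 then R else 0) + 1 / \<delta>))
      = (\<Sum>\<phi>\<in>P. R * (if L \<phi> = 0 then C \<phi> else 0) + C \<phi> / \<delta>)"
      by (intro sum.cong) (auto simp: distrib_left)
    then show ?thesis by (simp only: sum.distrib sum_distrib_left sum_divide_distrib)
  qed
  also have "(\<Sum>\<phi>\<in>P. if L \<phi> = 0 then C \<phi> else 0) = zero_moment J c l n"
    using finP by (simp add: zero_moment_def P_def C_def L_def sum.inter_filter cong: if_cong)
  also have "(\<Sum>\<phi>\<in>P. C \<phi>) = (\<Sum>j\<in>J. c j) ^ n"
    using fin prod_sum_PiE[of "{..<n}" "\<lambda>_. J" "\<lambda>_. c"] by (simp add: P_def C_def)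
  finally show ?thesis .
qed

section \<open>Zero moments of one class and of independent classes\<close>

lemma zero_moment_0 [simp]: "zero_moment J c l 0 = 1"
proof -
  have "{\<phi>\<in>PiE {..<0::nat} (\<lambda>_. J). (\<Sum>i<0. l (\<phi> i)) = 0} = {\<lambda>_. undefined}" by auto
  then show ?thesis by (simp add: zero_moment_def)
qed

lemma zero_moment_1:
  assumes "\<And>j. j \<in> J \<Longrightarrow> l j \<noteq> 0"
  shows "zero_moment J c l 1 = 0"
proof -
  have "{\<phi>\<in>PiE {..<1::nat} (\<lambda>_. J). (\<Sum>i<1. l (\<phi> i)) = 0} = {}" using assms by (auto simp: PiE_iff)
  then show ?thesis unfolding zero_moment_def by (simp only: sum.empty)
qed

lemma sum_triangle_le_product:
  fixes a b :: "nat \<Rightarrow> real"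
  assumes "\<And>i. a i \<ge> 0" "\<And>i. b i \<ge> 0"
  shows "(\<Sum>r\<le>K. \<Sum>k\<le>r. a k * b (r - k)) \<le> (\<Sum>k\<le>K. a k) * (\<Sum>k\<le>K. b k)"
proof -
  have "(\<Sum>r\<le>K. \<Sum>k\<le>r. a k * b (r - k)) = (\<Sum>(i, j)\<in>{(i, j). i + j \<le> K}. a i * b j)"
    by (rule sum.triangle_reindex_eq[symmetric])
  also have "\<dots> \<le> (\<Sum>(i, j)\<in>{..K} \<times> {..K}. a i * b j)"
    using assms by (intro sum_mono2) auto
  also have "\<dots> = (\<Sum>k\<le>K. a k) * (\<Sum>k\<le>K. b k)"
    by (simp add: sum_product sum.cartesian_product)
  finally show ?thesis .
qed

text \<open>By the binomial rule of \<open>zero_moment_union\<close>, exponential generating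
  functions multiply over the squarefree classes; cutting all of them at \<open>K\<close> only drops
  nonnegative terms. What counts is that no factor has a term linear in \<open>z\<close>: each is
  \<open>1 + O(z^2 / s)\<close>, so a \<open>z\<close> of size \<open>(ln N)^(-1/2)\<close> keeps
  the product bounded.\<close>

lemma zero_moment_generating:
  fixes J :: "nat \<Rightarrow> 'i set"
  assumes fS: "finite S" and sqf: "\<And>s. s \<in> S \<Longrightarrow> squarefree s"
    and fJ: "\<And>s. s \<in> S \<Longrightarrow> finite (J s)" and dJ: "\<And>s s'. s \<in> S \<Longrightarrow> s' \<in> S \<Longrightarrow> s \<noteq> s' \<Longrightarrow> J s \<inter> J s' = {}"
    and c: "\<And>s j. s \<in> S \<Longrightarrow> j \<in> J s \<Longrightarrow> c j \<ge> 0"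
    and l: "\<And>s j. s \<in> S \<Longrightarrow> j \<in> J s \<Longrightarrow> \<exists>b::int. l j = b * sqrt s"
    and m1: "\<And>s. s \<in> S \<Longrightarrow> zero_moment (J s) c l 1 = 0"
    and m2: "\<And>s r. s \<in> S \<Longrightarrow> r \<ge> 2 \<Longrightarrow> r \<le> K \<Longrightarrow> zero_moment (J s) c l r \<le> D / s"
    and D: "D \<ge> 0" and z: "0 \<le> z" "z \<le> 1"
  shows "(\<Sum>r\<le>K. zero_moment (\<Union>s\<in>S. J s) c l r / fact r * z ^ r) \<le> (\<Prod>s\<in>S. 1 + K * D * z\<^sup>2 / s)"
  using fS sqf fJ dJ c l m1 m2
proof (induction S rule: finite_induct)
  case empty
  have "zero_moment ({} :: 'i set) c l r = 0" if "r > 0" for r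
  proof -
    have "PiE {..<r} (\<lambda>_. {} :: 'i set) = {}" using that by (auto simp: PiE_eq_empty_iff)
    then show ?thesis by (simp add: zero_moment_def)
  qed
  then have "(\<Sum>r\<le>K. zero_moment ({} :: 'i set) c l r / fact r * z ^ r)
      = (\<Sum>r\<in>{0}. zero_moment ({} :: 'i set) c l r / fact r * z ^ r)"
    by (intro sum.mono_neutral_right) auto
  then show ?case by simp
next
  case (insert s S)
  define U where "U = (\<Union>s\<in>S. J s)"
  have Ufin: "finite U" using insert by (auto simp: U_def)
  have disj: "U \<inter> J s = {}" using insert.prems(3) insert.hyps(2) unfolding U_def by blast
  have c': "c j \<ge> 0" if "j \<in> U \<or> j \<in> J s" for j using that insert.prems(4) unfolding U_def by blast
  \<comment> \<open>The integer spans of the square roots of \<open>S\<close> and of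
    \<open>sqrt s\<close>. They meet only in 0 because square roots of distinct squarefree numbers
    are independent; this is the hypothesis \<open>indep\<close> of
    \<open>zero_moment_union\<close>.\<close>
  define \<Lambda> where "\<Lambda> = range (\<lambda>b :: nat \<Rightarrow> int. \<Sum>s\<in>S. b s * sqrt s)"
  define \<Lambda>' where "\<Lambda>' = range (\<lambda>b :: int. b * sqrt s)"
  have un: "zero_moment (U \<union> J s) c l n = (\<Sum>k\<le>n. real (n choose k) * zero_moment U c l k * zero_moment (J s) c l (n - k))" for n
  proof (rule zero_moment_union[of _ _ \<Lambda> \<Lambda>'])
    show "finite U" "finite (J s)" "U \<inter> J s = {}" using Ufin insert disj by auto
    show "0 \<in> \<Lambda>" unfolding \<Lambda>_def by (intro image_eqI[of _ _ "\<lambda>_. 0"]) auto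
    show "0 \<in> \<Lambda>'" unfolding \<Lambda>'_def by (intro image_eqI[of _ _ 0]) auto
    show "x + y \<in> \<Lambda>" if xy: "x \<in> \<Lambda>" "y \<in> \<Lambda>" for x y
    proof -
      obtain b b' where "x = (\<Sum>s\<in>S. real_of_int (b s) * sqrt s)" "y = (\<Sum>s\<in>S. real_of_int (b' s) * sqrt s)"
        using xy unfolding \<Lambda>_def by auto
      then have "x + y = (\<Sum>s\<in>S. real_of_int (b s + b' s) * sqrt s)" by (simp add: sum.distrib distrib_right)
      then show ?thesis unfolding \<Lambda>_def by (intro image_eqI[of _ _ "\<lambda>s. b s + b' s"]) auto
    qed
    show "x + y \<in> \<Lambda>'" if xy: "x \<in> \<Lambda>'" "y \<in> \<Lambda>'" for x y
    proof -
      obtain b b' where "x = real_of_int b * sqrt s" "y = real_of_int b' * sqrt s" using xy unfolding \<Lambda>'_def by auto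
      then have "x + y = real_of_int (b + b') * sqrt s" by (simp add: distrib_right)
      then show ?thesis unfolding \<Lambda>'_def by blast
    qed
    show "l j \<in> \<Lambda>" if jU: "j \<in> U" for j
    proof -
      obtain s' where s': "s' \<in> S" "j \<in> J s'" using jU unfolding U_def by blast
      then obtain b :: int where b: "l j = b * sqrt s'" using insert.prems(5)[of s' j] by auto
      have "(\<Sum>s\<in>S. real_of_int (if s = s' then b else 0) * sqrt s) = (\<Sum>s\<in>S. if s = s' then b * sqrt s' else 0)"
        by (intro sum.cong) auto
      also have "\<dots> = l j" using s' insert.hyps(1) b by simp
      finally show ?thesis unfolding \<Lambda>_def by (intro image_eqI[of _ _ "\<lambda>s. if s = s' then b else 0"]) auto
    qed
    show "l j \<in> \<Lambda>'" if "j \<in> J s" for j using insert.prems(5)[of s j] that unfolding \<Lambda>'_def by auto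
    show "x = 0" if xy: "x \<in> \<Lambda>" "y \<in> \<Lambda>'" "x + y = 0" for x y
    proof -
      obtain b b' where b: "x = (\<Sum>s\<in>S. real_of_int (b s) * sqrt s)" "y = real_of_int b' * sqrt s"
        using xy unfolding \<Lambda>_def \<Lambda>'_def by auto
      define d where "d = b(s := b')"
      have "(\<Sum>t\<in>insert s S. real_of_int (d t) * sqrt t) = y + x"
        using insert.hyps unfolding b d_def by (auto intro!: sum.cong)
      then have "(\<Sum>t\<in>insert s S. real_of_int (d t) * sqrt t) = 0" using xy by simp
      then have "d s = 0" using insert.hyps(1) insert.prems(1)
        by (intro sqrt_squarefree_independent[of "insert s S" d]) auto
      then show ?thesis using xy b by (simp add: d_def)
    qed
  qed
  have eq: "(\<Union>s\<in>insert s S. J s) = U \<union> J s" by (auto simp: U_def)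
  have nn: "0 \<le> zero_moment U c l r" "0 \<le> zero_moment (J s) c l r" for r
    using c' by (auto intro!: zero_moment_nonneg)
  have "(\<Sum>r\<le>K. zero_moment (\<Union>s\<in>insert s S. J s) c l r / fact r * z ^ r)
     = (\<Sum>r\<le>K. \<Sum>k\<le>r. (zero_moment U c l k / fact k * z ^ k) * (zero_moment (J s) c l (r - k) / fact (r - k) * z ^ (r - k)))"
    unfolding eq un sum_divide_distrib sum_distrib_right
  proof (intro sum.cong refl)
    fix r k :: nat assume "k \<in> {..r}"
    then have "real (r choose k) = fact r / (fact k * fact (r - k))" "z ^ r = z ^ k * z ^ (r - k)"
      by (auto simp: binomial_fact simp flip: power_add)
    then show "real (r choose k) * zero_moment U c l k * zero_moment (J s) c l (r - k) / fact r * z ^ r =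
         zero_moment U c l k / fact k * z ^ k * (zero_moment (J s) c l (r - k) / fact (r - k) * z ^ (r - k))"
      by (simp add: field_simps)
  qed
  also have "\<dots> \<le> (\<Sum>r\<le>K. zero_moment U c l r / fact r * z ^ r) * (\<Sum>r\<le>K. zero_moment (J s) c l r / fact r * z ^ r)"
    using nn z by (intro sum_triangle_le_product) auto
  also have "\<dots> \<le> (\<Prod>s\<in>S. 1 + K * D * z\<^sup>2 / s) * (1 + K * D * z\<^sup>2 / s)"
  proof (rule mult_mono)
    show "(\<Sum>r\<le>K. zero_moment U c l r / fact r * z ^ r) \<le> (\<Prod>s\<in>S. 1 + K * D * z\<^sup>2 / s)"
      unfolding U_def
      by (rule insert.IH[OF insert.prems(1)[OF insertI2] insert.prems(2)[OF insertI2]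
            insert.prems(3)[OF insertI2 insertI2] insert.prems(4)[OF insertI2] insert.prems(5)[OF insertI2]
            insert.prems(6)[OF insertI2] insert.prems(7)[OF insertI2]])
    \<comment> \<open>Order 0 contributes 1, order 1 nothing, and each of the fewer than
      \<open>K\<close> orders from 2 on at most \<open>D * z^2 / s\<close>, because
      \<open>z \<le> 1\<close>.\<close>
    have "(\<Sum>r\<le>K. zero_moment (J s) c l r / fact r * z ^ r) \<le> (\<Sum>r\<le>K. (if r = 0 then 1 else 0) + (if r \<ge> 2 then D * z\<^sup>2 / s else 0))"
    proof (rule sum_mono)
      fix r assume r: "r \<in> {..K}"
      consider "r = 0" | "r = 1" | "r \<ge> 2" by linarith
      then show "zero_moment (J s) c l r / fact r * z ^ r \<le> (if r = 0 then 1 else 0) + (if r \<ge> 2 then D * z\<^sup>2 / s else 0)"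
      proof cases
        case 2
        then show ?thesis using insert.prems(6)[of s] by simp
      next
        case 3
        have "z ^ r \<le> z\<^sup>2" using z 3 by (intro power_decreasing) auto
        moreover have "zero_moment (J s) c l r / fact r \<le> zero_moment (J s) c l r / 1"
          using nn by (intro divide_left_mono) auto
        then have "zero_moment (J s) c l r / fact r \<le> D / s"
          using insert.prems(7)[of s r] 3 r by auto
        ultimately have "zero_moment (J s) c l r / fact r * z ^ r \<le> (D / s) * z\<^sup>2"
          using z nn D by (intro mult_mono) auto
        then show ?thesis using 3 by simp
      qed simp
    qed
    also have "\<dots> = 1 + (\<Sum>r\<le>K. if r \<ge> 2 then D * z\<^sup>2 / s else 0)" by (simp add: sum.distrib)
    also have "(\<Sum>r\<le>K. if r \<ge> 2 then D * z\<^sup>2 / s else 0) = (\<Sum>r\<in>{2..K}. D * z\<^sup>2 / s)"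
      by (rule sum.mono_neutral_cong_right) auto
    also have "\<dots> = real (Suc K - 2) * (D * z\<^sup>2 / s)" by simp
    also have "\<dots> \<le> real K * (D * z\<^sup>2 / s)" using D by (intro mult_right_mono) auto
    finally show "(\<Sum>r\<le>K. zero_moment (J s) c l r / fact r * z ^ r) \<le> 1 + K * D * z\<^sup>2 / s" by simp
    show "0 \<le> (\<Prod>s\<in>S. 1 + K * D * z\<^sup>2 / s)" using D by (intro prod_nonneg) auto
    show "0 \<le> (\<Sum>r\<le>K. zero_moment (J s) c l r / fact r * z ^ r)" using nn z by (intro sum_nonneg) auto
  qed
  also have "\<dots> = (\<Prod>s\<in>insert s S. 1 + K * D * z\<^sup>2 / s)" using insert.hyps by simp
  finally show ?case .
qed

text \<open>In a vanishing signed sum the largest value \<open>v\<close> is determined by the other \<open>r - 1\<close> terms, so it occurs for at most \<open>4 \<surd>v\<close> indices. The total weight \<open>4 / \<surd>v\<close> of these is at most \<open>4\<close> times the product of the other values to the power \<open>- 1 / (2 (r - 1))\<close>, which makes the remaining sums converge.\<close>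

lemma zero_moment_class_le:
  fixes f :: "'i \<Rightarrow> nat" and e :: "'i \<Rightarrow> real"
  assumes r: "r \<ge> 2" and fin: "finite J" and f: "\<And>j. j \<in> J \<Longrightarrow> f j \<ge> 1"
    and e: "\<And>j. j \<in> J \<Longrightarrow> e j = 1 \<or> e j = -1"
    and card: "\<And>v. real (card {j\<in>J. f j = v}) \<le> 4 * sqrt v"
    and B: "(\<Sum>j\<in>J. real (f j) powr (- 1 - 1 / (2 * (real r - 1)))) \<le> B"
    and a: "a \<ge> 0" and b: "b \<noteq> 0"
  shows "zero_moment J (\<lambda>j. a / f j) (\<lambda>j. b * (e j * f j)) r \<le> a ^ r * (r * (4 * B ^ (r - 1)))"
proof -
  define \<eta> where "\<eta> = 1 / (2 * (real r - 1))"
  define P where "P = PiE {..<r} (\<lambda>_. J)"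
  define T where "T = {\<phi>\<in>P. (\<Sum>i<r. e (\<phi> i) * f (\<phi> i)) = 0}"
  define G where "G \<phi> = (\<Prod>i<r. 1 / real (f (\<phi> i)))" for \<phi>
  define Tq where "Tq q = {\<phi>\<in>T. \<forall>i<r. f (\<phi> i) \<le> f (\<phi> q)}" for q
  have Pfin: "finite P" unfolding P_def using fin by (intro finite_PiE) auto
  then have Tfin: "finite T" by (simp add: T_def)
  have G0: "G \<phi> \<ge> 0" for \<phi> unfolding G_def by (intro prod_nonneg) auto
  have zm: "zero_moment J (\<lambda>j. a / f j) (\<lambda>j. b * (e j * f j)) r = a ^ r * (\<Sum>\<phi>\<in>T. G \<phi>)"
  proof -
    have "{\<phi>\<in>PiE {..<r} (\<lambda>_. J). (\<Sum>i<r. b * (e (\<phi> i) * f (\<phi> i))) = 0} = T"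
      using b by (auto simp: T_def P_def simp flip: sum_distrib_left)
    moreover have "(\<Prod>i<r. a / real (f (\<phi> i))) = a ^ r * G \<phi>" for \<phi>
      by (simp add: G_def prod_dividef)
    ultimately show ?thesis by (simp add: zero_moment_def sum_distrib_left)
  qed
  have "T \<subseteq> (\<Union>q<r. Tq q)"
  proof
    fix \<phi> assume \<phi>: "\<phi> \<in> T"
    have "\<exists>q\<in>{..<r}. \<forall>i\<in>{..<r}. f (\<phi> i) \<le> f (\<phi> q)"
    proof -
      have ne: "finite ((\<lambda>i. f (\<phi> i)) ` {..<r})" "(\<lambda>i. f (\<phi> i)) ` {..<r} \<noteq> {}" using r by (auto simp: lessThan_empty_iff)
      from Max_in[OF ne] obtain q where "q < r" "Max ((\<lambda>i. f (\<phi> i)) ` {..<r}) = f (\<phi> q)" by auto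
      then show ?thesis using Max_ge[OF ne(1)] by (intro bexI[of _ q]) auto
    qed
    then show "\<phi> \<in> (\<Union>q<r. Tq q)" using \<phi> by (auto simp: Tq_def)
  qed
  note cover = this
  \<comment> \<open>Union bound over the position \<open>q\<close> of the maximum; a tuple attaining
    it several times is counted several times, which nonnegativity allows.\<close>
  have "(\<Sum>\<phi>\<in>T. G \<phi>) \<le> (\<Sum>\<phi>\<in>T. \<Sum>q<r. if \<phi> \<in> Tq q then G \<phi> else 0)"
  proof (rule sum_mono)
    fix \<phi> assume "\<phi> \<in> T"
    then obtain q where q: "q < r" "\<phi> \<in> Tq q" using cover by auto
    then have "G \<phi> = (\<Sum>q\<in>{q}. if \<phi> \<in> Tq q then G \<phi> else 0)" by simp
    also have "\<dots> \<le> (\<Sum>q<r. if \<phi> \<in> Tq q then G \<phi> else 0)"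
      using q G0 by (intro sum_mono2) auto
    finally show "G \<phi> \<le> (\<Sum>q<r. if \<phi> \<in> Tq q then G \<phi> else 0)" .
  qed
  also have "\<dots> = (\<Sum>q<r. \<Sum>\<phi>\<in>T. if \<phi> \<in> Tq q then G \<phi> else 0)" by (rule sum.swap)
  also have "\<dots> = (\<Sum>q<r. \<Sum>\<phi>\<in>Tq q. G \<phi>)"
    using Tfin by (intro sum.cong sum.mono_neutral_cong_right) (auto simp: Tq_def)
  also have "\<dots> \<le> (\<Sum>q<r. 4 * B ^ (r - 1))"
  proof (rule sum_mono)
    fix q assume q: "q \<in> {..<r}"
    define I where "I = {..<r} - {q}"
    have I: "finite I" "card I = r - 1" "insert q I = {..<r}" "q \<notin> I" using q by (auto simp: I_def)
    define Q where "Q = PiE I (\<lambda>_. J)"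
    have Qfin: "finite Q" unfolding Q_def using fin I by (intro finite_PiE) auto
    have Tqfin: "finite (Tq q)" using Tfin by (simp add: Tq_def)
    have "(\<Sum>\<phi>\<in>Tq q. G \<phi>) = (\<Sum>\<psi>\<in>Q. \<Sum>\<phi>\<in>{\<phi>\<in>Tq q. restrict \<phi> I = \<psi>}. G \<phi>)"
    proof (rule sum.group[symmetric, OF Tqfin Qfin])
      show "(\<lambda>\<phi>. restrict \<phi> I) ` Tq q \<subseteq> Q"
        by (auto simp: Tq_def T_def P_def Q_def I_def PiE_iff split: if_splits)
    qed
    also have "\<dots> \<le> (\<Sum>\<psi>\<in>Q. 4 * (\<Prod>i\<in>I. real (f (\<psi> i)) powr (- 1 - \<eta>)))"
    proof (rule sum_mono)
      fix \<psi> assume \<psi>: "\<psi> \<in> Q"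
      define W where "W = {\<phi>\<in>Tq q. restrict \<phi> I = \<psi>}"
      show "(\<Sum>\<phi>\<in>{\<phi>\<in>Tq q. restrict \<phi> I = \<psi>}. G \<phi>) \<le> 4 * (\<Prod>i\<in>I. real (f (\<psi> i)) powr (- 1 - \<eta>))"
      proof (cases "W = {}")
        case True
        then have "{\<phi>\<in>Tq q. restrict \<phi> I = \<psi>} = {}" by (simp add: W_def)
        then have "(\<Sum>\<phi>\<in>{\<phi>\<in>Tq q. restrict \<phi> I = \<psi>}. G \<phi>) = 0" by (simp only: sum.empty)
        moreover have "0 \<le> 4 * (\<Prod>i\<in>I. real (f (\<psi> i)) powr (- 1 - \<eta>))" by (intro mult_nonneg_nonneg prod_nonneg) auto
        ultimately show ?thesis by simp
      next
        case False
        then obtain \<phi>0 where \<phi>0: "\<phi>0 \<in> W" by auto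
        define v where "v = f (\<phi>0 q)"
        have WD: "\<phi> i = \<psi> i" if "\<phi> \<in> W" "i \<in> I" for \<phi> i
        proof -
          have "restrict \<phi> I i = \<psi> i" using that(1) by (simp add: W_def)
          then show ?thesis using that(2) by simp
        qed
        have WP: "\<phi> \<in> P" "\<phi> q \<in> J" if "\<phi> \<in> W" for \<phi>
          using that q by (auto simp: W_def Tq_def T_def P_def PiE_iff)
        have ev: "e (\<phi> q) * f (\<phi> q) = - (\<Sum>i\<in>I. e (\<psi> i) * f (\<psi> i))" if "\<phi> \<in> W" for \<phi>
        proof -
          have "0 = (\<Sum>i\<in>insert q I. e (\<phi> i) * f (\<phi> i))"
            using that unfolding I(3) by (simp add: W_def Tq_def T_def)
          also have "\<dots> = e (\<phi> q) * f (\<phi> q) + (\<Sum>i\<in>I. e (\<phi> i) * f (\<phi> i))" using I(1,4) by simp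
          also have "(\<Sum>i\<in>I. e (\<phi> i) * f (\<phi> i)) = (\<Sum>i\<in>I. e (\<psi> i) * f (\<psi> i))"
            using WD[OF that] by (intro sum.cong) auto
          finally show ?thesis by linarith
        qed
        have fv: "f (\<phi> q) = v" if "\<phi> \<in> W" for \<phi>
        proof -
          have "e (\<phi> q) * f (\<phi> q) = e (\<phi>0 q) * f (\<phi>0 q)" using ev[OF that] ev[OF \<phi>0] by simp
          then have "\<bar>e (\<phi> q) * f (\<phi> q)\<bar> = \<bar>e (\<phi>0 q) * f (\<phi>0 q)\<bar>" by simp
          moreover have "\<bar>e (\<phi> q)\<bar> = 1" "\<bar>e (\<phi>0 q)\<bar> = 1" using e[OF WP(2)[OF that]] e[OF WP(2)[OF \<phi>0]] by auto
          ultimately show ?thesis by (simp add: abs_mult v_def)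
        qed
        have v1: "v \<ge> 1" using f[OF WP(2)[OF \<phi>0]] by (simp add: v_def)
        have vmax: "f (\<psi> i) \<le> v" if "i \<in> I" for i
          using \<phi>0 WD[OF \<phi>0 that] that by (auto simp: W_def Tq_def v_def I_def)
        have psi1: "f (\<psi> i) \<ge> 1" if "i \<in> I" for i using that \<psi> f by (auto simp: Q_def PiE_iff)
        have Gv: "G \<phi> = (1 / v) * (\<Prod>i\<in>I. 1 / real (f (\<psi> i)))" if "\<phi> \<in> W" for \<phi>
        proof -
          have "G \<phi> = (\<Prod>i\<in>insert q I. 1 / real (f (\<phi> i)))" unfolding I(3) G_def ..
          also have "\<dots> = (1 / real (f (\<phi> q))) * (\<Prod>i\<in>I. 1 / real (f (\<phi> i)))" using I(1,4) by simp
          also have "(\<Prod>i\<in>I. 1 / real (f (\<phi> i))) = (\<Prod>i\<in>I. 1 / real (f (\<psi> i)))"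
            using WD[OF that] by (intro prod.cong) auto
          finally show ?thesis using fv[OF that] by simp
        qed
        have cardW: "real (card W) \<le> 4 * sqrt v"
        proof -
          have "inj_on (\<lambda>\<phi>. \<phi> q) W"
          proof (rule inj_onI)
            fix \<phi> \<phi>' assume a: "\<phi> \<in> W" "\<phi>' \<in> W" "\<phi> q = \<phi>' q"
            show "\<phi> = \<phi>'"
            proof
              fix i
              show "\<phi> i = \<phi>' i"
              proof (cases "i \<in> {..<r}")
                case True
                then have "i = q \<or> i \<in> I" by (auto simp: I_def)
                then show ?thesis using a(3) WD[OF a(1)] WD[OF a(2)] by auto
              next
                case False
                then show ?thesis using WP(1)[OF a(1)] WP(1)[OF a(2)] by (auto simp: P_def PiE_iff extensional_def)
              qed
            qed
          qed
          moreover have "(\<lambda>\<phi>. \<phi> q) ` W \<subseteq> {j\<in>J. f j = v}" using WP fv by auto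
          ultimately have "card W \<le> card {j\<in>J. f j = v}" using fin by (intro card_inj_on_le) auto
          then show ?thesis using card[of v] by linarith
        qed
        have "(\<Sum>\<phi>\<in>W. G \<phi>) = card W * ((1 / v) * (\<Prod>i\<in>I. 1 / real (f (\<psi> i))))" using Gv by simp
        also have "\<dots> \<le> (4 * sqrt v) * ((1 / v) * (\<Prod>i\<in>I. 1 / real (f (\<psi> i))))"
          using cardW by (intro mult_right_mono mult_nonneg_nonneg prod_nonneg) auto
        also have "\<dots> = 4 * (real v powr (- (1/2)) * (\<Prod>i\<in>I. 1 / real (f (\<psi> i))))"
        proof -
          have "sqrt v * (1 / v) = real v powr (- (1/2))"
            using v1 by (simp add: powr_minus powr_half_sqrt field_simps)
          then show ?thesis by (metis mult.assoc)
        qed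
        also have "\<dots> \<le> 4 * ((\<Prod>i\<in>I. real (f (\<psi> i)) powr (- \<eta>)) * (\<Prod>i\<in>I. 1 / real (f (\<psi> i))))"
        proof (intro mult_left_mono mult_right_mono)
          \<comment> \<open>The surplus \<open>v^(-1/2)\<close> is shared equally among the
            \<open>r - 1\<close> other positions, \<open>v^(-\<eta>)\<close> for each; since
            \<open>v\<close> is the maximum, each share is at most the same power of the value at
            that position.\<close>
          have "real v powr (- (1/2)) = (\<Prod>i\<in>I. real v powr (- \<eta>))"
          proof -
            have "(real v powr (- \<eta>)) ^ (r - 1) = real v powr (- \<eta> * real (r - 1))"
              using v1 by (simp flip: powr_realpow add: powr_powr)
            also have "- \<eta> * real (r - 1) = - (1/2)" unfolding \<eta>_def using r by (simp add: of_nat_diff field_simps)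
            finally show ?thesis by (simp only: prod_constant I(2))
          qed
          also have "\<dots> \<le> (\<Prod>i\<in>I. real (f (\<psi> i)) powr (- \<eta>))"
          proof (rule prod_mono)
            fix i assume i: "i \<in> I"
            have "\<eta> > 0" unfolding \<eta>_def using r by simp
            then show "0 \<le> real v powr (- \<eta>) \<and> real v powr (- \<eta>) \<le> real (f (\<psi> i)) powr (- \<eta>)"
              using vmax[OF i] psi1[OF i] by (auto intro!: powr_mono2')
          qed
          finally show "real v powr (- (1/2)) \<le> (\<Prod>i\<in>I. real (f (\<psi> i)) powr (- \<eta>))" .
        qed (auto intro!: prod_nonneg)
        also have "\<dots> = 4 * (\<Prod>i\<in>I. real (f (\<psi> i)) powr (- 1 - \<eta>))"
        proof -
          have "real (f (\<psi> i)) powr (- \<eta>) * (1 / real (f (\<psi> i))) = real (f (\<psi> i)) powr (- 1 - \<eta>)" if "i \<in> I" for i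
            using psi1[OF that] by (simp add: powr_diff powr_minus field_simps)
          then show ?thesis by (simp flip: prod.distrib)
        qed
        finally show ?thesis by (simp add: W_def)
      qed
    qed
    also have "\<dots> = 4 * (\<Prod>i\<in>I. \<Sum>j\<in>J. real (f j) powr (- 1 - \<eta>))"
    proof -
      have "(\<Prod>i\<in>I. \<Sum>j\<in>J. real (f j) powr (- 1 - \<eta>)) = (\<Sum>\<psi>\<in>Q. \<Prod>i\<in>I. real (f (\<psi> i)) powr (- 1 - \<eta>))"
        unfolding Q_def by (rule prod_sum_PiE) (use I(1) fin in auto)
      then show ?thesis by (simp only: sum_distrib_left)
    qed
    also have "\<dots> \<le> 4 * (\<Prod>i\<in>I. B)"
    proof (intro mult_left_mono prod_mono conjI)
      show "(\<Sum>j\<in>J. real (f j) powr (- 1 - \<eta>)) \<le> B" using B by (simp add: \<eta>_def)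
    qed (auto intro!: sum_nonneg)
    also have "\<dots> = 4 * B ^ (r - 1)" by (simp add: I)
    finally show "(\<Sum>\<phi>\<in>Tq q. G \<phi>) \<le> 4 * B ^ (r - 1)" .
  qed
  also have "\<dots> = r * (4 * B ^ (r - 1))" by simp
  finally show ?thesis unfolding zm using a by (intro mult_left_mono) auto
qed

section \<open>Moments of the cosine sum\<close>

text \<open>The smaller factor is at most \<open>sqrt v\<close> and determines the larger
  one.\<close>

lemma card_divisor_pairs_le: "real (card {(a, c). a * c = v \<and> a \<ge> 1 \<and> c \<ge> (1::nat)}) \<le> 2 * sqrt v"
proof -
  define w where "w = nat \<lfloor>sqrt v\<rfloor>"
  have "{(a, c). a * c = v \<and> a \<ge> 1 \<and> c \<ge> (1::nat)} \<subseteq> (\<lambda>a. (a, v div a)) ` {1..w} \<union> (\<lambda>c. (v div c, c)) ` {1..w}"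
  proof clarify
    fix a c :: nat assume a: "1 \<le> a" "1 \<le> c" "v = a * c" "(a, c) \<notin> (\<lambda>ca. (a * c div ca, ca)) ` {1..w}"
    have small: "x \<le> w" if "x * x \<le> v" for x :: nat
    proof -
      have "real x * real x \<le> real v" using that by (metis of_nat_le_iff of_nat_mult)
      then have "real x \<le> sqrt v" by (simp add: real_le_rsqrt power2_eq_square)
      then show ?thesis by (simp add: w_def le_nat_floor)
    qed
    have "\<not> c \<le> a"
    proof
      assume "c \<le> a"
      then have "c \<le> w" using a by (intro small) simp
      then have "(a, c) \<in> (\<lambda>ca. (a * c div ca, ca)) ` {1..w}" using a(1,2) by (intro image_eqI[of _ _ c]) auto
      then show False using a(4) by contradiction
    qed
    then have "a \<le> w" using a by (intro small) simp
    then show "(a, c) \<in> (\<lambda>x. (x, a * c div x)) ` {1..w}" using a(1,2) by (intro image_eqI[of _ _ a]) auto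
  qed
  then have "card {(a, c). a * c = v \<and> a \<ge> 1 \<and> c \<ge> (1::nat)} \<le> card ((\<lambda>a. (a, v div a)) ` {1..w} \<union> (\<lambda>c. (v div c, c)) ` {1..w})"
    by (intro card_mono) auto
  also have "\<dots> \<le> card {1..w} + card {1..w}"
    by (intro card_Un_le[THEN order_trans] add_mono card_image_le) auto
  finally have "card {(a, c). a * c = v \<and> a \<ge> 1 \<and> c \<ge> (1::nat)} \<le> 2 * w" by simp
  moreover have "real w \<le> sqrt v" by (simp add: w_def of_nat_floor)
  ultimately show ?thesis by linarith
qed

text \<open>The point is uniformity in the finite set \<open>A\<close>; an index 0 may be present,
  since \<open>0 powr _ = 0\<close>.\<close>

lemma sum_powr_bounded:
  assumes "\<eta> > 0"
  shows "\<exists>G\<ge>0. \<forall>A. finite A \<longrightarrow> (\<Sum>a\<in>A. real a powr (- 1 - \<eta>)) \<le> G"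
proof -
  have "summable (\<lambda>n. real n powr (- 1 - \<eta>))" using assms by (simp add: summable_real_powr_iff)
  then have "(\<Sum>a\<in>A. real a powr (- 1 - \<eta>)) \<le> (\<Sum>n. real n powr (- 1 - \<eta>))" if "finite A" for A
    using that by (intro sum_le_suminf) auto
  moreover have "(\<Sum>n. real n powr (- 1 - \<eta>)) \<ge> 0" using \<open>summable _\<close> by (intro suminf_nonneg) auto
  ultimately show ?thesis by blast
qed

lemma sum_inverse_le_ln: "n \<ge> 1 \<Longrightarrow> (\<Sum>k=1..n. 1 / real k) \<le> 1 + ln n"
proof -
  assume n: "n \<ge> 1"
  have "decseq (\<lambda>n. harm (Suc n) - ln (Suc n) :: real)" by (rule decseq_harm_diff_ln)
  then have "harm (Suc (n - 1)) - ln (real (Suc (n - 1))) \<le> (harm (Suc 0) - ln (Suc 0) :: real)"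
    by (rule decseqD) simp
  then show ?thesis using n by (simp add: harm_def inverse_eq_divide)
qed

definition cos_sum :: "nat \<Rightarrow> nat \<Rightarrow> real \<Rightarrow> real" where
  "cos_sum N Z t = (\<Sum>m\<in>{1..N}. \<Sum>c\<in>{1..Z}. cos (2 * pi * (real c * sqrt (real m)) * t) / (real c * sqrt (real m)))"

definition sqf_upto :: "nat \<Rightarrow> nat set" where
  "sqf_upto N = {s\<in>{1..N}. squarefree s}"

text \<open>An index \<open>(s, e, a, c)\<close> stands for the frequency \<open>e c \<surd>m\<close> with sign \<open>e\<close> and \<open>m = s a\<^sup>2\<close>, \<open>s\<close> squarefree.\<close>

definition class_index :: "nat \<Rightarrow> nat \<Rightarrow> nat \<Rightarrow> (nat \<times> real \<times> nat \<times> nat) set" where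
  "class_index N Z s = {s} \<times> {1, -1} \<times> {a\<in>{1..N}. s * a\<^sup>2 \<le> N} \<times> {1..Z}"

text \<open>The factor \<open>1/2\<close> is that of the cosine as the mean of two exponentials, one
  for each sign \<open>e\<close>.\<close>

definition cweight :: "nat \<times> real \<times> nat \<times> nat \<Rightarrow> real" where
  "cweight j = (case j of (s, e, a, c) \<Rightarrow> (1 / (2 * sqrt s)) / real (a * c))"

definition cfreq :: "nat \<times> real \<times> nat \<times> nat \<Rightarrow> real" where
  "cfreq j = (case j of (s, e, a, c) \<Rightarrow> sqrt s * (e * real (a * c)))"

lemma sum_squarefree_decompose:
  "(\<Sum>m=1..N. F m) = (\<Sum>s\<in>sqf_upto N. \<Sum>a\<in>{a\<in>{1..N}. s * a\<^sup>2 \<le> N}. F (s * a\<^sup>2))" for F :: "nat \<Rightarrow> 'a::comm_monoid_add"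
proof -
  define S where "S = (SIGMA s:sqf_upto N. {a\<in>{1..N}. s * a\<^sup>2 \<le> N})"
  have "(\<Sum>m=1..N. F m) = (\<Sum>(s, a)\<in>S. F (s * a\<^sup>2))"
  proof (rule sum.reindex_bij_witness[where i = "\<lambda>(s, a). s * a\<^sup>2" and j = "\<lambda>m. (squarefree_part m, square_part m)"])
    fix m assume m: "m \<in> {1..N}"
    show "(case (squarefree_part m, square_part m) of (s, a) \<Rightarrow> s * a\<^sup>2) = m"
      using squarefree_decompose[of m] by simp
    show "(case (squarefree_part m, square_part m) of (s, a) \<Rightarrow> F (s * a\<^sup>2)) = F m"
      using squarefree_decompose[of m] by simp
    have mm: "squarefree_part m * (square_part m)\<^sup>2 = m" using squarefree_decompose[of m] by simp
    have pos: "squarefree_part m > 0" "square_part m > 0" using m by (auto intro!: Nat.gr0I)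
    have "squarefree_part m \<le> m" "square_part m \<le> m"
    proof -
      have "squarefree_part m dvd m" "square_part m dvd m" using mm
        by (metis dvd_triv_left, metis dvd_mult dvd_power mm pos_add_strict zero_less_numeral)
      then show "squarefree_part m \<le> m" "square_part m \<le> m" using m by (auto intro!: dvd_imp_le)
    qed
    then show "(squarefree_part m, square_part m) \<in> S" using m mm pos by (auto simp: S_def sqf_upto_def)
  next
    fix x assume x: "x \<in> S"
    obtain s a where sa: "x = (s, a)" by force
    have h: "squarefree s" "s \<ge> 1" "a \<ge> 1" "s * a\<^sup>2 \<le> N" using x by (auto simp: S_def sqf_upto_def sa)
    have "squarefree_part (s * a\<^sup>2) = s \<and> square_part (s * a\<^sup>2) = a"
    proof -
      have *: "square_part (s * a\<^sup>2) = a"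
      proof (rule dvd_antisym)
        show "a dvd square_part (s * a\<^sup>2)" by (simp add: dvd_square_part_iff)
        then obtain k where k: "square_part (s * a\<^sup>2) = a * k" by auto
        have "(a * k)\<^sup>2 dvd s * a\<^sup>2" using square_part_square_dvd[of "s * a\<^sup>2"] by (simp add: k)
        then have "a\<^sup>2 * k\<^sup>2 dvd a\<^sup>2 * s" by (simp add: power_mult_distrib mult.commute)
        then have "k\<^sup>2 dvd s" using h by simp
        then have "k dvd 1" using h(1) unfolding squarefree_def by blast
        then show "square_part (s * a\<^sup>2) dvd a" by (simp add: k)
      qed
      moreover have "squarefree_part (s * a\<^sup>2) * a\<^sup>2 = s * a\<^sup>2"
        using squarefree_decompose[of "s * a\<^sup>2", unfolded *] by (rule sym)
      ultimately show ?thesis using h by simp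
    qed
    then show "(\<lambda>m. (squarefree_part m, square_part m)) (case x of (s, a) \<Rightarrow> s * a\<^sup>2) = x" by (simp add: sa)
    show "(case x of (s, a) \<Rightarrow> s * a\<^sup>2) \<in> {1..N}" using h by (simp add: sa)
  qed
  also have "\<dots> = (\<Sum>s\<in>sqf_upto N. \<Sum>a\<in>{a\<in>{1..N}. s * a\<^sup>2 \<le> N}. F (s * a\<^sup>2))"
    unfolding S_def by (subst sum.Sigma) (auto simp: sqf_upto_def)
  finally show ?thesis .
qed

lemma finite_class_index: "finite (class_index N Z s)"
  by (simp add: class_index_def)

lemma sum_class_index:
  "(\<Sum>j\<in>(\<Union>s\<in>sqf_upto N. class_index N Z s). F j)
    = (\<Sum>s\<in>sqf_upto N. \<Sum>a\<in>{a\<in>{1..N}. s * a\<^sup>2 \<le> N}. \<Sum>c=1..Z. F (s, 1, a, c) + F (s, -1, a, c))"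
  for F :: "_ \<Rightarrow> 'a::comm_monoid_add"
proof -
  have "(\<Sum>j\<in>(\<Union>s\<in>sqf_upto N. class_index N Z s). F j) = (\<Sum>s\<in>sqf_upto N. \<Sum>j\<in>class_index N Z s. F j)"
    by (intro sum.UNION_disjoint) (auto simp: sqf_upto_def class_index_def)
  also have "\<dots> = (\<Sum>s\<in>sqf_upto N. \<Sum>a\<in>{a\<in>{1..N}. s * a\<^sup>2 \<le> N}. \<Sum>c=1..Z. F (s, 1, a, c) + F (s, -1, a, c))"
  proof (intro sum.cong refl)
    fix s
    have "(\<Sum>j\<in>class_index N Z s. F j) = (\<Sum>e\<in>{1, -1}. \<Sum>a\<in>{a\<in>{1..N}. s * a\<^sup>2 \<le> N}. \<Sum>c=1..Z. F (s, e, a, c))"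
      unfolding class_index_def by (simp only: sum.cartesian_product' sum.insert sum.empty finite.emptyI empty_iff not_False_eq_True add_0_right)
    then show "(\<Sum>j\<in>class_index N Z s. F j) = (\<Sum>a\<in>{a\<in>{1..N}. s * a\<^sup>2 \<le> N}. \<Sum>c=1..Z. F (s, 1, a, c) + F (s, -1, a, c))"
      by (simp add: sum.distrib)
  qed
  finally show ?thesis .
qed

lemma sqrt_mult_square: "sqrt (real (s * a\<^sup>2)) = a * sqrt s"
  by (simp add: real_sqrt_mult)

lemma exp_sum_class_index:
  "exp_sum (\<Union>s\<in>sqf_upto N. class_index N Z s) cweight cfreq t = of_real (cos_sum N Z t)"
proof -
  have two: "of_real (1 / (2 * x) / y) * cis (2 * pi * (x * (1 * y)) * t) + of_real (1 / (2 * x) / y) * cis (2 * pi * (x * (- 1 * y)) * t)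
      = complex_of_real (cos (2 * pi * (x * y) * t) / (x * y))" for x y
    by (rule complex_eqI) (auto simp: field_simps)
  have "exp_sum (\<Union>s\<in>sqf_upto N. class_index N Z s) cweight cfreq t
     = (\<Sum>s\<in>sqf_upto N. \<Sum>a\<in>{a\<in>{1..N}. s * a\<^sup>2 \<le> N}. \<Sum>c=1..Z. complex_of_real (cos (2 * pi * (sqrt s * real (a * c)) * t) / (sqrt s * real (a * c))))"
    unfolding exp_sum_def sum_class_index cweight_def cfreq_def prod.case two ..
  also have "\<dots> = of_real (\<Sum>s\<in>sqf_upto N. \<Sum>a\<in>{a\<in>{1..N}. s * a\<^sup>2 \<le> N}. \<Sum>c=1..Z. cos (2 * pi * (c * sqrt (real (s * a\<^sup>2))) * t) / (c * sqrt (real (s * a\<^sup>2))))"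
    unfolding sqrt_mult_square of_real_sum by (intro sum.cong refl) (simp add: mult_ac)
  also have "\<dots> = of_real (cos_sum N Z t)"
    unfolding cos_sum_def sum_squarefree_decompose[of _ N] ..
  finally show ?thesis .
qed

text \<open>\<open>zero_moment_class_le\<close> applies with \<open>f = a * c\<close>: a value
  \<open>v\<close> comes from at most \<open>2 * sqrt v\<close> pairs and two signs, and the sum of
  \<open>f^(-1-\<eta>)\<close> factors into sums over \<open>a\<close> and \<open>c\<close> that are
  bounded uniformly in \<open>N\<close> and \<open>Z\<close>. The weight
  \<open>(2 * sqrt s)^(-r)\<close> is at most \<open>1 / s\<close> because
  \<open>r \<ge> 2\<close>.\<close>

lemma class_index_moment:
  assumes "r \<ge> 2"
  shows "\<exists>D\<ge>0. \<forall>N Z s. s \<ge> 1 \<longrightarrow> zero_moment (class_index N Z s) cweight cfreq r \<le> D / s"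
proof -
  define \<eta> where "\<eta> = 1 / (2 * (real r - 1))"
  have "\<eta> > 0" using assms by (simp add: \<eta>_def)
  then obtain G where G: "G \<ge> 0" "\<And>A. finite A \<Longrightarrow> (\<Sum>a\<in>A. real a powr (- 1 - \<eta>)) \<le> G"
    using sum_powr_bounded by blast
  define f :: "nat \<times> real \<times> nat \<times> nat \<Rightarrow> nat" where "f = (\<lambda>(s, e, a, c). a * c)"
  define e :: "nat \<times> real \<times> nat \<times> nat \<Rightarrow> real" where "e = (\<lambda>(s, e, a, c). e)"
  define D where "D = r * (4 * (2 * (G * G)) ^ (r - 1))"
  have "zero_moment (class_index N Z s) cweight cfreq r \<le> D / s" if s: "s \<ge> 1" for N Z s
  proof -
    define J where "J = class_index N Z s"
    have "zero_moment J cweight cfreq r = zero_moment J (\<lambda>j. (1 / (2 * sqrt s)) / f j) (\<lambda>j. sqrt s * (e j * f j)) r"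
      unfolding zero_moment_def
    proof (rule sum.cong)
      have *: "cfreq j = sqrt s * (e j * f j)" "cweight j = (1 / (2 * sqrt s)) / f j" if "j \<in> J" for j
        using that by (auto simp: J_def class_index_def cfreq_def cweight_def e_def f_def)
      have eq: "(\<Sum>i<r. cfreq (\<phi> i)) = (\<Sum>i<r. sqrt s * (e (\<phi> i) * f (\<phi> i)))" if "\<phi> \<in> PiE {..<r} (\<lambda>_. J)" for \<phi>
        using that by (intro sum.cong) (auto simp: * PiE_iff)
      then show "{\<phi> \<in> {..<r} \<rightarrow>\<^sub>E J. (\<Sum>i<r. cfreq (\<phi> i)) = 0}
        = {\<phi> \<in> {..<r} \<rightarrow>\<^sub>E J. (\<Sum>i<r. sqrt s * (e (\<phi> i) * f (\<phi> i))) = 0}" by auto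
      fix \<phi> assume "\<phi> \<in> {\<phi> \<in> {..<r} \<rightarrow>\<^sub>E J. (\<Sum>i<r. sqrt s * (e (\<phi> i) * f (\<phi> i))) = 0}"
      then show "(\<Prod>i<r. cweight (\<phi> i)) = (\<Prod>i<r. (1 / (2 * sqrt s)) / f (\<phi> i))"
        by (intro prod.cong) (auto simp: * PiE_iff)
    qed
    also have "\<dots> \<le> (1 / (2 * sqrt s)) ^ r * D"
      unfolding D_def
    proof (rule zero_moment_class_le[OF assms])
      show "finite J" by (simp add: J_def finite_class_index)
      show "1 \<le> f j" if "j \<in> J" for j using that by (auto simp: J_def class_index_def f_def)
      show "e j = 1 \<or> e j = - 1" if "j \<in> J" for j using that by (auto simp: J_def class_index_def e_def)
      show "0 \<le> 1 / (2 * sqrt s)" "sqrt s \<noteq> 0" using s by auto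
      show "real (card {j \<in> J. f j = v}) \<le> 4 * sqrt v" for v
      proof -
        define A where "A = {(a, c). a * c = v \<and> a \<ge> 1 \<and> c \<ge> (1::nat)}"
        have "{j \<in> J. f j = v} \<subseteq> {s} \<times> {1, -1} \<times> (A \<inter> {1..N} \<times> {1..Z})"
          by (auto simp: J_def class_index_def f_def A_def)
        then have "card {j \<in> J. f j = v} \<le> card ({s} \<times> {1, -1 :: real} \<times> (A \<inter> {1..N} \<times> {1..Z}))"
          by (intro card_mono) auto
        also have "\<dots> = 2 * card (A \<inter> {1..N} \<times> {1..Z})" by (simp add: card_cartesian_product)
        finally have 1: "card {j \<in> J. f j = v} \<le> 2 * card (A \<inter> {1..N} \<times> {1..Z})" .
        have "card (A \<inter> {1..N} \<times> {1..Z}) \<le> card A"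
        proof (rule card_mono)
          have "a \<le> a * c \<and> c \<le> a * c" if "a \<ge> 1" "c \<ge> 1" for a c :: nat using that by simp
          then have "A \<subseteq> {..v} \<times> {..v}" unfolding A_def by force
          then show "finite A" by (rule finite_subset) auto
        qed auto
        then show ?thesis using 1 card_divisor_pairs_le[of v] unfolding A_def[symmetric] by linarith
      qed
      have "(\<Sum>j\<in>J. real (f j) powr (- 1 - \<eta>)) = (\<Sum>e\<in>{1::real, -1}. \<Sum>a\<in>{a\<in>{1..N}. s * a\<^sup>2 \<le> N}. \<Sum>c=1..Z. real (f (s, e, a, c)) powr (- 1 - \<eta>))"
        unfolding J_def class_index_def
        by (simp only: sum.cartesian_product' sum.insert sum.empty finite.emptyI empty_iff not_False_eq_True add_0_right)
      also have "\<dots> = 2 * ((\<Sum>a\<in>{a\<in>{1..N}. s * a\<^sup>2 \<le> N}. real a powr (- 1 - \<eta>)) * (\<Sum>c=1..Z. real c powr (- 1 - \<eta>)))"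
        by (simp add: f_def powr_mult sum_product)
      also have "\<dots> \<le> 2 * (G * G)"
        using G(1) by (intro mult_left_mono mult_mono G(2) sum_nonneg) auto
      finally show "(\<Sum>j\<in>J. real (f j) powr (- 1 - 1 / (2 * (real r - 1)))) \<le> 2 * (G * G)"
        unfolding \<eta>_def .
    qed
    also have "\<dots> \<le> (1 / s) * D"
    proof (rule mult_right_mono)
      have "1 / (2 * sqrt s) \<le> 1 / sqrt s" using s by (simp add: field_simps)
      then have "(1 / (2 * sqrt s)) ^ r \<le> (1 / sqrt s) ^ r" by (intro power_mono) auto
      also have "\<dots> \<le> (1 / sqrt s) ^ 2" using s assms by (intro power_decreasing) auto
      also have "\<dots> = 1 / s" by (simp add: power_divide)
      finally show "(1 / (2 * sqrt s)) ^ r \<le> 1 / s" .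
      show "0 \<le> D" using G by (simp add: D_def)
    qed
    finally show ?thesis by (simp add: J_def)
  qed
  moreover have "D \<ge> 0" using G by (simp add: D_def)
  ultimately show ?thesis by blast
qed

text \<open>First term: one coefficient of a nonnegative generating function is at most its value at
  \<open>z\<close> divided by \<open>z^(2k)\<close>. Second term: the nonresonant tuples, of total
  weight at most \<open>(N * Z)^(2k)\<close>, times the inverse of the spacing from
  \<open>sqrt_sum_spacing\<close>. The second term is free of \<open>R\<close>, so small powers of
  \<open>R\<close> for \<open>N\<close> and \<open>Z\<close> make it negligible.\<close>

lemma cos_sum_moment:
  "\<exists>C\<ge>0. \<forall>N\<ge>1. \<forall>Z\<ge>1. \<forall>R\<ge>0. integral {R..2 * R} (\<lambda>t. cos_sum N Z t ^ (2 * k))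
     \<le> C * R * (1 + ln N) ^ k + (real N * real Z) ^ (2 * k) * (1 + real (2 * k) * (real Z * sqrt N)) ^ (2 ^ (2 * k))"
proof -
  define K where "K = 2 * k"
  \<comment> \<open>One constant for the finitely many orders up to \<open>K\<close>.\<close>
  have "\<exists>D\<ge>0. \<forall>r. r \<ge> 2 \<longrightarrow> r \<le> K \<longrightarrow> (\<forall>N Z s. s \<ge> 1 \<longrightarrow> zero_moment (class_index N Z s) cweight cfreq r \<le> D / s)"
  proof (induction K)
    case 0
    then show ?case by auto
  next
    case (Suc K)
    then obtain D where D: "D \<ge> 0" "\<And>r N Z s. r \<ge> 2 \<Longrightarrow> r \<le> K \<Longrightarrow> s \<ge> 1 \<Longrightarrow> zero_moment (class_index N Z s) cweight cfreq r \<le> D / real s"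
      by blast
    show ?case
    proof (cases "Suc K \<ge> 2")
      case True
      then obtain D' where D': "D' \<ge> 0" "\<And>N Z s. s \<ge> 1 \<Longrightarrow> zero_moment (class_index N Z s) cweight cfreq (Suc K) \<le> D' / real s"
        using class_index_moment by blast
      show ?thesis
      proof (intro exI[of _ "D + D'"] conjI allI impI)
        fix r N Z s assume a: "2 \<le> r" "r \<le> Suc K" "1 \<le> (s::nat)"
        have "D / s \<le> (D + D') / s" "D' / s \<le> (D + D') / s" using D(1) D'(1) by (auto simp: divide_right_mono)
        then show "zero_moment (class_index N Z s) cweight cfreq r \<le> (D + D') / s"
          using D(2)[of r s N Z] D'(2)[of s N Z] a by (cases "r = Suc K") force+
      qed (use D D' in auto)
    qed (use D in \<open>auto intro!: exI[of _ D]\<close>)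
  qed
  then obtain D where D: "D \<ge> 0" "\<And>r N Z s. r \<ge> 2 \<Longrightarrow> r \<le> K \<Longrightarrow> s \<ge> 1 \<Longrightarrow> zero_moment (class_index N Z s) cweight cfreq r \<le> D / real s"
    by blast
  define C where "C = fact K * exp (K * D)"
  have "integral {R..2 * R} (\<lambda>t. cos_sum N Z t ^ K)
     \<le> C * R * (1 + ln N) ^ k + (real N * real Z) ^ K * (1 + real K * (real Z * sqrt N)) ^ (2 ^ K)"
    if N: "N \<ge> 1" and Z: "Z \<ge> 1" and R: "R \<ge> 0" for N Z and R :: real
  proof -
    define S J where "S = sqf_upto N" and "J = (\<Union>s\<in>S. class_index N Z s)"
    define L where "L = 1 + ln (real N)"
    \<comment> \<open>The sum of \<open>1 / s\<close> over \<open>S\<close> is at most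
      \<open>L\<close>, so this \<open>z\<close> keeps the exponent
      \<open>K * D * z^2 * (\<Sum>s\<in>S. 1 / s)\<close> bounded by \<open>K * D\<close>, while
      \<open>z^(-K) = L^k\<close> is the growth to be proved.\<close>
    define z where "z = 1 / sqrt L"
    have L1: "L \<ge> 1" using N by (simp add: L_def)
    have z: "0 < z" "z \<le> 1" "z\<^sup>2 = 1 / L" using L1 by (auto simp: z_def power_divide)
    have Sfin: "finite S" by (simp add: S_def sqf_upto_def)
    have gen: "(\<Sum>r\<le>K. zero_moment J cweight cfreq r / fact r * z ^ r) \<le> (\<Prod>s\<in>S. 1 + K * D * z\<^sup>2 / s)"
      unfolding J_def
    proof (rule zero_moment_generating[OF Sfin])
      show "squarefree s" if "s \<in> S" for s using that by (simp add: S_def sqf_upto_def)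
      show "finite (class_index N Z s)" for s by (rule finite_class_index)
      show "class_index N Z s \<inter> class_index N Z s' = {}" if "s \<noteq> s'" for s s' using that by (auto simp: class_index_def)
      show "0 \<le> cweight j" for j by (simp add: cweight_def case_prod_beta)
      show "\<exists>b::int. cfreq j = b * sqrt s" if jJ: "j \<in> class_index N Z s" for s j
      proof -
        obtain e a c where j: "j = (s, e, a, c)" "e = 1 \<or> e = -1" using jJ by (auto simp: class_index_def)
        show ?thesis using j(2)
        proof
          assume "e = 1"
          then show ?thesis by (intro exI[of _ "int (a * c)"]) (simp add: j cfreq_def)
        next
          assume "e = -1"
          then show ?thesis by (intro exI[of _ "- int (a * c)"]) (simp add: j cfreq_def)
        qed
      qed
      show "zero_moment (class_index N Z s) cweight cfreq 1 = 0" if "s \<in> S" for s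
        using that by (intro zero_moment_1) (auto simp: class_index_def cfreq_def S_def sqf_upto_def)
      show "zero_moment (class_index N Z s) cweight cfreq r \<le> D / s" if "s \<in> S" "2 \<le> r" "r \<le> K" for s r
        using that by (intro D) (auto simp: S_def sqf_upto_def)
    qed (use D z in auto)
    have nn: "zero_moment J cweight cfreq r \<ge> 0" for r
      by (intro zero_moment_nonneg) (simp add: cweight_def case_prod_beta)
    have "zero_moment J cweight cfreq K / fact K * z ^ K \<le> (\<Sum>r\<le>K. zero_moment J cweight cfreq r / fact r * z ^ r)"
      using z nn by (intro member_le_sum) auto
    also note gen
    also have "(\<Prod>s\<in>S. 1 + K * D * z\<^sup>2 / s) \<le> (\<Prod>s\<in>S. exp (K * D * z\<^sup>2 / s))"
      using D by (intro prod_mono) (auto simp: exp_ge_add_one_self add.commute)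
    also have "\<dots> = exp (K * D * z\<^sup>2 * (\<Sum>s\<in>S. 1 / s))"
      using Sfin by (simp add: exp_sum sum_distrib_left)
    also have "\<dots> \<le> exp (K * D)"
    proof -
      have "(\<Sum>s\<in>S. 1 / s) \<le> (\<Sum>s=1..N. 1 / real s)" by (intro sum_mono2) (auto simp: S_def sqf_upto_def)
      also have "\<dots> \<le> L" using sum_inverse_le_ln[OF N] by (simp add: L_def)
      finally have "z\<^sup>2 * (\<Sum>s\<in>S. 1 / s) \<le> 1" using L1 by (simp add: z(3) field_simps)
      then have "K * D * (z\<^sup>2 * (\<Sum>s\<in>S. 1 / s)) \<le> K * D * 1" using D by (intro mult_left_mono) auto
      then show ?thesis by (simp add: mult.assoc)
    qed
    finally have "zero_moment J cweight cfreq K * z ^ K \<le> C" by (simp add: C_def field_simps)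
    moreover have "z ^ K = 1 / L ^ k" by (simp add: K_def power_mult z(3) power_divide)
    ultimately have zm: "zero_moment J cweight cfreq K \<le> C * L ^ k" using L1 by (simp add: field_simps)
    define Q where "Q = real Z * sqrt N"
    have Q0: "Q \<ge> 0" by (simp add: Q_def)
    \<comment> \<open>Each frequency is, up to sign, the square root of an integer and at most
      \<open>Q\<close> in size, so this is the spacing that \<open>sqrt_sum_spacing\<close>
      guarantees for \<open>K\<close> of them.\<close>
    define \<delta> where "\<delta> = 1 / (1 + real K * Q) ^ (2 ^ K)"
    have base: "1 + real K * Q > 0" using Q0 by (intro add_pos_nonneg) auto
    have "integral {R..2 * R} (\<lambda>t. cos_sum N Z t ^ K) \<le> R * zero_moment J cweight cfreq K + (\<Sum>j\<in>J. cweight j) ^ K / \<delta>"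
    proof (rule integral_exp_sum_power_le[OF _ _ _ R])
      show "finite J" unfolding J_def using Sfin finite_class_index by auto
      show "cweight j \<ge> 0" for j by (simp add: cweight_def case_prod_beta)
      show "exp_sum J cweight cfreq t = of_real (cos_sum N Z t)" for t
        unfolding J_def S_def by (rule exp_sum_class_index)
      show "\<delta> > 0" using base by (simp add: \<delta>_def)
      fix \<phi> assume \<phi>: "\<phi> \<in> PiE {..<K} (\<lambda>_. J)" and nz: "(\<Sum>i<K. cfreq (\<phi> i)) \<noteq> 0"
      define e n where "e i = fst (snd (\<phi> i))" and "n i = fst (\<phi> i) * (fst (snd (snd (\<phi> i))) * snd (snd (snd (\<phi> i))))\<^sup>2" for i
      have mem: "\<phi> i \<in> J" if "i < K" for i using \<phi> that by (auto simp: PiE_iff)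
      have fr: "cfreq (\<phi> i) = e i * sqrt (n i)" "e i = 1 \<or> e i = -1" "sqrt (n i) \<le> Q" if "i < K" for i
      proof -
        obtain s x a c where j: "\<phi> i = (s, x, a, c)" by (metis prod.exhaust)
        have h: "x = 1 \<or> x = -1" "s * a\<^sup>2 \<le> N" "c \<le> Z" "c \<ge> 1"
          using mem[OF that] by (auto simp: J_def class_index_def j)
        show "e i = 1 \<or> e i = -1" using h by (simp add: e_def j)
        have sq: "sqrt (n i) = sqrt s * (a * c)" by (simp add: n_def j sqrt_mult_square mult_ac real_sqrt_mult)
        then show "cfreq (\<phi> i) = e i * sqrt (n i)" by (simp add: cfreq_def j e_def)
        have "sqrt (n i) = c * sqrt (real (s * a\<^sup>2))" unfolding sq sqrt_mult_square by simp
        also have "\<dots> \<le> real Z * sqrt N" using h by (intro mult_mono) (auto intro!: real_sqrt_le_mono simp flip: of_nat_power of_nat_mult)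
        finally show "sqrt (n i) \<le> Q" by (simp add: Q_def)
      qed
      have eq: "(\<Sum>i<K. cfreq (\<phi> i)) = (\<Sum>i<K. e i * sqrt (n i))" using fr by (intro sum.cong) auto
      have "1 \<le> \<bar>\<Sum>i<K. e i * sqrt (n i)\<bar> * (1 + real K * Q) ^ (2 ^ K)"
        using fr nz unfolding eq by (intro sqrt_sum_spacing) auto
      then show "\<delta> \<le> \<bar>\<Sum>i<K. cfreq (\<phi> i)\<bar>" unfolding eq \<delta>_def using base by (simp add: divide_le_eq)
    qed
    also have "(\<Sum>j\<in>J. cweight j) \<le> real N * real Z"
    proof -
      have "complex_of_real (\<Sum>j\<in>J. cweight j) = exp_sum J cweight cfreq 0" by (simp add: exp_sum_def)
      also have "\<dots> = of_real (cos_sum N Z 0)" unfolding J_def S_def by (rule exp_sum_class_index)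
      finally have "(\<Sum>j\<in>J. cweight j) = cos_sum N Z 0" by (simp only: of_real_eq_iff)
      also have "\<dots> \<le> (\<Sum>m=1..N. \<Sum>c=1..Z. 1)"
        unfolding cos_sum_def
      proof (intro sum_mono)
        fix m c assume "m \<in> {1..N}" "c \<in> {1..Z}"
        then have "1 * 1 \<le> real c * sqrt m" by (intro mult_mono) auto
        then show "cos (2 * pi * (c * sqrt m) * 0) / (c * sqrt m) \<le> 1" by (simp add: divide_le_eq_1)
      qed
      finally show ?thesis by simp
    qed
    then have "R * zero_moment J cweight cfreq K + (\<Sum>j\<in>J. cweight j) ^ K / \<delta>
      \<le> R * (C * L ^ k) + (real N * real Z) ^ K / \<delta>"
      using zm R base by (intro add_mono mult_left_mono divide_right_mono power_mono sum_nonneg)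
        (auto simp: cweight_def case_prod_beta \<delta>_def)
    finally show ?thesis by (simp add: L_def \<delta>_def Q_def mult_ac)
  qed
  moreover have "C \<ge> 0" by (simp add: C_def)
  ultimately show ?thesis unfolding K_def by blast
qed

section \<open>Poisson summation in dimension three\<close>

definition fejer :: "nat \<Rightarrow> real \<Rightarrow> real" where
  "fejer M y = (\<Sum>k\<in>{- int M..int M}. (1 - \<bar>real_of_int k\<bar> / M) * cos (2 * pi * k * y))"

lemma sum_int_symmetric_Suc:
  "(\<Sum>k\<in>{- int (Suc M)..int (Suc M)}. F k) = (\<Sum>k\<in>{- int M..int M}. F k) + F (int (Suc M)) + F (- int (Suc M))"
  for F :: "int \<Rightarrow> 'a::comm_monoid_add"
proof -
  have "{- int (Suc M)..int (Suc M)} = insert (int (Suc M)) (insert (- int (Suc M)) {- int M..int M})" by auto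
  then show ?thesis by (simp add: add_ac)
qed

lemma sum_differences:
  fixes F :: "int \<Rightarrow> complex"
  shows "(\<Sum>j<M. \<Sum>l<M. F (int j - int l)) = (\<Sum>k\<in>{- int M..int M}. of_int (int M - \<bar>k\<bar>) * F k)"
proof (induction M)
  case 0
  then show ?case by simp
next
  case (Suc M)
  have S: "(\<Sum>k\<in>{- int M..int M}. F k) = F 0 + (\<Sum>j<M. F (int j - int M)) + (\<Sum>l<M. F (int M - int l))"
  proof -
    have split: "{- int M..int M} = insert 0 ((\<lambda>j. int j - int M) ` {..<M} \<union> (\<lambda>l. int M - int l) ` {..<M})"
    proof (rule set_eqI, rule iffI)
      fix k assume k: "k \<in> {- int M..int M}"
      consider "k = 0" | "k < 0" | "k > 0" by linarith
      then show "k \<in> insert 0 ((\<lambda>j. int j - int M) ` {..<M} \<union> (\<lambda>l. int M - int l) ` {..<M})"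
      proof cases
        case 2
        then have "k = int (nat (k + int M)) - int M" "nat (k + int M) < M" using k by auto
        then show ?thesis by blast
      next
        case 3
        then have "k = int M - int (nat (int M - k))" "nat (int M - k) < M" using k by auto
        then show ?thesis by blast
      qed simp
    qed auto
    have "(\<Sum>k\<in>{- int M..int M}. F k) = F 0 + (\<Sum>k\<in>(\<lambda>j. int j - int M) ` {..<M} \<union> (\<lambda>l. int M - int l) ` {..<M}. F k)"
      unfolding split by (subst sum.insert) auto
    also have "(\<Sum>k\<in>(\<lambda>j. int j - int M) ` {..<M} \<union> (\<lambda>l. int M - int l) ` {..<M}. F k)
        = (\<Sum>k\<in>(\<lambda>j. int j - int M) ` {..<M}. F k) + (\<Sum>k\<in>(\<lambda>l. int M - int l) ` {..<M}. F k)"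
      by (intro sum.union_disjoint) auto
    also have "\<dots> = (\<Sum>j<M. F (int j - int M)) + (\<Sum>l<M. F (int M - int l))"
      by (simp add: sum.reindex inj_on_def)
    finally show ?thesis by (simp add: add.assoc)
  qed
  have "(\<Sum>j<Suc M. \<Sum>l<Suc M. F (int j - int l)) = (\<Sum>j<M. \<Sum>l<M. F (int j - int l))
      + (F 0 + (\<Sum>j<M. F (int j - int M)) + (\<Sum>l<M. F (int M - int l)))"
    by (simp add: sum.distrib add_ac)
  also have "\<dots> = (\<Sum>k\<in>{- int M..int M}. of_int (int M - \<bar>k\<bar>) * F k) + (\<Sum>k\<in>{- int M..int M}. F k)"
    by (simp only: Suc.IH S)
  also have "\<dots> = (\<Sum>k\<in>{- int M..int M}. of_int (int (Suc M) - \<bar>k\<bar>) * F k)"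
    by (simp flip: sum.distrib add: algebra_simps)
  also have "\<dots> = (\<Sum>k\<in>{- int (Suc M)..int (Suc M)}. of_int (int (Suc M) - \<bar>k\<bar>) * F k)"
    by (subst sum_int_symmetric_Suc) simp
  finally show ?case .
qed

text \<open>Expanding the squared modulus, the difference \<open>k\<close> of two indices occurs
  \<open>M - \<bar>k\<bar>\<close> times. This form shows that the kernel is nonnegative.\<close>

lemma fejer_complex:
  assumes "M \<ge> 1"
  shows "(\<Sum>k\<in>{- int M..int M}. of_real (1 - \<bar>real_of_int k\<bar> / M) * cis (2 * pi * k * y))
      = of_real ((cmod (\<Sum>j<M. cis (2 * pi * real j * y)))\<^sup>2 / M)"
proof -
  define z where "z = (\<Sum>j<M. cis (2 * pi * real j * y))"
  have "of_real ((cmod z)\<^sup>2) = z * cnj z" by (rule complex_norm_square)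
  also have "\<dots> = (\<Sum>j<M. \<Sum>l<M. cis (2 * pi * (int j - int l) * y))"
    by (simp add: z_def sum_product cis_cnj cis_mult algebra_simps)
  also have "\<dots> = (\<Sum>k\<in>{- int M..int M}. of_int (int M - \<bar>k\<bar>) * cis (2 * pi * k * y))"
    using sum_differences[of "\<lambda>k. cis (2 * pi * k * y)" M] by simp
  finally have "of_real ((cmod z)\<^sup>2 / M) = (\<Sum>k\<in>{- int M..int M}. of_int (int M - \<bar>k\<bar>) * cis (2 * pi * k * y)) / of_nat M"
    by simp
  also have "\<dots> = (\<Sum>k\<in>{- int M..int M}. of_real (1 - \<bar>real_of_int k\<bar> / M) * cis (2 * pi * k * y))"
    unfolding sum_divide_distrib
  proof (intro sum.cong refl)
    fix k
    have "real_of_int (int M - \<bar>k\<bar>) / M = 1 - \<bar>real_of_int k\<bar> / M" using assms by (simp add: diff_divide_distrib)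
    then have "complex_of_real (real_of_int (int M - \<bar>k\<bar>) / M) = of_real (1 - \<bar>real_of_int k\<bar> / M)" by (simp only:)
    moreover have "complex_of_real (real_of_int (int M - \<bar>k\<bar>) / M) = of_int (int M - \<bar>k\<bar>) / of_nat M"
      by (simp only: of_real_divide of_real_of_int_eq of_real_of_nat_eq)
    ultimately show "of_int (int M - \<bar>k\<bar>) * cis (2 * pi * k * y) / of_nat M = of_real (1 - \<bar>real_of_int k\<bar> / M) * cis (2 * pi * k * y)"
      by (metis times_divide_eq_left)
  qed
  finally show ?thesis by (simp add: z_def)
qed

lemma fejer_eq:
  assumes "M \<ge> 1"
  shows "fejer M y = (cmod (\<Sum>j<M. cis (2 * pi * real j * y)))\<^sup>2 / M"
  using arg_cong[OF fejer_complex[OF assms, of y], of Re] by (simp add: fejer_def)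

lemma fejer_nonneg: "M \<ge> 1 \<Longrightarrow> fejer M y \<ge> 0"
  by (simp add: fejer_eq)

lemma continuous_fejer [continuous_intros]:
  fixes f :: "'a::t2_space \<Rightarrow> real"
  shows "continuous_on A f \<Longrightarrow> continuous_on A (\<lambda>x. fejer M (f x))"
  unfolding fejer_def by (intro continuous_intros)

lemma abs_sin_ge_half:
  fixes x :: real
  assumes "x\<^sup>2 \<le> 3"
  shows "\<bar>x\<bar> / 2 \<le> \<bar>sin x\<bar>"
proof -
  have "\<bar>sin x - (\<Sum>m<3. sin_coeff m * x ^ m)\<bar> \<le> inverse (fact 3) * \<bar>x\<bar> ^ 3"
    by (rule Maclaurin_sin_bound)
  then have "\<bar>sin x - x\<bar> \<le> \<bar>x\<bar> ^ 3 / 6"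
    by (simp add: sin_coeff_def lessThan_nat_numeral fact_numeral numeral_3_eq_3)
  also have "\<bar>x\<bar> ^ 3 = \<bar>x\<bar> * x\<^sup>2" by (simp add: power3_eq_cube power2_eq_square)
  also have "\<bar>x\<bar> * x\<^sup>2 / 6 \<le> \<bar>x\<bar> * 3 / 6" using assms by (intro divide_right_mono mult_left_mono) auto
  finally show ?thesis by linarith
qed

text \<open>The geometric sum satisfies \<open>cmod (z - 1) * cmod S \<le> 2\<close>, and
  \<open>cmod (z - 1) = 2 * \<bar>sin (pi * (y - n))\<bar>\<close> is at least
  \<open>2 * \<bar>y - n\<bar>\<close> within half a period of \<open>n\<close>.\<close>

lemma fejer_bound:
  assumes "M \<ge> 1" "\<bar>y - real_of_int n\<bar> \<le> 1/2"
  shows "(y - n)\<^sup>2 * fejer M y \<le> 1 / M"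
proof -
  define z where "z = cis (2 * pi * y)"
  define S where "S = (\<Sum>j<M. cis (2 * pi * real j * y))"
  have "S = (\<Sum>j<M. z ^ j)" by (simp add: S_def z_def Complex.DeMoivre mult_ac)
  then have "(z - 1) * S = z ^ M - 1" by (simp add: power_diff_1_eq)
  then have "cmod (z - 1) * cmod S = cmod (z ^ M - 1)" by (metis norm_mult)
  also have "\<dots> \<le> cmod (z ^ M) + cmod 1" by (rule norm_triangle_ineq4)
  also have "\<dots> = 2" by (simp add: z_def norm_power)
  finally have zS: "cmod (z - 1) * cmod S \<le> 2" .
  have "(cmod (z - 1))\<^sup>2 = (cos (2 * pi * y) - 1)\<^sup>2 + (sin (2 * pi * y))\<^sup>2"
    by (simp add: z_def cmod_power2)
  also have "\<dots> = 2 - 2 * cos (2 * pi * y)"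
    using sin_cos_squared_add[of "2 * pi * y"] by (simp add: power2_diff)
  also have "cos (2 * pi * y) = cos (2 * (pi * (y - n)))"
  proof -
    have "cos (2 * (pi * (y - n))) = cos (2 * pi * y - 2 * pi * n)" by (simp add: algebra_simps)
    also have "\<dots> = cos (2 * pi * y)" by (simp add: cos_diff)
    finally show ?thesis by simp
  qed
  also have "2 - 2 * cos (2 * (pi * (y - n))) = (2 * sin (pi * (y - n)))\<^sup>2"
    by (simp add: cos_double_sin power_mult_distrib)
  finally have zm: "cmod (z - 1) = 2 * \<bar>sin (pi * (y - n))\<bar>"
    by (metis abs_mult abs_numeral norm_ge_zero abs_of_nonneg power2_eq_iff_nonneg abs_ge_zero power2_abs)
  \<comment> \<open>The argument is at most \<open>3.2 / 2 = 1.6\<close>, whose square is below 3;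
    \<open>abs_sin_ge_half\<close> then plays the part of Jordan's inequality.\<close>
  have "(pi * (y - n))\<^sup>2 \<le> 3"
  proof -
    have "\<bar>pi * (y - n)\<bar> \<le> 3.2 * (1/2)"
      unfolding abs_mult using assms pi_less_4 pi_approx by (intro mult_mono) auto
    then have "\<bar>pi * (y - n)\<bar>\<^sup>2 \<le> (3.2 * (1/2))\<^sup>2" by (intro power_mono) auto
    then show ?thesis by (simp add: power2_eq_square)
  qed
  then have "\<bar>pi * (y - n)\<bar> / 2 \<le> \<bar>sin (pi * (y - n))\<bar>" by (rule abs_sin_ge_half)
  then have "pi * \<bar>y - n\<bar> \<le> cmod (z - 1)" unfolding zm by (simp add: abs_mult)
  then have "2 * \<bar>y - n\<bar> \<le> cmod (z - 1)"
    using pi_ge_two mult_right_mono[of 2 pi "\<bar>y - n\<bar>"] by linarith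
  then have "2 * \<bar>y - n\<bar> * cmod S \<le> cmod (z - 1) * cmod S" by (intro mult_right_mono) auto
  then have "\<bar>y - n\<bar> * cmod S \<le> 1" using zS by simp
  then have "(\<bar>y - n\<bar> * cmod S)\<^sup>2 \<le> 1\<^sup>2" by (intro power_mono) auto
  then have "(y - n)\<^sup>2 * (cmod S)\<^sup>2 \<le> 1" by (simp add: power_mult_distrib)
  then have "((y - n)\<^sup>2 * (cmod S)\<^sup>2) / M \<le> 1 / M" by (intro divide_right_mono) auto
  moreover have "(y - n)\<^sup>2 * fejer M y = ((y - n)\<^sup>2 * (cmod S)\<^sup>2) / M"
    unfolding fejer_eq[OF assms(1)] S_def by simp
  ultimately show ?thesis by simp
qed

lemma integral_cos_period:
  fixes k :: int
  shows "integral {a..a + 1} (\<lambda>y. cos (2 * pi * k * y)) = (if k = 0 then 1 else 0)"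
proof (cases "k = 0")
  case False
  define F where "F y = sin (2 * pi * k * y) / (2 * pi * k)" for y
  have "((\<lambda>y. cos (2 * pi * k * y)) has_integral (F (a + 1) - F a)) {a..a + 1}"
  proof (rule fundamental_theorem_of_calculus)
    fix y
    have "(F has_real_derivative cos (2 * pi * k * y)) (at y within {a..a + 1})"
      unfolding F_def using False by (auto intro!: derivative_eq_intros)
    then show "(F has_vector_derivative cos (2 * pi * k * y)) (at y within {a..a + 1})"
      by (simp add: has_real_derivative_iff_has_vector_derivative)
  qed simp
  moreover have "F (a + 1) = F a"
  proof -
    have "sin (2 * pi * k * (a + 1)) = sin (2 * pi * k * a + 2 * pi * k)" by (simp add: algebra_simps)
    also have "\<dots> = sin (2 * pi * k * a)" by (simp add: sin_add)
    finally show ?thesis by (simp add: F_def)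
  qed
  ultimately show ?thesis using False by (simp add: integral_unique)
qed simp

lemma integral_fejer:
  assumes "M \<ge> 1"
  shows "integral {a..a + 1} (fejer M) = 1"
proof -
  have "integral {a..a + 1} (fejer M) = (\<Sum>k\<in>{- int M..int M}. integral {a..a + 1} (\<lambda>y. (1 - \<bar>real_of_int k\<bar> / M) * cos (2 * pi * k * y)))"
    unfolding fejer_def by (intro integral_sum integrable_continuous_interval continuous_intros) auto
  also have "\<dots> = (\<Sum>k\<in>{- int M..int M}. (1 - \<bar>real_of_int k\<bar> / M) * (if k = 0 then 1 else 0))"
    by (simp only: integral_mult_right integral_cos_period)
  also have "\<dots> = (\<Sum>k\<in>{- int M..int M}. if k = 0 then 1 else 0)" by (intro sum.cong) auto
  also have "\<dots> = 1" by simp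
  finally show ?thesis .
qed

lemma fejer_integrable:
  fixes g :: "real \<Rightarrow> real"
  assumes "continuous_on {a..b} g"
  shows "(\<lambda>y. fejer M y * g y) integrable_on {a..b}"
  using assms by (intro integrable_continuous_interval continuous_intros)

text \<open>The kernel has mass 1 on the period, and \<open>(y - n)^2\<close> times the kernel is at
  most \<open>1 / M\<close>; so it samples a Lipschitz function at \<open>n\<close> with error
  \<open>O(L / sqrt M)\<close>.\<close>

lemma fejer_approx_unit:
  fixes n :: int and g :: "real \<Rightarrow> real" and L :: real
  assumes M: "M \<ge> 1" and g: "continuous_on {n - 1/2..n + 1/2} g"
    and lip: "\<And>y :: real. y \<in> {n - 1/2..n + 1/2} \<Longrightarrow> \<bar>g y - g n\<bar> \<le> L * \<bar>y - n\<bar>" and L: "L \<ge> 0"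
  shows "\<bar>integral {n - 1/2..n + 1/2} (\<lambda>y. fejer M y * g y) - g n\<bar> \<le> 2 * L / sqrt M"
proof -
  define I where "I = {n - 1/2..n + 1/2 :: real}"
  have eqI: "I = {n - 1/2..(n - 1/2) + 1}" by (simp add: I_def)
  have f1: "integral I (fejer M) = 1" unfolding eqI by (rule integral_fejer[OF M])
  have fint: "fejer M integrable_on I" using fejer_integrable[of "n - 1/2" "n + 1/2" "\<lambda>_. 1" M] by (simp add: I_def)
  have gint: "(\<lambda>y. fejer M y * g y) integrable_on I" using fejer_integrable[OF g] by (simp add: I_def)
  have cint: "(\<lambda>y. fejer M y * g n) integrable_on I"
    unfolding I_def by (intro fejer_integrable continuous_intros)
  have sM: "sqrt M > 0" "sqrt M * sqrt M = M" using M by auto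
  have "integral I (\<lambda>y. fejer M y * g y) - g n = integral I (\<lambda>y. fejer M y * g y) - integral I (\<lambda>y. fejer M y * g n)"
    by (simp add: f1)
  also have "\<dots> = integral I (\<lambda>y. fejer M y * g y - fejer M y * g n)"
    by (rule integral_diff[OF gint cint, symmetric])
  finally have "\<bar>integral I (\<lambda>y. fejer M y * g y) - g n\<bar> = norm (integral I (\<lambda>y. fejer M y * g y - fejer M y * g n))" by simp
  also have "\<dots> \<le> integral I (\<lambda>y. (L / sqrt M) * fejer M y + L * sqrt M * (1 / M))"
  proof (rule integral_norm_bound_integral)
    show "(\<lambda>y. fejer M y * g y - fejer M y * g n) integrable_on I" by (rule integrable_diff[OF gint cint])
    show "(\<lambda>y. (L / sqrt M) * fejer M y + L * sqrt M * (1 / M)) integrable_on I"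
      unfolding I_def by (intro integrable_continuous_interval continuous_intros)
    fix y assume y: "y \<in> I"
    \<comment> \<open>Arithmetic-geometric mean inequality: it trades the first power of the
      distance, for which no kernel bound is at hand, for a constant and a square.\<close>
    have "\<bar>y - n\<bar> \<le> 1 / sqrt M + sqrt M * (y - n)\<^sup>2"
    proof -
      have "0 \<le> (sqrt M * \<bar>y - n\<bar> - 1)\<^sup>2" by simp
      then have "2 * (sqrt M * \<bar>y - n\<bar>) \<le> M * (y - n)\<^sup>2 + 1"
        by (simp add: power2_diff power_mult_distrib)
      moreover have "0 \<le> sqrt M * \<bar>y - n\<bar>" by simp
      ultimately have "sqrt M * \<bar>y - n\<bar> \<le> M * (y - n)\<^sup>2 + 1" by linarith
      also have "\<dots> = sqrt M * (1 / sqrt M + sqrt M * (y - n)\<^sup>2)" using sM by (simp add: distrib_left)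
      finally show ?thesis using sM by simp
    qed
    then have "L * \<bar>y - n\<bar> \<le> L * (1 / sqrt M + sqrt M * (y - n)\<^sup>2)" using L by (intro mult_left_mono)
    then have "\<bar>g y - g n\<bar> \<le> L * (1 / sqrt M + sqrt M * (y - n)\<^sup>2)" using lip[of y] y by (auto simp: I_def)
    then have "fejer M y * \<bar>g y - g n\<bar> \<le> fejer M y * (L * (1 / sqrt M + sqrt M * (y - n)\<^sup>2))"
      using fejer_nonneg[OF M] by (intro mult_left_mono)
    also have "\<dots> = (L / sqrt M) * fejer M y + L * sqrt M * ((y - n)\<^sup>2 * fejer M y)" by (simp add: algebra_simps)
    also have "\<dots> \<le> (L / sqrt M) * fejer M y + L * sqrt M * (1 / M)"
    proof -
      have "\<bar>y - n\<bar> \<le> 1/2" using y unfolding I_def atLeastAtMost_iff abs_le_iff by linarith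
      then show ?thesis using L by (intro add_left_mono mult_left_mono fejer_bound[OF M]) auto
    qed
    finally show "norm (fejer M y * g y - fejer M y * g n) \<le> (L / sqrt M) * fejer M y + L * sqrt M * (1 / M)"
      using fejer_nonneg[OF M, of y] by (simp add: abs_mult flip: right_diff_distrib)
  qed
  also have "\<dots> = L / sqrt M + L * sqrt M * (1 / M)"
  proof -
    have "(\<lambda>y. (L / sqrt M) * fejer M y) integrable_on I" "(\<lambda>y. L * sqrt M * (1 / M)) integrable_on I"
      unfolding I_def by (intro integrable_continuous_interval continuous_intros)+
    then have "integral I (\<lambda>y. (L / sqrt M) * fejer M y + L * sqrt M * (1 / M))
      = integral I (\<lambda>y. (L / sqrt M) * fejer M y) + integral I (\<lambda>y. L * sqrt M * (1 / M))"
      by (rule integral_add)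
    also have "integral I (\<lambda>y. (L / sqrt M) * fejer M y) = L / sqrt M"
      by (simp only: integral_mult_right f1)
    also have "integral I (\<lambda>y. L * sqrt M * (1 / M)) = L * sqrt M * (1 / M)" by (simp add: I_def)
    finally show ?thesis .
  qed
  also have "\<dots> = 2 * L / sqrt M" using sM by (simp add: field_simps)
  finally show ?thesis by (simp add: I_def)
qed

lemma integral_split_unit:
  fixes f :: "real \<Rightarrow> real"
  assumes "continuous_on UNIV f"
  shows "integral {- (B + 1/2)..real B + 1/2} f = (\<Sum>n\<in>{- int B..int B}. integral {n - 1/2..n + 1/2} f)"
proof (induction B)
  case (Suc B)
  have int: "f integrable_on {a..b}" for a b
    by (intro integrable_continuous_interval continuous_on_subset[OF assms]) auto
  have "integral {- (Suc B + 1/2)..real (Suc B) + 1/2} f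
    = integral {- (Suc B + 1/2)..- (B + 1/2)} f + integral {- (B + 1/2)..real (Suc B) + 1/2} f"
    by (intro Henstock_Kurzweil_Integration.integral_combine[symmetric] int) auto
  also have "integral {- (B + 1/2)..real (Suc B) + 1/2} f
    = integral {- (B + 1/2)..real B + 1/2} f + integral {real B + 1/2..real (Suc B) + 1/2} f"
    by (intro Henstock_Kurzweil_Integration.integral_combine[symmetric] int) auto
  also have "{- (Suc B + 1/2)..- (B + 1/2)} = {real_of_int (- int (Suc B)) - 1/2..real_of_int (- int (Suc B)) + 1/2}" by auto
  also have "{real B + 1/2..real (Suc B) + 1/2} = {real_of_int (int (Suc B)) - 1/2..real_of_int (int (Suc B)) + 1/2}" by auto
  finally show ?case unfolding Suc.IH sum_int_symmetric_Suc by simp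
qed simp

text \<open>The interval consists of \<open>2 * B + 1\<close> periods centred at
  \<open>-B, ..., B\<close>, so for large \<open>M\<close> the operator approaches the sum of
  \<open>g\<close> over these integers.\<close>

definition fejer_op :: "nat \<Rightarrow> nat \<Rightarrow> (real \<Rightarrow> real) \<Rightarrow> real" where
  "fejer_op M B g = integral {- (B + 1/2)..real B + 1/2} (\<lambda>y. fejer M y * g y)"

lemma fejer_op_approx:
  fixes g :: "real \<Rightarrow> real"
  assumes M: "M \<ge> 1" and g: "continuous_on UNIV g" and lip: "\<And>x y. \<bar>g x - g y\<bar> \<le> L * \<bar>x - y\<bar>" and L: "L \<ge> 0"
  shows "\<bar>fejer_op M B g - (\<Sum>n\<in>{- int B..int B}. g n)\<bar> \<le> (2 * B + 1) * (2 * L / sqrt M)"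
proof -
  have "fejer_op M B g = (\<Sum>n\<in>{- int B..int B}. integral {n - 1/2..n + 1/2} (\<lambda>y. fejer M y * g y))"
    unfolding fejer_op_def by (intro integral_split_unit continuous_intros g)
  then have "\<bar>fejer_op M B g - (\<Sum>n\<in>{- int B..int B}. g n)\<bar>
      = \<bar>\<Sum>n\<in>{- int B..int B}. integral {n - 1/2..n + 1/2} (\<lambda>y. fejer M y * g y) - g n\<bar>" by (simp add: sum_subtractf)
  also have "\<dots> \<le> (\<Sum>n\<in>{- int B..int B}. \<bar>integral {n - 1/2..n + 1/2} (\<lambda>y. fejer M y * g y) - g n\<bar>)" by (rule sum_abs)
  also have "\<dots> \<le> (\<Sum>n\<in>{- int B..int B}. 2 * L / sqrt M)"
  proof (rule sum_mono)
    fix n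
    show "\<bar>integral {real_of_int n - 1/2..real_of_int n + 1/2} (\<lambda>y. fejer M y * g y) - g n\<bar> \<le> 2 * L / sqrt M"
      by (rule fejer_approx_unit[OF M _ _ L]) (auto intro: lip continuous_on_subset[OF g])
  qed
  also have "\<dots> = (2 * real B + 1) * (2 * L / sqrt M)" by (simp add: nat_add_distrib)
  finally show ?thesis .
qed

lemma fejer_op_diff_le:
  fixes g h :: "real \<Rightarrow> real"
  assumes M: "M \<ge> 1" and g: "continuous_on UNIV g" "continuous_on UNIV h" and le: "\<And>y. \<bar>g y - h y\<bar> \<le> e"
  shows "\<bar>fejer_op M B g - fejer_op M B h\<bar> \<le> (2 * B + 1) * e"
proof -
  define I where "I = {- (B + 1/2)..real B + 1/2}"
  have int: "(\<lambda>y. fejer M y * f y) integrable_on I" if "continuous_on UNIV f" for f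
    unfolding I_def by (intro fejer_integrable continuous_on_subset[OF that]) auto
  have f1: "integral I (fejer M) = 2 * B + 1"
  proof -
    have "integral I (fejer M) = (\<Sum>n\<in>{- int B..int B}. integral {n - 1/2..n + 1/2} (fejer M))"
      unfolding I_def by (intro integral_split_unit) (simp add: continuous_fejer continuous_on_id)
    also have "\<dots> = (\<Sum>n\<in>{- int B..int B}. 1)"
    proof (intro sum.cong refl)
      fix n
      have "{real_of_int n - 1/2..real_of_int n + 1/2} = {(n - 1/2)..(n - 1/2) + 1}" by simp
      then show "integral {real_of_int n - 1/2..real_of_int n + 1/2} (fejer M) = 1"
        by (simp only: integral_fejer[OF M])
    qed
    finally show ?thesis by (simp add: nat_add_distrib)
  qed
  have "\<bar>fejer_op M B g - fejer_op M B h\<bar> = norm (integral I (\<lambda>y. fejer M y * g y - fejer M y * h y))"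
    unfolding fejer_op_def I_def[symmetric] using int g by (simp add: integral_diff)
  also have "\<dots> \<le> integral I (\<lambda>y. fejer M y * e)"
  proof (rule integral_norm_bound_integral)
    show "(\<lambda>y. fejer M y * g y - fejer M y * h y) integrable_on I" using int g by (intro integrable_diff)
    show "(\<lambda>y. fejer M y * e) integrable_on I" by (intro int continuous_intros)
    fix y
    have "fejer M y * \<bar>g y - h y\<bar> \<le> fejer M y * e" using le fejer_nonneg[OF M] by (intro mult_left_mono)
    then show "norm (fejer M y * g y - fejer M y * h y) \<le> fejer M y * e"
      using fejer_nonneg[OF M, of y] by (simp add: abs_mult flip: right_diff_distrib)
  qed
  also have "\<dots> = (2 * real B + 1) * e" by (simp add: f1)
  finally show ?thesis .
qed

section \<open>Fejer summation in three variables\<close>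

definition box3 :: "nat \<Rightarrow> (real \<times> real \<times> real) set" where
  "box3 B = cbox (- (B + 1/2), - (B + 1/2), - (B + 1/2)) (B + 1/2, B + 1/2, B + 1/2)"

definition emb3 :: "int \<times> int \<times> int \<Rightarrow> real \<times> real \<times> real" where
  "emb3 v = (real_of_int (fst v), real_of_int (fst (snd v)), real_of_int (snd (snd v)))"

definition dot3 :: "int \<times> int \<times> int \<Rightarrow> real \<times> real \<times> real \<Rightarrow> real" where
  "dot3 k u = fst k * fst u + fst (snd k) * fst (snd u) + snd (snd k) * snd (snd u)"

text \<open>Only the cosine part is kept: the product of three Fejer kernels has symmetric
  coefficients and is a pure cosine sum.\<close>

definition fhat3 :: "nat \<Rightarrow> (real \<times> real \<times> real \<Rightarrow> real) \<Rightarrow> int \<times> int \<times> int \<Rightarrow> real" where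
  "fhat3 B f k = integral (box3 B) (\<lambda>u. f u * cos (2 * pi * dot3 k u))"

definition cube3 :: "nat \<Rightarrow> (int \<times> int \<times> int) set" where
  "cube3 B = {- int B..int B} \<times> {- int B..int B} \<times> {- int B..int B}"

definition fejer_weight :: "nat \<Rightarrow> int \<times> int \<times> int \<Rightarrow> real" where
  "fejer_weight M k = (1 - \<bar>real_of_int (fst k)\<bar> / M) * ((1 - \<bar>real_of_int (fst (snd k))\<bar> / M) * (1 - \<bar>real_of_int (snd (snd k))\<bar> / M))"

lemma fejer_product:
  assumes "M \<ge> 1"
  shows "fejer M x * (fejer M y * fejer M z) = (\<Sum>k\<in>cube3 M. fejer_weight M k * cos (2 * pi * dot3 k (x, y, z)))"
proof -
  have c: "complex_of_real (fejer M y) = (\<Sum>k\<in>{- int M..int M}. of_real (1 - \<bar>real_of_int k\<bar> / M) * cis (2 * pi * k * y))" for y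
    unfolding fejer_eq[OF assms] by (rule fejer_complex[OF assms, symmetric])
  have prod3: "(\<Sum>a\<in>I. A a) * ((\<Sum>b\<in>I. B b) * (\<Sum>d\<in>I. C d)) = (\<Sum>a\<in>I. \<Sum>b\<in>I. \<Sum>d\<in>I. A a * (B b * C d))"
    for A B C :: "int \<Rightarrow> complex" and I
    unfolding sum_product[of B I C I] unfolding sum_distrib_right[of A] unfolding sum_distrib_left ..
  have "complex_of_real (fejer M x * (fejer M y * fejer M z)) = (\<Sum>k\<in>cube3 M. of_real (fejer_weight M k) * cis (2 * pi * dot3 k (x, y, z)))"
    unfolding of_real_mult c prod3 cube3_def sum.cartesian_product'
  proof (intro sum.cong refl)
    fix a b d :: int
    have 1: "cis (2 * pi * a * x) * (cis (2 * pi * b * y) * cis (2 * pi * d * z)) = cis (2 * pi * dot3 (a, b, d) (x, y, z))"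
      by (simp add: cis_mult dot3_def distrib_left add.assoc mult.assoc)
    have 2: "complex_of_real (fejer_weight M (a, b, d)) = of_real (1 - \<bar>real_of_int a\<bar> / M) * (of_real (1 - \<bar>real_of_int b\<bar> / M) * of_real (1 - \<bar>real_of_int d\<bar> / M))"
      by (simp only: fejer_weight_def fst_conv snd_conv of_real_mult)
    show "complex_of_real (1 - \<bar>real_of_int a\<bar> / M) * cis (2 * pi * a * x) *
         (complex_of_real (1 - \<bar>real_of_int b\<bar> / M) * cis (2 * pi * b * y) * (complex_of_real (1 - \<bar>real_of_int d\<bar> / M) * cis (2 * pi * d * z)))
      = complex_of_real (fejer_weight M (a, b, d)) * cis (2 * pi * dot3 (a, b, d) (x, y, z))"
      unfolding 1[symmetric] 2 by (simp only: mult_ac)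
  qed
  from arg_cong[OF this, of Re] show ?thesis by simp
qed

lemma continuous_of_lipschitz:
  fixes g :: "real \<Rightarrow> real"
  assumes "\<And>x y. \<bar>g x - g y\<bar> \<le> L * \<bar>x - y\<bar>" "L \<ge> 0"
  shows "continuous_on UNIV g"
  by (rule lipschitz_on_continuous_on[of L]) (use assms in \<open>auto simp: lipschitz_on_def dist_real_def\<close>)

lemma fejer_op_lipschitz:
  fixes g :: "real \<Rightarrow> real \<Rightarrow> real"
  assumes M: "M \<ge> 1" and "\<And>x z z'. \<bar>g x z - g x z'\<bar> \<le> L * \<bar>z - z'\<bar>" "\<And>x x' z. \<bar>g x z - g x' z\<bar> \<le> L' * \<bar>x - x'\<bar>" "L \<ge> 0"
  shows "\<bar>fejer_op M B (g x) - fejer_op M B (g x')\<bar> \<le> ((2 * B + 1) * L') * \<bar>x - x'\<bar>"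
  using fejer_op_diff_le[OF M, of "g x" "g x'" "L' * \<bar>x - x'\<bar>" B] assms continuous_of_lipschitz[of "g x" L for x]
  by (simp add: mult.assoc)

text \<open>The one-variable operator is applied coordinate by coordinate. Each application keeps
  the result Lipschitz in the remaining variables and costs a factor \<open>n = 2 * B + 1\<close>,
  so each of the three steps loses at most \<open>n^3 * e\<close>. On the other side, expanding the
  product of the kernels produces the weighted Fourier coefficients over the box.\<close>

lemma poisson_fejer:
  fixes f :: "real \<times> real \<times> real \<Rightarrow> real"
  assumes M: "M \<ge> 1" and lip: "\<And>u v. \<bar>f u - f v\<bar> \<le> L * dist u v" and L: "L \<ge> 0"
  shows "\<bar>(\<Sum>k\<in>cube3 M. fejer_weight M k * fhat3 B f k) - (\<Sum>v\<in>cube3 B. f (emb3 v))\<bar>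
      \<le> 3 * (2 * B + 1) ^ 3 * (2 * L / sqrt M)"
proof -
  define b where "b = real B + 1/2"
  define n where "n = 2 * real B + 1"
  define e where "e = 2 * L / sqrt M"
  have n0: "n \<ge> 0" and e0: "e \<ge> 0" using L by (auto simp: n_def e_def)
  have lx: "\<bar>f (x, y, z) - f (x', y, z)\<bar> \<le> L * \<bar>x - x'\<bar>" for x x' y z
    using lip[of "(x, y, z)" "(x', y, z)"] by (simp add: dist_prod_def dist_real_def)
  have ly: "\<bar>f (x, y, z) - f (x, y', z)\<bar> \<le> L * \<bar>y - y'\<bar>" for x y y' z
    using lip[of "(x, y, z)" "(x, y', z)"] by (simp add: dist_prod_def dist_real_def)
  have lz: "\<bar>f (x, y, z) - f (x, y, z')\<bar> \<le> L * \<bar>z - z'\<bar>" for x y z z'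
    using lip[of "(x, y, z)" "(x, y, z')"] by (simp add: dist_prod_def dist_real_def)
  have fc: "continuous_on UNIV f"
    by (rule lipschitz_on_continuous_on[of L]) (use lip L in \<open>auto simp: lipschitz_on_def dist_real_def\<close>)
  define h1 where "h1 x y = fejer_op M B (\<lambda>z. f (x, y, z))" for x y
  define h2 where "h2 x = fejer_op M B (h1 x)" for x
  have h1y: "\<bar>h1 x y - h1 x y'\<bar> \<le> (n * L) * \<bar>y - y'\<bar>" for x y y'
    unfolding h1_def n_def by (rule fejer_op_lipschitz[OF M lz ly L])
  have h1x: "\<bar>h1 x y - h1 x' y\<bar> \<le> (n * L) * \<bar>x - x'\<bar>" for x x' y
    unfolding h1_def n_def by (rule fejer_op_lipschitz[OF M lz lx L])
  have nL: "n * L \<ge> 0" using n0 L by simp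
  have h2x: "\<bar>h2 x - h2 x'\<bar> \<le> (n * (n * L)) * \<bar>x - x'\<bar>" for x x'
    unfolding h2_def using fejer_op_lipschitz[OF M h1y h1x nL, of B x x'] by (simp add: n_def)
  let ?I = "{- int B..int B}"
  have cardI: "real (card ?I) = n" by (simp add: n_def nat_add_distrib)
  have a1: "\<bar>h1 x y - (\<Sum>c\<in>?I. f (x, y, real_of_int c))\<bar> \<le> n * e" for x y
    unfolding h1_def n_def e_def by (rule fejer_op_approx[OF M continuous_of_lipschitz[OF lz L] lz L])
  have s1: "\<bar>(\<Sum>c\<in>?I. f (x, y, real_of_int c)) - (\<Sum>c\<in>?I. f (x, y', real_of_int c))\<bar> \<le> (n * L) * \<bar>y - y'\<bar>" for x y y'
  proof -
    have "\<bar>(\<Sum>c\<in>?I. f (x, y, real_of_int c)) - (\<Sum>c\<in>?I. f (x, y', real_of_int c))\<bar> \<le> (\<Sum>c\<in>?I. L * \<bar>y - y'\<bar>)"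
      unfolding sum_subtractf[symmetric] by (rule order_trans[OF sum_abs sum_mono[OF ly]])
    then show ?thesis by (simp only: sum_constant cardI mult.assoc)
  qed
  have a2: "\<bar>h2 x - (\<Sum>d\<in>?I. \<Sum>c\<in>?I. f (x, real_of_int d, real_of_int c))\<bar> \<le> 2 * (n * (n * e))" for x
  proof -
    have "\<bar>h2 x - fejer_op M B (\<lambda>y. \<Sum>c\<in>?I. f (x, y, real_of_int c))\<bar> \<le> n * (n * e)"
      unfolding h2_def using fejer_op_diff_le[OF M continuous_of_lipschitz[OF h1y nL] continuous_of_lipschitz[OF s1 nL] a1]
      by (simp add: n_def)
    moreover have "\<bar>fejer_op M B (\<lambda>y. \<Sum>c\<in>?I. f (x, y, real_of_int c)) - (\<Sum>d\<in>?I. \<Sum>c\<in>?I. f (x, real_of_int d, real_of_int c))\<bar>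
        \<le> n * (2 * (n * L) / sqrt M)"
      using fejer_op_approx[OF M continuous_of_lipschitz[OF s1 nL] s1 nL] by (simp add: n_def)
    ultimately show ?thesis by (simp add: e_def)
  qed
  have s2: "\<bar>(\<Sum>d\<in>?I. \<Sum>c\<in>?I. f (x, real_of_int d, real_of_int c)) - (\<Sum>d\<in>?I. \<Sum>c\<in>?I. f (x', real_of_int d, real_of_int c))\<bar> \<le> (n * (n * L)) * \<bar>x - x'\<bar>" for x x'
  proof -
    have "\<bar>(\<Sum>d\<in>?I. \<Sum>c\<in>?I. f (x, real_of_int d, real_of_int c)) - (\<Sum>d\<in>?I. \<Sum>c\<in>?I. f (x', real_of_int d, real_of_int c))\<bar>
       \<le> (\<Sum>d\<in>?I. \<Sum>c\<in>?I. L * \<bar>x - x'\<bar>)"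
      unfolding sum_subtractf[symmetric]
      by (rule order_trans[OF sum_abs sum_mono[OF order_trans[OF sum_abs sum_mono[OF lx]]]])
    then show ?thesis by (simp only: sum_constant cardI mult.assoc)
  qed
  have nnL: "n * (n * L) \<ge> 0" using n0 nL by simp
  have a3: "\<bar>fejer_op M B h2 - (\<Sum>a\<in>?I. \<Sum>d\<in>?I. \<Sum>c\<in>?I. f (real_of_int a, real_of_int d, real_of_int c))\<bar> \<le> 3 * n ^ 3 * e"
  proof -
    have "\<bar>fejer_op M B h2 - fejer_op M B (\<lambda>x. \<Sum>d\<in>?I. \<Sum>c\<in>?I. f (x, real_of_int d, real_of_int c))\<bar> \<le> n * (2 * (n * (n * e)))"
      using fejer_op_diff_le[OF M continuous_of_lipschitz[OF h2x nnL] continuous_of_lipschitz[OF s2 nnL] a2]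
      by (simp add: n_def)
    moreover have "\<bar>fejer_op M B (\<lambda>x. \<Sum>d\<in>?I. \<Sum>c\<in>?I. f (x, real_of_int d, real_of_int c)) - (\<Sum>a\<in>?I. \<Sum>d\<in>?I. \<Sum>c\<in>?I. f (real_of_int a, real_of_int d, real_of_int c))\<bar>
        \<le> n * (2 * (n * (n * L)) / sqrt M)"
      using fejer_op_approx[OF M continuous_of_lipschitz[OF s2 nnL] s2 nnL] by (simp add: n_def)
    moreover have "n * (2 * (n * (n * e))) = 2 * n ^ 3 * e" "n * (2 * (n * (n * L)) / sqrt M) = n ^ 3 * e"
      by (simp_all add: e_def power3_eq_cube)
    ultimately show ?thesis by linarith
  qed
  have "fejer_op M B h2 = integral (box3 B) (\<lambda>(x, y, z). fejer M x * (fejer M y * (fejer M z * f (x, y, z))))"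
  proof -
    define F where "F = (\<lambda>(x, y, z). fejer M x * (fejer M y * (fejer M z * f (x, y, z))))"
    have Fc: "continuous_on S F" for S
      unfolding F_def case_prod_unfold
      by (intro continuous_intros continuous_on_compose2[OF fc]) auto
    have "integral (box3 B) F = integral (cbox (- b) b) (\<lambda>x. integral (cbox (- b, - b) (b, b)) (\<lambda>w. F (x, w)))"
      unfolding box3_def b_def[symmetric] by (rule integral_prod_continuous[OF Fc])
    also have "\<dots> = integral (cbox (- b) b) (\<lambda>x. integral (cbox (- b) b) (\<lambda>y. integral (cbox (- b) b) (\<lambda>z. F (x, y, z))))"
    proof (rule Henstock_Kurzweil_Integration.integral_cong)
      fix x
      have "continuous_on S (\<lambda>w. F (x, w))" for S
        unfolding F_def case_prod_unfold by (intro continuous_intros continuous_on_compose2[OF fc]) auto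
      then show "integral (cbox (- b, - b) (b, b)) (\<lambda>w. F (x, w)) = integral (cbox (- b) b) (\<lambda>y. integral (cbox (- b) b) (\<lambda>z. F (x, y, z)))"
        by (rule integral_prod_continuous)
    qed
    also have "\<dots> = fejer_op M B h2"
      unfolding F_def prod.case h2_def h1_def fejer_op_def b_def by simp
    finally show ?thesis by (simp add: F_def)
  qed
  also have "\<dots> = integral (box3 B) (\<lambda>u. \<Sum>k\<in>cube3 M. fejer_weight M k * (f u * cos (2 * pi * dot3 k u)))"
  proof (rule Henstock_Kurzweil_Integration.integral_cong)
    fix u :: "real \<times> real \<times> real"
    obtain x y z where u: "u = (x, y, z)" by (metis prod.exhaust)
    have "fejer M x * (fejer M y * (fejer M z * f (x, y, z))) = (fejer M x * (fejer M y * fejer M z)) * f (x, y, z)" by simp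
    also have "\<dots> = (\<Sum>k\<in>cube3 M. fejer_weight M k * (f u * cos (2 * pi * dot3 k u)))"
      unfolding fejer_product[OF M] u sum_distrib_right by (intro sum.cong) auto
    finally show "(case u of (x, y, z) \<Rightarrow> fejer M x * (fejer M y * (fejer M z * f (x, y, z))))
       = (\<Sum>k\<in>cube3 M. fejer_weight M k * (f u * cos (2 * pi * dot3 k u)))" by (simp add: u)
  qed
  also have "\<dots> = (\<Sum>k\<in>cube3 M. fejer_weight M k * fhat3 B f k)"
  proof -
    have "(\<lambda>u. fejer_weight M k * (f u * cos (2 * pi * dot3 k u))) integrable_on box3 B" for k
      unfolding box3_def dot3_def by (intro integrable_continuous continuous_intros continuous_on_subset[OF fc]) auto
    then show ?thesis unfolding fhat3_def by (subst integral_sum) (auto simp: cube3_def)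
  qed
  finally have "fejer_op M B h2 = (\<Sum>k\<in>cube3 M. fejer_weight M k * fhat3 B f k)" .
  moreover have "(\<Sum>a\<in>?I. \<Sum>d\<in>?I. \<Sum>c\<in>?I. f (real_of_int a, real_of_int d, real_of_int c)) = (\<Sum>v\<in>cube3 B. f (emb3 v))"
    unfolding cube3_def emb3_def sum.cartesian_product by (intro sum.cong) auto
  ultimately show ?thesis using a3 by (simp add: n_def e_def)
qed

text \<open>Poisson summation for a Lipschitz function whose Fourier coefficients need only be summable off \<open>K0\<close>; the Fejer kernel replaces any smoothness assumption.\<close>

lemma poisson_bound:
  fixes f :: "real \<times> real \<times> real \<Rightarrow> real"
  assumes lip: "\<And>u v. \<bar>f u - f v\<bar> \<le> L * dist u v" and L: "L \<ge> 0" and K0: "finite K0"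
    and bd: "\<And>K. finite K \<Longrightarrow> K \<inter> K0 = {} \<Longrightarrow> (\<Sum>k\<in>K. \<bar>fhat3 B f k\<bar>) \<le> E"
  shows "\<bar>(\<Sum>v\<in>cube3 B. f (emb3 v)) - (\<Sum>k\<in>K0. fhat3 B f k)\<bar> \<le> E"
proof -
  define S where "S = (\<Sum>v\<in>cube3 B. f (emb3 v))"
  define c where "c = 3 * (2 * real B + 1) ^ 3 * (2 * L)"
  have lim1: "(\<lambda>M. S - (\<Sum>k\<in>K0. fejer_weight M k * fhat3 B f k)) \<longlonglongrightarrow> S - (\<Sum>k\<in>K0. fhat3 B f k)"
  proof -
    have "(\<lambda>M. 1 - \<bar>real_of_int a\<bar> / real M) \<longlonglongrightarrow> 1" for a
      using tendsto_diff[OF tendsto_const[of 1] lim_const_over_n[of "\<bar>real_of_int a\<bar>"]] by simp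
    then have "(\<lambda>M. fejer_weight M k) \<longlonglongrightarrow> 1 * (1 * 1)" for k
      unfolding fejer_weight_def by (intro tendsto_mult)
    then have "(\<lambda>M. S - (\<Sum>k\<in>K0. fejer_weight M k * fhat3 B f k)) \<longlonglongrightarrow> S - (\<Sum>k\<in>K0. (1 * (1 * 1)) * fhat3 B f k)"
      by (intro tendsto_diff tendsto_const tendsto_sum tendsto_mult)
    then show ?thesis by simp
  qed
  have lim2: "(\<lambda>M. E + c / sqrt (real M)) \<longlonglongrightarrow> E" by real_asymp
  have ev: "\<forall>\<^sub>F M in sequentially. \<bar>S - (\<Sum>k\<in>K0. fejer_weight M k * fhat3 B f k)\<bar> \<le> E + c / sqrt (real M)"
  proof -
    \<comment> \<open>Exceeds every coordinate in \<open>K0\<close>, so \<open>K0\<close> lies in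
      \<open>cube3 M\<close> once \<open>M \<ge> m\<close>.\<close>
    define m where "m = (\<Sum>k\<in>K0. nat \<bar>fst k\<bar> + nat \<bar>fst (snd k)\<bar> + nat \<bar>snd (snd k)\<bar>)"
    show ?thesis using eventually_ge_at_top[of "max 1 m"]
    proof eventually_elim
      case (elim M)
      then have M: "M \<ge> 1" and mM: "m \<le> M" by auto
      have sub: "K0 \<subseteq> cube3 M"
      proof
        fix k assume k: "k \<in> K0"
        then have "nat \<bar>fst k\<bar> + nat \<bar>fst (snd k)\<bar> + nat \<bar>snd (snd k)\<bar> \<le> m"
          unfolding m_def using K0 by (intro member_le_sum[of k K0 "\<lambda>k. nat \<bar>fst k\<bar> + nat \<bar>fst (snd k)\<bar> + nat \<bar>snd (snd k)\<bar>"]) auto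
        then have "\<bar>fst k\<bar> \<le> int M" "\<bar>fst (snd k)\<bar> \<le> int M" "\<bar>snd (snd k)\<bar> \<le> int M" using mM by linarith+
        then show "k \<in> cube3 M" by (auto simp: cube3_def mem_Times_iff abs_le_iff)
      qed
      have fin: "finite (cube3 M)" by (simp add: cube3_def)
      have w: "0 \<le> fejer_weight M k \<and> fejer_weight M k \<le> 1" if "k \<in> cube3 M" for k
      proof -
        have "0 \<le> 1 - \<bar>real_of_int a\<bar> / M \<and> 1 - \<bar>real_of_int a\<bar> / M \<le> 1" if "a \<in> {- int M..int M}" for a
        proof -
          have "\<bar>real_of_int a\<bar> \<le> real M" using that by auto
          then show ?thesis using M by (simp add: divide_le_eq_1)
        qed
        then show ?thesis using that unfolding cube3_def fejer_weight_def
          by (auto intro!: mult_le_one mult_nonneg_nonneg)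
      qed
      have "(\<Sum>k\<in>cube3 M. fejer_weight M k * fhat3 B f k)
          = (\<Sum>k\<in>K0. fejer_weight M k * fhat3 B f k) + (\<Sum>k\<in>cube3 M - K0. fejer_weight M k * fhat3 B f k)"
        using sum.subset_diff[OF sub fin] by (simp add: add.commute)
      moreover have "\<bar>\<Sum>k\<in>cube3 M - K0. fejer_weight M k * fhat3 B f k\<bar> \<le> E"
      proof -
        have "\<bar>\<Sum>k\<in>cube3 M - K0. fejer_weight M k * fhat3 B f k\<bar> \<le> (\<Sum>k\<in>cube3 M - K0. \<bar>fejer_weight M k * fhat3 B f k\<bar>)"
          by (rule sum_abs)
        also have "\<dots> \<le> (\<Sum>k\<in>cube3 M - K0. \<bar>fhat3 B f k\<bar>)"
        proof (rule sum_mono)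
          fix k assume "k \<in> cube3 M - K0"
          then have "\<bar>fejer_weight M k\<bar> \<le> 1" using w[of k] by auto
          then show "\<bar>fejer_weight M k * fhat3 B f k\<bar> \<le> \<bar>fhat3 B f k\<bar>"
            unfolding abs_mult by (intro mult_left_le_one_le) auto
        qed
        also have "\<dots> \<le> E" using fin by (intro bd) auto
        finally show ?thesis .
      qed
      moreover have "\<bar>(\<Sum>k\<in>cube3 M. fejer_weight M k * fhat3 B f k) - S\<bar> \<le> c / sqrt M"
        using poisson_fejer[OF M lip L, of B] by (simp add: S_def c_def)
      ultimately show ?case by linarith
    qed
  qed
  show ?thesis unfolding S_def[symmetric]
    by (rule tendsto_le[OF trivial_limit_sequentially lim2 tendsto_rabs[OF lim1] ev])
qed

section \<open>Fourier transforms of radial functions\<close>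

lemma gauss_integrable_moment:
  fixes a :: real
  assumes "a > 0"
  shows "integrable lborel (\<lambda>x. exp (- a * x\<^sup>2) * x ^ k)"
proof -
  define c where "c = sqrt (2 * a)"
  have c: "c > 0" "c\<^sup>2 = 2 * a" using assms by (auto simp: c_def)
  have "integrable lborel (\<lambda>x. (sqrt (2 * pi) / c ^ k) * (std_normal_density (0 + c * x) * (0 + c * x) ^ k))"
    by (intro integrable_mult_right lborel_integrable_real_affine[OF integrable_std_normal_moment]) (use c in auto)
  moreover have "(sqrt (2 * pi) / c ^ k) * (std_normal_density (0 + c * x) * (0 + c * x) ^ k) = exp (- a * x\<^sup>2) * x ^ k" for x
    using c by (simp add: std_normal_density_def power_mult_distrib)
  ultimately show ?thesis by simp
qed

text \<open>The characteristic function of the standard normal law, rescaled by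
  \<open>c = sqrt (2 * a)\<close>.\<close>

lemma gauss_char:
  assumes a: "a > 0"
  shows "has_bochner_integral lborel (\<lambda>x. of_real (exp (- a * x\<^sup>2)) * cis (2 * pi * \<xi> * x))
           (complex_of_real (sqrt (pi / a) * exp (- (pi\<^sup>2 * \<xi>\<^sup>2 / a))))"
proof -
  define c where "c = sqrt (2 * a)"
  have c: "c > 0" "c\<^sup>2 = 2 * a" using assms by (auto simp: c_def)
  define t where "t = 2 * pi * \<xi> / c"
  have int: "integrable lborel (\<lambda>x. std_normal_density x *\<^sub>R iexp (t * x))"
    by (rule Bochner_Integration.integrable_bound[OF integrable_std_normal_moment[of 0]]) (auto simp: normal_density_nonneg)
  have "(CLINT x|std_normal_distribution. iexp (t * x)) = complex_of_real (exp (- (t\<^sup>2) / 2))"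
    using fun_cong[OF char_std_normal_distribution, of t] by (simp add: char_def)
  then have "(LINT x|lborel. std_normal_density x *\<^sub>R iexp (t * x)) = complex_of_real (exp (- (t\<^sup>2) / 2))"
    by (subst (asm) integral_density) (auto simp: normal_density_nonneg)
  then have "has_bochner_integral lborel (\<lambda>x. std_normal_density x *\<^sub>R iexp (t * x)) (complex_of_real (exp (- (t\<^sup>2) / 2)))"
    using int by (simp add: has_bochner_integral_iff)
  then have "has_bochner_integral lborel (\<lambda>x. std_normal_density (0 + c * x) *\<^sub>R iexp (t * (0 + c * x))) (complex_of_real (exp (- (t\<^sup>2) / 2)) /\<^sub>R \<bar>c\<bar>)"
    using lborel_has_bochner_integral_real_affine_iff[of c "\<lambda>x. std_normal_density x *\<^sub>R iexp (t * x)" _ 0] c by simp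
  then have "has_bochner_integral lborel (\<lambda>x. of_real (sqrt (2 * pi)) * (std_normal_density (0 + c * x) *\<^sub>R iexp (t * (0 + c * x))))
      (of_real (sqrt (2 * pi)) * (complex_of_real (exp (- (t\<^sup>2) / 2)) /\<^sub>R \<bar>c\<bar>))"
    by (rule has_bochner_integral_mult_right)
  moreover have "of_real (sqrt (2 * pi)) * (std_normal_density (0 + c * x) *\<^sub>R iexp (t * (0 + c * x)))
     = of_real (exp (- a * x\<^sup>2)) * cis (2 * pi * \<xi> * x)" for x
  proof -
    have "sqrt (2 * pi) * std_normal_density (0 + c * x) = exp (- a * x\<^sup>2)"
      using c by (simp add: std_normal_density_def power_mult_distrib)
    then have "complex_of_real (sqrt (2 * pi)) * of_real (std_normal_density (0 + c * x)) = of_real (exp (- a * x\<^sup>2))"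
      by (simp only: flip: of_real_mult)
    moreover have "t * (0 + c * x) = 2 * pi * \<xi> * x" using c by (simp add: t_def)
    then have "iexp (t * (0 + c * x)) = cis (2 * pi * \<xi> * x)" by (simp only: cis_conv_exp)
    ultimately show ?thesis by (simp only: scaleR_conv_of_real mult.assoc[symmetric])
  qed
  moreover have "of_real (sqrt (2 * pi)) * (complex_of_real (exp (- (t\<^sup>2) / 2)) /\<^sub>R \<bar>c\<bar>)
     = complex_of_real (sqrt (pi / a) * exp (- (pi\<^sup>2 * \<xi>\<^sup>2 / a)))"
  proof -
    have "t\<^sup>2 / 2 = pi\<^sup>2 * \<xi>\<^sup>2 / a" using c a by (simp add: t_def power_divide power_mult_distrib field_simps)
    then have "exp (- (t\<^sup>2) / 2) = exp (- (pi\<^sup>2 * \<xi>\<^sup>2 / a))" by simp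
    moreover have "sqrt (2 * pi) / c = sqrt (pi / a)" unfolding c_def by (simp add: real_sqrt_divide[symmetric])
    moreover have "sqrt (2 * pi) * (exp (- (t\<^sup>2) / 2) / c) = sqrt (2 * pi) / c * exp (- (t\<^sup>2) / 2)" by simp
    ultimately have 1: "sqrt (2 * pi) * (exp (- (t\<^sup>2) / 2) / c) = sqrt (pi / a) * exp (- (pi\<^sup>2 * \<xi>\<^sup>2 / a))"
      by (simp only:)
    have 2: "complex_of_real x * (complex_of_real y /\<^sub>R \<bar>c\<bar>) = complex_of_real (x * (y / c))" for x y
      by (simp only: scaleR_conv_of_real abs_of_pos[OF c(1)] of_real_mult[symmetric] divide_inverse mult_ac)
    show ?thesis unfolding 2 1 ..
  qed
  ultimately show ?thesis by (simp only:)
qed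

lemma has_bochner_integral_lborel_product:
  fixes f :: "'a::euclidean_space \<Rightarrow> complex" and g :: "'b::euclidean_space \<Rightarrow> complex"
  assumes f: "has_bochner_integral lborel f A" and g: "has_bochner_integral lborel g B"
  shows "has_bochner_integral lborel (\<lambda>u. f (fst u) * g (snd u)) (A * B)"
proof -
  have fi: "integrable lborel f" "integral\<^sup>L lborel f = A" and gi: "integrable lborel g" "integral\<^sup>L lborel g = B"
    using f g by (auto simp: has_bochner_integral_iff)
  have fm: "f \<in> borel_measurable borel" using borel_measurable_integrable[OF fi(1)] by simp
  have gm: "g \<in> borel_measurable borel" using borel_measurable_integrable[OF gi(1)] by simp
  have int: "integrable (lborel \<Otimes>\<^sub>M lborel) (\<lambda>u. f (fst u) * g (snd u))"
  proof (rule lborel_pair.Fubini_integrable)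
    show "(\<lambda>u. f (fst u) * g (snd u)) \<in> borel_measurable (lborel \<Otimes>\<^sub>M lborel)"
      using fm gm by (intro borel_measurable_times measurable_compose[OF measurable_fst] measurable_compose[OF measurable_snd]) auto
    show "integrable lborel (\<lambda>x. \<integral>y. norm (f (fst (x, y)) * g (snd (x, y))) \<partial>lborel)"
      using fi(1) gi(1) by (simp add: norm_mult)
    show "AE x in lborel. integrable lborel (\<lambda>y. f (fst (x, y)) * g (snd (x, y)))"
      using gi(1) by simp
  qed
  have "integral\<^sup>L (lborel \<Otimes>\<^sub>M lborel) (\<lambda>u. f (fst u) * g (snd u)) = (\<integral>x. \<integral>y. f (fst (x, y)) * g (snd (x, y)) \<partial>lborel \<partial>lborel)"
    by (rule lborel_pair.integral_fst'[OF int, symmetric])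
  also have "\<dots> = A * B" using fi gi by simp
  finally show ?thesis using int by (simp add: has_bochner_integral_iff lborel_prod)
qed

definition rad3 :: "int \<times> int \<times> int \<Rightarrow> real" where
  "rad3 k = norm (emb3 k)"

lemma rad3_sq: "(rad3 k)\<^sup>2 = (real_of_int (fst k))\<^sup>2 + ((real_of_int (fst (snd k)))\<^sup>2 + (real_of_int (snd (snd k)))\<^sup>2)"
  by (simp add: rad3_def emb3_def norm_Pair)

lemma gauss_fourier3:
  assumes a: "a > 0"
  shows "has_bochner_integral lborel (\<lambda>u. exp (- a * (norm u)\<^sup>2) * cos (2 * pi * dot3 k u))
     (sqrt (pi / a) ^ 3 * exp (- (pi\<^sup>2 * (rad3 k)\<^sup>2 / a)))"
proof -
  define G where "G \<xi> x = complex_of_real (exp (- a * x\<^sup>2)) * cis (2 * pi * \<xi> * x)" for \<xi> x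
  define V where "V \<xi> = complex_of_real (sqrt (pi / a) * exp (- (pi\<^sup>2 * \<xi>\<^sup>2 / a)))" for \<xi>
  have G: "has_bochner_integral lborel (G \<xi>) (V \<xi>)" for \<xi> unfolding G_def V_def by (rule gauss_char[OF a])
  obtain p q r where k: "k = (p, q, r)" by (metis prod.exhaust)
  have "has_bochner_integral lborel (\<lambda>u. G p (fst u) * (G q (fst (snd u)) * G r (snd (snd u)))) (V p * (V q * V r))"
    by (rule has_bochner_integral_lborel_product[OF G has_bochner_integral_lborel_product[OF G G]])
  moreover have "G p (fst u) * (G q (fst (snd u)) * G r (snd (snd u))) = complex_of_real (exp (- a * (norm u)\<^sup>2)) * cis (2 * pi * dot3 k u)" for u
  proof -
    obtain x y z where u: "u = (x, y, z)" by (metis prod.exhaust)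
    have "exp (- a * (norm u)\<^sup>2) = exp (- a * x\<^sup>2) * (exp (- a * y\<^sup>2) * exp (- a * z\<^sup>2))"
      by (simp add: u norm_Pair distrib_left flip: exp_add)
    then have 1: "complex_of_real (exp (- a * (norm u)\<^sup>2)) = of_real (exp (- a * x\<^sup>2)) * (of_real (exp (- a * y\<^sup>2)) * of_real (exp (- a * z\<^sup>2)))"
      by (simp only: of_real_mult)
    have 2: "cis (2 * pi * dot3 k u) = cis (2 * pi * p * x) * (cis (2 * pi * q * y) * cis (2 * pi * r * z))"
      by (simp add: cis_mult u k dot3_def distrib_left add.assoc mult.assoc)
    show ?thesis unfolding 1 2 unfolding G_def u fst_conv snd_conv by (simp only: mult_ac)
  qed
  moreover have "V p * (V q * V r) = complex_of_real (sqrt (pi / a) ^ 3 * exp (- (pi\<^sup>2 * (rad3 k)\<^sup>2 / a)))"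
  proof -
    have "exp (- (pi\<^sup>2 * (rad3 k)\<^sup>2 / a)) = exp (- (pi\<^sup>2 * (real_of_int p)\<^sup>2 / a)) * (exp (- (pi\<^sup>2 * (real_of_int q)\<^sup>2 / a)) * exp (- (pi\<^sup>2 * (real_of_int r)\<^sup>2 / a)))"
      unfolding rad3_sq k by (simp add: distrib_left add_divide_distrib flip: exp_add)
    then have "sqrt (pi / a) ^ 3 * exp (- (pi\<^sup>2 * (rad3 k)\<^sup>2 / a)) = (sqrt (pi / a) * exp (- (pi\<^sup>2 * (real_of_int p)\<^sup>2 / a))) *
      ((sqrt (pi / a) * exp (- (pi\<^sup>2 * (real_of_int q)\<^sup>2 / a))) * (sqrt (pi / a) * exp (- (pi\<^sup>2 * (real_of_int r)\<^sup>2 / a))))"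
      by (simp only: power3_eq_cube mult_ac)
    then show ?thesis unfolding V_def by (simp only: of_real_mult)
  qed
  ultimately have "has_bochner_integral lborel (\<lambda>u. complex_of_real (exp (- a * (norm u)\<^sup>2)) * cis (2 * pi * dot3 k u))
    (complex_of_real (sqrt (pi / a) ^ 3 * exp (- (pi\<^sup>2 * (rad3 k)\<^sup>2 / a))))" by (simp only:)
  from has_bochner_integral_Re[OF this] show ?thesis by simp
qed

text \<open>The radial Fourier kernel: the transform of \<open>F(|u|)\<close> at a frequency of length \<open>\<rho>\<close> is the integral of \<open>F(r) r\<close> against \<open>sker \<rho> r\<close>.\<close>

definition sker :: "real \<Rightarrow> real \<Rightarrow> real" where
  "sker \<rho> r = (if \<rho> = 0 then 4 * pi * r else 2 / \<rho> * sin (2 * pi * \<rho> * r))"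

lemma sker_deriv: "(sker \<rho> has_real_derivative 4 * pi * cos (2 * pi * \<rho> * r)) (at r)"
  unfolding sker_def by (cases "\<rho> = 0") (auto intro!: derivative_eq_intros)

lemma sker_bound: "\<bar>sker \<rho> r\<bar> \<le> 4 * pi * \<bar>r\<bar>"
proof (cases "\<rho> = 0")
  case False
  have "\<bar>sin (2 * pi * \<rho> * r)\<bar> \<le> \<bar>2 * pi * \<rho> * r\<bar>" by (rule abs_sin_x_le_abs_x)
  then have "\<bar>2 / \<rho>\<bar> * \<bar>sin (2 * pi * \<rho> * r)\<bar> \<le> \<bar>2 / \<rho>\<bar> * \<bar>2 * pi * \<rho> * r\<bar>" by (intro mult_left_mono) auto
  then show ?thesis using False by (simp add: sker_def abs_mult)
qed (simp add: sker_def abs_mult)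

lemma continuous_sker: "continuous_on S (sker \<rho>)"
  by (rule continuous_on_subset[OF DERIV_continuous_on[OF has_field_derivative_at_within[OF sker_deriv]]]) auto

lemma sker_minus: "sker \<rho> (- r) = - sker \<rho> r"
  by (simp add: sker_def)

lemma sker_measurable [measurable]: "sker \<rho> \<in> borel_measurable borel"
  using continuous_sker[of UNIV \<rho>] by (rule borel_measurable_continuous_onI)

lemma gauss_sker_integrable:
  assumes a: "a > 0"
  shows "integrable lborel (\<lambda>r. exp (- a * r\<^sup>2) * (r * sker \<rho> r))"
proof (rule Bochner_Integration.integrable_bound)
  show "integrable lborel (\<lambda>r. 4 * pi * (exp (- a * r\<^sup>2) * r ^ 2))"
    using gauss_integrable_moment[OF a, of 2] by simp
  show "AE r in lborel. norm (exp (- a * r\<^sup>2) * (r * sker \<rho> r)) \<le> norm (4 * pi * (exp (- a * r\<^sup>2) * r ^ 2))"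
  proof (rule AE_I2)
    fix r :: real
    have "\<bar>r\<bar> * \<bar>sker \<rho> r\<bar> \<le> \<bar>r\<bar> * (4 * pi * \<bar>r\<bar>)" using sker_bound by (intro mult_left_mono) auto
    also have "\<dots> = 4 * pi * r\<^sup>2" by (simp add: power2_eq_square)
    finally have "exp (- a * r\<^sup>2) * (\<bar>r\<bar> * \<bar>sker \<rho> r\<bar>) \<le> exp (- a * r\<^sup>2) * (4 * pi * r\<^sup>2)" by (intro mult_left_mono) auto
    then show "norm (exp (- a * r\<^sup>2) * (r * sker \<rho> r)) \<le> norm (4 * pi * (exp (- a * r\<^sup>2) * r ^ 2))"
      by (simp add: abs_mult mult_ac)
  qed
qed measurable

text \<open>The derivative of \<open>exp (- a * r^2) * sker \<rho> r\<close> combines the Gaussian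
  cosine integral, known from \<open>gauss_char\<close>, with the integral sought, and its total
  integral is 0. The factor 2 stems from integrating over the whole line instead of the
  half-line.\<close>

lemma gauss_sker_full:
  assumes a: "a > 0"
  shows "(\<integral>r. exp (- a * r\<^sup>2) * (r * sker \<rho> r) \<partial>lborel) = 2 * (sqrt (pi / a) ^ 3 * exp (- (pi\<^sup>2 * \<rho>\<^sup>2 / a)))"
proof -
  define F where "F r = exp (- a * r\<^sup>2) * sker \<rho> r" for r
  define f where "f r = 4 * pi * (exp (- a * r\<^sup>2) * cos (2 * pi * \<rho> * r)) - 2 * a * (exp (- a * r\<^sup>2) * (r * sker \<rho> r))" for r
  have cosb: "has_bochner_integral lborel (\<lambda>r. exp (- a * r\<^sup>2) * cos (2 * pi * \<rho> * r)) (sqrt (pi / a) * exp (- (pi\<^sup>2 * \<rho>\<^sup>2 / a)))"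
    using has_bochner_integral_Re[OF gauss_char[OF a, of \<rho>]] by simp
  have cosi: "integrable lborel (\<lambda>r. exp (- a * r\<^sup>2) * cos (2 * pi * \<rho> * r))"
    "(\<integral>r. exp (- a * r\<^sup>2) * cos (2 * pi * \<rho> * r) \<partial>lborel) = sqrt (pi / a) * exp (- (pi\<^sup>2 * \<rho>\<^sup>2 / a))"
    using cosb by (auto simp: has_bochner_integral_iff)
  have fint: "integrable lborel f" unfolding f_def
    using cosi(1) gauss_sker_integrable[OF a, of \<rho>] by (intro Bochner_Integration.integrable_diff integrable_mult_right)
  have lim: "(F \<longlongrightarrow> 0) at_top" "(F \<longlongrightarrow> 0) at_bot"
  proof -
    have b: "norm (F r) \<le> exp (- a * r\<^sup>2) * (4 * pi * \<bar>r\<bar>)" for r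
      unfolding F_def using sker_bound[of \<rho> r] by (auto simp: abs_mult intro!: mult_left_mono)
    have "((\<lambda>r. exp (- a * r\<^sup>2) * (4 * pi * \<bar>r\<bar>)) \<longlongrightarrow> 0) at_top" using a by real_asymp
    then show "(F \<longlongrightarrow> 0) at_top" by (rule Lim_null_comparison[OF always_eventually[OF allI[OF b]]])
    have "((\<lambda>r. exp (- a * r\<^sup>2) * (4 * pi * \<bar>r\<bar>)) \<longlongrightarrow> 0) at_bot" using a by real_asymp
    then show "(F \<longlongrightarrow> 0) at_bot" by (rule Lim_null_comparison[OF always_eventually[OF allI[OF b]]])
  qed
  have "(LBINT x=-\<infinity>..\<infinity>. f x) = 0 - 0"
  proof (rule interval_integral_FTC_integrable[of _ _ F])
    show "(F has_vector_derivative f x) (at x)" for x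
      unfolding has_real_derivative_iff_has_vector_derivative[symmetric] F_def f_def
      by (auto intro!: derivative_eq_intros sker_deriv simp: algebra_simps power2_eq_square)
    have "continuous_on UNIV f" unfolding f_def by (intro continuous_intros continuous_sker)
    then show "isCont f x" for x by (simp add: continuous_on_eq_continuous_at)
    show "set_integrable lborel (einterval (- \<infinity>) \<infinity>) f" using fint by (simp add: set_integrable_def)
    show "((F \<circ> real_of_ereal) \<longlongrightarrow> 0) (at_right (- \<infinity>))" "((F \<circ> real_of_ereal) \<longlongrightarrow> 0) (at_left \<infinity>)"
      using lim by (simp_all add: ereal_tendsto_simps)
  qed simp
  then have "integral\<^sup>L lborel f = 0" by (simp add: interval_lebesgue_integral_def set_lebesgue_integral_def)
  then have "4 * pi * (\<integral>r. exp (- a * r\<^sup>2) * cos (2 * pi * \<rho> * r) \<partial>lborel) - 2 * a * (\<integral>r. exp (- a * r\<^sup>2) * (r * sker \<rho> r) \<partial>lborel) = 0"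
    unfolding f_def using cosi(1) gauss_sker_integrable[OF a, of \<rho>] by simp
  then have "(\<integral>r. exp (- a * r\<^sup>2) * (r * sker \<rho> r) \<partial>lborel) = 2 * ((pi / a) * (sqrt (pi / a) * exp (- (pi\<^sup>2 * \<rho>\<^sup>2 / a))))"
    unfolding cosi(2) using a by (simp add: field_simps)
  also have "(pi / a) * (sqrt (pi / a) * exp (- (pi\<^sup>2 * \<rho>\<^sup>2 / a))) = sqrt (pi / a) ^ 3 * exp (- (pi\<^sup>2 * \<rho>\<^sup>2 / a))"
    using a by (simp add: power3_eq_cube)
  finally show ?thesis .
qed

definition half_int :: "(real \<Rightarrow> real) \<Rightarrow> real" where
  "half_int g = (\<integral>r. indicator {0..} r *\<^sub>R g r \<partial>lborel)"

lemma gauss_sker_half: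
  assumes a: "a > 0"
  shows "half_int (\<lambda>r. exp (- a * r\<^sup>2) * (r * sker \<rho> r)) = sqrt (pi / a) ^ 3 * exp (- (pi\<^sup>2 * \<rho>\<^sup>2 / a))"
proof -
  define g where "g r = exp (- a * r\<^sup>2) * (r * sker \<rho> r)" for r
  have "integrable lborel (\<lambda>r. indicator {0..} r *\<^sub>R g r)"
    using gauss_sker_integrable[OF a, of \<rho>] unfolding g_def by (intro integrable_mult_indicator) auto
  then have "has_bochner_integral lborel (\<lambda>r. indicator {0..} r *\<^sub>R g r) (half_int g)"
    by (simp add: has_bochner_integral_iff half_int_def)
  then have "has_bochner_integral lborel g (2 *\<^sub>R half_int g)"
    by (rule has_bochner_integral_even_function) (simp add: g_def sker_minus)
  then have "integral\<^sup>L lborel g = 2 * half_int g" by (simp add: has_bochner_integral_iff)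
  moreover have "integral\<^sup>L lborel g = 2 * (sqrt (pi / a) ^ 3 * exp (- (pi\<^sup>2 * \<rho>\<^sup>2 / a)))"
    unfolding g_def by (rule gauss_sker_full[OF a])
  ultimately have "half_int g = sqrt (pi / a) ^ 3 * exp (- (pi\<^sup>2 * \<rho>\<^sup>2 / a))" by simp
  moreover have "(\<lambda>r. exp (- a * r\<^sup>2) * (r * sker \<rho> r)) = g" by (simp add: g_def fun_eq_iff)
  ultimately show ?thesis by (simp only:)
qed

text \<open>The radial formula is explicit for Gaussians, and their linear combinations are dense by Stone-Weierstrass in the variable \<open>exp (- r\<^sup>2)\<close>.\<close>

lemma approx_by_gaussians:
  fixes F :: "real \<Rightarrow> real"
  assumes F: "continuous_on UNIV F" and T: "T > 0" "\<And>r. r \<ge> T \<Longrightarrow> F r = 0" and e: "e > 0"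
  obtains c :: "nat \<Rightarrow> real" and n where "\<And>r. r \<ge> 0 \<Longrightarrow> \<bar>F r - (\<Sum>i\<le>n. c i * exp (- real (Suc i) * r\<^sup>2))\<bar> \<le> e * exp (- 1 * r\<^sup>2)"
proof -
  \<comment> \<open>In the variable \<open>q = exp (- r^2)\<close> one has
    \<open>F r = q * G q\<close>. Dividing by \<open>q\<close> keeps one Gaussian factor on the
    error, which makes the error integrable; \<open>G\<close> vanishes near 0 because
    \<open>F\<close> has bounded support, and at 0 itself by division by zero.\<close>
  define G where "G q = F (sqrt (- ln q)) / q" for q
  define \<delta> where "\<delta> = exp (- T\<^sup>2)"
  have \<delta>: "\<delta> > 0" "\<delta> \<le> 1" by (auto simp: \<delta>_def)
  have G0: "G q = 0" if "q \<in> {0..\<delta>}" for q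
  proof (cases "q = 0")
    case False
    then have q: "q > 0" using that by auto
    then have "ln q \<le> ln \<delta>" using that \<delta> by simp
    then have "T\<^sup>2 \<le> - ln q" by (simp add: \<delta>_def)
    then have "T \<le> sqrt (- ln q)" by (rule real_le_rsqrt)
    then show ?thesis using T by (simp add: G_def)
  qed (simp add: G_def)
  have "continuous_on ({0..\<delta>} \<union> {\<delta>..1}) G"
  proof (rule continuous_on_closed_Un)
    show "continuous_on {0..\<delta>} G"
      by (rule continuous_on_eq[of _ "\<lambda>_. 0"]) (auto simp: G0)
    show "continuous_on {\<delta>..1} G"
      unfolding G_def using \<delta>(1) by (intro continuous_intros continuous_on_compose2[OF F]) auto
  qed auto
  moreover have "{0..\<delta>} \<union> {\<delta>..1} = {0..1}" using \<delta> by auto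
  ultimately have Gc: "continuous_on {0..1} G" by simp
  obtain p where p: "real_polynomial_function p" "\<And>q. q \<in> {0..1} \<Longrightarrow> \<bar>G q - p q\<bar> < e"
    using Stone_Weierstrass_real_polynomial_function[OF compact_Icc Gc e] by blast
  obtain c n where cn: "p = (\<lambda>x. \<Sum>i\<le>n. c i * x ^ i)"
    using p(1) real_polynomial_function_iff_sum by blast
  show ?thesis
  proof (rule that)
    fix r :: real assume r: "r \<ge> 0"
    define q where "q = exp (- 1 * r\<^sup>2)"
    have q: "q > 0" "q \<in> {0..1}" by (auto simp: q_def)
    have "F r = q * G q" using r by (simp add: G_def q_def)
    moreover have "(\<Sum>i\<le>n. c i * exp (- real (Suc i) * r\<^sup>2)) = q * p q"
    proof -
      have "exp (- real (Suc i) * r\<^sup>2) = q * q ^ i" for i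
      proof -
        have "q * q ^ i = q ^ Suc i" by simp
        also have "\<dots> = exp (real (Suc i) * (- 1 * r\<^sup>2))" unfolding q_def by (rule exp_of_nat_mult[symmetric])
        also have "real (Suc i) * (- 1 * r\<^sup>2) = - real (Suc i) * r\<^sup>2" by (simp only: mult_minus_left mult_minus_right mult_1)
        finally show ?thesis by (rule sym)
      qed
      then show ?thesis by (simp add: cn sum_distrib_left mult_ac)
    qed
    ultimately have "\<bar>F r - (\<Sum>i\<le>n. c i * exp (- real (Suc i) * r\<^sup>2))\<bar> = q * \<bar>G q - p q\<bar>"
      using q by (simp add: abs_mult flip: right_diff_distrib)
    also have "\<dots> \<le> q * e" using p(2)[OF q(2)] q by (intro mult_left_mono) auto
    finally show "\<bar>F r - (\<Sum>i\<le>n. c i * exp (- real (Suc i) * r\<^sup>2))\<bar> \<le> e * exp (- 1 * r\<^sup>2)" by (simp add: q_def mult.commute)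
  qed
qed

text \<open>Both integrals agree for Gaussians, by \<open>gauss_fourier3\<close> and
  \<open>gauss_sker_half\<close>, and each changes by at most \<open>e\<close> times a fixed
  constant (\<open>I\<close> or \<open>I'\<close>) when \<open>F\<close> is replaced by a
  combination of Gaussians within \<open>e * exp (- r^2)\<close>. Integrability follows from the
  same comparison, and equality by letting \<open>e\<close> tend to 0.\<close>

lemma radial_fourier:
  fixes F :: "real \<Rightarrow> real"
  assumes F: "continuous_on UNIV F" and T: "T > 0" "\<And>r. r \<ge> T \<Longrightarrow> F r = 0"
  shows "integrable lborel (\<lambda>u :: real \<times> real \<times> real. F (norm u) * cos (2 * pi * dot3 k u))"
    and "integrable lborel (\<lambda>r. indicator {0..} r *\<^sub>R (F r * (r * sker (rad3 k) r)))"
    and "(\<integral>u. F (norm u) * cos (2 * pi * dot3 k u) \<partial>lborel) = half_int (\<lambda>r. F r * (r * sker (rad3 k) r))"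
proof -
  let ?\<rho> = "rad3 k"
  define C where "C u = cos (2 * pi * dot3 k u)" for u
  define W where "W r = indicator {0..} r *\<^sub>R (r * sker ?\<rho> r)" for r :: real
  have Cm: "C \<in> borel_measurable borel"
    unfolding C_def dot3_def by (intro borel_measurable_continuous_onI continuous_intros)
  have Wm: "W \<in> borel_measurable borel" unfolding W_def by measurable
  have Fm: "F \<in> borel_measurable borel" by (rule borel_measurable_continuous_onI[OF F])
  have F3m: "(\<lambda>u :: real \<times> real \<times> real. F (norm u)) \<in> borel_measurable borel"
    by (rule measurable_compose[OF _ Fm]) measurable
  define I where "I = (\<integral>u. exp (- 1 * (norm u)\<^sup>2) \<partial>(lborel :: (real \<times> real \<times> real) measure))"
  have Ii: "integrable lborel (\<lambda>u :: real \<times> real \<times> real. exp (- 1 * (norm u)\<^sup>2))"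
    using gauss_fourier3[of 1 "(0, 0, 0)"] by (simp add: has_bochner_integral_iff dot3_def)
  define I' where "I' = (\<integral>r. \<bar>exp (- 1 * r\<^sup>2) * W r\<bar> \<partial>lborel)"
  have gW: "integrable lborel (\<lambda>r. exp (- a * r\<^sup>2) * W r)" if "a > 0" for a
  proof -
    have "integrable lborel (\<lambda>r. indicator {0..} r *\<^sub>R (exp (- a * r\<^sup>2) * (r * sker ?\<rho> r)))"
      using gauss_sker_integrable[OF that, of ?\<rho>] by (intro integrable_mult_indicator) auto
    then show ?thesis by (simp add: W_def mult_ac)
  qed
  have FW: "indicator {0..} r *\<^sub>R (F r * (r * sker ?\<rho> r)) = F r * W r" for r by (simp add: W_def)
  have key: "integrable lborel (\<lambda>u. F (norm u) * C u) \<and> integrable lborel (\<lambda>r. F r * W r) \<and>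
     \<bar>(\<integral>u. F (norm u) * C u \<partial>lborel) - (\<integral>r. F r * W r \<partial>lborel)\<bar> \<le> e * (I + I')" if e: "e > 0" for e
  proof -
    obtain c :: "nat \<Rightarrow> real" and n where app: "\<And>r. r \<ge> 0 \<Longrightarrow> \<bar>F r - (\<Sum>i\<le>n. c i * exp (- real (Suc i) * r\<^sup>2))\<bar> \<le> e * exp (- 1 * r\<^sup>2)"
      using approx_by_gaussians[OF F T e] by blast
    define P where "P r = (\<Sum>i\<le>n. c i * exp (- real (Suc i) * r\<^sup>2))" for r
    have g3: "has_bochner_integral lborel (\<lambda>u. exp (- real (Suc i) * (norm u)\<^sup>2) * C u)
         (sqrt (pi / real (Suc i)) ^ 3 * exp (- (pi\<^sup>2 * ?\<rho>\<^sup>2 / real (Suc i))))" for i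
      unfolding C_def by (rule gauss_fourier3) simp
    define V where "V i = sqrt (pi / real (Suc i)) ^ 3 * exp (- (pi\<^sup>2 * ?\<rho>\<^sup>2 / real (Suc i)))" for i
    have PC: "has_bochner_integral lborel (\<lambda>u. P (norm u) * C u) (\<Sum>i\<le>n. c i * V i)"
      unfolding P_def sum_distrib_right mult.assoc V_def
      by (intro has_bochner_integral_sum has_bochner_integral_mult_right g3)
    have gW': "has_bochner_integral lborel (\<lambda>r. exp (- real (Suc i) * r\<^sup>2) * W r) (V i)" for i
    proof -
      have "half_int (\<lambda>r. exp (- real (Suc i) * r\<^sup>2) * (r * sker ?\<rho> r)) = V i"
        unfolding V_def by (rule gauss_sker_half) simp
      moreover have "half_int (\<lambda>r. exp (- real (Suc i) * r\<^sup>2) * (r * sker ?\<rho> r)) = (\<integral>r. exp (- real (Suc i) * r\<^sup>2) * W r \<partial>lborel)"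
        unfolding half_int_def W_def by (intro Bochner_Integration.integral_cong) (auto simp: mult_ac)
      ultimately show ?thesis using gW[of "real (Suc i)"] by (simp add: has_bochner_integral_iff)
    qed
    have PW: "has_bochner_integral lborel (\<lambda>r. P r * W r) (\<Sum>i\<le>n. c i * V i)"
      unfolding P_def sum_distrib_right mult.assoc
      by (intro has_bochner_integral_sum has_bochner_integral_mult_right gW')
    have d1: "norm (F (norm u) * C u - P (norm u) * C u) \<le> e * exp (- 1 * (norm u)\<^sup>2)" for u
    proof -
      have "norm (F (norm u) * C u - P (norm u) * C u) = \<bar>F (norm u) - P (norm u)\<bar> * \<bar>C u\<bar>"
        by (simp add: abs_mult flip: left_diff_distrib)
      also have "\<dots> \<le> \<bar>F (norm u) - P (norm u)\<bar> * 1" by (intro mult_left_mono) (auto simp: C_def)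
      also have "\<dots> \<le> e * exp (- 1 * (norm u)\<^sup>2)" using app[of "norm u"] by (simp add: P_def)
      finally show ?thesis .
    qed
    have d2: "norm (F r * W r - P r * W r) \<le> e * \<bar>exp (- 1 * r\<^sup>2) * W r\<bar>" for r
    proof (cases "r \<ge> 0")
      case True
      have "norm (F r * W r - P r * W r) = \<bar>F r - P r\<bar> * \<bar>W r\<bar>"
        by (simp add: abs_mult flip: left_diff_distrib)
      also have "\<dots> \<le> (e * exp (- 1 * r\<^sup>2)) * \<bar>W r\<bar>" using app[OF True] by (intro mult_right_mono) (auto simp: P_def)
      finally show ?thesis by (simp add: abs_mult)
    qed (simp add: W_def)
    have Pm: "P \<in> borel_measurable borel" unfolding P_def by measurable
    have P3m: "(\<lambda>u :: real \<times> real \<times> real. P (norm u)) \<in> borel_measurable borel"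
      by (rule measurable_compose[OF _ Pm]) measurable
    have i1: "integrable lborel (\<lambda>u. F (norm u) * C u - P (norm u) * C u)"
    proof (rule Bochner_Integration.integrable_bound)
      show "integrable lborel (\<lambda>u :: real \<times> real \<times> real. e * exp (- 1 * (norm u)\<^sup>2))" using Ii by simp
      show "(\<lambda>u. F (norm u) * C u - P (norm u) * C u) \<in> borel_measurable lborel"
        using Cm F3m P3m by simp
      show "AE u in lborel. norm (F (norm u) * C u - P (norm u) * C u) \<le> norm (e * exp (- 1 * (norm (u :: real \<times> real \<times> real))\<^sup>2))"
        using d1 e by (intro AE_I2) (simp add: abs_mult)
    qed
    have i2: "integrable lborel (\<lambda>r. F r * W r - P r * W r)"
    proof (rule Bochner_Integration.integrable_bound)
      show "integrable lborel (\<lambda>r. e * \<bar>exp (- 1 * r\<^sup>2) * W r\<bar>)" using gW[of 1] by (intro integrable_mult_right integrable_abs) simp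
      show "(\<lambda>r. F r * W r - P r * W r) \<in> borel_measurable lborel" using Fm Wm Pm by simp
      show "AE r in lborel. norm (F r * W r - P r * W r) \<le> norm (e * \<bar>exp (- 1 * r\<^sup>2) * W r\<bar>)"
        using d2 e by (intro AE_I2) (simp add: abs_mult)
    qed
    have PCi: "integrable lborel (\<lambda>u. P (norm u) * C u)" "integral\<^sup>L lborel (\<lambda>u. P (norm u) * C u) = (\<Sum>i\<le>n. c i * V i)"
      using PC by (auto simp: has_bochner_integral_iff)
    have PWi: "integrable lborel (\<lambda>r. P r * W r)" "integral\<^sup>L lborel (\<lambda>r. P r * W r) = (\<Sum>i\<le>n. c i * V i)"
      using PW by (auto simp: has_bochner_integral_iff)
    have FCi: "integrable lborel (\<lambda>u. F (norm u) * C u)"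
      using Bochner_Integration.integrable_add[OF i1 PCi(1)] by simp
    have FWi: "integrable lborel (\<lambda>r. F r * W r)"
      using Bochner_Integration.integrable_add[OF i2 PWi(1)] by simp
    have "\<bar>(\<integral>u. F (norm u) * C u \<partial>lborel) - (\<Sum>i\<le>n. c i * V i)\<bar> \<le> e * I"
    proof -
      have "(\<integral>u. F (norm u) * C u \<partial>lborel) - (\<Sum>i\<le>n. c i * V i) = (\<integral>u. F (norm u) * C u - P (norm u) * C u \<partial>lborel)"
        unfolding PCi(2)[symmetric] by (rule Bochner_Integration.integral_diff[OF FCi PCi(1), symmetric])
      also have "\<bar>\<dots>\<bar> \<le> (\<integral>u. e * exp (- 1 * (norm u)\<^sup>2) \<partial>(lborel :: (real \<times> real \<times> real) measure))"
        unfolding real_norm_def[symmetric]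
      proof (rule Bochner_Integration.integral_norm_bound_integral[OF i1])
        show "integrable lborel (\<lambda>u :: real \<times> real \<times> real. e * exp (- 1 * (norm u)\<^sup>2))" using Ii by simp
      qed (rule d1)
      also have "\<dots> = e * I" by (simp add: I_def)
      finally show ?thesis .
    qed
    moreover have "\<bar>(\<integral>r. F r * W r \<partial>lborel) - (\<Sum>i\<le>n. c i * V i)\<bar> \<le> e * I'"
    proof -
      have "(\<integral>r. F r * W r \<partial>lborel) - (\<Sum>i\<le>n. c i * V i) = (\<integral>r. F r * W r - P r * W r \<partial>lborel)"
        unfolding PWi(2)[symmetric] by (rule Bochner_Integration.integral_diff[OF FWi PWi(1), symmetric])
      also have "\<bar>\<dots>\<bar> \<le> (\<integral>r. e * \<bar>exp (- 1 * r\<^sup>2) * W r\<bar> \<partial>lborel)"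
        unfolding real_norm_def[symmetric]
      proof (rule Bochner_Integration.integral_norm_bound_integral[OF i2])
        show "integrable lborel (\<lambda>r. e * norm (exp (- 1 * r\<^sup>2) * W r))" using gW[of 1] by (intro integrable_mult_right integrable_norm) simp
      qed (use d2 in simp)
      also have "\<dots> = e * I'" by (simp add: I'_def)
      finally show ?thesis .
    qed
    ultimately show ?thesis using FCi FWi by (simp add: distrib_left)
  qed
  from key[of 1] show "integrable lborel (\<lambda>u :: real \<times> real \<times> real. F (norm u) * cos (2 * pi * dot3 k u))"
    and "integrable lborel (\<lambda>r. indicator {0..} r *\<^sub>R (F r * (r * sker (rad3 k) r)))"
    unfolding FW C_def by auto
  have II: "I + I' \<ge> 0" unfolding I_def I'_def by (intro add_nonneg_nonneg Bochner_Integration.integral_nonneg) auto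
  have "\<bar>(\<integral>u. F (norm u) * C u \<partial>lborel) - (\<integral>r. F r * W r \<partial>lborel)\<bar> \<le> 0"
  proof (rule field_le_epsilon)
    fix \<epsilon> :: real assume \<epsilon>: "\<epsilon> > 0"
    define e where "e = \<epsilon> / (I + I' + 1)"
    have "e > 0" using \<epsilon> II by (simp add: e_def)
    then have "\<bar>(\<integral>u. F (norm u) * C u \<partial>lborel) - (\<integral>r. F r * W r \<partial>lborel)\<bar> \<le> e * (I + I')" using key by blast
    also have "\<dots> \<le> e * (I + I' + 1)" using \<open>e > 0\<close> by (intro mult_left_mono) auto
    also have "\<dots> = \<epsilon>" using II by (simp add: e_def)
    finally show "\<bar>(\<integral>u. F (norm u) * C u \<partial>lborel) - (\<integral>r. F r * W r \<partial>lborel)\<bar> \<le> 0 + \<epsilon>" by simp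
  qed
  then show "(\<integral>u. F (norm u) * cos (2 * pi * dot3 k u) \<partial>lborel) = half_int (\<lambda>r. F r * (r * sker (rad3 k) r))"
    unfolding half_int_def FW C_def by simp
qed

text \<open>The ball of radius \<open>T\<close> lies inside \<open>box3 B\<close>, so the
  coefficient over the box is the full Fourier transform.\<close>

lemma fhat3_radial:
  fixes F :: "real \<Rightarrow> real"
  assumes F: "continuous_on UNIV F" and T: "T > 0" "\<And>r. r \<ge> T \<Longrightarrow> F r = 0" and B: "T \<le> real B + 1/2"
  shows "fhat3 B (\<lambda>u. F (norm u)) k = integral {0..T} (\<lambda>r. F r * (r * sker (rad3 k) r))"
proof -
  have out: "F (norm u) = 0" if "u \<notin> box3 B" for u
  proof -
    obtain x y z where u: "u = (x, y, z)" by (metis prod.exhaust)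
    have "\<bar>x\<bar> > real B + 1/2 \<or> \<bar>y\<bar> > real B + 1/2 \<or> \<bar>z\<bar> > real B + 1/2"
      using that by (auto simp: box3_def u)
    moreover have "\<bar>x\<bar> \<le> norm u" "\<bar>y\<bar> \<le> norm u" "\<bar>z\<bar> \<le> norm u"
      using norm_fst_le[of x "(y, z)"] norm_snd_le[of "(y, z)" x] norm_fst_le[of y z] norm_snd_le[of z y] by (auto simp: u)
    ultimately have "norm u \<ge> T" using B by linarith
    then show ?thesis using T by simp
  qed
  note rf = radial_fourier[OF F T, of k]
  have "fhat3 B (\<lambda>u. F (norm u)) k = integral UNIV (\<lambda>u. if u \<in> box3 B then F (norm u) * cos (2 * pi * dot3 k u) else 0)"
    unfolding fhat3_def by (rule Henstock_Kurzweil_Integration.integral_restrict_UNIV[symmetric])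
  also have "\<dots> = integral UNIV (\<lambda>u. F (norm u) * cos (2 * pi * dot3 k u))"
    by (intro Henstock_Kurzweil_Integration.integral_cong) (use out in auto)
  also have "\<dots> = half_int (\<lambda>r. F r * (r * sker (rad3 k) r))"
    using integral_lborel[OF rf(1)] rf(3) by simp
  also have "\<dots> = integral UNIV (\<lambda>r. indicator {0..} r *\<^sub>R (F r * (r * sker (rad3 k) r)))"
    unfolding half_int_def by (rule integral_lborel[OF rf(2), symmetric])
  also have "\<dots> = integral UNIV (\<lambda>r. if r \<in> {0..T} then F r * (r * sker (rad3 k) r) else 0)"
    by (intro Henstock_Kurzweil_Integration.integral_cong) (use T in \<open>auto simp: indicator_def\<close>)
  also have "\<dots> = integral {0..T} (\<lambda>r. F r * (r * sker (rad3 k) r))"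
    by (rule Henstock_Kurzweil_Integration.integral_restrict_UNIV)
  finally show ?thesis .
qed

section \<open>The radial wave\<close>

text \<open>The cube makes the second derivative continuous at the ends of the support, so that the transforms decay like \<open>|\<xi>|\<^bsup>-3\<^esup>\<close>.\<close>

definition bump :: "real \<Rightarrow> real" where
  "bump u = (max 0 ((u - 1) * (2 - u))) ^ 3"

lemma bump_outside: "u \<le> 1 \<or> u \<ge> 2 \<Longrightarrow> bump u = 0"
  by (auto simp: bump_def max_def mult_le_0_iff zero_le_mult_iff intro: antisym)

lemma bump_inside: "u \<in> {1..2} \<Longrightarrow> bump u = ((u - 1) * (2 - u)) ^ 3"
  by (simp add: bump_def)

lemma bump_nonneg: "bump u \<ge> 0"
  by (simp add: bump_def)

lemma continuous_bump [continuous_intros]: "continuous_on S f \<Longrightarrow> continuous_on S (\<lambda>x. bump (f x))"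
  unfolding bump_def by (intro continuous_intros)

lemma bump_factor_bounds:
  assumes "u \<in> {1..2::real}"
  shows "0 \<le> (u - 1) * (2 - u)" "(u - 1) * (2 - u) \<le> 1" "\<bar>3 - 2 * u\<bar> \<le> 1"
proof -
  show "0 \<le> (u - 1) * (2 - u)" using assms by simp
  have "(u - 1) * (2 - u) \<le> 1 * 1" using assms by (intro mult_mono) auto
  then show "(u - 1) * (2 - u) \<le> 1" by simp
  show "\<bar>3 - 2 * u\<bar> \<le> 1" using assms by auto
qed

lemma bump_le_1: "bump u \<le> 1"
proof (cases "u \<in> {1..2}")
  case True
  then show ?thesis unfolding bump_inside[OF True] using bump_factor_bounds[OF True] by (intro power_le_one)
next
  case False
  then show ?thesis using bump_outside[of u] by auto
qed

text \<open>The functions \<open>bump1\<close>, \<open>bump2\<close>, \<open>bump3\<close> are the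
  successive derivatives of the polynomial branch, so they describe \<open>bump\<close> only on
  \<open>{1..2}\<close>.\<close>

definition bump1 :: "real \<Rightarrow> real" where
  "bump1 u = 3 * ((u - 1) * (2 - u))\<^sup>2 * (3 - 2 * u)"

definition bump2 :: "real \<Rightarrow> real" where
  "bump2 u = 6 * ((u - 1) * (2 - u)) * (3 - 2 * u)\<^sup>2 - 6 * ((u - 1) * (2 - u))\<^sup>2"

definition bump3 :: "real \<Rightarrow> real" where
  "bump3 u = 6 * (3 - 2 * u) ^ 3 - 36 * ((u - 1) * (2 - u)) * (3 - 2 * u)"

lemma bump_poly_deriv:
  "((\<lambda>u. ((u - 1) * (2 - u)) ^ 3) has_real_derivative bump1 u) (at u within S)"
  unfolding bump1_def by (auto intro!: derivative_eq_intros simp: algebra_simps power2_eq_square)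

lemma bump1_deriv: "(bump1 has_real_derivative bump2 u) (at u within S)"
  unfolding bump1_def bump2_def by (auto intro!: derivative_eq_intros simp: algebra_simps power2_eq_square)

lemma bump2_deriv: "(bump2 has_real_derivative bump3 u) (at u within S)"
  unfolding bump2_def bump3_def
  by (auto intro!: derivative_eq_intros simp: algebra_simps power2_eq_square power3_eq_cube)

lemma bump_deriv:
  assumes "u \<in> {1..2}"
  shows "(bump has_real_derivative bump1 u) (at u within {1..2})"
  by (rule has_field_derivative_transform_within[OF bump_poly_deriv zero_less_one assms])
    (simp add: bump_inside)

lemma bump_deriv_bounds:
  assumes "u \<in> {1..2}"
  shows "\<bar>bump1 u\<bar> \<le> 3" "\<bar>bump2 u\<bar> \<le> 12" "\<bar>bump3 u\<bar> \<le> 42"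
proof -
  define q w where "q = (u - 1) * (2 - u)" and "w = 3 - 2 * u"
  have q: "0 \<le> q" "q \<le> 1" and w: "\<bar>w\<bar> \<le> 1" using bump_factor_bounds[OF assms] by (auto simp: q_def w_def)
  have aq: "\<bar>q\<bar> \<le> 1" using q by simp
  have pq: "\<bar>q ^ n\<bar> \<le> 1" and pw: "\<bar>w ^ n\<bar> \<le> 1" for n using aq w by (auto simp: power_abs intro!: power_le_one)
  have m: "\<bar>x * y\<bar> \<le> 1" if "\<bar>x\<bar> \<le> 1" "\<bar>y\<bar> \<le> 1" for x y :: real
    using mult_mono[OF that] by (simp add: abs_mult)
  have "bump1 u = 3 * (q\<^sup>2 * w)" "bump2 u = 6 * (q * w\<^sup>2) - 6 * q\<^sup>2" "bump3 u = 6 * w ^ 3 - 36 * (q * w)"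
    by (simp_all add: bump1_def bump2_def bump3_def q_def w_def)
  then show "\<bar>bump1 u\<bar> \<le> 3" "\<bar>bump2 u\<bar> \<le> 12" "\<bar>bump3 u\<bar> \<le> 42"
    using m[OF pq[of 2] w] m[OF aq pw[of 2]] pq[of 2] pw[of 3] m[OF aq w] by linarith+
qed

lemma continuous_bump123: "continuous_on S bump1" "continuous_on S bump2" "continuous_on S bump3"
  unfolding bump1_def bump2_def bump3_def by (intro continuous_intros)+

section \<open>Decay of the transforms of the bump\<close>

lemma ibp_cos:
  fixes v v' :: "real \<Rightarrow> real"
  assumes v: "\<And>u. u \<in> {1..2} \<Longrightarrow> (v has_real_derivative v' u) (at u within {1..2})" "continuous_on {1..2} v'"
    and z: "v 1 = 0" "v 2 = 0" and w: "w \<noteq> 0"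
  shows "integral {1..2} (\<lambda>u. v u * cos (w * u)) = - integral {1..2} (\<lambda>u. v' u * sin (w * u)) / w"
proof -
  have vc: "continuous_on {1..2} v" by (rule DERIV_continuous_on[OF v(1)])
  have "((\<lambda>u. v' u * (sin (w * u) / w) + v u * cos (w * u)) has_integral (v 2 * (sin (w * 2) / w) - v 1 * (sin (w * 1) / w))) {1..2}"
  proof (rule fundamental_theorem_of_calculus)
    fix u :: real assume "u \<in> {1..2}"
    then show "((\<lambda>u. v u * (sin (w * u) / w)) has_vector_derivative (v' u * (sin (w * u) / w) + v u * cos (w * u))) (at u within {1..2})"
      unfolding has_real_derivative_iff_has_vector_derivative[symmetric]
      using w by (auto intro!: derivative_eq_intros v simp: field_simps)
  qed simp
  then have "integral {1..2} (\<lambda>u. v' u * (sin (w * u) / w) + v u * cos (w * u)) = 0" using z by (simp add: integral_unique)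
  moreover have "integral {1..2} (\<lambda>u. v' u * (sin (w * u) / w) + v u * cos (w * u))
     = integral {1..2} (\<lambda>u. v' u * (sin (w * u) / w)) + integral {1..2} (\<lambda>u. v u * cos (w * u))"
    using w by (intro integral_add integrable_continuous_interval continuous_intros vc v(2)) auto
  moreover have "integral {1..2} (\<lambda>u. v' u * (sin (w * u) / w)) = integral {1..2} (\<lambda>u. v' u * sin (w * u)) / w"
    by simp
  ultimately show ?thesis by simp
qed

lemma ibp_sin:
  fixes v v' :: "real \<Rightarrow> real"
  assumes v: "\<And>u. u \<in> {1..2} \<Longrightarrow> (v has_real_derivative v' u) (at u within {1..2})" "continuous_on {1..2} v'"
    and z: "v 1 = 0" "v 2 = 0" and w: "w \<noteq> 0"
  shows "integral {1..2} (\<lambda>u. v u * sin (w * u)) = integral {1..2} (\<lambda>u. v' u * cos (w * u)) / w"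
proof -
  have vc: "continuous_on {1..2} v" by (rule DERIV_continuous_on[OF v(1)])
  have "((\<lambda>u. v' u * (- cos (w * u) / w) + v u * sin (w * u)) has_integral (v 2 * (- cos (w * 2) / w) - v 1 * (- cos (w * 1) / w))) {1..2}"
  proof (rule fundamental_theorem_of_calculus)
    fix u :: real assume "u \<in> {1..2}"
    then show "((\<lambda>u. v u * (- cos (w * u) / w)) has_vector_derivative (v' u * (- cos (w * u) / w) + v u * sin (w * u))) (at u within {1..2})"
      unfolding has_real_derivative_iff_has_vector_derivative[symmetric]
      using w by (auto intro!: derivative_eq_intros v simp: field_simps)
  qed simp
  then have "integral {1..2} (\<lambda>u. v' u * (- cos (w * u) / w) + v u * sin (w * u)) = 0" using z by (simp add: integral_unique)
  moreover have "integral {1..2} (\<lambda>u. v' u * (- cos (w * u) / w) + v u * sin (w * u))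
     = integral {1..2} (\<lambda>u. v' u * (- cos (w * u) / w)) + integral {1..2} (\<lambda>u. v u * sin (w * u))"
    using w by (intro integral_add integrable_continuous_interval continuous_intros vc v(2)) auto
  moreover have "integral {1..2} (\<lambda>u. v' u * (- cos (w * u) / w)) = - integral {1..2} (\<lambda>u. v' u * cos (w * u)) / w"
    by simp
  ultimately show ?thesis by simp
qed

text \<open>Its value at 0, the mass of the bump, is the constant of the resonance; away from 0 it
  measures how strongly a detuned shell contributes.\<close>

definition bump_cos :: "real \<Rightarrow> real" where
  "bump_cos \<xi> = integral {1..2} (\<lambda>u. bump u * cos (2 * pi * \<xi> * u))"

definition bump_usin :: "real \<Rightarrow> real" where
  "bump_usin \<xi> = integral {1..2} (\<lambda>u. u * bump u * sin (2 * pi * \<xi> * u))"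

lemma abs_integral_le_unit:
  fixes f :: "real \<Rightarrow> real"
  assumes "continuous_on {1..2} f" "\<And>u. u \<in> {1..2} \<Longrightarrow> \<bar>f u\<bar> \<le> K"
  shows "\<bar>integral {1..2} f\<bar> \<le> K"
  using integral_bound[of 1 2 f K] assms by simp

lemma bump_cos_eq2:
  assumes "\<xi> \<noteq> 0"
  shows "bump_cos \<xi> = - integral {1..2} (\<lambda>u. bump2 u * cos (2 * pi * \<xi> * u)) / (2 * pi * \<xi>)\<^sup>2"
proof -
  define w where "w = 2 * pi * \<xi>"
  have w: "w \<noteq> 0" using assms by (simp add: w_def)
  have "bump_cos \<xi> = - integral {1..2} (\<lambda>u. bump1 u * sin (w * u)) / w"
    unfolding bump_cos_def w_def[symmetric]
    by (intro ibp_cos bump_deriv continuous_bump123 w) (auto simp: bump_outside)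
  also have "integral {1..2} (\<lambda>u. bump1 u * sin (w * u)) = integral {1..2} (\<lambda>u. bump2 u * cos (w * u)) / w"
    by (intro ibp_sin bump1_deriv continuous_bump123 w) (auto simp: bump1_def)
  finally show ?thesis by (simp add: w_def power2_eq_square)
qed

text \<open>Two integrations by parts, whose boundary terms vanish because \<open>bump\<close> and
  \<open>bump1\<close> are 0 at 1 and 2. The constant is enlarged from 12 to 42 to match the cubic
  bound.\<close>

lemma bump_cos_bound2:
  assumes "\<xi> \<noteq> 0"
  shows "\<bar>bump_cos \<xi>\<bar> \<le> 42 / \<xi>\<^sup>2"
proof -
  have "\<bar>integral {1..2} (\<lambda>u. bump2 u * cos (2 * pi * \<xi> * u))\<bar> \<le> 12"
  proof (rule abs_integral_le_unit)
    show "continuous_on {1..2} (\<lambda>u. bump2 u * cos (2 * pi * \<xi> * u))" by (intro continuous_intros continuous_bump123)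
    fix u :: real assume "u \<in> {1..2}"
    then have "\<bar>bump2 u\<bar> * \<bar>cos (2 * pi * \<xi> * u)\<bar> \<le> 12 * 1" by (intro mult_mono bump_deriv_bounds) auto
    then show "\<bar>bump2 u * cos (2 * pi * \<xi> * u)\<bar> \<le> 12" by (simp add: abs_mult)
  qed
  then have "\<bar>bump_cos \<xi>\<bar> \<le> 12 / (2 * pi * \<xi>)\<^sup>2"
    unfolding bump_cos_eq2[OF assms] by (simp add: divide_right_mono)
  also have "\<dots> \<le> 42 / \<xi>\<^sup>2"
  proof (rule frac_le)
    have "1\<^sup>2 \<le> (2 * pi)\<^sup>2" using pi_ge_two by (intro power_mono) auto
    then have "1 * \<xi>\<^sup>2 \<le> (2 * pi)\<^sup>2 * \<xi>\<^sup>2" by (intro mult_right_mono) auto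
    then show "\<xi>\<^sup>2 \<le> (2 * pi * \<xi>)\<^sup>2" by (simp add: power_mult_distrib)
  qed (use assms in auto)
  finally show ?thesis .
qed

text \<open>A third integration by parts is possible because \<open>bump2\<close> still vanishes at
  both ends; \<open>bump3\<close> does not, and there the process stops.\<close>

lemma bump_cos_bound3:
  assumes "\<xi> \<noteq> 0"
  shows "\<bar>bump_cos \<xi>\<bar> \<le> 42 / \<bar>\<xi>\<bar> ^ 3"
proof -
  define w where "w = 2 * pi * \<xi>"
  have w: "w \<noteq> 0" using assms by (simp add: w_def)
  have "integral {1..2} (\<lambda>u. bump2 u * cos (w * u)) = - integral {1..2} (\<lambda>u. bump3 u * sin (w * u)) / w"
    by (intro ibp_cos bump2_deriv continuous_bump123 w) (auto simp: bump2_def)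
  then have eq: "\<bar>bump_cos \<xi>\<bar> = \<bar>integral {1..2} (\<lambda>u. bump3 u * sin (w * u))\<bar> / \<bar>w\<bar> ^ 3"
    unfolding bump_cos_eq2[OF assms] w_def[symmetric]
    by (simp add: abs_mult abs_divide power3_eq_cube power2_eq_square)
  have "\<bar>integral {1..2} (\<lambda>u. bump3 u * sin (w * u))\<bar> \<le> 42"
  proof (rule abs_integral_le_unit)
    show "continuous_on {1..2} (\<lambda>u. bump3 u * sin (w * u))" by (intro continuous_intros continuous_bump123)
    fix u :: real assume "u \<in> {1..2}"
    then have "\<bar>bump3 u\<bar> * \<bar>sin (w * u)\<bar> \<le> 42 * 1" by (intro mult_mono bump_deriv_bounds) auto
    then show "\<bar>bump3 u * sin (w * u)\<bar> \<le> 42" by (simp add: abs_mult)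
  qed
  then have "\<bar>bump_cos \<xi>\<bar> \<le> 42 / \<bar>w\<bar> ^ 3" unfolding eq by (intro divide_right_mono) auto
  also have "\<dots> \<le> 42 / \<bar>\<xi>\<bar> ^ 3"
  proof (rule divide_left_mono)
    have "1 * \<bar>\<xi>\<bar> \<le> (2 * pi) * \<bar>\<xi>\<bar>" using pi_ge_two by (intro mult_right_mono) auto
    then have "\<bar>\<xi>\<bar> \<le> \<bar>w\<bar>" by (simp add: w_def abs_mult)
    then show "\<bar>\<xi>\<bar> ^ 3 \<le> \<bar>w\<bar> ^ 3" by (intro power_mono) auto
  qed (use assms w in auto)
  finally show ?thesis .
qed

lemma bump_usin_bound:
  assumes "\<xi> \<noteq> 0"
  shows "\<bar>bump_usin \<xi>\<bar> \<le> 30 / \<xi>\<^sup>2"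
proof -
  define w where "w = 2 * pi * \<xi>"
  have w: "w \<noteq> 0" using assms by (simp add: w_def)
  define v1 v2 where "v1 u = bump u + u * bump1 u" and "v2 u = bump1 u + (bump1 u + u * bump2 u)" for u
  have "bump_usin \<xi> = integral {1..2} (\<lambda>u. v1 u * cos (w * u)) / w"
    unfolding bump_usin_def w_def[symmetric]
  proof (rule ibp_sin[OF _ _ _ _ w])
    show "((\<lambda>u. u * bump u) has_real_derivative v1 u) (at u within {1..2})" if "u \<in> {1..2}" for u
      unfolding v1_def using that by (auto intro!: derivative_eq_intros bump_deriv)
    show "continuous_on {1..2} v1" unfolding v1_def by (intro continuous_intros continuous_bump123)
  qed (auto simp: bump_outside)
  also have "integral {1..2} (\<lambda>u. v1 u * cos (w * u)) = - integral {1..2} (\<lambda>u. v2 u * sin (w * u)) / w"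
  proof (rule ibp_cos[OF _ _ _ _ w])
    show "(v1 has_real_derivative v2 u) (at u within {1..2})" if "u \<in> {1..2}" for u
      unfolding v1_def v2_def using that by (auto intro!: derivative_eq_intros bump_deriv bump1_deriv)
    show "continuous_on {1..2} v2" unfolding v2_def by (intro continuous_intros continuous_bump123)
  qed (auto simp: v1_def bump_outside bump1_def)
  finally have eq: "\<bar>bump_usin \<xi>\<bar> = \<bar>integral {1..2} (\<lambda>u. v2 u * sin (w * u))\<bar> / w\<^sup>2"
    by (simp add: abs_divide power2_eq_square)
  have "\<bar>integral {1..2} (\<lambda>u. v2 u * sin (w * u))\<bar> \<le> 30"
  proof (rule abs_integral_le_unit)
    show "continuous_on {1..2} (\<lambda>u. v2 u * sin (w * u))" unfolding v2_def by (intro continuous_intros continuous_bump123)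
    fix u :: real assume u: "u \<in> {1..2}"
    \<comment> \<open>With \<open>u \<le> 2\<close> the second derivative of
      \<open>u * bump u\<close> is at most \<open>2 * 3 + 2 * 12 = 30\<close>.\<close>
    have "\<bar>u * bump2 u\<bar> \<le> 2 * 12" unfolding abs_mult using u bump_deriv_bounds[OF u] by (intro mult_mono) auto
    then have "\<bar>v2 u\<bar> \<le> 30" unfolding v2_def using bump_deriv_bounds[OF u] by linarith
    then have "\<bar>v2 u\<bar> * \<bar>sin (w * u)\<bar> \<le> 30 * 1" by (intro mult_mono) auto
    then show "\<bar>v2 u * sin (w * u)\<bar> \<le> 30" by (simp add: abs_mult)
  qed
  then have "\<bar>bump_usin \<xi>\<bar> \<le> 30 / w\<^sup>2" unfolding eq by (intro divide_right_mono) auto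
  also have "\<dots> \<le> 30 / \<xi>\<^sup>2"
  proof (rule divide_left_mono)
    have "1 * \<bar>\<xi>\<bar> \<le> (2 * pi) * \<bar>\<xi>\<bar>" using pi_ge_two by (intro mult_right_mono) auto
    then have "\<bar>\<xi>\<bar> \<le> \<bar>w\<bar>" by (simp add: w_def abs_mult)
    then show "\<xi>\<^sup>2 \<le> w\<^sup>2" by (simp add: abs_le_square_iff)
  qed (use assms w in auto)
  finally show ?thesis .
qed

lemma bump_cos_0_pos: "bump_cos 0 > 0"
proof -
  have int: "bump integrable_on {a..b}" for a b
    by (intro integrable_continuous_interval continuous_bump continuous_on_id)
  have "0 < (3/16 :: real) ^ 3 * (1/2)" by simp
  also have "\<dots> = integral {5/4..7/4} (\<lambda>u::real. (3/16 :: real) ^ 3)" by simp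
  also have "\<dots> \<le> integral {5/4..7/4} bump"
  proof (rule integral_le[OF _ int])
    fix u :: real assume u: "u \<in> {5/4..7/4}"
    \<comment> \<open>\<open>3/16\<close> is the value of \<open>(u - 1) * (2 - u)\<close> at both
      ends of the middle half, where this concave function is smallest.\<close>
    have "0 \<le> (u - 5/4) * (7/4 - u)" using u by simp
    then have "3/16 \<le> (u - 1) * (2 - u)" by (simp add: algebra_simps)
    then show "(3/16) ^ 3 \<le> bump u" unfolding bump_def by (intro power_mono) auto
  qed auto
  also have "\<dots> \<le> integral {1..2} bump"
    by (intro integral_subset_le int) (auto simp: bump_nonneg)
  finally show ?thesis by (simp add: bump_cos_def)
qed

text \<open>The factor \<open>1 / r\<close> cancels one of the factors \<open>r\<close> that the
  radial Fourier formula carries in dimension three, so the transform reduces to one-dimensional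
  cosine transforms of \<open>bump\<close>.\<close>

definition wave :: "real \<Rightarrow> real \<Rightarrow> real \<Rightarrow> real" where
  "wave A R r = bump (r / R) * sin (2 * pi * A * r) / r"

lemma wave_zero: "R > 0 \<Longrightarrow> r \<le> R \<or> r \<ge> 2 * R \<Longrightarrow> wave A R r = 0"
  by (auto simp: wave_def bump_outside field_simps)

definition wave_deriv :: "real \<Rightarrow> real \<Rightarrow> real \<Rightarrow> real" where
  "wave_deriv A R r = bump (r / R) * (2 * pi * A * cos (2 * pi * A * r)) / r
      + (bump1 (r / R) / R / r - bump (r / R) / r\<^sup>2) * sin (2 * pi * A * r)"

lemma wave_deriv:
  assumes R: "R > 0" and r: "r \<in> {R..2 * R}"
  shows "(wave A R has_real_derivative wave_deriv A R r) (at r within {R..2 * R})"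
proof -
  have "r / R \<in> {1..2}" using R r by (simp add: field_simps)
  have img: "(\<lambda>r. r / R) ` {R..2 * R} \<subseteq> {1..2}" using R by (auto simp: field_simps)
  have "((\<lambda>r. r / R) has_real_derivative 1 / R) (at r within {R..2 * R})"
    using R by (auto intro!: derivative_eq_intros)
  moreover have "(bump has_real_derivative bump1 (r / R)) (at (r / R) within (\<lambda>r. r / R) ` {R..2 * R})"
    by (rule DERIV_subset[OF bump_deriv[OF \<open>r / R \<in> {1..2}\<close>] img])
  ultimately have b: "((\<lambda>r. bump (r / R)) has_real_derivative bump1 (r / R) * (1 / R)) (at r within {R..2 * R})"
    by (rule DERIV_image_chain[unfolded o_def, rotated])
  have r0: "r \<noteq> 0" using R r by auto
  have s: "((\<lambda>r. sin (2 * pi * A * r)) has_real_derivative cos (2 * pi * A * r) * (2 * pi * A)) (at r within {R..2 * R})"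
    by (auto intro!: derivative_eq_intros)
  show ?thesis
    unfolding wave_def
    by (rule DERIV_cong[OF DERIV_divide[OF DERIV_mult[OF b s] DERIV_ident r0]])
      (use r0 R in \<open>simp add: wave_deriv_def field_simps power2_eq_square\<close>)
qed

lemma wave_lipschitz:
  assumes R: "R > 0"
  shows "\<exists>L\<ge>0. \<forall>r s. \<bar>wave A R r - wave A R s\<bar> \<le> L * \<bar>r - s\<bar>"
proof -
  have "continuous_on {R..2 * R} (wave_deriv A R)"
    unfolding wave_deriv_def using R
    by (intro continuous_intros continuous_on_compose2[OF continuous_bump123(1)[of UNIV]]) auto
  then have "bounded (wave_deriv A R ` {R..2 * R})" by (intro compact_imp_bounded compact_continuous_image) auto
  then obtain L where L: "L > 0" "\<And>r. r \<in> {R..2 * R} \<Longrightarrow> \<bar>wave_deriv A R r\<bar> \<le> L"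
    unfolding bounded_pos by auto
  \<comment> \<open>Clamping to the support does not change the wave and does not increase
    distances, so a derivative bound on \<open>{R..2 * R}\<close> gives a global Lipschitz
    constant.\<close>
  define cl where "cl r = max R (min r (2 * R))" for r
  have cl: "cl r \<in> {R..2 * R}" "wave A R r = wave A R (cl r)" for r
    using R wave_zero[OF R, of r A] wave_zero[OF R, of R A] wave_zero[OF R, of "2 * R" A] by (auto simp: cl_def max_def min_def)
  have "\<bar>wave A R r - wave A R s\<bar> \<le> L * \<bar>r - s\<bar>" for r s
  proof -
    have "\<bar>wave A R (cl r) - wave A R (cl s)\<bar> \<le> L * \<bar>cl r - cl s\<bar>"
      using field_differentiable_bound[of "{R..2 * R}" "wave A R" "wave_deriv A R" L "cl r" "cl s"] wave_deriv[OF R] L cl by simp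
    also have "\<dots> \<le> L * \<bar>r - s\<bar>" using L by (intro mult_left_mono) (auto simp: cl_def)
    finally show ?thesis using cl(2) by metis
  qed
  then show ?thesis using L by (intro exI[of _ L]) auto
qed

text \<open>After the substitution \<open>r = R / d * u\<close> the kernel \<open>sker\<close>
  contributes a second sine, and the product of sines becomes a difference of cosines with
  frequencies \<open>R * (rad3 k / d - A)\<close> and \<open>R * (rad3 k / d + A)\<close>. The first
  is 0 exactly on the shell \<open>rad3 k = A * d\<close>. At \<open>k = 0\<close> the kernel is
  linear and leaves \<open>bump_usin\<close>.\<close>

lemma fhat3_wave:
  fixes d :: real
  assumes R: "R > 0" and d: "d > 0" and B: "2 * R / d \<le> real B + 1/2"
  shows "rad3 k \<noteq> 0 \<Longrightarrow> fhat3 B (\<lambda>u. wave A R (d * norm u)) k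
      = R / (rad3 k * d\<^sup>2) * (bump_cos (R * (rad3 k / d - A)) - bump_cos (R * (rad3 k / d + A)))"
    and "rad3 k = 0 \<Longrightarrow> fhat3 B (\<lambda>u. wave A R (d * norm u)) k = 4 * pi * R\<^sup>2 / d ^ 3 * bump_usin (A * R)"
proof -
  define \<rho> where "\<rho> = rad3 k"
  define F where "F r = wave A R (d * r)" for r
  define T where "T = 2 * R / d"
  have T: "T > 0" using R d by (simp add: T_def)
  obtain L where L: "L \<ge> 0" "\<And>r s. \<bar>wave A R r - wave A R s\<bar> \<le> L * \<bar>r - s\<bar>" using wave_lipschitz[OF R] by blast
  have wc: "continuous_on UNIV (wave A R)" by (rule continuous_of_lipschitz[OF L(2) L(1)])
  have Fc: "continuous_on S F" for S
    unfolding F_def by (intro continuous_on_compose2[OF wc] continuous_intros) auto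
  have FT: "F r = 0" if "r \<ge> T" for r
    using that R d by (intro wave_zero[OF R, of "d * r" A, folded F_def]) (auto simp: T_def field_simps)
  have "fhat3 B (\<lambda>u. F (norm u)) k = integral {0..T} (\<lambda>r. F r * (r * sker \<rho> r))"
    unfolding \<rho>_def using B by (intro fhat3_radial Fc T FT) (auto simp: T_def)
  also have "\<dots> = integral {0..2} (\<lambda>u. (R / d) * (F (R / d * u) * (R / d * u * sker \<rho> (R / d * u))))"
  proof -
    have "((\<lambda>u. (R / d) *\<^sub>R (\<lambda>r. F r * (r * sker \<rho> r)) (R / d * u)) has_integral (integral {R / d * 0..R / d * 2} (\<lambda>r. F r * (r * sker \<rho> r)))) {0..2}"
    proof (rule has_integral_substitution[of _ _ _ 0 T])
      show "continuous_on {0..T} (\<lambda>r. F r * (r * sker \<rho> r))" by (intro continuous_intros Fc continuous_sker)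
      show "(\<lambda>u. R / d * u) ` {0..2} \<subseteq> {0..T}" using R d by (auto simp: T_def field_simps)
      show "((\<lambda>u. R / d * u) has_real_derivative R / d) (at u within {0..2})" for u
        by (rule DERIV_cmult_Id)
    qed (use R d in auto)
    from integral_unique[OF this] show ?thesis by (simp add: T_def mult.commute)
  qed
  also have "\<dots> = integral {0..2} (\<lambda>u. if u \<in> {1..2} then (R / d\<^sup>2) * (bump u * (sin (2 * pi * (A * R) * u) * sker \<rho> (R / d * u))) else 0)"
  proof (rule Henstock_Kurzweil_Integration.integral_cong)
    fix u :: real assume u: "u \<in> {0..2}"
    have "R / d * u * F (R / d * u) = bump u * sin (2 * pi * (A * R) * u) / d" if "u > 0"
      using R d that by (simp add: F_def wave_def field_simps)
    moreover have "bump u = 0" if "u < 1" using bump_outside[of u] that by simp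
    ultimately show "(R / d) * (F (R / d * u) * (R / d * u * sker \<rho> (R / d * u)))
       = (if u \<in> {1..2} then (R / d\<^sup>2) * (bump u * (sin (2 * pi * (A * R) * u) * sker \<rho> (R / d * u))) else 0)"
      using u R d by (cases "u = 0") (auto simp: field_simps power2_eq_square F_def wave_def)
  qed
  also have "\<dots> = integral {1..2} (\<lambda>u. (R / d\<^sup>2) * (bump u * (sin (2 * pi * (A * R) * u) * sker \<rho> (R / d * u))))"
    by (subst Henstock_Kurzweil_Integration.integral_restrict_Int) simp
  finally have eq: "fhat3 B (\<lambda>u. wave A R (d * norm u)) k
     = R / d\<^sup>2 * integral {1..2} (\<lambda>u. bump u * (sin (2 * pi * (A * R) * u) * sker \<rho> (R / d * u)))"
    by (simp add: F_def)
  show "fhat3 B (\<lambda>u. wave A R (d * norm u)) k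
      = R / (rad3 k * d\<^sup>2) * (bump_cos (R * (rad3 k / d - A)) - bump_cos (R * (rad3 k / d + A)))" if "rad3 k \<noteq> 0"
  proof -
    have \<rho>: "\<rho> \<noteq> 0" using that by (simp add: \<rho>_def)
    have "integral {1..2} (\<lambda>u. bump u * (sin (2 * pi * (A * R) * u) * sker \<rho> (R / d * u)))
      = integral {1..2} (\<lambda>u. (1 / \<rho>) * (bump u * cos (2 * pi * (R * (\<rho> / d - A)) * u) - bump u * cos (2 * pi * (R * (\<rho> / d + A)) * u)))"
    proof (rule Henstock_Kurzweil_Integration.integral_cong)
      fix u :: real
      have "2 * (sin x * sin y) = cos (y - x) - cos (y + x)" for x y :: real by (simp add: cos_diff cos_add)
      note this[of "2 * pi * (A * R) * u" "2 * pi * \<rho> * (R / d * u)"]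
      moreover have "2 * pi * \<rho> * (R / d * u) - 2 * pi * (A * R) * u = 2 * pi * (R * (\<rho> / d - A)) * u"
        "2 * pi * \<rho> * (R / d * u) + 2 * pi * (A * R) * u = 2 * pi * (R * (\<rho> / d + A)) * u"
        by (simp_all add: algebra_simps)
      ultimately have e: "2 * (sin (2 * pi * (A * R) * u) * sin (2 * pi * \<rho> * (R / d * u)))
         = cos (2 * pi * (R * (\<rho> / d - A)) * u) - cos (2 * pi * (R * (\<rho> / d + A)) * u)" by simp
      have "bump u * (sin (2 * pi * (A * R) * u) * sker \<rho> (R / d * u))
        = (1 / \<rho>) * (bump u * (2 * (sin (2 * pi * (A * R) * u) * sin (2 * pi * \<rho> * (R / d * u)))))"
        using \<rho> by (simp add: sker_def)
      then show "bump u * (sin (2 * pi * (A * R) * u) * sker \<rho> (R / d * u))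
        = (1 / \<rho>) * (bump u * cos (2 * pi * (R * (\<rho> / d - A)) * u) - bump u * cos (2 * pi * (R * (\<rho> / d + A)) * u))"
        unfolding e by (simp only: right_diff_distrib)
    qed
    also have "\<dots> = (1 / \<rho>) * (bump_cos (R * (\<rho> / d - A)) - bump_cos (R * (\<rho> / d + A)))"
      unfolding bump_cos_def integral_mult_right
      by (subst integral_diff) (auto intro!: integrable_continuous_interval continuous_intros)
    finally show ?thesis unfolding eq \<rho>_def[symmetric] by simp
  qed
  show "fhat3 B (\<lambda>u. wave A R (d * norm u)) k = 4 * pi * R\<^sup>2 / d ^ 3 * bump_usin (A * R)" if "rad3 k = 0"
  proof -
    have "integral {1..2} (\<lambda>u. bump u * (sin (2 * pi * (A * R) * u) * sker \<rho> (R / d * u)))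
      = integral {1..2} (\<lambda>u. (4 * pi * R / d) * (u * bump u * sin (2 * pi * (A * R) * u)))"
      using that by (intro Henstock_Kurzweil_Integration.integral_cong) (simp add: sker_def \<rho>_def)
    also have "\<dots> = (4 * pi * R / d) * bump_usin (A * R)" unfolding bump_usin_def integral_mult_right ..
    finally show ?thesis unfolding eq by (simp add: power2_eq_square power3_eq_cube)
  qed
qed

section \<open>Lattice sums of the wave\<close>

lemma rad3_eq: "rad3 k = sqrt (real_of_int (nsq k))"
proof -
  have "(rad3 k)\<^sup>2 = real_of_int (nsq k)" unfolding rad3_sq nsq_def by simp
  then show ?thesis by (metis norm_ge_zero rad3_def real_sqrt_unique)
qed

text \<open>Uniform in the centre \<open>v\<close>: the two sides of \<open>v\<close> are each
  shifted to a subset of the positive integers.\<close>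

lemma sum_inverse_square_shift:
  "\<exists>G\<ge>0. \<forall>S v. finite S \<longrightarrow> v \<notin> S \<longrightarrow> (\<Sum>n\<in>S. 1 / (real n - real v)\<^sup>2) \<le> G"
proof -
  obtain G where G: "G \<ge> 0" "\<And>A. finite A \<Longrightarrow> (\<Sum>a\<in>A. real a powr (- 1 - 1)) \<le> G"
    using sum_powr_bounded[of 1] by auto
  have "(\<Sum>n\<in>S. 1 / (real n - real v)\<^sup>2) \<le> 2 * G" if S: "finite S" "v \<notin> S" for S v
  proof -
    define S1 S2 where "S1 = {n\<in>S. n < v}" and "S2 = {n\<in>S. n > v}"
    have "S = S1 \<union> S2" "S1 \<inter> S2 = {}" "finite S1" "finite S2" using S unfolding S1_def S2_def by (auto, metis linorder_neqE_nat)
    then have "(\<Sum>n\<in>S. 1 / (real n - real v)\<^sup>2) = (\<Sum>n\<in>S1. 1 / (real n - real v)\<^sup>2) + (\<Sum>n\<in>S2. 1 / (real n - real v)\<^sup>2)"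
      by (simp add: sum.union_disjoint)
    also have "(\<Sum>n\<in>S1. 1 / (real n - real v)\<^sup>2) = (\<Sum>j\<in>(\<lambda>n. v - n) ` S1. real j powr (- 1 - 1))"
    proof -
      have "inj_on (\<lambda>n. v - n) S1" by (auto simp: inj_on_def S1_def)
      then have "(\<Sum>j\<in>(\<lambda>n. v - n) ` S1. real j powr (- 1 - 1)) = (\<Sum>n\<in>S1. real (v - n) powr (- 1 - 1))" by (simp add: sum.reindex)
      also have "\<dots> = (\<Sum>n\<in>S1. 1 / (real n - real v)\<^sup>2)"
        by (intro sum.cong) (auto simp: S1_def of_nat_diff powr_minus powr_numeral inverse_eq_divide power2_commute)
      finally show ?thesis by simp
    qed
    also have "(\<Sum>n\<in>S2. 1 / (real n - real v)\<^sup>2) = (\<Sum>j\<in>(\<lambda>n. n - v) ` S2. real j powr (- 1 - 1))"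
    proof -
      have "inj_on (\<lambda>n. n - v) S2" by (auto simp: inj_on_def S2_def)
      then have "(\<Sum>j\<in>(\<lambda>n. n - v) ` S2. real j powr (- 1 - 1)) = (\<Sum>n\<in>S2. real (n - v) powr (- 1 - 1))" by (simp add: sum.reindex)
      also have "\<dots> = (\<Sum>n\<in>S2. 1 / (real n - real v)\<^sup>2)"
        by (intro sum.cong) (auto simp: S2_def of_nat_diff powr_minus powr_numeral inverse_eq_divide)
      finally show ?thesis by simp
    qed
    finally show ?thesis using G(2)[of "(\<lambda>n. v - n) ` S1"] G(2)[of "(\<lambda>n. n - v) ` S2"] \<open>finite S1\<close> \<open>finite S2\<close> by simp
  qed
  then show ?thesis using G(1) by (intro exI[of _ "2 * G"]) auto
qed

lemma sum_over_shells_le: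
  fixes \<Theta> :: "nat \<Rightarrow> real"
  assumes "finite K" "\<And>n. \<Theta> n \<ge> 0"
  shows "(\<Sum>k\<in>K. \<Theta> (nat (nsq k))) \<le> (\<Sum>n\<in>(\<lambda>k. nat (nsq k)) ` K. real (r3 n) * \<Theta> n)"
proof -
  have "(\<Sum>k\<in>K. \<Theta> (nat (nsq k))) = (\<Sum>n\<in>(\<lambda>k. nat (nsq k)) ` K. \<Sum>k\<in>{k\<in>K. nat (nsq k) = n}. \<Theta> (nat (nsq k)))"
    by (rule sum.image_gen[OF assms(1)])
  also have "\<dots> \<le> (\<Sum>n\<in>(\<lambda>k. nat (nsq k)) ` K. real (r3 n) * \<Theta> n)"
  proof (rule sum_mono)
    fix n
    have "(\<Sum>k\<in>{k\<in>K. nat (nsq k) = n}. \<Theta> (nat (nsq k))) = real (card {k\<in>K. nat (nsq k) = n}) * \<Theta> n" by simp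
    also have "\<dots> \<le> real (r3 n) * \<Theta> n"
    proof (intro mult_right_mono of_nat_mono assms(2))
      show "card {k\<in>K. nat (nsq k) = n} \<le> r3 n"
        unfolding r3_def using nsq_nonneg by (intro card_mono finite_nsq_eq) auto
    qed
    finally show "(\<Sum>k\<in>{k\<in>K. nat (nsq k) = n}. \<Theta> (nat (nsq k))) \<le> real (r3 n) * \<Theta> n" .
  qed
  finally show ?thesis .
qed

lemma bump_cos_diff_bounds:
  assumes "x \<noteq> 0" "\<bar>x\<bar> \<le> \<bar>y\<bar>"
  shows "\<bar>bump_cos x - bump_cos y\<bar> \<le> 84 / x\<^sup>2" "\<bar>bump_cos x - bump_cos y\<bar> \<le> 84 / \<bar>x\<bar> ^ 3"
proof -
  have y: "y \<noteq> 0" using assms by auto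
  have "x\<^sup>2 \<le> y\<^sup>2" "\<bar>x\<bar> ^ 3 \<le> \<bar>y\<bar> ^ 3" using assms by (auto simp: abs_le_square_iff intro!: power_mono)
  then have "42 / y\<^sup>2 \<le> 42 / x\<^sup>2" "42 / \<bar>y\<bar> ^ 3 \<le> 42 / \<bar>x\<bar> ^ 3" using assms y by (auto intro!: divide_left_mono mult_pos_pos)
  then show "\<bar>bump_cos x - bump_cos y\<bar> \<le> 84 / x\<^sup>2" "\<bar>bump_cos x - bump_cos y\<bar> \<le> 84 / \<bar>x\<bar> ^ 3"
    using bump_cos_bound2[OF assms(1)] bump_cos_bound2[OF y] bump_cos_bound3[OF assms(1)] bump_cos_bound3[OF y] by linarith+
qed

text \<open>Poisson summation with the shell of squared radius \<open>v2 = n0 * d^2\<close> as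
  exceptional set; it carries the main term. The remaining shells are bounded by absolute values,
  through the decay of \<open>bump_cos\<close> and the bound on \<open>r3\<close>.\<close>

lemma wave_lattice_sum:
  "\<exists>C\<ge>0. \<forall>R\<ge>1. \<forall>n0\<ge>1. \<forall>d\<ge>1. \<forall>B. 2 * R / real d \<le> real B + 1/2 \<longrightarrow>
     \<bar>(\<Sum>v\<in>cube3 B. wave (sqrt (real n0)) R (real d * rad3 v)) - R * bump_cos 0 * real (r3 (n0 * d\<^sup>2)) / (sqrt (real n0) * real d ^ 3)\<bar>
       \<le> C * (1 + (sqrt (real n0) * real d) powr (8/3) / R)"
proof -
  obtain C3 where C3: "C3 \<ge> 1" "\<And>n. n \<ge> 1 \<Longrightarrow> real (r3 n) \<le> C3 * real n powr (5/6)" using r3_bound by blast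
  obtain G2 where G2: "G2 \<ge> 0" "\<And>S v. finite S \<Longrightarrow> v \<notin> S \<Longrightarrow> (\<Sum>n\<in>S. 1 / (real n - real v)\<^sup>2) \<le> G2"
    using sum_inverse_square_shift by blast
  obtain G7 where G7: "G7 \<ge> 0" "\<And>S. finite S \<Longrightarrow> (\<Sum>n\<in>S. real n powr (- 1 - 1/6)) \<le> G7"
    using sum_powr_bounded[of "1/6"] by auto
  \<comment> \<open>\<open>120 * pi\<close> bounds the zero frequency, the middle term the other
    nonresonant shells, and \<open>42 * C3\<close> the second cosine on the resonant shell.\<close>
  define C where "C = 120 * pi + 1512 * C3 * (G2 + G7) + 42 * C3"
  have C0: "C \<ge> 0" using C3 G2 G7 by (simp add: C_def)
  have "\<bar>(\<Sum>v\<in>cube3 B. wave (sqrt (real n0)) R (real d * rad3 v)) - R * bump_cos 0 * real (r3 (n0 * d\<^sup>2)) / (sqrt (real n0) * real d ^ 3)\<bar>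
       \<le> C * (1 + (sqrt (real n0) * real d) powr (8/3) / R)"
    if R: "R \<ge> 1" and n0: "n0 \<ge> 1" and d: "d \<ge> 1" and B: "2 * R / real d \<le> real B + 1/2" for R :: real and n0 d B :: nat
  proof -
    define A where "A = sqrt (real n0)"
    define v where "v = A * real d"
    define v2 where "v2 = n0 * d\<^sup>2"
    have A1: "A \<ge> 1" using n0 by (simp add: A_def)
    have dv: "real d \<le> v" using A1 mult_right_mono[of 1 A "real d"] by (simp add: v_def)
    have d1: "real d \<ge> 1" using d by simp
    have v1: "v \<ge> 1" using dv d1 by linarith
    have vv: "v\<^sup>2 = real v2" by (simp add: v_def v2_def A_def power_mult_distrib)
    have v21: "v2 \<ge> 1" using n0 d by (simp add: v2_def)
    have vpow: "v \<le> v powr (8/3)" using powr_mono[of 1 "8/3" v] v1 by simp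
    define Q where "Q = v powr (8/3) / R"
    have Q0: "Q \<ge> 0" using R by (simp add: Q_def)
    define f where "f u = wave A R (real d * norm u)" for u :: "real \<times> real \<times> real"
    have R0: "R > 0" and d0: "real d > 0" using R d by auto
    obtain L where L: "L \<ge> 0" "\<And>r s. \<bar>wave A R r - wave A R s\<bar> \<le> L * \<bar>r - s\<bar>" using wave_lipschitz[OF R0] by blast
    have flip: "\<bar>f u - f w\<bar> \<le> (L * real d) * dist u w" for u w
    proof -
      have "\<bar>f u - f w\<bar> \<le> L * \<bar>real d * norm u - real d * norm w\<bar>" unfolding f_def by (rule L(2))
      also have "\<bar>real d * norm u - real d * norm w\<bar> = real d * \<bar>norm u - norm w\<bar>" by (simp add: abs_mult flip: right_diff_distrib)
      also have "L * (real d * \<bar>norm u - norm w\<bar>) \<le> L * (real d * dist u w)"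
        using L(1) by (intro mult_left_mono) (auto simp: dist_norm norm_triangle_ineq3)
      finally show ?thesis by (simp add: mult.assoc)
    qed
    define K0 where "K0 = {k. nsq k = int v2}"
    note fh = fhat3_wave[OF R0 d0 B, of _ A, folded f_def]
    \<comment> \<open>Majorant of the coefficient on the shell \<open>n\<close>. Up to
      \<open>4 * v2\<close> it uses quadratic decay with
      \<open>\<bar>sqrt n - v\<bar> \<ge> \<bar>n - v2\<bar> / (3 * v)\<close>; beyond, where
      \<open>sqrt n - v \<ge> sqrt n / 2\<close>, cubic decay.\<close>
    define \<Theta> where "\<Theta> n = (if n \<le> 4 * v2 then 2 * R / (sqrt n * (real d)\<^sup>2) * (42 * (9 * (real d)\<^sup>2 * v\<^sup>2 / (R\<^sup>2 * (real n - real v2)\<^sup>2)))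
       else 2 * R / (sqrt n * (real d)\<^sup>2) * (42 * (8 * real d ^ 3 / (R ^ 3 * (real n * sqrt n)))))" for n :: nat
    have \<Theta>0: "\<Theta> n \<ge> 0" for n using R by (simp add: \<Theta>_def)
    have e84: "R / z * (84 * X) = 2 * R / z * (42 * X)" for z X :: real by simp
    have fh\<Theta>: "\<bar>fhat3 B f k\<bar> \<le> \<Theta> (nat (nsq k))" if k: "nsq k \<noteq> 0" "nsq k \<noteq> int v2" for k
    proof -
      define n where "n = nat (nsq k)"
      have n: "nsq k = int n" "n \<ge> 1" "n \<noteq> v2" using k nsq_nonneg[of k] by (auto simp: n_def)
      have \<rho>: "rad3 k = sqrt (real n)" by (simp add: rad3_eq n)
      have s1: "sqrt (real n) \<ge> 1" "(sqrt (real n))\<^sup>2 = real n" using n by auto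
      have fac: "(sqrt n - v) * (sqrt n + v) = real n - real v2"
        using vv s1(2) by (simp add: algebra_simps power2_eq_square)
      then have ne: "sqrt n \<noteq> v" using n(3) by auto
      define x y where "x = R * (sqrt n / real d - A)" and "y = R * (sqrt n / real d + A)"
      have xe: "x = R * (sqrt n - v) / real d" using d0 by (simp add: x_def v_def field_simps)
      have x0: "x \<noteq> 0" using ne R0 d0 by (simp add: xe)
      have xy: "\<bar>x\<bar> \<le> \<bar>y\<bar>"
      proof -
        have "\<bar>sqrt n / real d - A\<bar> \<le> sqrt n / real d + A" using A1 d0 s1 by (auto simp: abs_le_iff)
        then show ?thesis using R0 A1 d0 s1 unfolding x_def y_def abs_mult by (intro mult_left_mono) auto
      qed
      have fhk: "\<bar>fhat3 B f k\<bar> = R / (sqrt n * (real d)\<^sup>2) * \<bar>bump_cos x - bump_cos y\<bar>"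
        using fh(1)[of k] s1 R0 d0 by (simp add: \<rho> x_def y_def abs_mult)
      have pre0: "0 \<le> R / (sqrt n * (real d)\<^sup>2)" using R by simp
      show ?thesis
      proof (cases "n \<le> 4 * v2")
        case True
        have "sqrt n \<le> sqrt (real (4 * v2))" using True by (simp only: real_sqrt_le_iff of_nat_le_iff)
        also have "\<dots> = 2 * v" using v1 by (simp add: real_sqrt_mult flip: vv)
        finally have "sqrt n + v \<le> 3 * v" by simp
        have "\<bar>real n - real v2\<bar> = \<bar>sqrt n - v\<bar> * (sqrt n + v)" using v1 s1 unfolding fac[symmetric] by (simp add: abs_mult)
        also have "\<dots> \<le> \<bar>sqrt n - v\<bar> * (3 * v)" using \<open>sqrt n + v \<le> 3 * v\<close> by (intro mult_left_mono) auto
        finally have low: "\<bar>real n - real v2\<bar> \<le> \<bar>sqrt n - v\<bar> * (3 * v)" .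
        have "\<bar>real n - real v2\<bar>\<^sup>2 \<le> (\<bar>sqrt n - v\<bar> * (3 * v))\<^sup>2" using low by (intro power_mono) auto
        then have low2: "(real n - real v2)\<^sup>2 \<le> (sqrt n - v)\<^sup>2 * (9 * v\<^sup>2)" by (simp add: power_mult_distrib)
        have nz: "(real n - real v2)\<^sup>2 > 0" "(sqrt n - v)\<^sup>2 > 0" using n(3) ne by auto
        have "84 / x\<^sup>2 = 84 * ((real d)\<^sup>2 / (R\<^sup>2 * (sqrt n - v)\<^sup>2))"
          by (simp add: xe power_divide power_mult_distrib)
        also have "(real d)\<^sup>2 / (R\<^sup>2 * (sqrt n - v)\<^sup>2) \<le> 9 * (real d)\<^sup>2 * v\<^sup>2 / (R\<^sup>2 * (real n - real v2)\<^sup>2)"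
        proof -
          have "(real d)\<^sup>2 * (R\<^sup>2 * (real n - real v2)\<^sup>2) \<le> (real d)\<^sup>2 * (R\<^sup>2 * ((sqrt n - v)\<^sup>2 * (9 * v\<^sup>2)))"
            using low2 by (intro mult_left_mono) auto
          then show ?thesis using nz R0 by (simp add: divide_le_eq pos_le_divide_eq mult_ac)
        qed
        finally have "\<bar>bump_cos x - bump_cos y\<bar> \<le> 84 * (9 * (real d)\<^sup>2 * v\<^sup>2 / (R\<^sup>2 * (real n - real v2)\<^sup>2))"
          using bump_cos_diff_bounds(1)[OF x0 xy] by linarith
        then have "\<bar>fhat3 B f k\<bar> \<le> R / (sqrt n * (real d)\<^sup>2) * (84 * (9 * (real d)\<^sup>2 * v\<^sup>2 / (R\<^sup>2 * (real n - real v2)\<^sup>2)))"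
          unfolding fhk using pre0 by (intro mult_left_mono)
        then show ?thesis unfolding n_def[symmetric] \<Theta>_def e84 by (simp only: True if_True)
      next
        case False
        have "sqrt (real (4 * v2)) \<le> sqrt n" using False by (simp only: real_sqrt_le_iff of_nat_le_iff)
        moreover have "sqrt (real (4 * v2)) = 2 * v" using v1 by (simp add: real_sqrt_mult flip: vv)
        ultimately have low: "sqrt n / 2 \<le> sqrt n - v" by linarith
        have "R * (sqrt n / 2) / real d \<le> x" unfolding xe using low R0 d0 by (intro divide_right_mono mult_left_mono) auto
        then have "(R * (sqrt n / 2) / real d) ^ 3 \<le> \<bar>x\<bar> ^ 3" using R0 s1 d0 by (intro power_mono) auto
        moreover have pos: "0 < (R * (sqrt n / 2) / real d) ^ 3" using R0 s1 d0 by (intro zero_less_power divide_pos_pos mult_pos_pos) auto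
        ultimately have "84 / \<bar>x\<bar> ^ 3 \<le> 84 / (R * (sqrt n / 2) / real d) ^ 3"
          using x0 by (intro divide_left_mono mult_pos_pos) auto
        also have "(R * (sqrt n / 2) / real d) ^ 3 = R ^ 3 * (real n * sqrt n) / (8 * real d ^ 3)"
        proof -
          have "sqrt n ^ 3 = real n * sqrt n" using s1 by (simp add: power3_eq_cube)
          then show ?thesis by (simp add: power_divide power_mult_distrib)
        qed
        finally have "\<bar>bump_cos x - bump_cos y\<bar> \<le> 84 * (8 * real d ^ 3 / (R ^ 3 * (real n * sqrt n)))"
          using bump_cos_diff_bounds(2)[OF x0 xy] by simp
        then have "\<bar>fhat3 B f k\<bar> \<le> R / (sqrt n * (real d)\<^sup>2) * (84 * (8 * real d ^ 3 / (R ^ 3 * (real n * sqrt n))))"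
          unfolding fhk using pre0 by (intro mult_left_mono)
        then show ?thesis unfolding n_def[symmetric] \<Theta>_def e84 by (simp only: False if_False)
      qed
    qed
    \<comment> \<open>Origin of the exponent \<open>8/3\<close>: near the resonance
      \<open>r3 n / sqrt n\<close> is \<open>O(n^(1/3)) = O(v^(2/3))\<close>, and the gap estimate
      costs \<open>v^2\<close>. The sum over \<open>n\<close> of the last bracket is bounded
      independently of \<open>v2\<close>.\<close>
    have r\<Theta>: "real (r3 n) * \<Theta> n \<le> 1512 * C3 * Q * (1 / (real n - real v2)\<^sup>2 + real n powr (- 1 - 1/6))" if n: "n \<ge> 1" "n \<noteq> v2" for n
    proof -
      have np: "real n > 0" using n by simp
      have "real (r3 n) / sqrt n \<le> C3 * real n powr (5/6) / sqrt n" using C3(2)[OF n(1)] by (intro divide_right_mono) auto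
      also have "\<dots> = C3 * (real n powr (5/6) / real n powr (1/2))" using np by (simp add: powr_half_sqrt)
      also have "\<dots> = C3 * real n powr (1/3)" by (simp flip: powr_diff)
      finally have rs: "real (r3 n) / sqrt n \<le> C3 * real n powr (1/3)" .
      show ?thesis
      proof (cases "n \<le> 4 * v2")
        case True
        have "real n powr (1/3) \<le> (4 * v\<^sup>2) powr (1/3)" using True np unfolding vv by (intro powr_mono2) (auto simp flip: of_nat_mult)
        also have "\<dots> = 4 powr (1/3) * v powr (2/3)" using v1 by (simp add: powr_mult powr_powr flip: powr_numeral)
        also have "\<dots> \<le> 2 * v powr (2/3)"
        proof (rule mult_right_mono)
          have "(4::real) powr (1/3) \<le> 4 powr (1/2)" by (intro powr_mono) auto
          then show "(4::real) powr (1/3) \<le> 2" by (simp add: powr_half_sqrt)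
        qed simp
        finally have "C3 * real n powr (1/3) \<le> C3 * (2 * v powr (2/3))" using C3(1) by (intro mult_left_mono) auto
        then have rs2: "real (r3 n) / sqrt n \<le> C3 * (2 * v powr (2/3))" using rs by linarith
        have "real (r3 n) * \<Theta> n = (real (r3 n) / sqrt n) * (756 * v\<^sup>2 / (R * (real n - real v2)\<^sup>2))"
          using True R0 d0 by (simp add: \<Theta>_def power2_eq_square)
        also have "\<dots> \<le> (C3 * (2 * v powr (2/3))) * (756 * v\<^sup>2 / (R * (real n - real v2)\<^sup>2))"
          using rs2 R0 by (intro mult_right_mono) auto
        also have "\<dots> = 1512 * C3 * (v powr (2/3) * v\<^sup>2 / R) * (1 / (real n - real v2)\<^sup>2)" by simp
        also have "v powr (2/3) * v\<^sup>2 / R = Q"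
        proof -
          have "v\<^sup>2 = v powr 2" using v1 by simp
          then show ?thesis unfolding Q_def by (simp only: powr_add[symmetric]) simp
        qed
        also have "1512 * C3 * Q * (1 / (real n - real v2)\<^sup>2) \<le> 1512 * C3 * Q * (1 / (real n - real v2)\<^sup>2 + real n powr (- 1 - 1/6))"
          using C3(1) Q0 by (intro mult_left_mono) auto
        finally show ?thesis .
      next
        case False
        have "real (r3 n) * \<Theta> n = (real (r3 n) / sqrt n) * (672 * real d / (R\<^sup>2 * (real n * sqrt n)))"
          using False R0 d0 by (simp add: \<Theta>_def power2_eq_square power3_eq_cube)
        also have "\<dots> \<le> (C3 * real n powr (1/3)) * (672 * real d / (R\<^sup>2 * (real n * sqrt n)))"
          using rs R0 by (intro mult_right_mono) auto
        also have "\<dots> = 672 * C3 * (real d / R\<^sup>2) * (real n powr (1/3) / (real n * sqrt n))" by simp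
        \<comment> \<open>Quadratic decay would leave \<open>n^(1/3 - 1)\<close>, whose sum
          diverges; cubic decay gives the convergent \<open>n^(-7/6)\<close>.\<close>
        also have "real n powr (1/3) / (real n * sqrt n) = real n powr (- 1 - 1/6)"
        proof -
          have "real n * sqrt n = real n powr (3/2)"
          proof -
            have "real n * sqrt n = real n powr 1 * real n powr (1/2)" using np by (simp add: powr_half_sqrt)
            then show ?thesis by (simp only: powr_add[symmetric]) simp
          qed
          then show ?thesis by (simp flip: powr_diff)
        qed
        also have "672 * C3 * (real d / R\<^sup>2) * real n powr (- 1 - 1/6) \<le> 1512 * C3 * Q * real n powr (- 1 - 1/6)"
        proof (intro mult_right_mono mult_mono)
          have "real d \<le> v powr (8/3)" using dv vpow by linarith
          moreover have "R \<le> R\<^sup>2" using R by (simp add: power2_eq_square)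
          ultimately show "real d / R\<^sup>2 \<le> Q" unfolding Q_def using R0 by (intro frac_le) auto
        qed (use C3 in auto)
        also have "\<dots> \<le> 1512 * C3 * Q * (1 / (real n - real v2)\<^sup>2 + real n powr (- 1 - 1/6))"
          using C3(1) Q0 by (intro mult_left_mono) auto
        finally show ?thesis .
      qed
    qed
    \<comment> \<open>The frequency 0 is never resonant and is treated apart; there
      \<open>bump_usin (A * R) = O((A * R)^(-2))\<close> cancels the factor
      \<open>R^2\<close>.\<close>
    have E: "(\<Sum>k\<in>K. \<bar>fhat3 B f k\<bar>) \<le> 120 * pi + 1512 * C3 * (G2 + G7) * Q" if K: "finite K" "K \<inter> K0 = {}" for K
    proof -
      define K1 where "K1 = {k\<in>K. nsq k \<noteq> 0}"
      have nz: "nsq k = 0 \<longleftrightarrow> k = (0, 0, 0)" for k by (cases k) (auto simp: nsq_def add_nonneg_eq_0_iff)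
      have "(\<Sum>k\<in>K. \<bar>fhat3 B f k\<bar>) \<le> (\<Sum>k\<in>insert (0, 0, 0) K1. \<bar>fhat3 B f k\<bar>)"
        using K by (intro sum_mono2) (auto simp: K1_def nz)
      also have "\<dots> = \<bar>fhat3 B f (0, 0, 0)\<bar> + (\<Sum>k\<in>K1. \<bar>fhat3 B f k\<bar>)"
        using K by (intro sum.insert) (auto simp: K1_def nsq_def)
      also have "\<bar>fhat3 B f (0, 0, 0)\<bar> \<le> 120 * pi"
      proof -
        have "rad3 (0, 0, 0) = 0" by (simp add: rad3_eq nsq_def)
        then have "\<bar>fhat3 B f (0, 0, 0)\<bar> = 4 * pi * R\<^sup>2 / real d ^ 3 * \<bar>bump_usin (A * R)\<bar>"
          using fh(2)[of "(0, 0, 0)"] R0 d0 by (simp add: abs_mult)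
        also have "\<dots> \<le> 4 * pi * R\<^sup>2 / 1 * (30 / (A * R)\<^sup>2)"
          using R0 A1 d1 by (intro mult_mono bump_usin_bound divide_left_mono one_le_power) auto
        also have "\<dots> = 120 * pi * (1 / A\<^sup>2)" using R0 by (simp add: power_mult_distrib)
        also have "\<dots> \<le> 120 * pi * 1" using A1 by (intro mult_left_mono) (auto simp: divide_le_eq_1)
        finally show ?thesis by simp
      qed
      also have "(\<Sum>k\<in>K1. \<bar>fhat3 B f k\<bar>) \<le> (\<Sum>k\<in>K1. \<Theta> (nat (nsq k)))"
        using K by (intro sum_mono fh\<Theta>) (auto simp: K1_def K0_def)
      also have "\<dots> \<le> (\<Sum>n\<in>(\<lambda>k. nat (nsq k)) ` K1. real (r3 n) * \<Theta> n)"
        using K \<Theta>0 by (intro sum_over_shells_le) (auto simp: K1_def)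
      also have "\<dots> \<le> (\<Sum>n\<in>(\<lambda>k. nat (nsq k)) ` K1. 1512 * C3 * Q * (1 / (real n - real v2)\<^sup>2 + real n powr (- 1 - 1/6)))"
      proof (intro sum_mono r\<Theta>)
        fix n assume "n \<in> (\<lambda>k. nat (nsq k)) ` K1"
        then obtain k where k: "k \<in> K1" "n = nat (nsq k)" by auto
        then have "nsq k \<noteq> 0" "nsq k \<noteq> int v2" "nsq k \<ge> 0" using K nsq_nonneg by (auto simp: K1_def K0_def)
        then show "1 \<le> n" "n \<noteq> v2" using k by auto
      qed
      also have "\<dots> = 1512 * C3 * Q * ((\<Sum>n\<in>(\<lambda>k. nat (nsq k)) ` K1. 1 / (real n - real v2)\<^sup>2) + (\<Sum>n\<in>(\<lambda>k. nat (nsq k)) ` K1. real n powr (- 1 - 1/6)))"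
        by (simp only: sum_distrib_left sum.distrib distrib_left)
      also have "\<dots> \<le> 1512 * C3 * Q * (G2 + G7)"
      proof (intro mult_left_mono add_mono G2(2) G7(2))
        show "finite ((\<lambda>k. nat (nsq k)) ` K1)" "finite ((\<lambda>k. nat (nsq k)) ` K1)" using K by (auto simp: K1_def)
        show "v2 \<notin> (\<lambda>k. nat (nsq k)) ` K1"
        proof
          assume "v2 \<in> (\<lambda>k. nat (nsq k)) ` K1"
          then obtain k where k: "k \<in> K1" "v2 = nat (nsq k)" by auto
          then have "nsq k = int v2" using nsq_nonneg[of k] by simp
          then show False using k K by (auto simp: K1_def K0_def)
        qed
        show "0 \<le> 1512 * C3 * Q" using C3 Q0 by simp
      qed
      finally show ?thesis by (simp add: mult_ac)
    qed
    have main: "\<bar>(\<Sum>k\<in>cube3 B. f (emb3 k)) - (\<Sum>k\<in>K0. fhat3 B f k)\<bar> \<le> 120 * pi + 1512 * C3 * (G2 + G7) * Q"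
      by (rule poisson_bound[OF flip _ _ E]) (use L d0 in \<open>auto simp: K0_def finite_nsq_eq\<close>)
    \<comment> \<open>On the resonant shell the difference of frequencies is 0 and gives
      \<open>bump_cos 0\<close>; their sum \<open>2 * A\<close> leaves the small term
      \<open>bump_cos (2 * A * R)\<close>.\<close>
    have diag: "\<bar>(\<Sum>k\<in>K0. fhat3 B f k) - R * bump_cos 0 * real (r3 v2) / (A * real d ^ 3)\<bar> \<le> 42 * C3 * Q"
    proof -
      have rk: "rad3 k = v" if "k \<in> K0" for k
      proof -
        have "rad3 k = sqrt (v\<^sup>2)" using that by (simp add: rad3_eq K0_def vv)
        then show ?thesis using v1 by simp
      qed
      have fk: "fhat3 B f k = R / (v * (real d)\<^sup>2) * (bump_cos 0 - bump_cos (2 * A * R))" if "k \<in> K0" for k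
      proof -
        have "v / real d = A" using d0 by (simp add: v_def)
        then show ?thesis using fh(1)[of k] rk[OF that] v1 by (simp add: mult_ac)
      qed
      have "(\<Sum>k\<in>K0. fhat3 B f k) = real (r3 v2) * (R / (v * (real d)\<^sup>2) * (bump_cos 0 - bump_cos (2 * A * R)))"
        using fk by (simp add: r3_def K0_def)
      also have "\<dots> = R * bump_cos 0 * real (r3 v2) / (A * real d ^ 3) - real (r3 v2) * (R / (v * (real d)\<^sup>2) * bump_cos (2 * A * R))"
      proof -
        have "v * (real d)\<^sup>2 = A * real d ^ 3" by (simp add: v_def power2_eq_square power3_eq_cube)
        then show ?thesis by (simp add: right_diff_distrib diff_divide_distrib)
      qed
      finally have "\<bar>(\<Sum>k\<in>K0. fhat3 B f k) - R * bump_cos 0 * real (r3 v2) / (A * real d ^ 3)\<bar>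
          = real (r3 v2) * (R / (v * (real d)\<^sup>2) * \<bar>bump_cos (2 * A * R)\<bar>)"
        using R0 v1 by (simp add: abs_mult)
      also have "\<dots> \<le> (C3 * v powr (5/3)) * (R / (1 * 1) * (42 / R\<^sup>2))"
      proof (intro mult_mono)
        have "real v2 powr (5/6) = v powr (5/3)" using v1 by (simp add: powr_powr flip: vv powr_numeral)
        then show "real (r3 v2) \<le> C3 * v powr (5/3)" using C3(2)[OF v21] by simp
        have "1 * 1 \<le> v * (real d)\<^sup>2" using v1 d1 by (intro mult_mono one_le_power) auto
        then show "R / (v * (real d)\<^sup>2) \<le> R / (1 * 1)" using R0 v1 d0 by (intro divide_left_mono) auto
        have "\<bar>bump_cos (2 * A * R)\<bar> \<le> 42 / (2 * A * R)\<^sup>2" using A1 R0 by (intro bump_cos_bound2) auto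
        also have "\<dots> \<le> 42 / R\<^sup>2"
        proof (intro divide_left_mono power_mono)
          show "R \<le> 2 * A * R" using A1 R0 by simp
        qed (use A1 R0 in auto)
        finally show "\<bar>bump_cos (2 * A * R)\<bar> \<le> 42 / R\<^sup>2" .
      qed (use R0 v1 C3 in auto)
      also have "\<dots> = 42 * C3 * (v powr (5/3) / R)" using R0 by (simp add: power2_eq_square)
      also have "\<dots> \<le> 42 * C3 * Q"
        unfolding Q_def using C3 R0 v1 by (intro mult_left_mono divide_right_mono powr_mono) auto
      finally show ?thesis .
    qed
    have "\<bar>(\<Sum>k\<in>cube3 B. f (emb3 k)) - R * bump_cos 0 * real (r3 v2) / (A * real d ^ 3)\<bar> \<le> 120 * pi + 1512 * C3 * (G2 + G7) * Q + 42 * C3 * Q"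
      using main diag by linarith
    also have "\<dots> \<le> C * (1 + Q)"
    proof -
      have "0 \<le> 1512 * C3 * (G2 + G7) + 42 * C3" "0 \<le> 120 * pi * Q" using C3 G2 G7 Q0 by auto
      then show ?thesis by (simp add: C_def algebra_simps)
    qed
    finally show ?thesis unfolding f_def Q_def v_def v2_def A_def rad3_def .
  qed
  then show ?thesis using C0 by blast
qed

section \<open>Visible points and Moebius inversion\<close>

text \<open>The gcd of three zeros is 0, so the origin is excluded without a separate
  clause.\<close>

definition vis3 :: "int \<times> int \<times> int \<Rightarrow> bool" where
  "vis3 v \<longleftrightarrow> gcd (fst v) (gcd (fst (snd v)) (snd (snd v))) = 1"

definition VS :: "real \<Rightarrow> (int \<times> int \<times> int) set" where
  "VS t = {v. vis3 v \<and> rad3 v \<le> t}"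

lemma abs_le_rad3: "\<bar>real_of_int (fst v)\<bar> \<le> rad3 v" "\<bar>real_of_int (fst (snd v))\<bar> \<le> rad3 v" "\<bar>real_of_int (snd (snd v))\<bar> \<le> rad3 v"
proof -
  define x y z where "x = real_of_int (fst v)" and "y = real_of_int (fst (snd v))" and "z = real_of_int (snd (snd v))"
  have "rad3 v = norm (x, y, z)" by (simp add: rad3_def emb3_def x_def y_def z_def)
  then show "\<bar>real_of_int (fst v)\<bar> \<le> rad3 v" "\<bar>real_of_int (fst (snd v))\<bar> \<le> rad3 v" "\<bar>real_of_int (snd (snd v))\<bar> \<le> rad3 v"
    using norm_fst_le[of x "(y, z)"] norm_snd_le[of "(y, z)" x] norm_fst_le[of y z] norm_snd_le[of z y]
    unfolding x_def[symmetric] y_def[symmetric] z_def[symmetric] by auto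
qed

lemma rad3_nonneg: "rad3 v \<ge> 0"
  by (simp add: rad3_def)

lemma in_cube3_of_rad3:
  assumes "rad3 v \<le> real B"
  shows "v \<in> cube3 B"
proof -
  have "\<bar>fst v\<bar> \<le> int B" "\<bar>fst (snd v)\<bar> \<le> int B" "\<bar>snd (snd v)\<bar> \<le> int B"
    using abs_le_rad3[of v] assms by linarith+
  then show ?thesis by (auto simp: cube3_def mem_Times_iff abs_le_iff)
qed

lemma finite_cube3: "finite (cube3 B)"
  by (simp add: cube3_def)

lemma finite_VS: "finite (VS t)"
proof (rule finite_subset[OF _ finite_cube3])
  show "VS t \<subseteq> cube3 (nat \<lceil>t\<rceil>)"
  proof
    fix v assume "v \<in> VS t"
    then have "rad3 v \<le> t" by (simp add: VS_def)
    moreover have "t \<le> real (nat \<lceil>t\<rceil>)" by (rule real_nat_ceiling_ge)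
    ultimately show "v \<in> cube3 (nat \<lceil>t\<rceil>)" by (intro in_cube3_of_rad3) linarith
  qed
qed

lemma visible_count_eq: "visible_count t = card (VS t)"
proof -
  define h :: "int ^ 3 \<Rightarrow> int \<times> int \<times> int" where "h x = (x $ 1, x $ 2, x $ 3)" for x
  have nrm: "norm (real_vec x) = rad3 (h x)" for x
    by (simp add: norm_vec_def L2_set_def real_vec_def rad3_eq nsq_def h_def sum_3)
  have vis: "visible x \<longleftrightarrow> vis3 (h x)" for x
    by (auto simp: visible_def vis3_def h_def)
  have inj: "inj h" by (auto simp: inj_def h_def vec_eq_iff forall_3)
  have surj: "\<exists>x. h x = v" for v
  proof -
    obtain a b c where v: "v = (a, b, c)" by (metis prod.exhaust)
    have "h (vector [a, b, c]) = v" by (simp add: h_def v vector_3)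
    then show ?thesis by blast
  qed
  have "h ` {x. visible x \<and> norm (real_vec x) \<le> t} = VS t"
  proof (rule set_eqI, rule iffI)
    fix v assume v: "v \<in> VS t"
    obtain x where x: "h x = v" using surj by blast
    then have "x \<in> {x. visible x \<and> norm (real_vec x) \<le> t}" using v by (simp add: VS_def vis nrm)
    then show "v \<in> h ` {x. visible x \<and> norm (real_vec x) \<le> t}" using x by blast
  qed (auto simp: VS_def vis nrm)
  then show ?thesis unfolding visible_count_def using card_image[OF inj_on_subset[OF inj subset_UNIV]] by metis
qed

lemma visible_count_indicator:
  assumes "t \<le> T"
  shows "real (visible_count t) = (\<Sum>v\<in>VS T. if rad3 v \<le> t then 1 else 0)"
proof -
  have "VS t = {v\<in>VS T. rad3 v \<le> t}" using assms by (auto simp: VS_def)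
  then show ?thesis unfolding visible_count_eq by (simp add: sum.If_cases finite_VS Int_def)
qed

lemma continuous_wave_deriv:
  assumes "R > 0"
  shows "continuous_on {R..2 * R} (wave_deriv A R)"
  unfolding wave_deriv_def using assms
  by (intro continuous_intros continuous_on_compose2[OF continuous_bump123(1)[of UNIV]]) auto

lemma wave_deriv_ftc:
  assumes R: "R > 0" and "R \<le> a" "a \<le> 2 * R"
  shows "(wave_deriv A R has_integral - wave A R a) {a..2 * R}"
proof -
  have "(wave_deriv A R has_integral (wave A R (2 * R) - wave A R a)) {a..2 * R}"
  proof (rule fundamental_theorem_of_calculus)
    fix t assume t: "t \<in> {a..2 * R}"
    then have "(wave A R has_real_derivative wave_deriv A R t) (at t within {R..2 * R})" using assms by (intro wave_deriv) auto
    then show "(wave A R has_vector_derivative wave_deriv A R t) (at t within {a..2 * R})"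
      unfolding has_real_derivative_iff_has_vector_derivative
      by (rule has_vector_derivative_within_subset) (use assms in auto)
  qed (use assms in auto)
  then show ?thesis using wave_zero[OF R, of "2 * R" A] by simp
qed

text \<open>The counting function is a sum of steps \<open>rad3 v \<le> t\<close>. Against
  \<open>wave_deriv\<close> each step integrates to minus the wave at \<open>rad3 v\<close>, since
  the wave vanishes at \<open>2 * R\<close>. The volume term \<open>t^3\<close> is integrated by
  parts and rescaled by \<open>R\<close>.\<close>

lemma visible_wave_integral:
  assumes R: "R > 0"
  shows "((\<lambda>t. visible_error t * wave_deriv A R t) has_integral
     (4 * pi / zeta 3 * (R\<^sup>2 * bump_usin (A * R)) - (\<Sum>v\<in>VS (2 * R). wave A R (rad3 v)))) {R..2 * R}"
proof -
  define \<kappa> where "\<kappa> = 4 * pi / (3 * zeta 3)"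
  have step: "((\<lambda>t. (if a \<le> t then 1 else 0) * wave_deriv A R t) has_integral - wave A R a) {R..2 * R}" if a: "a \<le> 2 * R" for a
  proof -
    \<comment> \<open>A point with \<open>rad3 v < R\<close> is counted on the whole interval;
      starting at \<open>R\<close> instead changes nothing, because the wave is 0 up to
      \<open>R\<close>.\<close>
    define b where "b = max a R"
    have b: "R \<le> b" "b \<le> 2 * R" using a R by (auto simp: b_def)
    have "wave A R b = wave A R a" using wave_zero[OF R, of a A] wave_zero[OF R, of R A] by (auto simp: b_def max_def)
    then have "(wave_deriv A R has_integral - wave A R a) {b..2 * R}" using wave_deriv_ftc[OF R b, of A] by simp
    then have "((\<lambda>t. if t \<in> {b..2 * R} then wave_deriv A R t else 0) has_integral - wave A R a) {R..2 * R}"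
      by (subst has_integral_restrict) (use b in auto)
    then show ?thesis by (rule has_integral_eq[rotated]) (auto simp: b_def)
  qed
  have 1: "((\<lambda>t. \<Sum>v\<in>VS (2 * R). (if rad3 v \<le> t then 1 else 0) * wave_deriv A R t) has_integral (\<Sum>v\<in>VS (2 * R). - wave A R (rad3 v))) {R..2 * R}"
    by (intro has_integral_sum finite_VS step) (auto simp: VS_def)
  have wc: "continuous_on {R..2 * R} (wave A R)" by (rule DERIV_continuous_on[OF wave_deriv[OF R]])
  have t2: "integral {R..2 * R} (\<lambda>t. t\<^sup>2 * wave A R t) = R\<^sup>2 * bump_usin (A * R)"
  proof -
    have "((\<lambda>u. R *\<^sub>R (\<lambda>t. t\<^sup>2 * wave A R t) (R * u)) has_integral (integral {R * 1..R * 2} (\<lambda>t. t\<^sup>2 * wave A R t))) {1..2}"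
    proof (rule has_integral_substitution[of _ _ _ R "2 * R"])
      show "continuous_on {R..2 * R} (\<lambda>t. t\<^sup>2 * wave A R t)" by (intro continuous_intros wc)
      show "(\<lambda>u. R * u) ` {1..2} \<subseteq> {R..2 * R}" using R by auto
      show "((\<lambda>u. R * u) has_real_derivative R) (at u within {1..2})" for u by (rule DERIV_cmult_Id)
    qed (use R in auto)
    then have "integral {1..2} (\<lambda>u. R *\<^sub>R (\<lambda>t. t\<^sup>2 * wave A R t) (R * u)) = integral {R * 1..R * 2} (\<lambda>t. t\<^sup>2 * wave A R t)"
      by (rule integral_unique)
    moreover have "{R * 1..R * 2} = {R..2 * R}" by simp
    ultimately have "integral {R..2 * R} (\<lambda>t. t\<^sup>2 * wave A R t) = integral {1..2} (\<lambda>u. R * ((R * u)\<^sup>2 * wave A R (R * u)))"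
      by (simp only: real_scaleR_def)
    also have "\<dots> = integral {1..2} (\<lambda>u. R\<^sup>2 * (u * bump u * sin (2 * pi * (A * R) * u)))"
      by (rule Henstock_Kurzweil_Integration.integral_cong) (use R in \<open>auto simp: wave_def power2_eq_square mult_ac\<close>)
    also have "\<dots> = R\<^sup>2 * bump_usin (A * R)" unfolding bump_usin_def integral_mult_right ..
    finally show ?thesis .
  qed
  have 2: "((\<lambda>t. t ^ 3 * wave_deriv A R t) has_integral - (3 * (R\<^sup>2 * bump_usin (A * R)))) {R..2 * R}"
  proof -
    have "((\<lambda>t. 3 * (t\<^sup>2 * wave A R t) + t ^ 3 * wave_deriv A R t) has_integral ((2 * R) ^ 3 * wave A R (2 * R) - R ^ 3 * wave A R R)) {R..2 * R}"
    proof (rule fundamental_theorem_of_calculus)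
      fix t assume "t \<in> {R..2 * R}"
      then show "((\<lambda>t. t ^ 3 * wave A R t) has_vector_derivative 3 * (t\<^sup>2 * wave A R t) + t ^ 3 * wave_deriv A R t) (at t within {R..2 * R})"
        unfolding has_real_derivative_iff_has_vector_derivative[symmetric]
        by (intro DERIV_cong[OF DERIV_mult[OF DERIV_pow wave_deriv[OF R]]]) (auto simp: power2_eq_square)
    qed (use R in auto)
    then have "((\<lambda>t. 3 * (t\<^sup>2 * wave A R t) + t ^ 3 * wave_deriv A R t) has_integral 0) {R..2 * R}"
      using wave_zero[OF R, of R A] wave_zero[OF R, of "2 * R" A] by simp
    from has_integral_diff[OF this] have "((\<lambda>t. 3 * (t\<^sup>2 * wave A R t)) has_integral i) {R..2 * R} \<Longrightarrow>
        ((\<lambda>t. t ^ 3 * wave_deriv A R t) has_integral - i) {R..2 * R}" for i by fastforce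
    moreover have "((\<lambda>t. 3 * (t\<^sup>2 * wave A R t)) has_integral (3 * (R\<^sup>2 * bump_usin (A * R)))) {R..2 * R}"
      unfolding t2[symmetric]
      by (intro has_integral_mult_right integrable_integral integrable_continuous_interval continuous_intros wc)
    ultimately show ?thesis by blast
  qed
  have "((\<lambda>t. (\<Sum>v\<in>VS (2 * R). (if rad3 v \<le> t then 1 else 0) * wave_deriv A R t) - \<kappa> * (t ^ 3 * wave_deriv A R t)) has_integral
     ((\<Sum>v\<in>VS (2 * R). - wave A R (rad3 v)) - \<kappa> * (- (3 * (R\<^sup>2 * bump_usin (A * R)))))) {R..2 * R}"
    by (intro has_integral_diff[OF 1] has_integral_mult_right[OF 2])
  moreover have "(\<Sum>v\<in>VS (2 * R). - wave A R (rad3 v)) - \<kappa> * (- (3 * (R\<^sup>2 * bump_usin (A * R))))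
     = 4 * pi / zeta 3 * (R\<^sup>2 * bump_usin (A * R)) - (\<Sum>v\<in>VS (2 * R). wave A R (rad3 v))"
    by (simp add: \<kappa>_def sum_negf)
  ultimately have "((\<lambda>t. (\<Sum>v\<in>VS (2 * R). (if rad3 v \<le> t then 1 else 0) * wave_deriv A R t) - \<kappa> * (t ^ 3 * wave_deriv A R t)) has_integral
     (4 * pi / zeta 3 * (R\<^sup>2 * bump_usin (A * R)) - (\<Sum>v\<in>VS (2 * R). wave A R (rad3 v)))) {R..2 * R}" by simp
  then show ?thesis
  proof (rule has_integral_eq[rotated])
    fix t assume "t \<in> {R..2 * R}"
    then have "real (visible_count t) = (\<Sum>v\<in>VS (2 * R). if rad3 v \<le> t then 1 else 0)" by (intro visible_count_indicator) auto
    then show "(\<Sum>v\<in>VS (2 * R). (if rad3 v \<le> t then 1 else 0) * wave_deriv A R t) - \<kappa> * (t ^ 3 * wave_deriv A R t) = visible_error t * wave_deriv A R t"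
      unfolding visible_error_def \<kappa>_def by (simp add: left_diff_distrib sum_distrib_right)
  qed
qed

section \<open>Moebius inversion over the dilated lattices\<close>

definition smul3 :: "nat \<Rightarrow> int \<times> int \<times> int \<Rightarrow> int \<times> int \<times> int" where
  "smul3 d w = (int d * fst w, int d * fst (snd w), int d * snd (snd w))"

lemma rad3_smul3: "rad3 (smul3 d w) = real d * rad3 w"
proof -
  have "(rad3 (smul3 d w))\<^sup>2 = (real d * rad3 w)\<^sup>2"
    unfolding power_mult_distrib rad3_sq by (simp add: smul3_def power_mult_distrib distrib_left)
  then show ?thesis using rad3_nonneg by (metis mult_nonneg_nonneg of_nat_0_le_iff power2_eq_iff_nonneg)
qed

definition gcd3 :: "int \<times> int \<times> int \<Rightarrow> nat" where
  "gcd3 v = nat (gcd (fst v) (gcd (fst (snd v)) (snd (snd v))))"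

lemma gcd3_dvd_iff: "d dvd gcd3 v \<longleftrightarrow> (\<exists>w. v = smul3 d w)"
proof -
  obtain a b c where v: "v = (a, b, c)" by (metis prod.exhaust)
  have "d dvd gcd3 v \<longleftrightarrow> int d dvd gcd a (gcd b c)" by (simp add: gcd3_def v dvd_nat_abs_iff nat_dvd_iff int_dvd_int_iff[symmetric])
  also have "\<dots> \<longleftrightarrow> int d dvd a \<and> int d dvd b \<and> int d dvd c" by simp
  also have "\<dots> \<longleftrightarrow> (\<exists>w. v = smul3 d w)" unfolding v smul3_def dvd_def by force
  finally show ?thesis .
qed

text \<open>The condition \<open>gcd3 v = 1\<close> is the sum of \<open>moebius_mu d\<close> over
  the divisors \<open>d\<close> of \<open>gcd3 v\<close>, and the points with \<open>d\<close>
  dividing \<open>gcd3 v\<close> are exactly the multiples \<open>smul3 d w\<close>. The hypotheses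
  on \<open>g\<close> allow each inner sum to run over the whole cube.\<close>

lemma visible_sum_moebius:
  fixes g :: "real \<Rightarrow> real"
  assumes B: "T \<le> real B" and g0: "g 0 = 0" and gT: "\<And>r. r \<ge> T \<Longrightarrow> g r = 0"
  shows "(\<Sum>v\<in>VS T. g (rad3 v)) = (\<Sum>d=1..B. moebius_mu d * (\<Sum>w\<in>cube3 B. g (real d * rad3 w)))"
proof -
  have vg: "vis3 v \<longleftrightarrow> gcd3 v = 1" for v by (auto simp: vis3_def gcd3_def)
  \<comment> \<open>Off the origin the gcd is positive and at most \<open>B\<close>, so all its
    divisors lie in \<open>{1..B}\<close>; \<open>g 0 = 0\<close> lets the origin return in the
    final sums.\<close>
  define U where "U = {v\<in>cube3 B. v \<noteq> (0, 0, 0)}"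
  have Ufin: "finite U" using finite_cube3 by (simp add: U_def)
  have gpos: "gcd3 v > 0 \<and> gcd3 v \<le> B" if vU: "v \<in> U" for v
  proof -
    obtain a b c where v: "v = (a, b, c)" by (metis prod.exhaust)
    have le: "\<bar>a\<bar> \<le> int B" "\<bar>b\<bar> \<le> int B" "\<bar>c\<bar> \<le> int B" and nz: "a \<noteq> 0 \<or> b \<noteq> 0 \<or> c \<noteq> 0"
      using vU by (auto simp: U_def cube3_def v)
    define G where "G = gcd a (gcd b c)"
    have G0: "G > 0" using nz by (auto simp: G_def)
    have "G \<le> int B"
    proof -
      have Ga: "G dvd a" and Gbc: "G dvd gcd b c" unfolding G_def by (rule gcd_dvd1, rule gcd_dvd2)
      have "G dvd b" "G dvd c" by (rule dvd_trans[OF Gbc gcd_dvd1], rule dvd_trans[OF Gbc gcd_dvd2])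
      note Ga this
      then have "G \<le> \<bar>x\<bar>" if "x \<noteq> 0" "x = a \<or> x = b \<or> x = c" for x using that by (auto intro: zdvd_imp_le simp: dvd_imp_le_int)
      then show ?thesis using nz le by force
    qed
    then show ?thesis using G0 by (simp add: gcd3_def v G_def[symmetric])
  qed
  have "(\<Sum>v\<in>VS T. g (rad3 v)) = (\<Sum>v\<in>{v\<in>U. gcd3 v = 1}. g (rad3 v))"
  proof (rule sum.mono_neutral_cong_left)
    show "finite {v\<in>U. gcd3 v = 1}" using Ufin by simp
    show "VS T \<subseteq> {v\<in>U. gcd3 v = 1}"
    proof
      fix v assume v: "v \<in> VS T"
      then have "v \<in> cube3 B" using B by (intro in_cube3_of_rad3) (auto simp: VS_def)
      moreover have "v \<noteq> (0, 0, 0)" using v by (auto simp: VS_def vis3_def)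
      ultimately show "v \<in> {v\<in>U. gcd3 v = 1}" using v by (simp add: U_def VS_def vg)
    qed
    show "\<forall>v\<in>{v\<in>U. gcd3 v = 1} - VS T. g (rad3 v) = 0" by (auto simp: VS_def vg intro!: gT)
  qed auto
  also have "\<dots> = (\<Sum>v\<in>U. (if gcd3 v = 1 then 1 else 0) * g (rad3 v))"
    using Ufin by (simp add: sum.inter_filter if_distrib[of "\<lambda>x. x * _"] cong: if_cong)
  also have "\<dots> = (\<Sum>v\<in>U. \<Sum>d=1..B. if d dvd gcd3 v then moebius_mu d * g (rad3 v) else 0)"
  proof (rule sum.cong[OF refl])
    fix v assume v: "v \<in> U"
    have "(if gcd3 v = 1 then 1 else 0) = (\<Sum>d | d dvd gcd3 v. moebius_mu d)" using sum_moebius_divisors gpos[OF v] by simp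
    also have "{d. d dvd gcd3 v} = {d\<in>{1..B}. d dvd gcd3 v}"
      using gpos[OF v] by (auto dest: dvd_imp_le intro: dvd_pos_nat Suc_leI)
    finally have "(if gcd3 v = 1 then 1 else 0) * g (rad3 v) = (\<Sum>d\<in>{d\<in>{1..B}. d dvd gcd3 v}. moebius_mu d * g (rad3 v))"
      by (simp add: sum_distrib_right)
    then show "(if gcd3 v = 1 then 1 else 0) * g (rad3 v) = (\<Sum>d=1..B. if d dvd gcd3 v then moebius_mu d * g (rad3 v) else 0)"
      by (simp only: sum.inter_filter finite_atLeastAtMost)
  qed
  also have "\<dots> = (\<Sum>d=1..B. \<Sum>v\<in>U. if d dvd gcd3 v then moebius_mu d * g (rad3 v) else 0)" by (rule sum.swap)
  also have "\<dots> = (\<Sum>d=1..B. moebius_mu d * (\<Sum>w\<in>cube3 B. g (real d * rad3 w)))"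
  proof (rule sum.cong[OF refl])
    fix d assume d: "d \<in> {1..B}"
    then have d1: "d \<ge> 1" by simp
    have inj: "inj_on (smul3 d) S" for S using d1 by (auto simp: inj_on_def smul3_def prod_eq_iff)
    have "(\<Sum>v\<in>U. if d dvd gcd3 v then moebius_mu d * g (rad3 v) else 0) = (\<Sum>v\<in>{v\<in>U. d dvd gcd3 v}. moebius_mu d * g (rad3 v))"
      using Ufin by (simp add: sum.inter_filter)
    also have "{v\<in>U. d dvd gcd3 v} = smul3 d ` {w. smul3 d w \<in> U}" by (auto simp: gcd3_dvd_iff)
    also have "(\<Sum>v\<in>smul3 d ` {w. smul3 d w \<in> U}. moebius_mu d * g (rad3 v)) = (\<Sum>w\<in>{w. smul3 d w \<in> U}. moebius_mu d * g (real d * rad3 w))"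
      by (simp add: sum.reindex[OF inj] rad3_smul3)
    also have "\<dots> = (\<Sum>w\<in>cube3 B. moebius_mu d * g (real d * rad3 w))"
    proof (rule sum.mono_neutral_left[OF finite_cube3])
      show "{w. smul3 d w \<in> U} \<subseteq> cube3 B"
      proof
        fix w assume w: "w \<in> {w. smul3 d w \<in> U}"
        obtain a b c where abc: "w = (a, b, c)" by (metis prod.exhaust)
        have le: "\<bar>int d * a\<bar> \<le> int B" "\<bar>int d * b\<bar> \<le> int B" "\<bar>int d * c\<bar> \<le> int B"
          using w by (auto simp: U_def cube3_def smul3_def abc)
        have "\<bar>x\<bar> \<le> \<bar>int d * x\<bar>" for x
          using d1 mult_right_mono[of 1 "int d" "\<bar>x\<bar>"] by (simp add: abs_mult)
        then have "\<bar>a\<bar> \<le> int B" "\<bar>b\<bar> \<le> int B" "\<bar>c\<bar> \<le> int B" using le order_trans by blast+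
        then show "w \<in> cube3 B" by (auto simp: cube3_def abc)
      qed
      show "\<forall>w\<in>cube3 B - {w. smul3 d w \<in> U}. moebius_mu d * g (real d * rad3 w) = 0"
      proof
        fix w assume "w \<in> cube3 B - {w. smul3 d w \<in> U}"
        then have "smul3 d w \<notin> cube3 B \<or> smul3 d w = (0, 0, 0)" by (auto simp: U_def)
        then have "g (rad3 (smul3 d w)) = 0"
        proof
          assume "smul3 d w \<notin> cube3 B"
          then have "rad3 (smul3 d w) > real B" using in_cube3_of_rad3 not_le_imp_less by blast
          then show ?thesis using B by (intro gT) simp
        next
          assume "smul3 d w = (0, 0, 0)"
          then show ?thesis using g0 by (simp add: rad3_eq nsq_def)
        qed
        then show "moebius_mu d * g (real d * rad3 w) = 0" by (simp add: rad3_smul3)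
      qed
    qed
    finally show "(\<Sum>v\<in>U. if d dvd gcd3 v then moebius_mu d * g (rad3 v) else 0) = moebius_mu d * (\<Sum>w\<in>cube3 B. g (real d * rad3 w))"
      by (simp add: sum_distrib_left)
  qed
  finally show ?thesis .
qed

text \<open>No cancellation is used: the shell contains at most \<open>(6 * R / d)^3\<close> lattice
  points, and the wave is at most \<open>1 / R\<close> there. It serves for large \<open>d\<close>,
  where the accumulated error of Poisson summation would be too big.\<close>

lemma wave_tail_bound:
  assumes R: "R \<ge> 1" and d: "d \<ge> 1"
  shows "\<bar>\<Sum>w\<in>cube3 B. wave A R (real d * rad3 w)\<bar> \<le> 216 * R\<^sup>2 / real d ^ 3"
proof -
  define W where "W = {w\<in>cube3 B. R < real d * rad3 w \<and> real d * rad3 w < 2 * R}"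
  have R0: "R > 0" and d0: "real d > 0" using R d by auto
  have "(\<Sum>w\<in>cube3 B. wave A R (real d * rad3 w)) = (\<Sum>w\<in>W. wave A R (real d * rad3 w))"
    using wave_zero[OF R0] by (intro sum.mono_neutral_right finite_cube3) (auto simp: W_def not_less)
  then have "\<bar>\<Sum>w\<in>cube3 B. wave A R (real d * rad3 w)\<bar> \<le> (\<Sum>w\<in>W. \<bar>wave A R (real d * rad3 w)\<bar>)" by (simp add: sum_abs)
  also have "\<dots> \<le> (\<Sum>w\<in>W. 1 / R)"
  proof (rule sum_mono)
    fix w assume "w \<in> W"
    then have r: "real d * rad3 w > R" by (simp add: W_def)
    have "\<bar>wave A R (real d * rad3 w)\<bar> = bump (real d * rad3 w / R) * \<bar>sin (2 * pi * A * (real d * rad3 w))\<bar> / (real d * rad3 w)"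
      using r R0 bump_nonneg rad3_nonneg[of w] by (simp add: wave_def abs_mult)
    also have "\<dots> \<le> (1 * 1) / R"
      using r R0 bump_le_1 bump_nonneg by (intro frac_le mult_mono) auto
    finally show "\<bar>wave A R (real d * rad3 w)\<bar> \<le> 1 / R" by simp
  qed
  also have "\<dots> = real (card W) / R" by simp
  also have "\<dots> \<le> (6 * R / real d) ^ 3 / R"
  proof (intro divide_right_mono)
    show "real (card W) \<le> (6 * R / real d) ^ 3"
    proof (cases "W = {}")
      case True
      then show ?thesis using R0 d0 by simp
    next
      case False
      define s where "s = nat \<lfloor>2 * R / real d\<rfloor>"
      have rw: "rad3 w \<le> 2 * R / real d" if "w \<in> W" for w using that d0 by (auto simp: W_def field_simps)
      have sub: "W \<subseteq> cube3 s"
      proof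
        fix w assume w: "w \<in> W"
        have "\<bar>fst w\<bar> \<le> int s" "\<bar>fst (snd w)\<bar> \<le> int s" "\<bar>snd (snd w)\<bar> \<le> int s"
          using abs_le_rad3[of w] rw[OF w] unfolding s_def by linarith+
        then show "w \<in> cube3 s" by (auto simp: cube3_def mem_Times_iff abs_le_iff)
      qed
      obtain w where w: "w \<in> W" using False by auto
      have "1 \<le> nsq w"
      proof -
        have "real d * rad3 w > 0" using w R0 by (auto simp: W_def)
        then have "rad3 w \<noteq> 0" by auto
        then have "nsq w \<noteq> 0" by (auto simp: rad3_eq)
        then show ?thesis using nsq_nonneg[of w] by linarith
      qed
      then have "1 \<le> rad3 w" by (simp add: rad3_eq)
      \<comment> \<open>A nonempty shell contains a nonzero lattice point, of length at least 1;
        this absorbs the \<open>+ 1\<close> of the cube count and turns it into the factor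
        3.\<close>
      then have one: "1 \<le> 2 * R / real d" using rw[OF w] by linarith
      have "card W \<le> card (cube3 s)" using sub finite_cube3 by (rule card_mono[rotated])
      also have "\<dots> = (2 * s + 1) ^ 3"
      proof -
        have "card {- int s..int s} = 2 * s + 1" by simp
        then show ?thesis unfolding cube3_def card_cartesian_product by (simp only: power3_eq_cube mult.assoc)
      qed
      finally have "real (card W) \<le> real ((2 * s + 1) ^ 3)" by (rule of_nat_mono)
      also have "\<dots> = (2 * real s + 1) ^ 3" by (simp add: add.commute)
      also have "\<dots> \<le> (6 * R / real d) ^ 3"
      proof (rule power_mono)
        have "real s \<le> 2 * R / real d" unfolding s_def using one by (intro of_nat_floor) auto
        then have "2 * real s + 1 \<le> 3 * (2 * R / real d)" using one by linarith
        then show "2 * real s + 1 \<le> 6 * R / real d" by simp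
      qed simp
      finally show ?thesis .
    qed
  qed (use R in auto)
  also have "\<dots> = 216 * R\<^sup>2 / real d ^ 3" using R0 by (simp add: power_divide power_mult_distrib power3_eq_cube power2_eq_square)
  finally show ?thesis .
qed

section \<open>Lower bound for the correlation with the test function\<close>

definition test_fun :: "nat \<Rightarrow> nat \<Rightarrow> real \<Rightarrow> real \<Rightarrow> real" where
  "test_fun N Z R t = (\<Sum>m\<in>{1..N}. \<Sum>c\<in>{1..Z}. 1 / (real m * (real c)\<^sup>2) * wave_deriv (sqrt (real (m * c\<^sup>2))) R t)"

text \<open>With \<open>f = c * d\<close> the summand depends on \<open>c\<close>, \<open>d\<close>
  only through \<open>f\<close> and \<open>moebius_mu d\<close>. Pairs with \<open>f \<le> Z\<close>
  form complete divisor sums; the other pairs are bounded by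
  \<open>r3 (m * f^2) / f^3 = O(m^(5/6) * f^(-4/3))\<close>.\<close>

lemma moebius_convolution_lower:
  "\<exists>C\<ge>0. \<forall>m\<ge>1. \<forall>Z\<ge>1. \<forall>D\<ge>Z. (\<Sum>c\<in>{1..Z}. \<Sum>d\<in>{1..D}. moebius_mu d * (real (r3 (m * c\<^sup>2 * d\<^sup>2)) / (real c * real d) ^ 3))
      \<ge> real (r3 m) - C * real m powr (5/6) * real Z powr (-1/6)"
proof -
  obtain C3 where C3: "C3 \<ge> 1" "\<And>n. n \<ge> 1 \<Longrightarrow> real (r3 n) \<le> C3 * real n powr (5/6)" using r3_bound by blast
  obtain G where G: "G \<ge> 0" "\<And>S. finite S \<Longrightarrow> (\<Sum>n\<in>S. real n powr (- 1 - 1/6)) \<le> G"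
    using sum_powr_bounded[of "1/6"] by auto
  have "(\<Sum>c\<in>{1..Z}. \<Sum>d\<in>{1..D}. moebius_mu d * (real (r3 (m * c\<^sup>2 * d\<^sup>2)) / (real c * real d) ^ 3))
      \<ge> real (r3 m) - (C3 * (G * G)) * real m powr (5/6) * real Z powr (-1/6)"
    if m: "m \<ge> 1" and Z: "Z \<ge> 1" and D: "D \<ge> Z" for m Z D :: nat
  proof -
    define a where "a f = real (r3 (m * f\<^sup>2)) / real f ^ 3" for f
    define P where "P = {1..Z} \<times> {1..D}"
    define P1 P2 where "P1 = {x\<in>P. fst x * snd x \<le> Z}" and "P2 = {x\<in>P. \<not> fst x * snd x \<le> Z}"
    have Pfin: "finite P" by (simp add: P_def)
    have "(\<Sum>c\<in>{1..Z}. \<Sum>d\<in>{1..D}. moebius_mu d * (real (r3 (m * c\<^sup>2 * d\<^sup>2)) / (real c * real d) ^ 3))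
       = (\<Sum>x\<in>P. moebius_mu (snd x) * a (fst x * snd x))"
      unfolding P_def sum.cartesian_product by (intro sum.cong) (auto simp: a_def power_mult_distrib mult_ac)
    also have "\<dots> = (\<Sum>x\<in>P1. moebius_mu (snd x) * a (fst x * snd x)) + (\<Sum>x\<in>P2. moebius_mu (snd x) * a (fst x * snd x))"
    proof -
      have eq: "P = P1 \<union> P2" and disj: "P1 \<inter> P2 = {}" by (auto simp: P1_def P2_def)
      have "finite P1" "finite P2" using Pfin by (auto simp: P1_def P2_def)
      then show ?thesis by (subst eq, intro sum.union_disjoint disj)
    qed
    finally have split: "(\<Sum>c\<in>{1..Z}. \<Sum>d\<in>{1..D}. moebius_mu d * (real (r3 (m * c\<^sup>2 * d\<^sup>2)) / (real c * real d) ^ 3))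
      = (\<Sum>x\<in>P1. moebius_mu (snd x) * a (fst x * snd x)) + (\<Sum>x\<in>P2. moebius_mu (snd x) * a (fst x * snd x))" .
    have "(\<Sum>x\<in>P1. moebius_mu (snd x) * a (fst x * snd x)) = (\<Sum>y\<in>(SIGMA f:{1..Z}. {d. d dvd f}). moebius_mu (snd y) * a (fst y))"
    proof (rule sum.reindex_bij_witness[where i = "\<lambda>(f, d). (f div d, d)" and j = "\<lambda>(c, d). (c * d, d)"])
      fix x assume "x \<in> P1"
      then obtain c d where x: "x = (c, d)" "1 \<le> c" "1 \<le> d" "c * d \<le> Z" by (auto simp: P1_def P_def)
      show "(case (case x of (c, d) \<Rightarrow> (c * d, d)) of (f, d) \<Rightarrow> (f div d, d)) = x" using x by simp
      show "(case x of (c, d) \<Rightarrow> (c * d, d)) \<in> (SIGMA f:{1..Z}. {d. d dvd f})" using x by simp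
      show "moebius_mu (snd (case x of (c, d) \<Rightarrow> (c * d, d))) * a (fst (case x of (c, d) \<Rightarrow> (c * d, d))) = moebius_mu (snd x) * a (fst x * snd x)"
        using x by simp
    next
      fix y assume "y \<in> (SIGMA f:{1..Z}. {d. d dvd f})"
      then obtain f d where y: "y = (f, d)" "1 \<le> f" "f \<le> Z" "d dvd f" by auto
      have d1: "d \<ge> 1" using y(2,4) by (cases "d = 0") auto
      have fd: "f div d * d = f" using y by simp
      show "(case (case y of (f, d) \<Rightarrow> (f div d, d)) of (c, d) \<Rightarrow> (c * d, d)) = y" using y fd by simp
      have "d \<le> f" using y by (intro dvd_imp_le) auto
      moreover have "f div d \<le> Z" by (rule order_trans[OF div_le_dividend y(3)])
      moreover have "f div d \<ge> 1" using fd y(2) by (cases "f div d") auto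
      ultimately show "(case y of (f, d) \<Rightarrow> (f div d, d)) \<in> P1" using y d1 fd D by (auto simp: P1_def P_def)
    qed
    also have "\<dots> = (\<Sum>f\<in>{1..Z}. \<Sum>d\<in>{d. d dvd f}. moebius_mu d * a f)"
      by (subst sum.Sigma) (auto intro!: sum.cong)
    also have "\<dots> = (\<Sum>f\<in>{1..Z}. (if f = 1 then 1 else 0) * a f)"
    proof (rule sum.cong[OF refl])
      fix f assume "f \<in> {1..Z}"
      then have "f > 0" by auto
      then show "(\<Sum>d\<in>{d. d dvd f}. moebius_mu d * a f) = (if f = 1 then 1 else 0) * a f"
        using sum_moebius_divisors[of f] by (simp flip: sum_distrib_right)
    qed
    also have "\<dots> = (\<Sum>f\<in>{1..Z}. if f = 1 then a 1 else 0)" by (intro sum.cong) auto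
    also have "\<dots> = real (r3 m)" using Z by (simp add: a_def)
    finally have S1: "(\<Sum>x\<in>P1. moebius_mu (snd x) * a (fst x * snd x)) = real (r3 m)" .
    have "\<bar>\<Sum>x\<in>P2. moebius_mu (snd x) * a (fst x * snd x)\<bar> \<le> (\<Sum>x\<in>P2. \<bar>moebius_mu (snd x) * a (fst x * snd x)\<bar>)" by (rule sum_abs)
    also have "\<dots> \<le> (\<Sum>x\<in>P2. C3 * real m powr (5/6) * real Z powr (-1/6) * (real (fst x) powr (- 1 - 1/6) * real (snd x) powr (- 1 - 1/6)))"
    proof (rule sum_mono)
      fix x assume x: "x \<in> P2"
      define f where "f = fst x * snd x"
      have fZ: "f > Z" using x by (simp add: f_def P2_def)
      then have f: "f > Z" "f \<ge> 1" using Z by linarith+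
      have fp: "real f > 0" using f by simp
      have "\<bar>moebius_mu (snd x) * a f\<bar> \<le> 1 * a f"
        unfolding abs_mult by (intro mult_mono) (auto simp: abs_moebius_le a_def)
      also have "a f \<le> C3 * real (m * f\<^sup>2) powr (5/6) / real f ^ 3"
        unfolding a_def using m f by (intro divide_right_mono C3(2)) auto
      also have "\<dots> = C3 * real m powr (5/6) * ((real f)\<^sup>2 powr (5/6) / real f ^ 3)" by (simp add: powr_mult)
      \<comment> \<open>\<open>5/3 - 3 = - 1/6 - 7/6\<close>: the first part yields the saving in
        \<open>Z\<close>, the second is multiplicative in \<open>c * d\<close> and sums to at most
        \<open>G * G\<close>.\<close>
      also have "(real f)\<^sup>2 powr (5/6) / real f ^ 3 = real f powr (-1/6) * real f powr (- 1 - 1/6)"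
      proof -
        have "(real f)\<^sup>2 powr (5/6) = real f powr (5/3)" using fp by (simp add: powr_powr flip: powr_numeral)
        moreover have "real f ^ 3 = real f powr 3" using fp by simp
        ultimately have "(real f)\<^sup>2 powr (5/6) / real f ^ 3 = real f powr (5/3 - 3)" by (simp only: powr_diff)
        also have "\<dots> = real f powr (-1/6) * real f powr (- 1 - 1/6)" unfolding powr_add[symmetric] by simp
        finally show ?thesis .
      qed
      also have "C3 * real m powr (5/6) * (real f powr (-1/6) * real f powr (- 1 - 1/6))
          \<le> C3 * real m powr (5/6) * (real Z powr (-1/6) * real f powr (- 1 - 1/6))"
      proof (intro mult_left_mono mult_right_mono)
        show "real f powr (-1/6) \<le> real Z powr (-1/6)" using f Z by (intro powr_mono2') auto
      qed (use C3(1) in auto)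
      also have "real f powr (- 1 - 1/6) = real (fst x) powr (- 1 - 1/6) * real (snd x) powr (- 1 - 1/6)"
        by (simp add: f_def powr_mult)
      finally show "\<bar>moebius_mu (snd x) * a (fst x * snd x)\<bar> \<le> C3 * real m powr (5/6) * real Z powr (-1/6) * (real (fst x) powr (- 1 - 1/6) * real (snd x) powr (- 1 - 1/6))"
        by (simp only: f_def mult_1 mult.assoc)
    qed
    also have "\<dots> \<le> (\<Sum>x\<in>P. C3 * real m powr (5/6) * real Z powr (-1/6) * (real (fst x) powr (- 1 - 1/6) * real (snd x) powr (- 1 - 1/6)))"
      using Pfin C3(1) by (intro sum_mono2) (auto simp: P2_def)
    also have "\<dots> = C3 * real m powr (5/6) * real Z powr (-1/6) * ((\<Sum>c\<in>{1..Z}. real c powr (- 1 - 1/6)) * (\<Sum>d\<in>{1..D}. real d powr (- 1 - 1/6)))"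
    proof -
      have "(\<Sum>c\<in>{1..Z}. real c powr (- 1 - 1/6)) * (\<Sum>d\<in>{1..D}. real d powr (- 1 - 1/6))
          = (\<Sum>x\<in>P. real (fst x) powr (- 1 - 1/6) * real (snd x) powr (- 1 - 1/6))"
        unfolding P_def sum_product sum.cartesian_product by (intro sum.cong) auto
      then show ?thesis by (simp only: sum_distrib_left)
    qed
    also have "\<dots> \<le> C3 * real m powr (5/6) * real Z powr (-1/6) * (G * G)"
      using C3(1) G(1) by (intro mult_left_mono mult_mono G(2) sum_nonneg) auto
    finally have "\<bar>\<Sum>x\<in>P2. moebius_mu (snd x) * a (fst x * snd x)\<bar> \<le> (C3 * (G * G)) * real m powr (5/6) * real Z powr (-1/6)"
      by (simp add: mult_ac)
    then show ?thesis unfolding split S1 by linarith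
  qed
  moreover have "C3 * (G * G) \<ge> 0" using C3 G by simp
  ultimately show ?thesis by blast
qed

text \<open>Two factors \<open>1 / d\<close> are replaced by \<open>1 / D\<close> and the third is
  summed harmonically; the lost logarithm is later absorbed by a power of \<open>R\<close>.\<close>

lemma sum_inverse_cube_tail:
  assumes "1 \<le> D" "1 \<le> B"
  shows "(\<Sum>d\<in>{D<..B}. 1 / real d ^ 3) \<le> (1 + ln B) / (real D)\<^sup>2"
proof -
  have "(\<Sum>d\<in>{D<..B}. 1 / real d ^ 3) \<le> (\<Sum>d\<in>{D<..B}. (1 / real d) / (real D)\<^sup>2)"
  proof (rule sum_mono)
    fix d assume d: "d \<in> {D<..B}"
    have "(real D)\<^sup>2 * real d \<le> (real d)\<^sup>2 * real d" using d by (intro mult_right_mono power_mono) auto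
    then have "1 / ((real d)\<^sup>2 * real d) \<le> 1 / ((real D)\<^sup>2 * real d)" using d assms by (intro divide_left_mono mult_pos_pos) auto
    then show "1 / real d ^ 3 \<le> (1 / real d) / (real D)\<^sup>2" by (simp add: power3_eq_cube power2_eq_square mult_ac)
  qed
  also have "\<dots> \<le> (\<Sum>d=1..B. (1 / real d) / (real D)\<^sup>2)" by (intro sum_mono2) auto
  also have "\<dots> = (\<Sum>d=1..B. 1 / real d) / (real D)\<^sup>2" by (simp add: sum_divide_distrib)
  also have "\<dots> \<le> (1 + ln B) / (real D)\<^sup>2" using sum_inverse_le_ln[OF assms(2)] by (intro divide_right_mono) auto
  finally show ?thesis .
qed

text \<open>The Moebius sum is cut at \<open>D\<close>. Poisson summation for
  \<open>d \<le> D\<close> costs \<open>D\<close> times the error at \<open>d = D\<close>; the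
  trivial bound for \<open>d > D\<close> costs \<open>R^2 / D^2\<close> up to a logarithm.\<close>

lemma visible_wave_lower:
  "\<exists>C\<ge>0. \<forall>R\<ge>1. \<forall>n0\<ge>1. \<forall>D\<ge>1. real D \<le> 2 * R \<longrightarrow>
     (\<Sum>v\<in>VS (2 * R). wave (sqrt (real n0)) R (rad3 v)) \<ge>
       R * bump_cos 0 * (\<Sum>d\<in>{1..D}. moebius_mu d * real (r3 (n0 * d\<^sup>2)) / (sqrt (real n0) * real d ^ 3))
       - C * (real D * (1 + (sqrt (real n0) * real D) powr (8/3) / R) + R\<^sup>2 * (1 + ln (3 * R)) / (real D)\<^sup>2)"
proof -
  obtain C where C: "C \<ge> 0" "\<And>R n0 d B. R \<ge> 1 \<Longrightarrow> n0 \<ge> 1 \<Longrightarrow> d \<ge> 1 \<Longrightarrow> 2 * R / real d \<le> real B + 1/2 \<Longrightarrow>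
     \<bar>(\<Sum>v\<in>cube3 B. wave (sqrt (real n0)) R (real d * rad3 v)) - R * bump_cos 0 * real (r3 (n0 * d\<^sup>2)) / (sqrt (real n0) * real d ^ 3)\<bar>
       \<le> C * (1 + (sqrt (real n0) * real d) powr (8/3) / R)"
    using wave_lattice_sum by blast
  define C' where "C' = C + 216"
  have "(\<Sum>v\<in>VS (2 * R). wave (sqrt (real n0)) R (rad3 v)) \<ge>
       R * bump_cos 0 * (\<Sum>d\<in>{1..D}. moebius_mu d * real (r3 (n0 * d\<^sup>2)) / (sqrt (real n0) * real d ^ 3))
       - C' * (real D * (1 + (sqrt (real n0) * real D) powr (8/3) / R) + R\<^sup>2 * (1 + ln (3 * R)) / (real D)\<^sup>2)"
    if R: "R \<ge> 1" and n0: "n0 \<ge> 1" and D: "D \<ge> 1" "real D \<le> 2 * R" for R :: real and n0 D :: nat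
  proof -
    define B where "B = nat \<lceil>2 * R\<rceil>"
    define A where "A = sqrt (real n0)"
    define T where "T d = (\<Sum>w\<in>cube3 B. wave A R (real d * rad3 w))" for d
    define M where "M d = R * bump_cos 0 * real (r3 (n0 * d\<^sup>2)) / (A * real d ^ 3)" for d
    define E where "E = 1 + (A * real D) powr (8/3) / R"
    have R0: "R > 0" using R by simp
    have B: "2 * R \<le> real B" "real B \<le> 3 * R" "B \<ge> 1" "D \<le> B"
    proof -
      show "2 * R \<le> real B" unfolding B_def by (rule real_nat_ceiling_ge)
      have "real B < 2 * R + 1" unfolding B_def using R by linarith
      then show "real B \<le> 3 * R" using R by linarith
      show "B \<ge> 1" using \<open>2 * R \<le> real B\<close> R by linarith
      show "D \<le> B" using \<open>2 * R \<le> real B\<close> D by linarith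
    qed
    have E0: "E \<ge> 0" using R by (simp add: E_def)
    have A0: "A \<ge> 0" by (simp add: A_def)
    have "(\<Sum>v\<in>VS (2 * R). wave A R (rad3 v)) = (\<Sum>d=1..B. moebius_mu d * T d)"
      unfolding T_def using wave_zero[OF R0] by (intro visible_sum_moebius B) (auto simp: wave_def)
    also have "\<dots> = (\<Sum>d\<in>{1..D}. moebius_mu d * T d) + (\<Sum>d\<in>{D<..B}. moebius_mu d * T d)"
    proof -
      have eq: "{1..B} = {1..D} \<union> {D<..B}" using B D by auto
      show ?thesis unfolding eq by (intro sum.union_disjoint) auto
    qed
    finally have e1: "(\<Sum>v\<in>VS (2 * R). wave A R (rad3 v)) = (\<Sum>d\<in>{1..D}. moebius_mu d * T d) + (\<Sum>d\<in>{D<..B}. moebius_mu d * T d)" .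
    have e2: "(\<Sum>d\<in>{D<..B}. moebius_mu d * T d) \<ge> - (216 * (R\<^sup>2 * (1 + ln (3 * R)) / (real D)\<^sup>2))"
    proof -
      have "\<bar>\<Sum>d\<in>{D<..B}. moebius_mu d * T d\<bar> \<le> (\<Sum>d\<in>{D<..B}. \<bar>moebius_mu d * T d\<bar>)" by (rule sum_abs)
      also have "\<dots> \<le> (\<Sum>d\<in>{D<..B}. 216 * R\<^sup>2 * (1 / real d ^ 3))"
      proof (rule sum_mono)
        fix d assume d: "d \<in> {D<..B}"
        have "\<bar>T d\<bar> \<le> 216 * R\<^sup>2 / real d ^ 3" unfolding T_def using d by (intro wave_tail_bound R) auto
        then have "\<bar>moebius_mu d\<bar> * \<bar>T d\<bar> \<le> 1 * (216 * R\<^sup>2 / real d ^ 3)" by (intro mult_mono abs_moebius_le) auto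
        then show "\<bar>moebius_mu d * T d\<bar> \<le> 216 * R\<^sup>2 * (1 / real d ^ 3)" by (simp add: abs_mult)
      qed
      also have "\<dots> = 216 * R\<^sup>2 * (\<Sum>d\<in>{D<..B}. 1 / real d ^ 3)" by (simp only: sum_distrib_left)
      also have "\<dots> \<le> 216 * R\<^sup>2 * ((1 + ln B) / (real D)\<^sup>2)" by (intro mult_left_mono sum_inverse_cube_tail D B) auto
      also have "\<dots> \<le> 216 * R\<^sup>2 * ((1 + ln (3 * R)) / (real D)\<^sup>2)"
        using B R by (intro mult_left_mono divide_right_mono add_left_mono) auto
      finally show ?thesis by simp
    qed
    have e3: "(\<Sum>d\<in>{1..D}. moebius_mu d * T d) \<ge> (\<Sum>d\<in>{1..D}. moebius_mu d * M d) - real D * (C * E)"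
    proof -
      have "\<bar>(\<Sum>d\<in>{1..D}. moebius_mu d * T d) - (\<Sum>d\<in>{1..D}. moebius_mu d * M d)\<bar> = \<bar>\<Sum>d\<in>{1..D}. moebius_mu d * (T d - M d)\<bar>"
        by (simp add: sum_subtractf right_diff_distrib)
      also have "\<dots> \<le> (\<Sum>d\<in>{1..D}. \<bar>moebius_mu d * (T d - M d)\<bar>)" by (rule sum_abs)
      also have "\<dots> \<le> (\<Sum>d\<in>{1..D}. C * E)"
      proof (rule sum_mono)
        fix d assume d: "d \<in> {1..D}"
        have "2 * R / real d \<le> 2 * R / 1" using d R by (intro divide_left_mono) auto
        then have "2 * R / real d \<le> real B + 1/2" using B by linarith
        then have "\<bar>T d - M d\<bar> \<le> C * (1 + (A * real d) powr (8/3) / R)"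
          unfolding T_def M_def A_def using d by (intro C(2) R n0) auto
        also have "\<dots> \<le> C * E"
          unfolding E_def using d A0 C(1) R by (intro mult_left_mono add_left_mono divide_right_mono powr_mono2) auto
        finally have "\<bar>moebius_mu d\<bar> * \<bar>T d - M d\<bar> \<le> 1 * (C * E)" by (intro mult_mono abs_moebius_le) auto
        then show "\<bar>moebius_mu d * (T d - M d)\<bar> \<le> C * E" by (simp add: abs_mult)
      qed
      also have "\<dots> = real D * (C * E)" by simp
      finally show ?thesis by linarith
    qed
    have e4: "(\<Sum>d\<in>{1..D}. moebius_mu d * M d) = R * bump_cos 0 * (\<Sum>d\<in>{1..D}. moebius_mu d * real (r3 (n0 * d\<^sup>2)) / (A * real d ^ 3))"
      unfolding sum_distrib_left M_def by (intro sum.cong) auto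
    have fin: "(\<Sum>v\<in>VS (2 * R). wave A R (rad3 v)) \<ge> R * bump_cos 0 * (\<Sum>d\<in>{1..D}. moebius_mu d * real (r3 (n0 * d\<^sup>2)) / (A * real d ^ 3))
        - real D * (C * E) - 216 * (R\<^sup>2 * (1 + ln (3 * R)) / (real D)\<^sup>2)"
      using e1 e2 e3 e4 by linarith
    define X where "X = R\<^sup>2 * (1 + ln (3 * R)) / (real D)\<^sup>2"
    have "0 \<le> X" using R by (simp add: X_def)
    then have "0 \<le> C * X" "0 \<le> real D * E" using E0 C(1) by auto
    then have "real D * (C * E) + 216 * X \<le> C' * (real D * E + X)"
      unfolding C'_def by (simp add: algebra_simps)
    then show ?thesis using fin unfolding A_def E_def X_def by linarith
  qed
  moreover have "C' \<ge> 0" using C by (simp add: C'_def)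
  ultimately show ?thesis by blast
qed

text \<open>Sums \<open>visible_wave_lower\<close> over the frequencies
  \<open>A = c * sqrt m\<close>. The weight \<open>1 / (m * c^2)\<close> and the factors
  \<open>1 / (A * d^3)\<close> combine to \<open>1 / (m^(3/2) * (c * d)^3)\<close>, the form that
  \<open>moebius_convolution_lower\<close> needs. The sign of \<open>I\<close> is that of the
  integration by parts.\<close>

lemma visible_test_lower:
  "\<exists>C\<ge>0. \<forall>R\<ge>1. \<forall>N\<ge>1. \<forall>Z\<ge>1. \<forall>D\<ge>Z. real D \<le> 2 * R \<longrightarrow>
     (\<exists>I. ((\<lambda>t. visible_error t * test_fun N Z R t) has_integral I) {R..2 * R} \<and>
       - I \<ge> R * bump_cos 0 * ((\<Sum>m=1..N. real (r3 m) / real m powr (3/2)) - C * real N * real Z powr (-1/6))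
         - C * (real N * real Z) * (1 + real D * (1 + (real Z * sqrt N * real D) powr (8/3) / R) + R\<^sup>2 * (1 + ln (3 * R)) / (real D)\<^sup>2))"
proof -
  obtain C1 where C1: "C1 \<ge> 0" "\<And>R n0 D. R \<ge> 1 \<Longrightarrow> n0 \<ge> 1 \<Longrightarrow> D \<ge> 1 \<Longrightarrow> real D \<le> 2 * R \<Longrightarrow>
     (\<Sum>v\<in>VS (2 * R). wave (sqrt (real n0)) R (rad3 v)) \<ge>
       R * bump_cos 0 * (\<Sum>d\<in>{1..D}. moebius_mu d * real (r3 (n0 * d\<^sup>2)) / (sqrt (real n0) * real d ^ 3))
       - C1 * (real D * (1 + (sqrt (real n0) * real D) powr (8/3) / R) + R\<^sup>2 * (1 + ln (3 * R)) / (real D)\<^sup>2)"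
    using visible_wave_lower by blast
  obtain C2 where C2: "C2 \<ge> 0" "\<And>m Z D. m \<ge> 1 \<Longrightarrow> Z \<ge> 1 \<Longrightarrow> D \<ge> Z \<Longrightarrow>
     (\<Sum>c\<in>{1..Z}. \<Sum>d\<in>{1..D}. moebius_mu d * (real (r3 (m * c\<^sup>2 * d\<^sup>2)) / (real c * real d) ^ 3))
      \<ge> real (r3 m) - C2 * real m powr (5/6) * real Z powr (-1/6)"
    using moebius_convolution_lower by blast
  \<comment> \<open>Bounds the volume term: \<open>bump_usin (A * R)\<close> is at most
    \<open>30 / (A * R)^2\<close>, which cancels \<open>R^2\<close>, and
    \<open>A \<ge> 1\<close>.\<close>
  define z where "z = \<bar>4 * pi / zeta 3\<bar> * 30"
  have z0: "z \<ge> 0" by (simp add: z_def)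
  define C where "C = C1 + C2 + z"
  have "\<exists>I. ((\<lambda>t. visible_error t * test_fun N Z R t) has_integral I) {R..2 * R} \<and>
       - I \<ge> R * bump_cos 0 * ((\<Sum>m=1..N. real (r3 m) / real m powr (3/2)) - C * real N * real Z powr (-1/6))
         - C * (real N * real Z) * (1 + real D * (1 + (real Z * sqrt N * real D) powr (8/3) / R) + R\<^sup>2 * (1 + ln (3 * R)) / (real D)\<^sup>2)"
    if R: "R \<ge> 1" and N: "N \<ge> 1" and Z: "Z \<ge> 1" and D: "D \<ge> Z" "real D \<le> 2 * R" for R :: real and N Z D :: nat
  proof -
    have R0: "R > 0" using R by simp
    define q where "q m c = 1 / (real m * (real c)\<^sup>2)" for m c :: nat
    define A where "A m c = sqrt (real (m * c\<^sup>2))" for m c :: nat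
    define V where "V m c = (\<Sum>v\<in>VS (2 * R). wave (A m c) R (rad3 v))" for m c
    define U where "U m c = 4 * pi / zeta 3 * (R\<^sup>2 * bump_usin (A m c * R))" for m c
    define I where "I = (\<Sum>m\<in>{1..N}. \<Sum>c\<in>{1..Z}. q m c * (U m c - V m c))"
    have hi: "((\<lambda>t. visible_error t * test_fun N Z R t) has_integral I) {R..2 * R}"
    proof -
      have "((\<lambda>t. \<Sum>m\<in>{1..N}. \<Sum>c\<in>{1..Z}. q m c * (visible_error t * wave_deriv (A m c) R t)) has_integral I) {R..2 * R}"
        unfolding I_def U_def V_def
        by (intro has_integral_sum finite_atLeastAtMost has_integral_mult_right visible_wave_integral R0)
      then show ?thesis unfolding test_fun_def q_def A_def sum_distrib_left
        by (rule has_integral_eq[rotated]) (simp add: mult_ac)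
    qed
    define Er where "Er = real D * (1 + (real Z * sqrt N * real D) powr (8/3) / R) + R\<^sup>2 * (1 + ln (3 * R)) / (real D)\<^sup>2"
    have Er0: "Er \<ge> 0" using R by (simp add: Er_def)
    define Mn where "Mn m c = (\<Sum>d\<in>{1..D}. moebius_mu d * real (r3 (m * c\<^sup>2 * d\<^sup>2)) / (A m c * real d ^ 3))" for m c :: nat
    have trm: "q m c * (V m c - U m c) \<ge> R * bump_cos 0 * (q m c * Mn m c) - (C1 * Er + z)" if mc: "m \<in> {1..N}" "c \<in> {1..Z}" for m c
    proof -
      have mc1: "m \<ge> 1" "c \<ge> 1" "m \<le> N" "c \<le> Z" using mc by auto
      have n01: "m * c\<^sup>2 \<ge> 1" using mc1 by simp
      have q01: "0 \<le> q m c" "q m c \<le> 1"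
      proof -
        show "0 \<le> q m c" by (simp add: q_def)
        have "1 * 1 \<le> real m * (real c)\<^sup>2" using mc1 by (intro mult_mono one_le_power) auto
        then show "q m c \<le> 1" by (simp add: q_def divide_le_eq_1)
      qed
      have A1: "A m c \<ge> 1" unfolding A_def using n01 by (simp add: real_sqrt_ge_1_iff del: of_nat_mult of_nat_power)
      have Ale: "A m c \<le> real Z * sqrt N"
      proof -
        have "A m c = real c * sqrt m" unfolding A_def by (simp add: real_sqrt_mult)
        also have "\<dots> \<le> real Z * sqrt N" using mc1 by (intro mult_mono) auto
        finally show ?thesis .
      qed
      have "V m c \<ge> R * bump_cos 0 * Mn m c - C1 * (real D * (1 + (A m c * real D) powr (8/3) / R) + R\<^sup>2 * (1 + ln (3 * R)) / (real D)\<^sup>2)"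
        unfolding V_def Mn_def A_def using D Z by (intro C1(2) R n01) auto
      moreover have "C1 * (real D * (1 + (A m c * real D) powr (8/3) / R) + R\<^sup>2 * (1 + ln (3 * R)) / (real D)\<^sup>2) \<le> C1 * Er"
        unfolding Er_def using Ale A1 C1(1) R by (intro mult_left_mono add_right_mono add_left_mono divide_right_mono powr_mono2 mult_right_mono) auto
      ultimately have Vl: "V m c \<ge> R * bump_cos 0 * Mn m c - C1 * Er" by linarith
      have "\<bar>U m c\<bar> = \<bar>4 * pi / zeta 3\<bar> * (R\<^sup>2 * \<bar>bump_usin (A m c * R)\<bar>)" by (simp add: U_def abs_mult)
      also have "\<dots> \<le> \<bar>4 * pi / zeta 3\<bar> * (R\<^sup>2 * (30 / (A m c * R)\<^sup>2))"
        using A1 R0 by (intro mult_left_mono bump_usin_bound) auto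
      also have "R\<^sup>2 * (30 / (A m c * R)\<^sup>2) = 30 / (A m c)\<^sup>2" using R0 by (simp add: power_mult_distrib)
      also have "\<bar>4 * pi / zeta 3\<bar> * (30 / (A m c)\<^sup>2) \<le> \<bar>4 * pi / zeta 3\<bar> * 30"
      proof (rule mult_left_mono)
        have "1 \<le> (A m c)\<^sup>2" using A1 by (intro one_le_power)
        then show "30 / (A m c)\<^sup>2 \<le> 30" using frac_le[of 30 30 1 "(A m c)\<^sup>2"] by simp
      qed simp
      finally have Ul: "\<bar>U m c\<bar> \<le> z" by (simp add: z_def)
      have "V m c - U m c \<ge> R * bump_cos 0 * Mn m c - (C1 * Er + z)" using Vl Ul by linarith
      then have 1: "q m c * (V m c - U m c) \<ge> q m c * (R * bump_cos 0 * Mn m c - (C1 * Er + z))" using q01 by (intro mult_left_mono)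
      have 2: "q m c * (C1 * Er + z) \<le> 1 * (C1 * Er + z)" using q01 C1 Er0 z0 by (intro mult_right_mono) auto
      have "R * bump_cos 0 * (q m c * Mn m c) - (C1 * Er + z) \<le> R * bump_cos 0 * (q m c * Mn m c) - q m c * (C1 * Er + z)"
        using 2 by (intro diff_left_mono) simp
      also have "\<dots> = q m c * (R * bump_cos 0 * Mn m c - (C1 * Er + z))" by (simp only: right_diff_distrib mult_ac)
      also note 1
      finally show ?thesis .
    qed
    have "- I = (\<Sum>m\<in>{1..N}. \<Sum>c\<in>{1..Z}. q m c * (V m c - U m c))"
      unfolding I_def sum_negf[symmetric] by (intro sum.cong refl) (simp add: algebra_simps)
    also have "\<dots> \<ge> (\<Sum>m\<in>{1..N}. \<Sum>c\<in>{1..Z}. R * bump_cos 0 * (q m c * Mn m c) - (C1 * Er + z))"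
      by (intro sum_mono trm)
    also have "(\<Sum>m\<in>{1..N}. \<Sum>c\<in>{1..Z}. R * bump_cos 0 * (q m c * Mn m c) - (C1 * Er + z))
       = R * bump_cos 0 * (\<Sum>m\<in>{1..N}. \<Sum>c\<in>{1..Z}. q m c * Mn m c) - real N * (real Z * (C1 * Er + z))"
      by (simp add: sum_subtractf sum_distrib_left)
    finally have L1: "- I \<ge> R * bump_cos 0 * (\<Sum>m\<in>{1..N}. \<Sum>c\<in>{1..Z}. q m c * Mn m c) - real N * (real Z * (C1 * Er + z))" .
    have L2: "(\<Sum>m\<in>{1..N}. \<Sum>c\<in>{1..Z}. q m c * Mn m c) \<ge> (\<Sum>m=1..N. real (r3 m) / real m powr (3/2)) - C2 * real N * real Z powr (-1/6)"
    proof -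
      have "(\<Sum>m\<in>{1..N}. \<Sum>c\<in>{1..Z}. q m c * Mn m c) \<ge> (\<Sum>m\<in>{1..N}. real (r3 m) / real m powr (3/2) - C2 * real Z powr (-1/6))"
      proof (rule sum_mono)
        fix m assume m: "m \<in> {1..N}"
        then have m1: "real m \<ge> 1" by simp
        have m32: "real m * sqrt m = real m powr (3/2)"
        proof -
          have "real m * sqrt m = real m powr 1 * real m powr (1/2)" using m1 by (simp add: powr_half_sqrt)
          then show ?thesis by (simp only: powr_add[symmetric]) simp
        qed
        have "(\<Sum>c\<in>{1..Z}. q m c * Mn m c) = (\<Sum>c\<in>{1..Z}. \<Sum>d\<in>{1..D}. moebius_mu d * (real (r3 (m * c\<^sup>2 * d\<^sup>2)) / (real c * real d) ^ 3)) / real m powr (3/2)"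
          unfolding Mn_def sum_distrib_left sum_divide_distrib
        proof (intro sum.cong refl)
          fix c d
          have "A m c = real c * sqrt m" unfolding A_def by (simp add: real_sqrt_mult)
          then show "q m c * (moebius_mu d * real (r3 (m * c\<^sup>2 * d\<^sup>2)) / (A m c * real d ^ 3)) = moebius_mu d * (real (r3 (m * c\<^sup>2 * d\<^sup>2)) / (real c * real d) ^ 3) / real m powr (3/2)"
            unfolding q_def m32[symmetric] by (simp add: power_mult_distrib power3_eq_cube power2_eq_square mult_ac)
        qed
        also have "\<dots> \<ge> (real (r3 m) - C2 * real m powr (5/6) * real Z powr (-1/6)) / real m powr (3/2)"
          using m Z D by (intro divide_right_mono C2(2)) auto
        finally have "(\<Sum>c\<in>{1..Z}. q m c * Mn m c) \<ge> real (r3 m) / real m powr (3/2) - C2 * (real m powr (5/6) / real m powr (3/2)) * real Z powr (-1/6)"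
          by (simp add: diff_divide_distrib)
        \<comment> \<open>The decay \<open>m^(-2/3)\<close> is given away, which puts a factor
          \<open>N\<close> into the error; a high power of \<open>N\<close> for \<open>Z\<close>
          pays for it.\<close>
        moreover have "real m powr (5/6) / real m powr (3/2) \<le> 1"
          using m1 powr_mono[of "5/6" "3/2" "real m"] by (simp add: divide_le_eq_1)
        then have "C2 * (real m powr (5/6) / real m powr (3/2)) * real Z powr (-1/6) \<le> C2 * 1 * real Z powr (-1/6)"
          using C2(1) by (intro mult_right_mono mult_left_mono) auto
        ultimately show "real (r3 m) / real m powr (3/2) - C2 * real Z powr (-1/6) \<le> (\<Sum>c\<in>{1..Z}. q m c * Mn m c)" by linarith
      qed
      then show ?thesis by (simp add: sum_subtractf mult_ac)
    qed
    have c0: "0 \<le> R * bump_cos 0" using R bump_cos_0_pos by simp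
    have "R * bump_cos 0 * (\<Sum>m\<in>{1..N}. \<Sum>c\<in>{1..Z}. q m c * Mn m c)
      \<ge> R * bump_cos 0 * ((\<Sum>m=1..N. real (r3 m) / real m powr (3/2)) - C2 * real N * real Z powr (-1/6))"
      by (rule mult_left_mono[OF L2 c0])
    moreover have "R * bump_cos 0 * ((\<Sum>m=1..N. real (r3 m) / real m powr (3/2)) - C2 * real N * real Z powr (-1/6))
      \<ge> R * bump_cos 0 * ((\<Sum>m=1..N. real (r3 m) / real m powr (3/2)) - C * real N * real Z powr (-1/6))"
      using C1(1) z0 by (intro mult_left_mono[OF _ c0] diff_left_mono mult_right_mono) (auto simp: C_def)
    moreover have "real N * (real Z * (C1 * Er + z)) \<le> C * (real N * real Z) * (1 + Er)"
    proof -
      have "C1 * Er + z \<le> C * (1 + Er)" using C1(1) C2(1) z0 Er0 by (simp add: C_def algebra_simps)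
      then have "(real N * real Z) * (C1 * Er + z) \<le> (real N * real Z) * (C * (1 + Er))" by (intro mult_left_mono) auto
      then show ?thesis by (simp add: mult_ac)
    qed
    ultimately have "- I \<ge> R * bump_cos 0 * ((\<Sum>m=1..N. real (r3 m) / real m powr (3/2)) - C * real N * real Z powr (-1/6)) - C * (real N * real Z) * (1 + Er)"
      using L1 by linarith
    then show ?thesis using hi unfolding Er_def by (auto simp: add.assoc)
  qed
  moreover have "C \<ge> 0" using C1 C2 z0 by (simp add: C_def)
  ultimately show ?thesis by blast
qed

text \<open>In \<open>wave_deriv\<close> the derivative falls either on the sine, giving the
  amplitude \<open>a = O(1 / R)\<close> times the cosine sum, or on the envelope, giving
  \<open>b = O(1 / R^2)\<close> times a sum bounded trivially by \<open>N * Z\<close>.\<close>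

lemma test_fun_bound:
  assumes R: "R \<ge> 1" and t: "t \<in> {R..2 * R}"
  shows "R * \<bar>test_fun N Z R t\<bar> \<le> 2 * pi * \<bar>cos_sum N Z t\<bar> + 4 * (real N * real Z) / R"
proof -
  have R0: "R > 0" and t0: "t > 0" "t \<ge> R" using R t by auto
  define s where "s = (\<Sum>m\<in>{1..N}. \<Sum>c\<in>{1..Z}. 1 / (real m * (real c)\<^sup>2) * sin (2 * pi * (real c * sqrt m) * t))"
  define a b where "a = 2 * pi * (bump (t / R) / t)" and "b = bump1 (t / R) / R / t - bump (t / R) / t\<^sup>2"
  have eq: "test_fun N Z R t = a * cos_sum N Z t + b * s"
    unfolding test_fun_def cos_sum_def s_def sum_distrib_left sum.distrib[symmetric]
  proof (intro sum.cong refl)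
    fix m c assume "m \<in> {1..N}" "c \<in> {1..Z}"
    then have pos: "real m > 0" "real c > 0" "sqrt m > 0" by auto
    have A: "sqrt (real (m * c\<^sup>2)) = real c * sqrt m" by (simp add: real_sqrt_mult)
    have w: "1 / (real m * (real c)\<^sup>2) * (real c * sqrt m) = 1 / (real c * sqrt m)"
    proof -
      have "real m = sqrt m * sqrt m" by simp
      then show ?thesis using pos by (simp add: field_simps power2_eq_square)
    qed
    have "1 / (real m * (real c)\<^sup>2) * wave_deriv (real c * sqrt m) R t
      = a * (1 / (real m * (real c)\<^sup>2) * (real c * sqrt m) * cos (2 * pi * (real c * sqrt m) * t)) + b * (1 / (real m * (real c)\<^sup>2) * sin (2 * pi * (real c * sqrt m) * t))"
      unfolding wave_deriv_def a_def b_def by (simp add: distrib_left mult_ac)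
    then show "1 / (real m * (real c)\<^sup>2) * wave_deriv (sqrt (real (m * c\<^sup>2))) R t
      = a * (cos (2 * pi * (real c * sqrt m) * t) / (real c * sqrt m)) + b * (1 / (real m * (real c)\<^sup>2) * sin (2 * pi * (real c * sqrt m) * t))"
      unfolding A w by simp
  qed
  have "\<bar>s\<bar> \<le> real N * real Z"
  proof -
    have "\<bar>s\<bar> \<le> (\<Sum>m\<in>{1..N}. \<Sum>c\<in>{1..Z}. 1)"
      unfolding s_def
    proof (intro order_trans[OF sum_abs sum_mono[OF order_trans[OF sum_abs sum_mono]]])
      fix m c assume "m \<in> {1..N}" "c \<in> {1..Z}"
      then have "1 * 1 \<le> real m * (real c)\<^sup>2" by (intro mult_mono one_le_power) auto
      then have "1 / (real m * (real c)\<^sup>2) \<le> 1" by (simp add: divide_le_eq_1)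
      then have "\<bar>1 / (real m * (real c)\<^sup>2)\<bar> * \<bar>sin (2 * pi * (real c * sqrt m) * t)\<bar> \<le> 1 * 1" by (intro mult_mono) auto
      then show "\<bar>1 / (real m * (real c)\<^sup>2) * sin (2 * pi * (real c * sqrt m) * t)\<bar> \<le> 1" by (simp only: abs_mult mult_1)
    qed
    then show ?thesis by simp
  qed
  moreover have "\<bar>b\<bar> \<le> 4 / R\<^sup>2"
  proof -
    have tR: "t / R \<in> {1..2}" using t R0 by (simp add: field_simps)
    have "\<bar>bump1 (t / R) / R / t\<bar> = \<bar>bump1 (t / R)\<bar> / (R * t)" using R0 t0 by (simp add: abs_mult)
    also have "\<dots> \<le> 3 / (R * R)" using bump_deriv_bounds(1)[OF tR] R0 t0 by (intro frac_le) auto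
    finally have 1: "\<bar>bump1 (t / R) / R / t\<bar> \<le> 3 / R\<^sup>2" by (simp add: power2_eq_square)
    have "\<bar>bump (t / R) / t\<^sup>2\<bar> = bump (t / R) / t\<^sup>2" using bump_nonneg by simp
    also have "\<dots> \<le> 1 / R\<^sup>2" using bump_le_1 R0 t0 by (intro frac_le power_mono) auto
    finally have "\<bar>bump (t / R) / t\<^sup>2\<bar> \<le> 1 / R\<^sup>2" .
    with 1 have "\<bar>b\<bar> \<le> 3 / R\<^sup>2 + 1 / R\<^sup>2" unfolding b_def
      by (intro order_trans[OF abs_triangle_ineq4 add_mono])
    then show ?thesis by (simp add: add_divide_distrib[symmetric])
  qed
  ultimately have bs: "\<bar>b\<bar> * \<bar>s\<bar> \<le> 4 / R\<^sup>2 * (real N * real Z)" by (intro mult_mono) auto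
  have "\<bar>a\<bar> \<le> 2 * pi / R"
  proof -
    have "bump (t / R) / t \<le> 1 / R" using bump_le_1 R0 t0 by (intro frac_le) auto
    then have "2 * pi * (bump (t / R) / t) \<le> 2 * pi * (1 / R)" by (intro mult_left_mono) auto
    moreover have "a \<ge> 0" unfolding a_def using bump_nonneg t0 by simp
    ultimately show ?thesis by (simp add: a_def)
  qed
  then have "\<bar>a\<bar> * \<bar>cos_sum N Z t\<bar> \<le> 2 * pi / R * \<bar>cos_sum N Z t\<bar>" by (intro mult_right_mono) auto
  then have "\<bar>test_fun N Z R t\<bar> \<le> 2 * pi / R * \<bar>cos_sum N Z t\<bar> + 4 / R\<^sup>2 * (real N * real Z)"
    unfolding eq using bs abs_triangle_ineq[of "a * cos_sum N Z t" "b * s"] unfolding abs_mult by linarith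
  then have "R * \<bar>test_fun N Z R t\<bar> \<le> R * (2 * pi / R * \<bar>cos_sum N Z t\<bar> + 4 / R\<^sup>2 * (real N * real Z))" using R0 by (intro mult_left_mono) auto
  also have "\<dots> = 2 * pi * \<bar>cos_sum N Z t\<bar> + 4 * (real N * real Z) / R" using R0 by (simp add: distrib_left power2_eq_square)
  finally show ?thesis .
qed

section \<open>Duality\<close>

text \<open>Young's inequality for \<open>x / \<tau>\<close> and \<open>\<tau> * y\<close>, with the
  factors \<open>1 / p\<close> and \<open>1 / q\<close> dropped. The conjugate exponent is at most
  \<open>2 * k\<close>, so \<open>y powr q \<le> 1 + y ^ (2 * k)\<close> reduces to an even integer
  moment.\<close>

lemma young_moment:
  fixes x y \<tau> p :: real
  assumes p: "p > 1" and k: "p / (p - 1) \<le> real (2 * k)" and \<tau>: "\<tau> > 0" and xy: "x \<ge> 0" "y \<ge> 0"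
  shows "x * y \<le> \<tau> powr (- p) * x powr p + \<tau> powr (p / (p - 1)) * (1 + y ^ (2 * k))"
proof -
  define q where "q = p / (p - 1)"
  have q: "q > 1" "1 / p + 1 / q = 1" using p by (auto simp: q_def field_simps)
  have "x * y = (x / \<tau>) * (\<tau> * y)" using \<tau> by simp
  also have "\<dots> \<le> (x / \<tau>) powr p / p + (\<tau> * y) powr q / q"
    using p q \<tau> xy by (intro Youngs_inequality) auto
  also have "\<dots> \<le> (x / \<tau>) powr p / 1 + (\<tau> * y) powr q / 1"
    using p q by (intro add_mono divide_left_mono) auto
  also have "(x / \<tau>) powr p = \<tau> powr (- p) * x powr p" using \<tau> xy by (simp add: powr_divide powr_minus field_simps)
  also have "(\<tau> * y) powr q = \<tau> powr q * y powr q" using \<tau> xy by (simp add: powr_mult)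
  also have "y powr q \<le> 1 + y ^ (2 * k)"
  proof (cases "y \<le> 1")
    case True
    then have "y powr q \<le> 1" using xy q by (intro powr_le1) auto
    moreover have "0 \<le> y ^ (2 * k)" using xy by simp
    ultimately show ?thesis by linarith
  next
    case False
    then have "y powr q \<le> y powr real (2 * k)" using k by (intro powr_mono) (auto simp: q_def)
    also have "\<dots> = y ^ (2 * k)" using False by (intro powr_realpow) auto
    finally show ?thesis by simp
  qed
  finally show ?thesis using \<tau> by (simp add: q_def)
qed

lemma integrable_bounded_measurable:
  fixes f :: "real \<Rightarrow> real"
  assumes "f \<in> borel_measurable borel" "\<And>t. t \<in> {a..b} \<Longrightarrow> \<bar>f t\<bar> \<le> M"
  shows "f integrable_on {a..b}"
proof -
  have "set_integrable lborel {a..b} f"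
    unfolding set_integrable_def using assms by (intro integrableI_bounded_set_indicator[where B = M]) (auto simp: emeasure_lborel_Icc_eq)
  then show ?thesis by (rule set_borel_integral_eq_integral(1))
qed

lemma duality_lower:
  fixes E T :: "real \<Rightarrow> real"
  assumes ab: "a \<le> b" and m: "E \<in> borel_measurable borel" "T \<in> borel_measurable borel"
    and bd: "\<And>t. t \<in> {a..b} \<Longrightarrow> \<bar>E t\<bar> \<le> M" "\<And>t. t \<in> {a..b} \<Longrightarrow> \<bar>T t\<bar> \<le> M"
    and p: "p > 1" and k: "p / (p - 1) \<le> real (2 * k)" and \<tau>: "\<tau> > 0"
  shows "\<bar>integral {a..b} (\<lambda>t. E t * T t)\<bar>
     \<le> \<tau> powr (- p) * integral {a..b} (\<lambda>t. \<bar>E t\<bar> powr p) + \<tau> powr (p / (p - 1)) * ((b - a) + integral {a..b} (\<lambda>t. T t ^ (2 * k)))"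
proof -
  have M0: "M \<ge> 0" using bd(1)[of a] ab by force
  have i1: "(\<lambda>t. E t * T t) integrable_on {a..b}"
  proof (rule integrable_bounded_measurable)
    show "(\<lambda>t. E t * T t) \<in> borel_measurable borel" using m by simp
    show "\<bar>E t * T t\<bar> \<le> M * M" if "t \<in> {a..b}" for t
      unfolding abs_mult using bd[OF that] M0 by (intro mult_mono) auto
  qed
  have i2: "(\<lambda>t. \<bar>E t\<bar> powr p) integrable_on {a..b}"
  proof (rule integrable_bounded_measurable)
    show "(\<lambda>t. \<bar>E t\<bar> powr p) \<in> borel_measurable borel" using m by simp
    show "\<bar>\<bar>E t\<bar> powr p\<bar> \<le> M powr p" if "t \<in> {a..b}" for t
      using bd(1)[OF that] p by (auto intro!: powr_mono2)
  qed
  have i3: "(\<lambda>t. T t ^ (2 * k)) integrable_on {a..b}"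
  proof (rule integrable_bounded_measurable)
    show "(\<lambda>t. T t ^ (2 * k)) \<in> borel_measurable borel" using m by simp
    show "\<bar>T t ^ (2 * k)\<bar> \<le> M ^ (2 * k)" if "t \<in> {a..b}" for t
      using bd(2)[OF that] unfolding power_abs by (intro power_mono) auto
  qed
  have i4: "(\<lambda>t. 1 + T t ^ (2 * k)) integrable_on {a..b}" using i3 by (intro integrable_add) auto
  have "\<bar>integral {a..b} (\<lambda>t. E t * T t)\<bar> \<le> integral {a..b} (\<lambda>t. \<tau> powr (- p) * \<bar>E t\<bar> powr p + \<tau> powr (p / (p - 1)) * (1 + T t ^ (2 * k)))"
    unfolding real_norm_def[symmetric]
  proof (rule integral_norm_bound_integral[OF i1])
    show "(\<lambda>t. \<tau> powr (- p) * norm (E t) powr p + \<tau> powr (p / (p - 1)) * (1 + T t ^ (2 * k))) integrable_on {a..b}"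
      unfolding real_norm_def by (rule integrable_add[OF integrable_on_mult_right[OF i2] integrable_on_mult_right[OF i4]])
    fix t
    have "\<bar>E t\<bar> * \<bar>T t\<bar> \<le> \<tau> powr (- p) * \<bar>E t\<bar> powr p + \<tau> powr (p / (p - 1)) * (1 + \<bar>T t\<bar> ^ (2 * k))"
      by (rule young_moment[OF p k \<tau>]) auto
    then show "norm (E t * T t) \<le> \<tau> powr (- p) * norm (E t) powr p + \<tau> powr (p / (p - 1)) * (1 + T t ^ (2 * k))"
      by (simp add: abs_mult power_even_abs)
  qed
  also have "\<dots> = integral {a..b} (\<lambda>t. \<tau> powr (- p) * \<bar>E t\<bar> powr p) + integral {a..b} (\<lambda>t. \<tau> powr (p / (p - 1)) * (1 + T t ^ (2 * k)))"
    by (rule integral_add[OF integrable_on_mult_right[OF i2] integrable_on_mult_right[OF i4]])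
  also have "integral {a..b} (\<lambda>t. \<tau> powr (p / (p - 1)) * (1 + T t ^ (2 * k))) = \<tau> powr (p / (p - 1)) * ((b - a) + integral {a..b} (\<lambda>t. T t ^ (2 * k)))"
  proof -
    have "integral {a..b} (\<lambda>t. 1 + T t ^ (2 * k)) = integral {a..b} (\<lambda>t. 1) + integral {a..b} (\<lambda>t. T t ^ (2 * k))"
      using i3 by (intro integral_add) auto
    then show ?thesis using ab by simp
  qed
  finally show ?thesis by simp
qed

lemma visible_error_measurable: "visible_error \<in> borel_measurable borel"
proof -
  have "mono (\<lambda>t. real (visible_count t))"
  proof (rule monoI)
    fix x y :: real assume "x \<le> y"
    then have "VS x \<subseteq> VS y" by (auto simp: VS_def)
    then show "real (visible_count x) \<le> real (visible_count y)"
      unfolding visible_count_eq of_nat_le_iff by (rule card_mono[OF finite_VS])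
  qed
  then have "(\<lambda>t. real (visible_count t)) \<in> borel_measurable borel" by (rule borel_measurable_mono)
  then show ?thesis unfolding visible_error_def by measurable
qed

lemma visible_error_bounded: "\<exists>M. \<forall>t\<in>{R..2 * R}. \<bar>visible_error t\<bar> \<le> M"
proof -
  define \<kappa> where "\<kappa> = 4 * pi / (3 * zeta 3)"
  have "\<bar>visible_error t\<bar> \<le> real (visible_count (2 * R)) + \<bar>\<kappa>\<bar> * (2 * \<bar>R\<bar>) ^ 3" if t: "t \<in> {R..2 * R}" for t
  proof -
    have "visible_count t \<le> visible_count (2 * R)"
      unfolding visible_count_eq using t by (intro card_mono finite_VS) (auto simp: VS_def)
    moreover have "\<bar>t ^ 3\<bar> \<le> (2 * \<bar>R\<bar>) ^ 3" unfolding power_abs using t by (intro power_mono) auto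
    then have "\<bar>\<kappa> * t ^ 3\<bar> \<le> \<bar>\<kappa>\<bar> * (2 * \<bar>R\<bar>) ^ 3" unfolding abs_mult by (intro mult_left_mono) auto
    moreover have "\<bar>visible_error t\<bar> \<le> real (visible_count t) + \<bar>\<kappa> * t ^ 3\<bar>"
      unfolding visible_error_def \<kappa>_def[symmetric] by linarith
    ultimately show ?thesis by linarith
  qed
  then show ?thesis by blast
qed

lemma continuous_test_fun: "R > 0 \<Longrightarrow> continuous_on {R..2 * R} (test_fun N Z R)"
  unfolding test_fun_def by (intro continuous_intros continuous_wave_deriv)

text \<open>Only the parameters remain to be chosen. \<open>N\<close> is about
  \<open>R^\<epsilon>\<close>, so the main term is a constant times \<open>R * ln R\<close>;
  \<open>Z = N^6\<close> and \<open>D\<close> about \<open>R^(13/25)\<close> control the errors of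
  the correlation, and \<open>\<epsilon>\<close>, small in terms of \<open>k\<close>, those of the
  moment.\<close>

lemma test_function_exists:
  assumes k1: "k \<ge> 1"
  shows "\<exists>c>0. \<exists>C\<ge>0. \<forall>\<^sub>F R in at_top. \<exists>T. continuous_on {R..2 * R} T \<and>
     (\<exists>I. ((\<lambda>t. visible_error t * T t) has_integral I) {R..2 * R} \<and> c * R * ln R \<le> \<bar>I\<bar>) \<and>
     integral {R..2 * R} (\<lambda>t. (R * T t) ^ (2 * k)) \<le> C * R * ln R ^ k"
proof -
  obtain Ct where Ct: "Ct \<ge> 0" "\<And>R N Z D. R \<ge> 1 \<Longrightarrow> N \<ge> 1 \<Longrightarrow> Z \<ge> 1 \<Longrightarrow> D \<ge> Z \<Longrightarrow> real D \<le> 2 * R \<Longrightarrow>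
     (\<exists>I. ((\<lambda>t. visible_error t * test_fun N Z R t) has_integral I) {R..2 * R} \<and>
       - I \<ge> R * bump_cos 0 * ((\<Sum>m=1..N. real (r3 m) / real m powr (3/2)) - Ct * real N * real Z powr (-1/6))
         - Ct * (real N * real Z) * (1 + real D * (1 + (real Z * sqrt N * real D) powr (8/3) / R) + R\<^sup>2 * (1 + ln (3 * R)) / (real D)\<^sup>2))"
    using visible_test_lower by blast
  obtain Cm where Cm: "Cm \<ge> 0" "\<And>N Z R. N \<ge> 1 \<Longrightarrow> Z \<ge> 1 \<Longrightarrow> R \<ge> 0 \<Longrightarrow> integral {R..2 * R} (\<lambda>t. cos_sum N Z t ^ (2 * k))
     \<le> Cm * R * (1 + ln N) ^ k + (real N * real Z) ^ (2 * k) * (1 + real (2 * k) * (real Z * sqrt N)) ^ (2 ^ (2 * k))"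
    using cos_sum_moment[of k] by blast
  \<comment> \<open>Exponent of \<open>x = R^\<epsilon>\<close> in the nonresonant part of the
    moment: \<open>N * Z\<close> and \<open>Z * sqrt N\<close> are at most \<open>x^7\<close>,
    raised to \<open>2 * k\<close> and \<open>2 ^ (2 * k)\<close>.\<close>
  define w where "w = 14 * k + 7 * 2 ^ (2 * k)"
  \<comment> \<open>Ensures \<open>x^w \<le> R\<close>; the 1000 keeps \<open>x^7\<close> below
    \<open>R^(7/1000)\<close>.\<close>
  define \<epsilon> where "\<epsilon> = 1 / (1000 + real w)"
  have \<epsilon>: "\<epsilon> > 0" "\<epsilon> \<le> 1/1000" "\<epsilon> * real w \<le> 1"
    by (auto simp: \<epsilon>_def field_simps add_pos_nonneg)
  define c0 where "c0 = bump_cos 0"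
  have c0: "c0 > 0" using bump_cos_0_pos by (simp add: c0_def)
  define s3 where "s3 = (3::real) powr (3/2)"
  have s3: "s3 > 0" by (simp add: s3_def)
  \<comment> \<open>Half of the coefficient \<open>c0 * \<epsilon> / (2 * s3)\<close> of the main
    term; the other half absorbs the bounded terms.\<close>
  define c1 where "c1 = c0 * \<epsilon> / (4 * s3)"
  have c1: "c1 > 0" using c0 \<epsilon> s3 by (simp add: c1_def)
  define C' where "C' = (1 + real (2 * k)) ^ (2 ^ (2 * k))"
  define C1 where "C1 = 14 ^ (2 * k) * (Cm * 2 ^ k + C') + 8 ^ (2 * k)"
  have C1: "C1 \<ge> 0" using Cm by (simp add: C1_def C'_def)
  \<comment> \<open>Majorant of the error in terms of \<open>R\<close> alone:
    \<open>R^(7/1000)\<close> stands for \<open>N * Z\<close> and \<open>Z * sqrt N\<close>,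
    \<open>R^(13/25)\<close> for \<open>D\<close>, and the 4 comes from
    \<open>D \<ge> R^(13/25) / 2\<close>. It is \<open>o(R)\<close>.\<close>
  define err where "err R = R powr (7/1000) * (1 + R powr (13/25) * (1 + (R powr (7/1000) * R powr (13/25)) powr (8/3) / R) + 4 * R\<^sup>2 * (1 + ln (3 * R)) / R powr (26/25))" for R :: real
  have "((\<lambda>R. err R / R) \<longlongrightarrow> 0) at_top" unfolding err_def by real_asymp
  then have "((\<lambda>R. Ct * (err R / R)) \<longlongrightarrow> Ct * 0) at_top" by (intro tendsto_mult tendsto_const)
  then have ev1: "\<forall>\<^sub>F R in at_top. Ct * (err R / R) < 1" by (intro order_tendstoD) auto
  have ev2: "\<forall>\<^sub>F R in at_top. R powr \<epsilon> \<ge> 2" using \<epsilon>(1) by real_asymp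
  have ev3: "\<forall>\<^sub>F R in at_top. (2::real) \<le> R powr (13/25)" by real_asymp
  \<comment> \<open>From here on \<open>c1 * ln R\<close> exceeds the bounded terms of the
    correlation.\<close>
  define X where "X = max 1 ((c0 * (ln 6 / (2 * s3) + Ct) + 1) / c1)"
  have ev4: "\<forall>\<^sub>F R::real in at_top. ln R \<ge> X" by (intro filterlim_at_top_mono[THEN iffD1[OF filterlim_at_top], THEN spec]) (use ln_at_top in auto)
  have ev5: "\<forall>\<^sub>F R::real in at_top. R \<ge> 1" by (rule eventually_ge_at_top)
  have "\<forall>\<^sub>F R in at_top. \<exists>T. continuous_on {R..2 * R} T \<and>
     (\<exists>I. ((\<lambda>t. visible_error t * T t) has_integral I) {R..2 * R} \<and> c1 * R * ln R \<le> \<bar>I\<bar>) \<and>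
     integral {R..2 * R} (\<lambda>t. (R * T t) ^ (2 * k)) \<le> C1 * R * ln R ^ k"
    using ev1 ev2 ev3 ev4 ev5
  proof eventually_elim
    case (elim R)
    have R0: "R > 0" and R1: "R \<ge> 1" using elim by auto
    define x where "x = R powr \<epsilon>"
    define N where "N = nat \<lfloor>x\<rfloor>"
    define Z where "Z = N ^ 6"
    \<comment> \<open>\<open>13/25\<close> lies between \<open>1/2\<close> and \<open>6/11\<close>:
      then both \<open>R^2 / D^2\<close> and \<open>D^(11/3) / R\<close> stay below \<open>R\<close>
      by a power, which also absorbs the factors from \<open>N\<close>, \<open>Z\<close> and the
      logarithm.\<close>
    define D where "D = nat \<lfloor>R powr (13/25)\<rfloor>"
    have x2: "x \<ge> 2" using elim by (simp add: x_def)
    have N: "real N \<le> x" "real N \<ge> x / 2" "N \<ge> 1"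
    proof -
      show "real N \<le> x" unfolding N_def using x2 by (intro of_nat_floor) auto
      have "x - 1 < real N" unfolding N_def using x2 by linarith
      then show "real N \<ge> x / 2" "N \<ge> 1" using x2 by linarith+
    qed
    have Z1: "Z \<ge> 1" using N by (simp add: Z_def)
    have N1: "real N \<ge> 1" using N by simp
    have xpow: "x ^ j \<le> R powr (real j / 1000)" for j
    proof -
      have "x ^ j = x powr real j" using x2 by (simp add: powr_realpow)
      also have "\<dots> = R powr (\<epsilon> * real j)" by (simp add: x_def powr_powr)
      also have "\<dots> \<le> R powr (real j / 1000)" using \<epsilon>(2) R1 mult_right_mono[OF \<epsilon>(2), of "real j"] by (intro powr_mono) auto
      finally show ?thesis .
    qed
    have NZ: "real N * real Z \<le> x ^ 7"
    proof -
      have "real N * real Z = real N ^ 7" by (simp add: Z_def power_numeral_reduce)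
      also have "\<dots> \<le> x ^ 7" using N by (intro power_mono) auto
      finally show ?thesis .
    qed
    have ZN: "real Z * sqrt N \<le> x ^ 7"
    proof -
      have "sqrt N \<le> real N" using N1 real_sqrt_le_mono[of "real N" "(real N)\<^sup>2"] by (simp add: power2_eq_square mult_le_cancel_left1)
      then have "real Z * sqrt N \<le> real Z * real N" by (intro mult_left_mono) auto
      then show ?thesis using NZ by (simp add: mult.commute)
    qed
    have NZr: "real N * real Z \<le> R powr (7/1000)" "real Z * sqrt N \<le> R powr (7/1000)" using NZ ZN xpow[of 7] by auto
    have D1: "real D \<le> R powr (13/25)" "real D \<ge> R powr (13/25) / 2" "D \<ge> 1"
    proof -
      show "real D \<le> R powr (13/25)" unfolding D_def by (intro of_nat_floor) auto
      have "R powr (13/25) - 1 < real D" unfolding D_def using elim(3) by linarith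
      then show "real D \<ge> R powr (13/25) / 2" "D \<ge> 1" using elim(3) by linarith+
    qed
    have DZ: "D \<ge> Z"
    proof -
      have "real Z \<le> x ^ 6" unfolding Z_def using N by (auto intro!: power_mono)
      also have "\<dots> \<le> R powr (6/1000)" using xpow[of 6] by simp
      also have "\<dots> \<le> R powr (13/25)" using R1 by (intro powr_mono) auto
      finally show ?thesis unfolding D_def by (rule le_nat_floor)
    qed
    have D2: "real D \<le> 2 * R"
    proof -
      have "R powr (13/25) \<le> R powr 1" using R1 by (intro powr_mono) auto
      then show ?thesis using D1 R0 by simp
    qed
    obtain I where I: "((\<lambda>t. visible_error t * test_fun N Z R t) has_integral I) {R..2 * R}"
       "- I \<ge> R * bump_cos 0 * ((\<Sum>m=1..N. real (r3 m) / real m powr (3/2)) - Ct * real N * real Z powr (-1/6))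
         - Ct * (real N * real Z) * (1 + real D * (1 + (real Z * sqrt N * real D) powr (8/3) / R) + R\<^sup>2 * (1 + ln (3 * R)) / (real D)\<^sup>2)"
      using Ct(2)[OF R1 N(3) Z1 DZ D2] by blast
    have lnx: "ln x = \<epsilon> * ln R" using R0 by (simp add: x_def ln_powr)
    have lR: "ln R \<ge> X" "ln R \<ge> 1" using elim(4) by (auto simp: X_def)
    have E: "Ct * (real N * real Z) * (1 + real D * (1 + (real Z * sqrt N * real D) powr (8/3) / R) + R\<^sup>2 * (1 + ln (3 * R)) / (real D)\<^sup>2) \<le> R"
    proof -
      have l3: "0 \<le> 1 + ln (3 * R)" using R1 by simp
      have "(real N * real Z) * (1 + real D * (1 + (real Z * sqrt N * real D) powr (8/3) / R) + R\<^sup>2 * (1 + ln (3 * R)) / (real D)\<^sup>2) \<le> err R"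
        unfolding err_def
      proof (intro mult_mono add_mono order_refl)
        show "(real Z * sqrt N * real D) powr (8/3) / R \<le> (R powr (7/1000) * R powr (13/25)) powr (8/3) / R"
          using NZr D1 R0 by (intro divide_right_mono powr_mono2 mult_mono) auto
        show "R\<^sup>2 * (1 + ln (3 * R)) / (real D)\<^sup>2 \<le> 4 * R\<^sup>2 * (1 + ln (3 * R)) / R powr (26/25)"
        proof -
          have "(R powr (13/25) / 2)\<^sup>2 \<le> (real D)\<^sup>2" using D1 by (intro power_mono) auto
          moreover have "(R powr (13/25) / 2)\<^sup>2 = R powr (26/25) / 4"
            using R0 by (simp add: power_divide power2_eq_square flip: powr_add)
          moreover have "R powr (26/25) / 4 > 0" using R0 by simp
          ultimately have "R\<^sup>2 * (1 + ln (3 * R)) / (real D)\<^sup>2 \<le> R\<^sup>2 * (1 + ln (3 * R)) / (R powr (26/25) / 4)"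
            using l3 D1(3) by (intro divide_left_mono mult_nonneg_nonneg mult_pos_pos) auto
          then show ?thesis by (simp add: mult_ac)
        qed
      qed (use NZr D1 R0 l3 in auto)
      then have "Ct * ((real N * real Z) * (1 + real D * (1 + (real Z * sqrt N * real D) powr (8/3) / R) + R\<^sup>2 * (1 + ln (3 * R)) / (real D)\<^sup>2)) \<le> Ct * err R"
        using Ct(1) by (rule mult_left_mono)
      also have "\<dots> \<le> R" using elim(1) R0 by (simp add: field_simps)
      finally show ?thesis by (simp add: mult.assoc)
    qed
    \<comment> \<open>This is why \<open>Z\<close> is the sixth power of \<open>N\<close>: the error
      from incomplete divisor sums becomes a constant.\<close>
    have Zp: "real N * real Z powr (-1/6) = 1"
    proof -
      have "real Z = real N powr 6" using N1 by (simp add: Z_def)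
      then have "real Z powr (-1/6) = real N powr (6 * (-1/6))" by (simp only: powr_powr)
      then show ?thesis using N1 by (simp add: powr_minus field_simps)
    qed
    have low: "(\<Sum>m=1..N. real (r3 m) / real m powr (3/2)) \<ge> (\<epsilon> * ln R - ln 6) / (2 * s3)"
    proof -
      \<comment> \<open>The largest \<open>K\<close> with \<open>3 * K^2 \<le> N\<close>, as
        \<open>r3_sum_lower\<close> requires. Since \<open>N \<ge> x / 2\<close>,
        \<open>K + 1\<close> exceeds \<open>sqrt (x / 6)\<close>, whence the
        \<open>ln 6\<close>.\<close>
      define K where "K = nat \<lfloor>sqrt (real N / 3)\<rfloor>"
      have "real K \<le> sqrt (real N / 3)" unfolding K_def by (intro of_nat_floor) auto
      then have "(real K)\<^sup>2 \<le> (sqrt (real N / 3))\<^sup>2" by (intro power_mono) auto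
      then have "real (3 * K\<^sup>2) \<le> real N" by simp
      then have "3 * K\<^sup>2 \<le> N" by (simp only: of_nat_le_iff)
      then have "(\<Sum>m=1..N. real (r3 m) / real m powr (3/2)) \<ge> ln (real K + 1) / s3" unfolding s3_def by (rule r3_sum_lower)
      moreover have "ln (real K + 1) \<ge> (\<epsilon> * ln R - ln 6) / 2"
      proof -
        have "sqrt (x / 6) \<le> sqrt (real N / 3)" using N by (intro real_sqrt_le_mono) auto
        also have "\<dots> < real K + 1" unfolding K_def by linarith
        finally have "ln (sqrt (x / 6)) \<le> ln (real K + 1)" using x2 by (intro ln_mono) auto
        moreover have "ln (sqrt (x / 6)) = (\<epsilon> * ln R - ln 6) / 2" using x2 by (simp add: ln_sqrt ln_div lnx)
        ultimately show ?thesis by simp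
      qed
      then have "ln (real K + 1) / s3 \<ge> ((\<epsilon> * ln R - ln 6) / 2) / s3" using s3 by (intro divide_right_mono) auto
      ultimately show ?thesis by simp
    qed
    have main: "c1 * R * ln R \<le> - I"
    proof -
      have "R * c0 * ((\<epsilon> * ln R - ln 6) / (2 * s3) - Ct) \<le> R * c0 * ((\<Sum>m=1..N. real (r3 m) / real m powr (3/2)) - Ct * real N * real Z powr (-1/6))"
        using low R0 c0 Zp by (intro mult_left_mono diff_mono) (auto simp: mult.assoc)
      then have "- I \<ge> R * c0 * ((\<epsilon> * ln R - ln 6) / (2 * s3) - Ct) - R" using I(2) E unfolding c0_def by linarith
      moreover have "R * c0 * ((\<epsilon> * ln R - ln 6) / (2 * s3) - Ct) - R = R * (2 * (c1 * ln R) - (c0 * (ln 6 / (2 * s3) + Ct) + 1))"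
        using s3 by (simp add: c1_def field_simps)
      moreover have "c1 * ln R \<ge> c0 * (ln 6 / (2 * s3) + Ct) + 1"
      proof -
        have "(c0 * (ln 6 / (2 * s3) + Ct) + 1) / c1 \<le> ln R" using elim(4) by (simp add: X_def)
        then show ?thesis using c1 by (simp add: field_simps)
      qed
      then have "R * (c1 * ln R) \<le> R * (2 * (c1 * ln R) - (c0 * (ln 6 / (2 * s3) + Ct) + 1))" using R0 by (intro mult_left_mono) auto
      ultimately show ?thesis by (simp add: mult_ac)
    qed
    have mom: "integral {R..2 * R} (\<lambda>t. cos_sum N Z t ^ (2 * k)) \<le> (Cm * 2 ^ k + C') * (R * ln R ^ k)"
    proof -
      have "1 + ln N \<le> 2 * ln R"
      proof -
        have "ln N \<le> ln x" using N N1 x2 by (intro ln_mono) auto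
        also have "\<dots> \<le> 1 * ln R" unfolding lnx using \<epsilon> lR by (intro mult_right_mono) auto
        finally show ?thesis using lR by linarith
      qed
      then have "(1 + ln N) ^ k \<le> (2 * ln R) ^ k" using N1 by (intro power_mono) auto
      then have 1: "Cm * R * (1 + ln N) ^ k \<le> Cm * R * (2 * ln R) ^ k" using Cm(1) R0 by (intro mult_left_mono) auto
      have "(real N * real Z) ^ (2 * k) * (1 + real (2 * k) * (real Z * sqrt N)) ^ (2 ^ (2 * k)) \<le> (x ^ 7) ^ (2 * k) * ((1 + real (2 * k)) * x ^ 7) ^ (2 ^ (2 * k))"
      proof (intro mult_mono power_mono NZ)
        have "1 \<le> x ^ 7" using x2 by (intro one_le_power) auto
        moreover have "real (2 * k) * (real Z * sqrt N) \<le> real (2 * k) * x ^ 7" using ZN by (intro mult_left_mono) auto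
        ultimately show "1 + real (2 * k) * (real Z * sqrt N) \<le> (1 + real (2 * k)) * x ^ 7" by (simp only: distrib_right mult_1)
      qed (use x2 in auto)
      also have "\<dots> = C' * x ^ w" by (simp add: C'_def w_def power_mult_distrib power_add power_mult[symmetric] mult_ac)
      also have "x ^ w \<le> R"
      proof -
        have "x ^ w = x powr real w" using x2 by (simp add: powr_realpow)
        also have "\<dots> = R powr (\<epsilon> * real w)" by (simp add: x_def powr_powr)
        also have "\<dots> \<le> R powr 1" using \<epsilon>(3) R1 by (intro powr_mono) auto
        finally show ?thesis using R0 by simp
      qed
      then have "C' * x ^ w \<le> C' * R" by (intro mult_left_mono) (auto simp: C'_def)
      finally have 2: "(real N * real Z) ^ (2 * k) * (1 + real (2 * k) * (real Z * sqrt N)) ^ (2 ^ (2 * k)) \<le> C' * R" .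
      have "1 \<le> ln R ^ k" using lR by (intro one_le_power)
      then have "C' * R * 1 \<le> C' * R * ln R ^ k" using R0 by (intro mult_left_mono) (auto simp: C'_def)
      then have "integral {R..2 * R} (\<lambda>t. cos_sum N Z t ^ (2 * k)) \<le> Cm * R * (2 * ln R) ^ k + C' * R * ln R ^ k"
        using Cm(2)[OF N(3) Z1, of R] R0 1 2 by linarith
      then show ?thesis by (simp add: power_mult_distrib algebra_simps)
    qed
    have Tmom: "integral {R..2 * R} (\<lambda>t. (R * test_fun N Z R t) ^ (2 * k)) \<le> C1 * R * ln R ^ k"
    proof -
      have cc: "continuous_on S (cos_sum N Z)" for S unfolding cos_sum_def by (intro continuous_intros) auto
      have "integral {R..2 * R} (\<lambda>t. (R * test_fun N Z R t) ^ (2 * k)) \<le> integral {R..2 * R} (\<lambda>t. 14 ^ (2 * k) * cos_sum N Z t ^ (2 * k) + 8 ^ (2 * k))"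
      proof (rule integral_le)
        show "(\<lambda>t. (R * test_fun N Z R t) ^ (2 * k)) integrable_on {R..2 * R}"
          by (intro integrable_continuous_interval continuous_intros continuous_test_fun R0)
        show "(\<lambda>t. 14 ^ (2 * k) * cos_sum N Z t ^ (2 * k) + 8 ^ (2 * k)) integrable_on {R..2 * R}"
          by (intro integrable_continuous_interval continuous_intros cc)
        fix t assume t: "t \<in> {R..2 * R}"
        have "4 * (real N * real Z) / R \<le> 4"
        proof -
          have "R powr (7/1000) \<le> R powr 1" using R1 by (intro powr_mono) auto
          then have "real N * real Z \<le> R" using NZr R0 by simp
          then show ?thesis using R0 by (simp add: field_simps)
        qed
        moreover have "2 * pi * \<bar>cos_sum N Z t\<bar> \<le> 7 * \<bar>cos_sum N Z t\<bar>" using pi_approx by (intro mult_right_mono) auto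
        ultimately have "R * \<bar>test_fun N Z R t\<bar> \<le> 7 * \<bar>cos_sum N Z t\<bar> + 4" using test_fun_bound[OF R1 t, of N Z] by linarith
        \<comment> \<open>Doubling the larger of the two summands; the power of a maximum is at most
          the sum of the powers. Hence the 14 and the 8 in \<open>C1\<close>.\<close>
        also have "\<dots> \<le> max (14 * \<bar>cos_sum N Z t\<bar>) 8" by auto
        finally have "(R * \<bar>test_fun N Z R t\<bar>) ^ (2 * k) \<le> (max (14 * \<bar>cos_sum N Z t\<bar>) 8) ^ (2 * k)" using R0 by (intro power_mono) auto
        also have "\<dots> \<le> (14 * \<bar>cos_sum N Z t\<bar>) ^ (2 * k) + 8 ^ (2 * k)" by (auto simp: max_def)
        also have "(14 * \<bar>cos_sum N Z t\<bar>) ^ (2 * k) = 14 ^ (2 * k) * cos_sum N Z t ^ (2 * k)" by (simp add: power_mult_distrib power_even_abs)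
        finally show "(R * test_fun N Z R t) ^ (2 * k) \<le> 14 ^ (2 * k) * cos_sum N Z t ^ (2 * k) + 8 ^ (2 * k)"
          by (simp add: power_mult_distrib power_even_abs)
      qed
      also have "\<dots> = 14 ^ (2 * k) * integral {R..2 * R} (\<lambda>t. cos_sum N Z t ^ (2 * k)) + 8 ^ (2 * k) * R"
      proof -
        have "(\<lambda>t. 14 ^ (2 * k) * cos_sum N Z t ^ (2 * k)) integrable_on {R..2 * R}"
          by (intro integrable_continuous_interval continuous_intros cc)
        then have "integral {R..2 * R} (\<lambda>t. 14 ^ (2 * k) * cos_sum N Z t ^ (2 * k) + 8 ^ (2 * k))
           = integral {R..2 * R} (\<lambda>t. 14 ^ (2 * k) * cos_sum N Z t ^ (2 * k)) + integral {R..2 * R} (\<lambda>t. 8 ^ (2 * k))"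
          by (intro integral_add) auto
        then show ?thesis using R0 by simp
      qed
      also have "\<dots> \<le> 14 ^ (2 * k) * ((Cm * 2 ^ k + C') * (R * ln R ^ k)) + 8 ^ (2 * k) * (R * ln R ^ k)"
      proof (intro add_mono mult_left_mono mom)
        have "1 \<le> ln R ^ k" using lR by (intro one_le_power)
        then have "R * 1 \<le> R * ln R ^ k" using R0 by (intro mult_left_mono) auto
        then show "R \<le> R * ln R ^ k" by simp
      qed auto
      also have "\<dots> = C1 * R * ln R ^ k" by (simp add: C1_def algebra_simps)
      finally show ?thesis .
    qed
    have "c1 * R * ln R \<le> \<bar>I\<bar>" using main by linarith
    then show ?case using I(1) Tmom continuous_test_fun[OF R0, of N Z] by blast
  qed
  then show ?thesis using c1 C1 by blast
qed

text \<open>After scaling the error by \<open>R * sqrt (ln R)\<close> and \<open>R * T\<close> by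
  \<open>sqrt (ln R)\<close>, the correlation is at least \<open>c * R\<close> and the moment at
  most \<open>C * R\<close>, so a fixed \<open>\<tau>\<close> in Young's inequality
  suffices.\<close>

theorem theorem2p1:
  fixes p :: real
  assumes "p > 1"
  shows "\<exists>c>0. \<forall>\<^sub>F R in at_top.
           integral {R..2 * R} (\<lambda>t. \<bar>visible_error t\<bar> powr p)
             \<ge> c * R powr (p + 1) * (ln R) powr (p / 2)"
proof -
  define q where "q = p / (p - 1)"
  have q0: "q > 0" using assms by (simp add: q_def)
  define k where "k = nat \<lceil>q\<rceil>"
  have k1: "k \<ge> 1"
  proof -
    have "0 < \<lceil>q\<rceil>" using q0 by simp
    then show ?thesis unfolding k_def by linarith
  qed
  have qk: "p / (p - 1) \<le> real (2 * k)"
  proof -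
    have "q \<le> real k" unfolding k_def by (rule real_nat_ceiling_ge)
    then show ?thesis by (simp add: q_def)
  qed
  obtain c C where c: "c > 0" and C: "C \<ge> 0" and ev: "\<forall>\<^sub>F R in at_top. \<exists>T. continuous_on {R..2 * R} T \<and>
     (\<exists>I. ((\<lambda>t. visible_error t * T t) has_integral I) {R..2 * R} \<and> c * R * ln R \<le> \<bar>I\<bar>) \<and>
     integral {R..2 * R} (\<lambda>t. (R * T t) ^ (2 * k)) \<le> C * R * ln R ^ k"
    using test_function_exists[OF k1] by blast
  \<comment> \<open>Chosen so that the moment side of the duality inequality is
    \<open>c / 2 * R\<close>, half of the correlation.\<close>
  define \<tau> where "\<tau> = (c / (2 * (1 + C))) powr (1 / q)"
  have \<tau>0: "\<tau> > 0" using c C by (simp add: \<tau>_def)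
  have \<tau>q: "\<tau> powr q * (1 + C) = c / 2" 
  proof -
    have "\<tau> powr q = c / (2 * (1 + C))" using c C q0 by (simp add: \<tau>_def powr_powr)
    then show ?thesis using C by (simp add: divide_simps) (simp add: algebra_simps)
  qed
  define c' where "c' = \<tau> powr p * (c / 2)"
  have "c' > 0" using \<tau>0 c by (simp add: c'_def)
  moreover have "\<forall>\<^sub>F R in at_top. integral {R..2 * R} (\<lambda>t. \<bar>visible_error t\<bar> powr p) \<ge> c' * R powr (p + 1) * (ln R) powr (p / 2)"
    using ev eventually_gt_at_top[of "exp 1"]
  proof eventually_elim
    case (elim R)
    then obtain T I where T: "continuous_on {R..2 * R} T" "((\<lambda>t. visible_error t * T t) has_integral I) {R..2 * R}"
      "c * R * ln R \<le> \<bar>I\<bar>" "integral {R..2 * R} (\<lambda>t. (R * T t) ^ (2 * k)) \<le> C * R * ln R ^ k" by blast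
    have R0: "R > 0" using elim(2) exp_gt_zero[of 1] by linarith
    have l1: "ln R > 1" using elim(2) R0 by (metis exp_less_cancel_iff exp_ln)
    define l where "l = ln R"
    have l0: "l > 0" "sqrt l > 0" "sqrt l * sqrt l = l" using l1 by (auto simp: l_def)
    \<comment> \<open>Clamping extends \<open>T\<close> continuously to the real line, which gives
      the Borel measurability that \<open>duality_lower\<close> asks for.\<close>
    define cl where "cl t = max R (min t (2 * R))" for t
    have cl: "cl t \<in> {R..2 * R}" "t \<in> {R..2 * R} \<Longrightarrow> cl t = t" for t using R0 by (auto simp: cl_def)
    define E where "E t = visible_error t / (R * sqrt l)" for t
    define U where "U t = R * T (cl t) / sqrt l" for t
    have clc: "continuous_on UNIV cl" unfolding cl_def by (intro continuous_intros)
    have Tc: "continuous_on UNIV (\<lambda>t. T (cl t))" by (rule continuous_on_compose2[OF T(1) clc]) (use cl in auto)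
    obtain M1 where M1: "\<And>t. t \<in> {R..2 * R} \<Longrightarrow> \<bar>visible_error t\<bar> \<le> M1" using visible_error_bounded[of R] by blast
    have "bounded (T ` {R..2 * R})" using T(1) by (intro compact_imp_bounded compact_continuous_image) auto
    then obtain M2 where M2: "\<And>t. t \<in> {R..2 * R} \<Longrightarrow> \<bar>T t\<bar> \<le> M2" unfolding bounded_iff by (metis imageI real_norm_def)
    define M where "M = max (M1 / (R * sqrt l)) (R * M2 / sqrt l)"
    have "\<bar>integral {R..2 * R} (\<lambda>t. E t * U t)\<bar>
     \<le> \<tau> powr (- p) * integral {R..2 * R} (\<lambda>t. \<bar>E t\<bar> powr p) + \<tau> powr (p / (p - 1)) * ((2 * R - R) + integral {R..2 * R} (\<lambda>t. U t ^ (2 * k)))"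
    proof (rule duality_lower[where M = M])
      show "E \<in> borel_measurable borel" unfolding E_def using visible_error_measurable by measurable
      show "U \<in> borel_measurable borel" unfolding U_def
        by (intro borel_measurable_continuous_onI continuous_intros Tc) (use l0 in auto)
      show "\<bar>E t\<bar> \<le> M" if "t \<in> {R..2 * R}" for t
      proof -
        have "\<bar>E t\<bar> = \<bar>visible_error t\<bar> / (R * sqrt l)" using R0 l0 by (simp add: E_def)
        also have "\<dots> \<le> M1 / (R * sqrt l)" using M1[OF that] R0 l0 by (intro divide_right_mono) auto
        finally show ?thesis by (simp add: M_def)
      qed
      show "\<bar>U t\<bar> \<le> M" if "t \<in> {R..2 * R}" for t
      proof -
        have "\<bar>U t\<bar> = R * \<bar>T (cl t)\<bar> / sqrt l" using R0 l0 by (simp add: U_def abs_mult)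
        also have "\<dots> \<le> R * M2 / sqrt l" using M2[OF cl(1)] R0 l0 by (intro divide_right_mono mult_left_mono) auto
        finally show ?thesis by (simp add: M_def)
      qed
    qed (use assms qk \<tau>0 R0 in auto)
    moreover have "integral {R..2 * R} (\<lambda>t. E t * U t) = I / l"
    proof -
      have "integral {R..2 * R} (\<lambda>t. E t * U t) = integral {R..2 * R} (\<lambda>t. visible_error t * T t / l)"
      proof (rule Henstock_Kurzweil_Integration.integral_cong)
        fix t assume "t \<in> {R..2 * R}"
        then have "E t * U t = visible_error t * T t / (sqrt l * sqrt l)" using R0 l0 by (simp add: E_def U_def cl)
        then show "E t * U t = visible_error t * T t / l" by (simp only: l0)
      qed
      also have "\<dots> = I / l" using T(2) by (simp add: integral_unique)
      finally show ?thesis .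
    qed
    moreover have "integral {R..2 * R} (\<lambda>t. U t ^ (2 * k)) \<le> C * R"
    proof -
      have "integral {R..2 * R} (\<lambda>t. U t ^ (2 * k)) = integral {R..2 * R} (\<lambda>t. (R * T t) ^ (2 * k) / l ^ k)"
      proof (rule Henstock_Kurzweil_Integration.integral_cong)
        fix t assume "t \<in> {R..2 * R}"
        then have "U t = R * T t / sqrt l" by (simp add: U_def cl)
        moreover have "sqrt l ^ (2 * k) = l ^ k" using l0 by (simp add: power_mult)
        ultimately show "U t ^ (2 * k) = (R * T t) ^ (2 * k) / l ^ k" by (simp add: power_divide)
      qed
      also have "\<dots> = integral {R..2 * R} (\<lambda>t. (R * T t) ^ (2 * k)) / l ^ k" by simp
      also have "\<dots> \<le> (C * R * l ^ k) / l ^ k" using T(4) l0 unfolding l_def by (intro divide_right_mono) auto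
      also have "\<dots> = C * R" using l0 by simp
      finally show ?thesis .
    qed
    moreover have "integral {R..2 * R} (\<lambda>t. \<bar>E t\<bar> powr p) = integral {R..2 * R} (\<lambda>t. \<bar>visible_error t\<bar> powr p) / (R powr p * l powr (p / 2))"
    proof -
      have "\<bar>E t\<bar> powr p = \<bar>visible_error t\<bar> powr p / (R powr p * l powr (p / 2))" for t
      proof -
        have "\<bar>E t\<bar> = \<bar>visible_error t\<bar> / (R * sqrt l)" using R0 l0 by (simp add: E_def)
        then have "\<bar>E t\<bar> powr p = \<bar>visible_error t\<bar> powr p / (R * sqrt l) powr p" using R0 l0 by (simp add: powr_divide)
        moreover have "(R * sqrt l) powr p = R powr p * sqrt l powr p" using R0 l0 by (simp add: powr_mult)
        moreover have "sqrt l powr p = l powr (p / 2)" using l0 by (simp add: powr_powr flip: powr_half_sqrt)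
        ultimately show ?thesis by simp
      qed
      then show ?thesis by simp
    qed
    ultimately have "\<bar>I / l\<bar> \<le> \<tau> powr (- p) * (integral {R..2 * R} (\<lambda>t. \<bar>visible_error t\<bar> powr p) / (R powr p * l powr (p / 2))) + \<tau> powr q * ((2 * R - R) + C * R)"
      using mult_left_mono[of "(2 * R - R) + integral {R..2 * R} (\<lambda>t. U t ^ (2 * k))" "(2 * R - R) + C * R" "\<tau> powr q"]
      unfolding q_def by (simp add: add_left_mono)
    moreover have "\<tau> powr q * ((2 * R - R) + C * R) = c / 2 * R" unfolding \<tau>q[symmetric] by (simp add: algebra_simps)
    moreover have "c * R \<le> \<bar>I / l\<bar>"
    proof -
      have "c * R = (c * R * l) / l" using l0 by simp
      also have "\<dots> \<le> \<bar>I\<bar> / l" using T(3) l0 unfolding l_def by (intro divide_right_mono) auto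
      finally show ?thesis using l0 by simp
    qed
    ultimately have "c / 2 * R \<le> \<tau> powr (- p) * (integral {R..2 * R} (\<lambda>t. \<bar>visible_error t\<bar> powr p) / (R powr p * l powr (p / 2)))" by linarith
    then have "\<tau> powr p * (c / 2 * R) \<le> \<tau> powr p * (\<tau> powr (- p) * (integral {R..2 * R} (\<lambda>t. \<bar>visible_error t\<bar> powr p) / (R powr p * l powr (p / 2))))"
      by (intro mult_left_mono) auto
    also have "\<dots> = integral {R..2 * R} (\<lambda>t. \<bar>visible_error t\<bar> powr p) / (R powr p * l powr (p / 2))"
      using \<tau>0 by (simp add: powr_minus)
    finally have "c' * R * (R powr p * l powr (p / 2)) \<le> integral {R..2 * R} (\<lambda>t. \<bar>visible_error t\<bar> powr p)"
      using R0 l0 by (simp add: c'_def pos_le_divide_eq mult_ac)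
    moreover have "R powr (p + 1) = R * R powr p" using R0 by (simp add: powr_add mult.commute)
    ultimately show ?case by (simp add: l_def mult_ac)
  qed
  ultimately show ?thesis by blast
qed

end
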